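(* The horizontal cohomology spaces of the differential algebra $(\mathcal A(\mathbf{CPE}),\{D_\mu\}_{\mu\in M})$ are $$H^q_{\mathrm H}(\mathbf{CPE})\cong\begin{cases}0,& q<0,\ 1\le q\le m-2,\ q>m;\\ \mathbb R,& q=0;\\ \ker D_1^{m-1}\cong\mathcal S\cap\mathcal H,& q=m-1;\\ H^{m-1}(\Theta)/\operatorname{im}D_1^{m-1},& q=m,\end{cases}$$ where in degree $m-1$ the isomorphism $H^{m-1}_{\mathrm H}(\mathbf{CPE})\to\mathcal S\cap\mathcal H$ is given by $[J^\mu d_\mu x]\mapsto\big(\delta_{u^1_0}J^1,\ (\delta_{u^\alpha_k}J^1)_{k,\alpha},\ \delta_{p_0}J^1,\ \delta_{p_1}J^1\big)$.
   Context: Fix an integer $m\ge 2$, $M=\{1,\dots,m\}$, $N=\{2,\dots,m\}$. Indices $\lambda,\mu,\nu$ range over $M$, indices $\alpha,\beta$ over $N$; repeated upper/lower indices are summed; $\delta^k_l$ is the Kronecker delta. $\mathbb I=\mathbb Z_+^m$ is the set of multi-indices $\mathrm i=(i^1,\dots,i^m)$; $\mathrm i+(\mu)$ is $\mathrm i$ with its $\mu$-th entry increased by $1$, $(\mu)=0+(\mu)$, $2(\mu)=(\mu)+(\mu)$; $\mathbb I_0=\{\mathrm i: i^1=0\}$, $\mathbb I_1=\{\mathrm i: i^1\in\{0,1\}\}$; $\mathbb J=\mathbb Z_+^{N}$, and we write $\mathrm i=(i^1,\mathrm j)$ with $\mathrm j\in\mathbb J$. The space $\mathbf B$ has coordinates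 $x^\mu$, $u^\mu_{\mathrm i}$, $p_{\mathrm i}$ ($\mathrm i\in\mathbb I$); $\mathcal A(\mathbf B)$ is the algebra of smooth real functions depending on finitely many coordinates; total derivatives $D_\mu=\partial_{x^\mu}+u^\lambda_{\mathrm i+(\mu)}\partial_{u^\lambda_{\mathrm i}}+p_{\mathrm i+(\mu)}\partial_{p_{\mathrm i}}$ (commuting), $D_{\mathrm i}=D_1^{i^1}\cdots D_m^{i^m}$, $\Delta=\sum_{\mu}D_\mu^2$, $\Delta'=\sum_{\alpha\in N}D_\alpha^2$. Let $CE_{\mathrm i}=u^\mu_{\mathrm i+(\mu)}$, $PE_{\mathrm i}=\Delta p_{\mathrm i}+D_{\mathrm i}(u^\lambda_{(\mu)}u^\mu_{(\lambda)})$; $\mathcal J\subset\mathcal A(\mathbf B)$ is the ideal generated by all $CE_{\mathrm i},PE_{\mathrm i}$, and $\mathcal A(\mathbf{CPE})=\mathcal A(\mathbf B)/\mathcal J$ with induced $D_\mu$. Concretely, $\mathcal A(\mathbf{CPE})$ consists of smooth functions of finitely many of $x^\mu$, $u^1_{\mathrm i}$ ($\mathrm i\in\mathbb I_0$), $u^\alpha_{\mathrm i}$ ($\mathrm i\in\mathbb I$), $p_{\mathrm i}$ ($\mathrm i\in\mathbb I_1$), the other variables being expressed recursively via $u^1_{\mathrm k}=-u^\beta_{\mathrm k-(1)+(\beta)}$ ($k^1\ge1$) and $p_{\mathrm k}=-D_{\mathrm k-2(1)}\Phi$ ($k^1\ge2$), with $\Phi=\Delta'p+u^\lambda_{(\mu)}u^\mu_{(\lambda)}$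 where $u^1_{(1)}$ is replaced by $-u^\alpha_{(\alpha)}$. Horizontal forms $\Omega^q_{\mathrm H}(\mathbf{CPE})$: $q$-forms in $dx^\mu$ with skew-symmetric coefficients in $\mathcal A(\mathbf{CPE})$ ($0\le q\le m$; zero otherwise), $d_{\mathrm H}\omega=(D_\mu\omega_{\mu_1\dots\mu_q})dx^\mu\wedge dx^{\mu_1}\wedge\dots\wedge dx^{\mu_q}$, $H^q_{\mathrm H}=\ker/\operatorname{im}$. Auxiliary complex $\Theta^q$: forms in $dx^\alpha$, $\alpha\in N$, only, coefficients in $\mathcal A(\mathbf{CPE})$, differential $d_\Theta\theta=(D_\alpha\theta_{\alpha_1\dots\alpha_q})dx^\alpha\wedge dx^{\alpha_1}\wedge\dots$, cohomology $H^q(\Theta)$; $D_1$ acting coefficientwise induces $D_1^q:H^q(\Theta)\to H^q(\Theta)$. $d_\mu x=(-1)^{\mu-1}dx^1\wedge\dots\wedge\widehat{dx^\mu}\wedge\dots\wedge dx^m$. Partial variational derivatives (with respect to $x^2,\dots,x^m$): for $L\in\mathcal A(\mathbf{CPE})$, $\delta_{u^1_0}L=(-D)_{\mathrm j}\partial_{u^1_{0,\mathrm j}}L$, $\delta_{u^\alpha_k}L=(-D)_{\mathrm j}\partial_{u^\alpha_{k,\mathrm j}}L$, $\delta_{p_k}L=(-D)_{\mathrm j}\partial_{p_{k,\mathrm j}}L$ ($k\in\{0,1\}$ for $p$), summed over $\mathrm j\in\mathbb J$, where $(-D)_{\mathrm j}=\prod_{\alpha\in N}(-D_\alpha)^{j^\alpha}$.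 $\mathcal S$ is the space of finite families $\chi=(\chi_u,(\chi^k_\alpha)_{k\in\mathbb Z_+,\alpha\in N},\chi_{p,0},\chi_{p,1})$ of elements of $\mathcal A(\mathbf{CPE})$ satisfying the linear system $D_1\chi_u+2D_\alpha(u^\alpha_{(1)}\chi_{p,1})=0$; $D_1\chi^k_\alpha+\delta^k_0D_\alpha\chi_u+\chi^{k-1}_\alpha+2(\delta^k_0D_\alpha(u^\beta_{(\beta)}\chi_{p,1})-\delta^k_1u^1_{(\alpha)}\chi_{p,1}+\delta^k_0D_\beta(u^\beta_{(\alpha)}\chi_{p,1}))=0$ ($\chi^{-1}_\alpha:=0$); $D_1\chi_{p,0}-\Delta'\chi_{p,1}=0$; $D_1\chi_{p,1}+\chi_{p,0}=0$. $\mathcal H$ is the Helmholtz space: the families $\chi$ of the same shape which are variational derivatives, i.e. $\chi=(\delta_{u^1_0}L,(\delta_{u^\alpha_k}L),\delta_{p_0}L,\delta_{p_1}L)$ for some $L\in\mathcal A(\mathbf{CPE})$ (equivalently, $\chi$ has self-adjoint linearization, $\chi_*=\chi^*$). *)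

theory Defs
  imports "HOL-Analysis.Analysis"
begin

text \<open>Multi-indices i = (i^1,...,i^m) are functions nat => nat supported in {1..m}.\<close>
type_synonym mi = "nat \<Rightarrow> nat"

definition valid_mi :: "nat \<Rightarrow> mi \<Rightarrow> bool" where
  "valid_mi m i \<longleftrightarrow> (\<forall>k. (k = 0 \<or> m < k) \<longrightarrow> i k = 0)"

definition inc :: "mi \<Rightarrow> nat \<Rightarrow> mi" where
  "inc i \<mu> = i(\<mu> := Suc (i \<mu>))"

definition unit :: "nat \<Rightarrow> mi" where
  "unit \<mu> = inc (\<lambda>_. 0) \<mu>"

definition at1 :: "nat \<Rightarrow> mi" where
  "at1 k = (\<lambda>_. 0)(1 := k)"

text \<open>Coordinates: X mu = x^mu, U lambda i = u^lambda_i, P i = p_i.\<close>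
datatype var = X nat | U nat mi | P mi

definition valid_var :: "nat \<Rightarrow> var \<Rightarrow> bool" where
  "valid_var m v = (case v of
      X \<mu> \<Rightarrow> 1 \<le> \<mu> \<and> \<mu> \<le> m
    | U l i \<Rightarrow> 1 \<le> l \<and> l \<le> m \<and> valid_mi m i
    | P i \<Rightarrow> valid_mi m i)"

definition is_X :: "var \<Rightarrow> bool" where
  "is_X v = (case v of X _ \<Rightarrow> True | _ \<Rightarrow> False)"

definition free_var :: "nat \<Rightarrow> var \<Rightarrow> bool" where
  "free_var m v \<longleftrightarrow> valid_var m v \<and> (case v of
      X _ \<Rightarrow> True
    | U l i \<Rightarrow> (l = 1 \<longrightarrow> i 1 = 0)
    | P i \<Rightarrow> i 1 \<le> 1)"

type_synonym pt = "var \<Rightarrow> real"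
type_synonym fn = "pt \<Rightarrow> real"

definition coord :: "var \<Rightarrow> fn" where
  "coord v = (\<lambda>y. y v)"

definition partial :: "var \<Rightarrow> fn \<Rightarrow> fn" where
  "partial v f = (\<lambda>y. deriv (\<lambda>t. f (y(v := t))) (y v))"

fun pds :: "var list \<Rightarrow> fn \<Rightarrow> fn" where
  "pds [] f = f"
| "pds (v # vs) f = partial v (pds vs f)"

definition AB :: "nat \<Rightarrow> fn set" where
  "AB m = {f. (\<exists>S. finite S \<and> S \<subseteq> {v. valid_var m v} \<and>
                 (\<forall>y z. (\<forall>v\<in>S. y v = z v) \<longrightarrow> f y = f z))
            \<and> (\<forall>vs. continuous_on UNIV (pds vs f)
                   \<and> (\<forall>v y. (\<lambda>t. pds vs f (y(v := t))) differentiable (at (y v))))}"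

definition shiftv :: "nat \<Rightarrow> var \<Rightarrow> var" where
  "shiftv \<mu> v = (case v of X \<nu> \<Rightarrow> X \<nu> | U l i \<Rightarrow> U l (inc i \<mu>) | P i \<Rightarrow> P (inc i \<mu>))"

text \<open>Total derivative D_mu (the sum is finite for f in A(B)).\<close>
definition Dt :: "nat \<Rightarrow> nat \<Rightarrow> fn \<Rightarrow> fn" where
  "Dt m \<mu> f = (\<lambda>y. partial (X \<mu>) f y +
      (\<Sum>v\<in>{v. valid_var m v \<and> \<not> is_X v \<and> partial v f \<noteq> (\<lambda>_. 0)}.
          y (shiftv \<mu> v) * partial v f y))"

definition Dmi :: "nat \<Rightarrow> mi \<Rightarrow> fn \<Rightarrow> fn" where
  "Dmi m i f = foldr (\<lambda>\<mu> g. (Dt m \<mu> ^^ i \<mu>) g) [1..<Suc m] f"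

definition CE :: "nat \<Rightarrow> mi \<Rightarrow> fn" where
  "CE m i = (\<lambda>y. \<Sum>\<mu>=1..m. y (U \<mu> (inc i \<mu>)))"

definition quadU :: "nat \<Rightarrow> fn" where
  "quadU m = (\<lambda>y. \<Sum>l=1..m. \<Sum>\<mu>=1..m. y (U l (unit \<mu>)) * y (U \<mu> (unit l)))"

definition PE :: "nat \<Rightarrow> mi \<Rightarrow> fn" where
  "PE m i = (\<lambda>y. (\<Sum>\<mu>=1..m. y (P (inc (inc i \<mu>) \<mu>))) + Dmi m i (quadU m) y)"

definition gen :: "nat \<Rightarrow> bool \<times> mi \<Rightarrow> fn" where
  "gen m k = (if fst k then PE m (snd k) else CE m (snd k))"

definition Jid :: "nat \<Rightarrow> fn set" where
  "Jid m = {g. \<exists>K a. finite K \<and> K \<subseteq> {k. valid_mi m (snd k)} \<and> (\<forall>k\<in>K. a k \<in> AB m)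
               \<and> g = (\<lambda>y. \<Sum>k\<in>K. a k y * gen m k y)}"

text \<open>Equality in A(CPE) of representatives.\<close>
definition eqJ :: "nat \<Rightarrow> fn \<Rightarrow> fn \<Rightarrow> bool" where
  "eqJ m f g \<longleftrightarrow> (\<lambda>y. f y - g y) \<in> Jid m"

text \<open>The representative of the class of f depending only on the free coordinates of CPE
  (unique by the concrete description of A(CPE)).\<close>
definition nf :: "nat \<Rightarrow> fn \<Rightarrow> fn" where
  "nf m f = (THE g. g \<in> AB m \<and> (\<forall>y z. (\<forall>v. free_var m v \<longrightarrow> y v = z v) \<longrightarrow> g y = g z)
                  \<and> eqJ m f g)"

text \<open>A form assigns to each increasing multi-index I (a finite set) the coefficient of
  dx^{i_1} wedge ... wedge dx^{i_q}.\<close>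
type_synonym form = "nat set \<Rightarrow> fn"

definition formsOn :: "nat \<Rightarrow> nat set \<Rightarrow> nat \<Rightarrow> form set" where
  "formsOn m Idx q = {\<omega>. \<forall>I. (I \<subseteq> Idx \<and> card I = q \<longrightarrow> \<omega> I \<in> AB m)
                              \<and> (\<not> (I \<subseteq> Idx \<and> card I = q) \<longrightarrow> \<omega> I = (\<lambda>_. 0))}"

definition sgn_ins :: "nat \<Rightarrow> nat set \<Rightarrow> real" where
  "sgn_ins \<mu> I = (-1) ^ card {\<nu>\<in>I. \<nu> < \<mu>}"

definition dOn :: "nat \<Rightarrow> nat set \<Rightarrow> form \<Rightarrow> form" where
  "dOn m Idx \<omega> = (\<lambda>I. if I \<subseteq> Idx then
       (\<lambda>y. \<Sum>\<mu>\<in>I. sgn_ins \<mu> (I - {\<mu>}) * Dt m \<mu> (\<omega> (I - {\<mu>})) y) else (\<lambda>_. 0))"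

definition formEqJ :: "nat \<Rightarrow> form \<Rightarrow> form \<Rightarrow> bool" where
  "formEqJ m \<omega> \<eta> \<longleftrightarrow> (\<forall>I. eqJ m (\<omega> I) (\<eta> I))"

definition Mset :: "nat \<Rightarrow> nat set" where "Mset m = {1..m}"
definition Nset :: "nat \<Rightarrow> nat set" where "Nset m = {2..m}"

text \<open>Horizontal complex of CPE (coefficients in A(CPE), via representatives).\<close>
definition Hcocycles :: "nat \<Rightarrow> nat \<Rightarrow> form set" where
  "Hcocycles m q = {\<omega> \<in> formsOn m (Mset m) q. formEqJ m (dOn m (Mset m) \<omega>) (\<lambda>_ _. 0)}"

definition Hcobound :: "nat \<Rightarrow> nat \<Rightarrow> form set" where
  "Hcobound m q = {\<omega> \<in> formsOn m (Mset m) q.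
      if q = 0 then formEqJ m \<omega> (\<lambda>_ _. 0)
      else (\<exists>\<eta> \<in> formsOn m (Mset m) (q - 1). formEqJ m \<omega> (dOn m (Mset m) \<eta>))}"

definition Tcocycles :: "nat \<Rightarrow> nat \<Rightarrow> form set" where
  "Tcocycles m q = {\<theta> \<in> formsOn m (Nset m) q. formEqJ m (dOn m (Nset m) \<theta>) (\<lambda>_ _. 0)}"

definition Tcobound :: "nat \<Rightarrow> nat \<Rightarrow> form set" where
  "Tcobound m q = {\<theta> \<in> formsOn m (Nset m) q.
      if q = 0 then formEqJ m \<theta> (\<lambda>_ _. 0)
      else (\<exists>\<eta> \<in> formsOn m (Nset m) (q - 1). formEqJ m \<theta> (dOn m (Nset m) \<eta>))}"

definition D1form :: "nat \<Rightarrow> form \<Rightarrow> form" where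
  "D1form m \<theta> = (\<lambda>I. Dt m 1 (\<theta> I))"

text \<open>ker D_1^{m-1} (representatives) and H^{m-1}(Theta)/im D_1^{m-1} (denominator).\<close>
definition kerD1 :: "nat \<Rightarrow> form set" where
  "kerD1 m = {\<theta> \<in> Tcocycles m (m - 1). D1form m \<theta> \<in> Tcobound m (m - 1)}"

definition TcoboundPlusImD1 :: "nat \<Rightarrow> form set" where
  "TcoboundPlusImD1 m = {\<theta> \<in> formsOn m (Nset m) (m - 1).
      \<exists>\<beta> \<in> Tcobound m (m - 1). \<exists>\<zeta> \<in> Tcocycles m (m - 1).
         formEqJ m \<theta> (\<lambda>I y. \<beta> I y + D1form m \<zeta> I y)}"

definition fadd :: "form \<Rightarrow> form \<Rightarrow> form" where
  "fadd \<omega> \<eta> = (\<lambda>I y. \<omega> I y + \<eta> I y)"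
definition fscale :: "real \<Rightarrow> form \<Rightarrow> form" where
  "fscale c \<omega> = (\<lambda>I y. c * \<omega> I y)"

text \<open>Families (chi_u, (chi^k_alpha)_{k,alpha}, chi_{p,0}, chi_{p,1}); chi^k_alpha is
  \<open>ck k alpha\<close>.\<close>
type_synonym fam = "fn \<times> (nat \<Rightarrow> nat \<Rightarrow> fn) \<times> fn \<times> fn"

definition famadd :: "fam \<Rightarrow> fam \<Rightarrow> fam" where
  "famadd a b = (case a of (u, c, p0, p1) \<Rightarrow> case b of (u', c', p0', p1') \<Rightarrow>
     (\<lambda>y. u y + u' y, \<lambda>k \<alpha> y. c k \<alpha> y + c' k \<alpha> y, \<lambda>y. p0 y + p0' y, \<lambda>y. p1 y + p1' y))"
definition famscale :: "real \<Rightarrow> fam \<Rightarrow> fam" where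
  "famscale r a = (case a of (u, c, p0, p1) \<Rightarrow>
     (\<lambda>y. r * u y, \<lambda>k \<alpha> y. r * c k \<alpha> y, \<lambda>y. r * p0 y, \<lambda>y. r * p1 y))"

definition Fams :: "nat \<Rightarrow> fam set" where
  "Fams m = {(u, c, p0, p1). u \<in> AB m \<and> p0 \<in> AB m \<and> p1 \<in> AB m
      \<and> (\<forall>k \<alpha>. (\<alpha> \<in> Nset m \<longrightarrow> c k \<alpha> \<in> AB m) \<and> (\<alpha> \<notin> Nset m \<longrightarrow> c k \<alpha> = (\<lambda>_. 0)))
      \<and> (\<exists>K. \<forall>k\<ge>K. \<forall>\<alpha>\<in>Nset m. eqJ m (c k \<alpha>) (\<lambda>_. 0))}"

definition famEqJ :: "nat \<Rightarrow> fam \<Rightarrow> fam \<Rightarrow> bool" where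
  "famEqJ m a b = (case a of (u, c, p0, p1) \<Rightarrow> case b of (u', c', p0', p1') \<Rightarrow>
     eqJ m u u' \<and> (\<forall>k. \<forall>\<alpha>\<in>Nset m. eqJ m (c k \<alpha>) (c' k \<alpha>)) \<and> eqJ m p0 p0' \<and> eqJ m p1 p1')"

definition famZeroJ :: "nat \<Rightarrow> fam set" where
  "famZeroJ m = {a \<in> Fams m. famEqJ m a (\<lambda>_. 0, \<lambda>_ _ _. 0, \<lambda>_. 0, \<lambda>_. 0)}"

definition mulf :: "fn \<Rightarrow> fn \<Rightarrow> fn" where "mulf f g = (\<lambda>y. f y * g y)"

definition Sspace :: "nat \<Rightarrow> fam set" where
  "Sspace m = {(u, c, p0, p1) \<in> Fams m.
     eqJ m (\<lambda>y. Dt m 1 u y + 2 * (\<Sum>\<alpha>\<in>Nset m. Dt m \<alpha> (mulf (coord (U \<alpha> (unit 1))) p1) y)) (\<lambda>_. 0)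
   \<and> (\<forall>k. \<forall>\<alpha>\<in>Nset m. eqJ m (\<lambda>y.
        Dt m 1 (c k \<alpha>) y
        + (if k = 0 then Dt m \<alpha> u y else 0)
        + (if k = 0 then 0 else c (k - 1) \<alpha> y)
        + 2 * ((if k = 0 then Dt m \<alpha> (\<lambda>z. (\<Sum>\<beta>\<in>Nset m. z (U \<beta> (unit \<beta>))) * p1 z) y else 0)
               - (if k = 1 then y (U 1 (unit \<alpha>)) * p1 y else 0)
               + (if k = 0 then (\<Sum>\<beta>\<in>Nset m. Dt m \<beta> (mulf (coord (U \<beta> (unit \<alpha>))) p1) y) else 0)))
        (\<lambda>_. 0))
   \<and> eqJ m (\<lambda>y. Dt m 1 p0 y - (\<Sum>\<alpha>\<in>Nset m. Dt m \<alpha> (Dt m \<alpha> p1) y)) (\<lambda>_. 0)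
   \<and> eqJ m (\<lambda>y. Dt m 1 p1 y + p0 y) (\<lambda>_. 0)}"

text \<open>Partial variational derivatives w.r.t. x^2..x^m, computed on the free-coordinate
  representative of L.\<close>
definition validJ :: "nat \<Rightarrow> mi \<Rightarrow> bool" where
  "validJ m j \<longleftrightarrow> valid_mi m j \<and> j 1 = 0"

definition shiftj :: "var \<Rightarrow> mi \<Rightarrow> var" where
  "shiftj v j = (case v of X \<nu> \<Rightarrow> X \<nu> | U l i \<Rightarrow> U l (\<lambda>k. i k + j k) | P i \<Rightarrow> P (\<lambda>k. i k + j k))"

definition negDj :: "nat \<Rightarrow> mi \<Rightarrow> fn \<Rightarrow> fn" where
  "negDj m j f = foldr (\<lambda>\<alpha> g. ((\<lambda>h y. - Dt m \<alpha> h y) ^^ j \<alpha>) g) [2..<Suc m] f"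

definition vder :: "nat \<Rightarrow> var \<Rightarrow> fn \<Rightarrow> fn" where
  "vder m v L = (let g = nf m L in
     (\<lambda>y. \<Sum>j\<in>{j. validJ m j \<and> partial (shiftj v j) g \<noteq> (\<lambda>_. 0)}.
            negDj m j (partial (shiftj v j) g) y))"

definition vdfam :: "nat \<Rightarrow> fn \<Rightarrow> fam" where
  "vdfam m L = (vder m (U 1 (\<lambda>_. 0)) L,
                \<lambda>k \<alpha>. if \<alpha> \<in> Nset m then vder m (U \<alpha> (at1 k)) L else (\<lambda>_. 0),
                vder m (P (\<lambda>_. 0)) L,
                vder m (P (at1 1)) L)"

definition Hspace :: "nat \<Rightarrow> fam set" where
  "Hspace m = {a \<in> Fams m. \<exists>L \<in> AB m. famEqJ m a (vdfam m L)}"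

section \<open>Linear isomorphism of quotient spaces Z1/E1 and Z2/E2 (via representatives)\<close>

definition quot_iso ::
  "('a \<Rightarrow> 'a \<Rightarrow> 'a) \<Rightarrow> (real \<Rightarrow> 'a \<Rightarrow> 'a) \<Rightarrow> 'a set \<Rightarrow> 'a set \<Rightarrow>
   ('b \<Rightarrow> 'b \<Rightarrow> 'b) \<Rightarrow> (real \<Rightarrow> 'b \<Rightarrow> 'b) \<Rightarrow> 'b set \<Rightarrow> 'b set \<Rightarrow> bool" where
  "quot_iso addA scA Z1 E1 addB scB Z2 E2 \<longleftrightarrow>
     (\<exists>\<phi>. (\<forall>x\<in>Z1. \<phi> x \<in> Z2)
        \<and> (\<forall>x\<in>Z1. \<forall>x'\<in>Z1. \<phi> (addA x x') = addB (\<phi> x) (\<phi> x'))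
        \<and> (\<forall>c. \<forall>x\<in>Z1. \<phi> (scA c x) = scB c (\<phi> x))
        \<and> (\<forall>x\<in>Z1. \<phi> x \<in> E2 \<longleftrightarrow> x \<in> E1)
        \<and> (\<forall>z\<in>Z2. \<exists>x\<in>Z1. addB z (scB (-1) (\<phi> x)) \<in> E2))"

end

theory Submission
  imports Defs
begin

text \<open>
Functions of the free coordinates represent the classes modulo the ideal uniquely, and on them
\<open>D\<^sub>2, \<dots>, D\<^sub>m\<close> act as the total derivatives of a free jet space, while \<open>D\<^sub>1\<close> acts as a further vector
field commuting with them. Splitting off one differential at a time makes every complex the cone of
a single derivation on a smaller complex, so the cohomology is read off inductively from the kernel and
cokernel of that derivation. In top degree an \<open>N\<close>-divergence is recognised by the vanishing of its
variational derivatives: integration by parts turns the linearisation of \<open>f\<close> into its variational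
derivatives modulo divergences, and integrating along \<open>t \<mapsto> f(x, t u)\<close> recovers \<open>f\<close> from its
linearisation. Finally \<open>\<delta>(D\<^sub>1 L)\<close> is the linear system of \<open>S\<close> applied to \<open>\<delta>L\<close>, because
\<open>D\<^sub>1\<close> acts on linearisations compatibly with \<open>D\<^sub>2, \<dots>, D\<^sub>m\<close>.
\<close>

section \<open>Smooth functions of finitely many coordinates\<close>

text \<open>What separates direction 1 from the others is the shape of the vector fields. For
  \<alpha> \<ge> 2 the components of \<open>D\<^sub>\<alpha>\<close> at dependent coordinates are
  coordinates again, one order higher. The induced operator on finite families is therefore
  injective, because the highest shift cannot cancel, and so \<open>D\<^sub>\<alpha>\<close> is
  injective on the top cohomology of the directions above \<alpha>. This carries the induction
  through the degree just below the top. These fields are also homogeneous in the dependent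
  coordinates, so they commute with averaging over the scaling. The field of
  \<open>D\<^sub>1\<close> contains the quadratic right-hand side of the pressure equation, and
  neither argument applies to it. It is split off last, and its kernel and cokernel on the top
  cohomology of the directions 2 to m survive in degrees m - 1 and m. In lower degrees it does no
  harm: there closed forms of positive degree are exact, and closed functions depend on
  \<open>x\<^sup>1\<close> alone, where \<open>D\<^sub>1\<close> is an ordinary derivative with an
  antiderivative.\<close>

definition depends_on :: "fn \<Rightarrow> var set \<Rightarrow> bool" where
  "depends_on f S \<longleftrightarrow> (\<forall>y z. (\<forall>v\<in>S. y v = z v) \<longrightarrow> f y = f z)"

text \<open>The conditions of \<open>AB\<close> relative to an arbitrary set of coordinates, so that
  \<open>AB\<close>, the algebra in the free coordinates and the functions of some of the x alone
  are instances of one notion.\<close>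

definition smf :: "var set \<Rightarrow> fn set" where
  "smf V = {f. (\<exists>S. finite S \<and> S \<subseteq> V \<and> depends_on f S)
            \<and> (\<forall>vs. continuous_on UNIV (pds vs f)
                   \<and> (\<forall>v y. (\<lambda>t. pds vs f (y(v := t))) differentiable (at (y v))))}"

lemma AB_eq_smf: "AB m = smf {v. valid_var m v}"
  unfolding AB_def smf_def depends_on_def by (rule refl)

lemma depends_onD: "depends_on f S \<Longrightarrow> (\<And>v. v \<in> S \<Longrightarrow> y v = z v) \<Longrightarrow> f y = f z"
  unfolding depends_on_def by blast

lemma depends_on_mono: "depends_on f S \<Longrightarrow> S \<subseteq> T \<Longrightarrow> depends_on f T"
  unfolding depends_on_def by blast

lemma partial_cong:
  assumes "depends_on f S" "\<And>u. u \<in> S \<Longrightarrow> y u = z u"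
  shows "partial v f y = partial v f z"
proof (cases "v \<in> S")
  case True
  then have "(\<lambda>t. f (y(v := t))) = (\<lambda>t. f (z(v := t)))" "y v = z v"
    using assms by (auto intro!: depends_onD[OF assms(1)])
  then show ?thesis unfolding partial_def by simp
next
  case False
  then have "f (y(v := t)) = f y" "f (z(v := t)) = f z" for t
    by (auto intro!: depends_onD[OF assms(1)])
  then show ?thesis unfolding partial_def by simp
qed

lemma depends_on_partial: "depends_on f S \<Longrightarrow> depends_on (partial v f) S"
  unfolding depends_on_def[of "partial v f"] using partial_cong by blast

lemma partial_outside:
  assumes "depends_on f S" "v \<notin> S" shows "partial v f = (\<lambda>_. 0)"
proof
  fix y
  have "f (y(v := t)) = f y" for t
    using assms by (intro depends_onD[OF assms(1)]) auto
  then show "partial v f y = 0" unfolding partial_def by simp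
qed

lemma partial_eqI:
  "((\<lambda>t. f (y(v := t))) has_real_derivative d) (at (y v)) \<Longrightarrow> partial v f y = d"
  unfolding partial_def by (rule DERIV_imp_deriv)

text \<open>Smoothness speaks of all iterated partial derivatives at once. A set closed under a
  single \<open>partial\<close> contains all of them, so one-step properties of its members are
  enough.\<close>

lemma smf_coinduct:
  assumes "f \<in> F"
    and "\<And>g. g \<in> F \<Longrightarrow> \<exists>S. finite S \<and> S \<subseteq> V \<and> depends_on g S"
    and "\<And>g. g \<in> F \<Longrightarrow> continuous_on UNIV g"
    and "\<And>g v y. g \<in> F \<Longrightarrow> \<exists>d. ((\<lambda>t. g (y(v := t))) has_real_derivative d) (at (y v))"
    and "\<And>g v. g \<in> F \<Longrightarrow> partial v g \<in> F"
  shows "f \<in> smf V"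
proof -
  have *: "pds vs f \<in> F" for vs
    by (induction vs) (auto simp: assms)
  then show ?thesis
    unfolding smf_def using assms(2)[OF assms(1)] assms(3)[OF *] assms(4)[OF *]
    by (auto simp: real_differentiable_def)
qed

lemma smf_finite_dep:
  assumes "f \<in> smf V" obtains S where "finite S" "S \<subseteq> V" "depends_on f S"
  using assms unfolding smf_def by blast

lemma smf_mono: "V \<subseteq> W \<Longrightarrow> f \<in> smf V \<Longrightarrow> f \<in> smf W"
  unfolding smf_def by blast

lemma smf_continuous: "f \<in> smf V \<Longrightarrow> continuous_on UNIV f"
  unfolding smf_def by (metis (mono_tags, lifting) mem_Collect_eq pds.simps(1))

lemma smf_has_partial:
  assumes "f \<in> smf V"
  shows "((\<lambda>t. f (y(v := t))) has_real_derivative partial v f (y(v := x))) (at x)"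
proof -
  have "(\<lambda>t. pds [] f ((y(v := x))(v := t))) differentiable (at ((y(v := x)) v))"
    using assms unfolding smf_def by blast
  then have "(\<lambda>t. f (y(v := t))) field_differentiable (at x)"
    by (simp add: real_differentiable_def field_differentiable_def)
  then show ?thesis
    unfolding partial_def using DERIV_deriv_iff_field_differentiable by fastforce
qed

lemma smf_has_partial_at:
  assumes "f \<in> smf V"
  shows "((\<lambda>t. f (y(v := t))) has_real_derivative partial v f y) (at (y v))"
  using smf_has_partial[OF assms, of y v "y v"] by simp

lemma smf_partial:
  assumes "f \<in> smf V" shows "partial v f \<in> smf V"
proof -
  have *: "pds vs (partial v f) = pds (vs @ [v]) f" for vs
    by (induction vs) auto
  then show ?thesis
    using assms depends_on_partial unfolding smf_def mem_Collect_eq * by blast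
qed

lemma smf_partial_outside: "f \<in> smf V \<Longrightarrow> v \<notin> V \<Longrightarrow> partial v f = (\<lambda>_. 0)"
  by (metis partial_outside smf_finite_dep subsetD)

lemma smf_depends: "f \<in> smf V \<Longrightarrow> depends_on f V"
  by (metis depends_on_mono smf_finite_dep)

lemma smf_const: "(\<lambda>_. c) \<in> smf V"
proof (rule smf_coinduct[where F = "range (\<lambda>c _. c)"])
  fix g :: fn and v assume "g \<in> range (\<lambda>c _. c)"
  then obtain c where "g = (\<lambda>_. c)" by auto
  then have "partial v g = (\<lambda>_. 0)" unfolding partial_def by simp
  then show "partial v g \<in> range (\<lambda>c _. c)" by simp
qed (auto simp: depends_on_def intro!: exI[of _ "{}"] exI[of _ 0])

lemma partial_const [simp]: "partial v (\<lambda>_. c) = (\<lambda>_. 0)"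
  unfolding partial_def by simp

lemma partial_coord: "partial v (coord w) = (\<lambda>_. if v = w then 1 else 0)"
proof
  fix y show "partial v (coord w) y = (if v = w then 1 else 0)"
    by (rule partial_eqI) (auto simp: coord_def intro!: derivative_eq_intros)
qed

lemma smf_coord:
  assumes "w \<in> V" shows "coord w \<in> smf V"
proof (rule smf_coinduct[where F = "insert (coord w) (smf V)"])
  fix g v y assume g: "g \<in> insert (coord w) (smf V)"
  show "continuous_on UNIV g" using g smf_continuous by (auto simp: coord_def)
  show "\<exists>S. finite S \<and> S \<subseteq> V \<and> depends_on g S"
  proof (cases "g \<in> smf V")
    case False
    then show ?thesis using g assms
      by (intro exI[of _ "{w}"]) (auto simp: coord_def depends_on_def)
  qed (meson smf_finite_dep)
  show "partial v g \<in> insert (coord w) (smf V)"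
    using g smf_partial smf_const by (auto simp: partial_coord)
  have "((\<lambda>t. coord w (y(v := t))) has_real_derivative (if v = w then 1 else 0)) (at (y v))"
    by (auto simp: coord_def intro!: derivative_eq_intros)
  then show "\<exists>d. ((\<lambda>t. g (y(v := t))) has_real_derivative d) (at (y v))"
    using g smf_has_partial_at by blast
qed auto

text \<open>The invariant of the coinductive smoothness proofs.\<close>

inductive_set alg :: "fn set \<Rightarrow> fn set" for B where
  alg_base: "f \<in> B \<Longrightarrow> f \<in> alg B"
| alg_add: "f \<in> alg B \<Longrightarrow> g \<in> alg B \<Longrightarrow> (\<lambda>y. f y + g y) \<in> alg B"
| alg_mult: "f \<in> alg B \<Longrightarrow> g \<in> alg B \<Longrightarrow> (\<lambda>y. f y * g y) \<in> alg B"

lemma depends_on_Un2: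
  assumes "\<exists>S. finite S \<and> S \<subseteq> V \<and> depends_on f S" "\<exists>S. finite S \<and> S \<subseteq> V \<and> depends_on g S"
  shows "\<exists>S. finite S \<and> S \<subseteq> V \<and> depends_on (\<lambda>y. h (f y) (g y)) S"
proof -
  obtain S T where S: "finite S" "S \<subseteq> V" "depends_on f S" and T: "finite T" "T \<subseteq> V" "depends_on g T"
    using assms by blast
  have "depends_on (\<lambda>y. h (f y) (g y)) (S \<union> T)"
    using S T unfolding depends_on_def by (metis UnCI)
  then show ?thesis using S T by (metis finite_Un Un_least)
qed

text \<open>The Leibniz rule brings derivatives of products back into the algebra, so only the
  generators have to be examined. Their derivatives may leave \<open>B\<close> as long as they stay
  in \<open>alg B\<close>, which is exactly what the chain rule provides.\<close>

lemma alg_subset_smf: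
  assumes dep: "\<And>g. g \<in> B \<Longrightarrow> \<exists>S. finite S \<and> S \<subseteq> V \<and> depends_on g S"
    and cont: "\<And>g. g \<in> B \<Longrightarrow> continuous_on UNIV g"
    and der: "\<And>g v y. g \<in> B \<Longrightarrow> ((\<lambda>t. g (y(v := t))) has_real_derivative partial v g y) (at (y v))"
    and part: "\<And>g v. g \<in> B \<Longrightarrow> partial v g \<in> alg B"
    and "f \<in> alg B"
  shows "f \<in> smf V"
proof (rule smf_coinduct[OF \<open>f \<in> alg B\<close>])
  have *: "(\<exists>S. finite S \<and> S \<subseteq> V \<and> depends_on g S) \<and> continuous_on UNIV g
     \<and> (\<forall>v y. ((\<lambda>t. g (y(v := t))) has_real_derivative partial v g y) (at (y v)))
     \<and> (\<forall>v. partial v g \<in> alg B)" if "g \<in> alg B" for g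
    using that
  proof induction
    case (alg_base f)
    then show ?case using assms by blast
  next
    case (alg_add f g)
    have d: "((\<lambda>t. f (y(v := t)) + g (y(v := t))) has_real_derivative partial v f y + partial v g y) (at (y v))" for v y
      by (intro DERIV_add) (use alg_add.IH in blast)+
    have p: "partial v (\<lambda>y. f y + g y) = (\<lambda>y. partial v f y + partial v g y)" for v
      by (rule ext, rule partial_eqI, rule d)
    have "continuous_on UNIV (\<lambda>y. f y + g y)"
      using alg_add.IH by (intro continuous_on_add) blast+
    moreover have "(\<lambda>y. partial v f y + partial v g y) \<in> alg B" for v
      using alg_add.IH by (intro alg.alg_add) blast+
    ultimately show ?case using alg_add.IH d depends_on_Un2[of V f g "(+)"] unfolding p by blast
  next
    case (alg_mult f g)
    have d: "((\<lambda>t. f (y(v := t)) * g (y(v := t))) has_real_derivative partial v f y * g y + partial v g y * f y) (at (y v))" for v y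
      using DERIV_mult[of "\<lambda>t. f (y(v := t))" "partial v f y" "y v" UNIV "\<lambda>t. g (y(v := t))" "partial v g y"]
        alg_mult.IH by simp
    have p: "partial v (\<lambda>y. f y * g y) = (\<lambda>y. partial v f y * g y + partial v g y * f y)" for v
      by (rule ext, rule partial_eqI, rule d)
    have "continuous_on UNIV (\<lambda>y. f y * g y)"
      using alg_mult.IH by (intro continuous_on_mult) blast+
    moreover have "(\<lambda>y. partial v f y * g y + partial v g y * f y) \<in> alg B" for v
      using alg_mult by (intro alg.alg_add alg.alg_mult) blast+
    ultimately show ?case using alg_mult.IH d depends_on_Un2[of V f g "(*)"] unfolding p by blast
  qed
  show "\<And>g. g \<in> alg B \<Longrightarrow> \<exists>S. finite S \<and> S \<subseteq> V \<and> depends_on g S"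
    and "\<And>g. g \<in> alg B \<Longrightarrow> continuous_on UNIV g"
    and "\<And>g v y. g \<in> alg B \<Longrightarrow> \<exists>d. ((\<lambda>t. g (y(v := t))) has_real_derivative d) (at (y v))"
    and "\<And>g v. g \<in> alg B \<Longrightarrow> partial v g \<in> alg B"
    using * by blast+
qed

lemma smf_alg:
  assumes "f \<in> alg (smf V)" shows "f \<in> smf V"
proof (rule alg_subset_smf[OF _ _ _ _ assms])
  fix g v y assume g: "g \<in> smf V"
  show "\<exists>S. finite S \<and> S \<subseteq> V \<and> depends_on g S" by (rule smf_finite_dep[OF g]) blast
  show "partial v g \<in> alg (smf V)" using g by (intro alg_base smf_partial)
  show "continuous_on UNIV g" using g by (rule smf_continuous)
  show "((\<lambda>t. g (y(v := t))) has_real_derivative partial v g y) (at (y v))"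
    using g by (rule smf_has_partial_at)
qed

lemma smf_add: "f \<in> smf V \<Longrightarrow> g \<in> smf V \<Longrightarrow> (\<lambda>y. f y + g y) \<in> smf V"
  by (rule smf_alg, rule alg_add; rule alg_base)

lemma smf_mult: "f \<in> smf V \<Longrightarrow> g \<in> smf V \<Longrightarrow> (\<lambda>y. f y * g y) \<in> smf V"
  by (rule smf_alg, rule alg_mult; rule alg_base)

lemma smf_cmult: "f \<in> smf V \<Longrightarrow> (\<lambda>y. c * f y) \<in> smf V"
  by (intro smf_mult smf_const)

lemma smf_uminus: "f \<in> smf V \<Longrightarrow> (\<lambda>y. - f y) \<in> smf V"
  using smf_cmult[of f V "-1"] by simp

lemma smf_diff: "f \<in> smf V \<Longrightarrow> g \<in> smf V \<Longrightarrow> (\<lambda>y. f y - g y) \<in> smf V"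
  using smf_add[of f V "\<lambda>y. - g y"] smf_uminus by simp

lemma smf_sum: "(\<And>i. i \<in> I \<Longrightarrow> f i \<in> smf V) \<Longrightarrow> (\<lambda>y. \<Sum>i\<in>I. f i y) \<in> smf V"
  by (induction I rule: infinite_finite_induct) (auto intro: smf_const smf_add)

lemmas smf_intros = smf_const smf_coord smf_add smf_mult smf_uminus smf_diff smf_sum smf_partial

lemma partial_add:
  "f \<in> smf V \<Longrightarrow> g \<in> smf W \<Longrightarrow> partial v (\<lambda>y. f y + g y) = (\<lambda>y. partial v f y + partial v g y)"
  by (rule ext, rule partial_eqI) (intro DERIV_add smf_has_partial_at)

lemma partial_mult:
  assumes "f \<in> smf V" "g \<in> smf W"
  shows "partial v (\<lambda>y. f y * g y) = (\<lambda>y. partial v f y * g y + f y * partial v g y)"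
  by (rule ext, rule partial_eqI, rule DERIV_mult[THEN DERIV_cong])
    (auto intro: smf_has_partial_at assms)

lemma partial_cmult: "f \<in> smf V \<Longrightarrow> partial v (\<lambda>y. c * f y) = (\<lambda>y. c * partial v f y)"
  by (simp add: partial_mult[OF smf_const])

lemma partial_uminus: "f \<in> smf V \<Longrightarrow> partial v (\<lambda>y. - f y) = (\<lambda>y. - partial v f y)"
  using partial_cmult[of f V v "-1"] by simp

lemma partial_sum:
  "(\<And>i. i \<in> I \<Longrightarrow> f i \<in> smf V) \<Longrightarrow> partial v (\<lambda>y. \<Sum>i\<in>I. f i y) = (\<lambda>y. \<Sum>i\<in>I. partial v (f i) y)"
proof (induction I rule: infinite_finite_induct)
  case (insert a I)
  then show ?case
    by (simp add: partial_add[OF _ smf_sum, of "f a" V I f V])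
qed auto

subsection \<open>Chain rule\<close>

lemma tendsto_coordinatewise:
  fixes c :: "'b \<Rightarrow> 'a \<Rightarrow> real"
  assumes "\<And>v. ((\<lambda>t. c t v) \<longlongrightarrow> l v) F"
  shows "(c \<longlongrightarrow> l) F"
proof -
  have "limitin (product_topology (\<lambda>i. euclidean) UNIV) c l F"
    unfolding limitin_componentwise using assms by simp
  then show ?thesis
    by (simp add: euclidean_product_topology)
qed

text \<open>Points lie in an infinite product, so the chain rule is obtained by releasing the moving
  coordinates one at a time. The increment due to the new coordinate is rewritten by the mean value
  theorem, and continuity of the partial derivative in all coordinates jointly takes its
  intermediate value to the value at \<open>c x\<close>.\<close>

lemma deriv_along_curve_aux:
  assumes f: "f \<in> smf V" and "finite S"
    and "\<And>v. v \<in> S \<Longrightarrow> ((\<lambda>t. c t v) has_real_derivative c' v) (at x)"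
  shows "((\<lambda>t. f (\<lambda>v. if v \<in> S then c t v else c x v)) has_real_derivative
          (\<Sum>v\<in>S. partial v f (c x) * c' v)) (at x)"
  using assms(2,3)
proof (induction S rule: finite_induct)
  case empty
  then show ?case by simp
next
  case (insert a S)
  define C where "C t = (\<lambda>v. if v \<in> S then c t v else c x v)" for t
  have "\<exists>\<xi>. \<bar>\<xi> - c x a\<bar> \<le> \<bar>c t a - c x a\<bar> \<and>
      f ((C t)(a := c t a)) - f ((C t)(a := c x a)) = partial a f ((C t)(a := \<xi>)) * (c t a - c x a)" for t
  proof (cases "c t a" "c x a" rule: linorder_cases)
    case less
    from MVT2[OF this, of "\<lambda>s. f ((C t)(a := s))" "\<lambda>s. partial a f ((C t)(a := s))"]
    obtain z where "c t a < z" "z < c x a"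
      "f ((C t)(a := c x a)) - f ((C t)(a := c t a)) = (c x a - c t a) * partial a f ((C t)(a := z))"
      using smf_has_partial[OF f] by metis
    then show ?thesis by (intro exI[of _ z]) (auto simp: algebra_simps)
  next
    case greater
    from MVT2[OF this, of "\<lambda>s. f ((C t)(a := s))" "\<lambda>s. partial a f ((C t)(a := s))"]
    obtain z where "c x a < z" "z < c t a"
      "f ((C t)(a := c t a)) - f ((C t)(a := c x a)) = (c t a - c x a) * partial a f ((C t)(a := z))"
      using smf_has_partial[OF f] by metis
    then show ?thesis by (intro exI[of _ z]) (auto simp: algebra_simps)
  qed auto
  then obtain \<xi> where xi: "\<And>t. \<bar>\<xi> t - c x a\<bar> \<le> \<bar>c t a - c x a\<bar>"
    "\<And>t. f ((C t)(a := c t a)) - f ((C t)(a := c x a)) = partial a f ((C t)(a := \<xi> t)) * (c t a - c x a)"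
    by metis
  have ca: "((\<lambda>t. c t a) has_real_derivative c' a) (at x)" using insert by auto
  then obtain g where g: "\<And>z. c z a - c x a = g z * (z - x)" "isCont g x" "g x = c' a"
    unfolding CARAT_DERIV by blast
  have xix: "\<xi> x = c x a" using xi(1)[of x] by simp
  have contc: "isCont (\<lambda>t. c t v) x" if "v \<in> insert a S" for v
    using insert(4)[OF that] DERIV_isCont by blast
  have "((\<lambda>t. \<xi> t - c x a) \<longlongrightarrow> 0) (at x)"
  proof (rule Lim_null_comparison[where g = "\<lambda>t. \<bar>c t a - c x a\<bar>"])
    show "((\<lambda>t. \<bar>c t a - c x a\<bar>) \<longlongrightarrow> 0) (at x)"
      using contc[of a] by (auto simp: isCont_def intro!: tendsto_eq_intros)
  qed (use xi(1) in auto)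
  then have "isCont \<xi> x"
    by (simp add: isCont_def xix LIM_zero_iff)
  then have contC: "((\<lambda>t. (C t)(a := \<xi> t)) \<longlongrightarrow> (C x)(a := \<xi> x)) (at x)"
  proof (intro tendsto_coordinatewise)
    fix v show "((\<lambda>t. ((C t)(a := \<xi> t)) v) \<longlongrightarrow> ((C x)(a := \<xi> x)) v) (at x)"
      using \<open>isCont \<xi> x\<close> contc[of v]
      by (cases "v = a"; cases "v \<in> S") (auto simp: C_def isCont_def)
  qed
  have Cx: "(C x)(a := \<xi> x) = c x" unfolding C_def by (auto simp: xix)
  have "isCont (\<lambda>t. partial a f ((C t)(a := \<xi> t))) x"
    unfolding isCont_def
    by (rule continuous_on_tendsto_compose[OF smf_continuous[OF smf_partial[OF f]] contC]) auto
  \<comment> \<open>Caratheodory's criterion: the slope of the composite is the partial derivative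
    at the intermediate point times the slope \<open>g\<close> of the coordinate curve, and both
    factors are continuous at \<open>x\<close>.\<close>
  then have "((\<lambda>t. f ((C t)(a := c t a)) - f ((C t)(a := c x a))) has_real_derivative
      partial a f (c x) * c' a) (at x)"
    unfolding CARAT_DERIV
    by (intro exI[of _ "\<lambda>t. partial a f ((C t)(a := \<xi> t)) * g t"])
      (auto simp: xi(2) g Cx intro!: continuous_intros)
  moreover have "((\<lambda>t. f (C t)) has_real_derivative (\<Sum>v\<in>S. partial v f (c x) * c' v)) (at x)"
    unfolding C_def using insert by auto
  ultimately have "((\<lambda>t. f ((C t)(a := c t a)) - f ((C t)(a := c x a)) + f (C t)) has_real_derivative
      partial a f (c x) * c' a + (\<Sum>v\<in>S. partial v f (c x) * c' v)) (at x)"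
    by (rule DERIV_add)
  moreover have "f ((C t)(a := c t a)) - f ((C t)(a := c x a)) + f (C t) =
      f (\<lambda>v. if v \<in> insert a S then c t v else c x v)" for t
  proof -
    have "(C t)(a := c x a) = C t" using insert by (auto simp: C_def)
    moreover have "(C t)(a := c t a) = (\<lambda>v. if v \<in> insert a S then c t v else c x v)"
      by (auto simp: C_def)
    ultimately show ?thesis by simp
  qed
  ultimately show ?case using insert by simp
qed

lemma deriv_along_curve:
  assumes f: "f \<in> smf V" and S: "finite S" "depends_on f S"
    and c: "\<And>v. v \<in> S \<Longrightarrow> ((\<lambda>t. c t v) has_real_derivative c' v) (at x)"
  shows "((\<lambda>t. f (c t)) has_real_derivative (\<Sum>v\<in>S. partial v f (c x) * c' v)) (at x)"
proof -
  have "(\<lambda>t. f (c t)) = (\<lambda>t. f (\<lambda>v. if v \<in> S then c t v else c x v))"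
    by (intro ext depends_onD[OF S(2)]) auto
  then show ?thesis using deriv_along_curve_aux[OF f S(1) c] by simp
qed

definition subst :: "(var \<Rightarrow> fn) \<Rightarrow> fn \<Rightarrow> fn" where
  "subst s f = (\<lambda>y. f (\<lambda>v. s v y))"

lemma subst_has_partial:
  assumes "f \<in> smf V" "finite S" "depends_on f S" "\<And>v. v \<in> S \<Longrightarrow> s v \<in> smf W"
  shows "((\<lambda>t. subst s f (y(w := t))) has_real_derivative
     (\<Sum>v\<in>S. subst s (partial v f) y * partial w (s v) y)) (at (y w))"
proof -
  have "((\<lambda>t. f (\<lambda>v. s v (y(w := t)))) has_real_derivative
     (\<Sum>v\<in>S. partial v f (\<lambda>v. s v (y(w := y w))) * partial w (s v) y)) (at (y w))"
    by (rule deriv_along_curve[OF assms(1-3)]) (use assms(4) smf_has_partial_at in blast)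
  then show ?thesis by (simp add: subst_def)
qed

lemma partial_subst:
  assumes "f \<in> smf V" "finite S" "depends_on f S" "\<And>v. v \<in> S \<Longrightarrow> s v \<in> smf W"
  shows "partial w (subst s f) = (\<lambda>y. \<Sum>v\<in>S. subst s (partial v f) y * partial w (s v) y)"
  by (rule ext, rule partial_eqI, rule subst_has_partial) (use assms in auto)

lemma alg_sum:
  "finite I \<Longrightarrow> (\<lambda>_. 0) \<in> B \<Longrightarrow> (\<And>i. i \<in> I \<Longrightarrow> f i \<in> alg B) \<Longrightarrow> (\<lambda>y. \<Sum>i\<in>I. f i y) \<in> alg B"
  by (induction I rule: finite_induct) (auto intro: alg_base alg_add)

text \<open>A partial derivative of a composite is a sum of composites with coefficients in
  \<open>smf W\<close>, so the algebra generated by both kinds of functions is closed under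
  \<open>partial\<close>. The substitution is first made zero outside \<open>V\<close>, which
  \<open>f\<close> cannot notice, to have every component smooth.\<close>

lemma smf_subst:
  assumes f: "f \<in> smf V" and s: "\<And>v. v \<in> V \<Longrightarrow> s v \<in> smf W"
  shows "subst s f \<in> smf W"
proof -
  define s' where "s' v = (if v \<in> V then s v else (\<lambda>_. 0))" for v
  have s': "s' v \<in> smf W" for v using s smf_const by (auto simp: s'_def)
  have eq: "subst s f = subst s' f"
    unfolding subst_def s'_def by (intro ext depends_onD[OF smf_depends[OF f]]) auto
  let ?B = "smf W \<union> subst s' ` smf V"
  have "subst s' f \<in> smf W"
  proof (rule alg_subset_smf[where B = ?B])
    fix g assume g: "g \<in> ?B"
    show "\<exists>S. finite S \<and> S \<subseteq> W \<and> depends_on g S"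
    proof (cases "g \<in> smf W")
      case False
      then obtain h where h: "h \<in> smf V" "g = subst s' h" using g by auto
      obtain S where S: "finite S" "depends_on h S" using smf_finite_dep[OF h(1)] by metis
      obtain T where T: "\<And>v. finite (T v) \<and> T v \<subseteq> W \<and> depends_on (s' v) (T v)"
        by (meson smf_finite_dep[OF s'])
      have "depends_on g (\<Union>v\<in>S. T v)"
        unfolding depends_on_def h subst_def
      proof (intro allI impI)
        fix y z :: pt assume "\<forall>v\<in>\<Union>v\<in>S. T v. y v = z v"
        then show "h (\<lambda>v. s' v y) = h (\<lambda>v. s' v z)"
          using T by (intro depends_onD[OF S(2)]) (metis UN_I depends_onD)
      qed
      then show ?thesis using S T by (intro exI[of _ "\<Union>v\<in>S. T v"]) auto
    qed (meson smf_finite_dep)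
    show "continuous_on UNIV g"
    proof (cases "g \<in> smf W")
      case False
      then obtain h where h: "h \<in> smf V" "g = subst s' h" using g by auto
      have "continuous_on UNIV (\<lambda>y v. s' v y)"
        by (rule continuous_on_coordinatewise_then_product) (use s' smf_continuous in blast)
      then show ?thesis unfolding h subst_def
        using continuous_on_compose2[OF smf_continuous[OF h(1)]] by blast
    qed (rule smf_continuous)
    fix v y
    show "((\<lambda>t. g (y(v := t))) has_real_derivative partial v g y) (at (y v))"
    proof (cases "g \<in> smf W")
      case False
      then obtain h where h: "h \<in> smf V" "g = subst s' h" using g by auto
      obtain S where S: "finite S" "depends_on h S" using smf_finite_dep[OF h(1)] by metis
      show ?thesis unfolding h(2) partial_subst[OF h(1) S s'] by (rule subst_has_partial[OF h(1) S s'])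
    qed (rule smf_has_partial_at)
    show "partial v g \<in> alg ?B"
    proof (cases "g \<in> smf W")
      case False
      then obtain h where h: "h \<in> smf V" "g = subst s' h" using g by auto
      obtain S where S: "finite S" "depends_on h S" using smf_finite_dep[OF h(1)] by metis
      show ?thesis unfolding h(2) partial_subst[OF h(1) S s']
        by (intro alg_sum S alg_mult alg_base)
          (use smf_const s' smf_partial h(1) in auto)
    qed (auto intro: alg_base smf_partial)
  qed (use f in \<open>auto intro: alg_base\<close>)
  then show ?thesis using eq by simp
qed

subsection \<open>Integration over one coordinate\<close>

text \<open>A spare coordinate plays the integration parameter. Integrals along a path thus remain
  functions of points, and the integrand is an ordinary substitution to which
  \<open>smf_subst\<close> applies.\<close>

definition int01 :: "var \<Rightarrow> fn \<Rightarrow> fn" where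
  "int01 v f = (\<lambda>y. integral {0..1} (\<lambda>t. f (y(v := t))))"

lemma continuous_on_upd:
  fixes g :: "'a::topological_space \<Rightarrow> 'b \<Rightarrow> real"
  assumes "continuous_on A g" "continuous_on A h"
  shows "continuous_on A (\<lambda>x. (g x)(v := h x))"
proof (rule continuous_on_coordinatewise_then_product)
  fix i
  show "continuous_on A (\<lambda>x. ((g x)(v := h x)) i)"
    using assms(2) continuous_on_product_then_coordinatewise[OF assms(1)] by (cases "i = v") auto
qed

lemma smf_continuous_compose:
  "f \<in> smf V \<Longrightarrow> continuous_on A g \<Longrightarrow> continuous_on A (\<lambda>x. f (g x))"
  using continuous_on_compose2[OF smf_continuous] by blast

lemma int01_has_partial:
  assumes f: "f \<in> smf V" and "w \<noteq> v"
  shows "((\<lambda>t. int01 v f (y(w := t))) has_real_derivative int01 v (partial w f) y) (at (y w))"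
proof -
  have "((\<lambda>s. integral (cbox 0 1) (\<lambda>t. f (y(w := s, v := t)))) has_real_derivative
      integral (cbox 0 1) (\<lambda>t. partial w f (y(w := y w, v := t)))) (at (y w) within UNIV)"
  proof (rule leibniz_rule_field_derivative)
    fix s t :: real
    show "((\<lambda>s. f (y(w := s, v := t))) has_real_derivative partial w f (y(w := s, v := t))) (at s within UNIV)"
      using smf_has_partial[OF f, of "y(v := t)" w s] \<open>w \<noteq> v\<close> by (simp add: fun_upd_twist)
    show "(\<lambda>t. f (y(w := s, v := t))) integrable_on cbox 0 1"
      by (intro integrable_continuous smf_continuous_compose[OF f] continuous_on_upd continuous_intros)
  next
    show "continuous_on (UNIV \<times> cbox 0 1) (\<lambda>(s, t). partial w f (y(w := s, v := t)))"
      unfolding split_beta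
      by (intro smf_continuous_compose[OF smf_partial[OF f]] continuous_on_upd continuous_intros)
  qed auto
  then show ?thesis by (simp add: int01_def)
qed

lemma partial_int01:
  assumes "f \<in> smf V" "w \<noteq> v" shows "partial w (int01 v f) = int01 v (partial w f)"
  by (rule ext, rule partial_eqI, rule int01_has_partial) (use assms in auto)

lemma int01_upd: "int01 v f (y(v := t)) = int01 v f y"
  by (simp add: int01_def)

lemma smf_int01:
  assumes "f \<in> smf V" shows "int01 v f \<in> smf (V - {v})"
proof (rule smf_coinduct[where F = "int01 v ` smf V"])
  fix g assume "g \<in> int01 v ` smf V"
  then obtain h where h: "h \<in> smf V" "g = int01 v h" by auto
  obtain S where S: "finite S" "S \<subseteq> V" "depends_on h S" using smf_finite_dep[OF h(1)] by metis
  have "depends_on g (S - {v})"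
    unfolding depends_on_def h(2) int01_def
  proof (intro allI impI)
    fix y z :: pt assume "\<forall>w\<in>S - {v}. y w = z w"
    then have "h (y(v := t)) = h (z(v := t))" for t by (intro depends_onD[OF S(3)]) auto
    then show "integral {0..1} (\<lambda>t. h (y(v := t))) = integral {0..1} (\<lambda>t. h (z(v := t)))" by simp
  qed
  then show "\<exists>S. finite S \<and> S \<subseteq> V - {v} \<and> depends_on g S" using S by (intro exI[of _ "S - {v}"]) auto
  have "continuous_on UNIV (\<lambda>y. integral (cbox 0 1) (\<lambda>t. h (y(v := t))))"
    by (rule integral_continuous_on_param, unfold split_beta)
      (intro smf_continuous_compose[OF h(1)] continuous_on_upd continuous_intros)
  then show "continuous_on UNIV g" by (simp add: h int01_def)
  fix w y
  have v: "g (y(v := t)) = g y" for t y by (simp add: h int01_upd)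
  show "\<exists>d. ((\<lambda>t. g (y(w := t))) has_real_derivative d) (at (y w))"
  proof (cases "w = v")
    case True
    then show ?thesis unfolding True v by (intro exI[of _ 0] DERIV_const)
  next
    case False
    then show ?thesis using int01_has_partial[OF h(1), of w v y] h by blast
  qed
  have z: "int01 v (\<lambda>_. 0) = (\<lambda>_. 0)" by (simp add: int01_def)
  show "partial w g \<in> int01 v ` smf V"
  proof (cases "w = v")
    case True
    have "partial w g = int01 v (\<lambda>_. 0)" unfolding partial_def True v z by simp
    then show ?thesis using smf_const by blast
  next
    case False
    then show ?thesis using partial_int01[OF h(1) False] h smf_partial by blast
  qed
qed (rule imageI[OF assms])

text \<open>Clairaut's theorem, from differentiating under the integral sign.\<close>

lemma partial_commute:
  assumes f: "f \<in> smf V" shows "partial a (partial b f) = partial b (partial a f)"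
proof (cases "a = b")
  case ab: False
  show ?thesis
  proof
    fix y :: pt
    let ?x = "y a"
    \<comment> \<open>The base point lies strictly to the left of \<open>?x\<close>, so that
      \<open>?x\<close> is interior to \<open>{A..?x + 1}\<close> and the derivative of the integral
      within the interval is a two-sided one.\<close>
    define A where "A = ?x - 1"
    have fa: "partial a f \<in> smf V" and fb: "partial b f \<in> smf V" and fba: "partial b (partial a f) \<in> smf V"
      using f smf_partial by blast+
    have c: "continuous_on S (\<lambda>t. partial a f (z(a := t)))" for S and z :: pt
      by (intro smf_continuous_compose[OF fa] continuous_on_upd continuous_intros)
    have c2: "continuous_on S (\<lambda>t. partial b (partial a f) (z(a := t)))" for S and z :: pt
      by (intro smf_continuous_compose[OF fba] continuous_on_upd continuous_intros)
    have ftc: "integral {A..u} (\<lambda>t. partial a f (z(a := t))) = f (z(a := u)) - f (z(a := A))"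
      if "A \<le> u" for u and z :: pt
      using fundamental_theorem_of_calculus[OF that, of "\<lambda>t. f (z(a := t))" "\<lambda>t. partial a f (z(a := t))"]
        smf_has_partial[OF f, of z a]
      by (auto simp flip: has_real_derivative_iff_has_vector_derivative
          intro!: integral_unique intro: has_field_derivative_at_within)
    have eq: "integral {A..u} (\<lambda>t. partial b (partial a f) (y(a := t))) =
        partial b f (y(a := u)) - partial b f (y(a := A))" if "A \<le> u" for u
    proof -
      have "((\<lambda>s. integral (cbox A u) (\<lambda>t. partial a f (y(b := s, a := t)))) has_real_derivative
          integral (cbox A u) (\<lambda>t. partial b (partial a f) (y(b := y b, a := t)))) (at (y b) within UNIV)"
      proof (rule leibniz_rule_field_derivative)
        fix s t :: real
        show "((\<lambda>s. partial a f (y(b := s, a := t))) has_real_derivative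
            partial b (partial a f) (y(b := s, a := t))) (at s within UNIV)"
          using smf_has_partial[OF fa, of "y(a := t)" b s] ab by (simp add: fun_upd_twist)
        show "(\<lambda>t. partial a f (y(b := s, a := t))) integrable_on cbox A u"
          by (intro integrable_continuous c)
      next
        show "continuous_on (UNIV \<times> cbox A u) (\<lambda>(s, t). partial b (partial a f) (y(b := s, a := t)))"
          unfolding split_beta
          by (intro smf_continuous_compose[OF fba] continuous_on_upd continuous_intros)
      qed auto
      then have 1: "((\<lambda>s. f (y(b := s, a := u)) - f (y(b := s, a := A))) has_real_derivative
          integral {A..u} (\<lambda>t. partial b (partial a f) (y(a := t)))) (at (y b))"
        using ftc[OF that] by simp
      have 2: "((\<lambda>s. f (y(b := s, a := w))) has_real_derivative partial b f (y(a := w))) (at (y b))" for w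
        using smf_has_partial_at[OF f, of "y(a := w)" b] ab by (simp add: fun_upd_twist)
      show ?thesis using DERIV_unique[OF 1 DERIV_diff[OF 2 2]] .
    qed
    have "((\<lambda>u. integral {A..u} (\<lambda>t. partial b (partial a f) (y(a := t)))) has_real_derivative
        partial b (partial a f) (y(a := ?x))) (at ?x within {A..?x + 1})"
      by (rule integral_has_real_derivative[OF c2]) (auto simp: A_def)
    then have "((\<lambda>u. partial b f (y(a := u)) - partial b f (y(a := A))) has_real_derivative
        partial b (partial a f) (y(a := ?x))) (at ?x within {A..?x + 1})"
      by (rule has_field_derivative_transform_within[where d = 1]) (auto simp: A_def eq[unfolded A_def])
    then have "((\<lambda>u. partial b f (y(a := u)) - partial b f (y(a := A))) has_real_derivative
        partial b (partial a f) y) (at ?x)"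
      using at_within_Icc_at[of A ?x "?x + 1"] by (simp add: A_def)
    moreover have "((\<lambda>u. partial b f (y(a := u)) - partial b f (y(a := A))) has_real_derivative
        partial a (partial b f) y) (at ?x)"
      using smf_has_partial_at[OF fb, of y a] by (auto intro!: derivative_eq_intros)
    ultimately show "partial a (partial b f) y = partial b (partial a f) y"
      using DERIV_unique by blast
  qed
qed simp

subsection \<open>Vector fields\<close>

definition vf :: "(var \<Rightarrow> fn) \<Rightarrow> fn \<Rightarrow> fn" where
  "vf a f = (\<lambda>y. \<Sum>v | partial v f \<noteq> (\<lambda>_. 0). a v y * partial v f y)"

lemma vf_eq:
  assumes "finite S" "depends_on f S"
  shows "vf a f = (\<lambda>y. \<Sum>v\<in>S. a v y * partial v f y)"
proof
  fix y
  have "{v. partial v f \<noteq> (\<lambda>_. 0)} \<subseteq> S" using partial_outside[OF assms(2)] by blast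
  then show "vf a f y = (\<Sum>v\<in>S. a v y * partial v f y)"
    unfolding vf_def by (intro sum.mono_neutral_left assms) auto
qed

lemma smf_common_dep:
  assumes "f \<in> smf V" "g \<in> smf V"
  obtains S where "finite S" "S \<subseteq> V" "depends_on f S" "depends_on g S"
proof -
  obtain S T where "finite S" "S \<subseteq> V" "depends_on f S" "finite T" "T \<subseteq> V" "depends_on g T"
    using smf_finite_dep[OF assms(1)] smf_finite_dep[OF assms(2)] by metis
  then show thesis using that[of "S \<union> T"] depends_on_mono by (metis Un_least Un_upper1 Un_upper2 finite_Un)
qed

lemma depends_on_comb:
  "depends_on f S \<Longrightarrow> depends_on g S \<Longrightarrow> depends_on (\<lambda>y. h (f y) (g y)) S"
  unfolding depends_on_def by metis

lemma smf_vf: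
  assumes "f \<in> smf V" "\<And>v. v \<in> V \<Longrightarrow> a v \<in> smf V" shows "vf a f \<in> smf V"
proof -
  obtain S where S: "finite S" "S \<subseteq> V" "depends_on f S" using smf_finite_dep[OF assms(1)] by metis
  show ?thesis unfolding vf_eq[OF S(1,3)]
    by (intro smf_sum smf_mult smf_partial assms) (use S in auto)
qed

lemma vf_const [simp]: "vf a (\<lambda>_. c) = (\<lambda>_. 0)"
  by (simp add: vf_def)

lemma depends_on_coord: "depends_on (coord w) {w}"
  by (simp add: depends_on_def coord_def)

lemma vf_coord [simp]: "vf a (coord w) = a w"
  by (simp add: vf_eq[OF _ depends_on_coord] partial_coord)

lemma vf_add:
  assumes "f \<in> smf V" "g \<in> smf V" shows "vf a (\<lambda>y. f y + g y) = (\<lambda>y. vf a f y + vf a g y)"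
proof -
  obtain S where S: "finite S" "depends_on f S" "depends_on g S" using smf_common_dep[OF assms] by metis
  show ?thesis
    by (simp add: vf_eq[OF S(1) depends_on_comb[OF S(2,3)]] vf_eq[OF S(1,2)] vf_eq[OF S(1,3)]
        partial_add[OF assms] sum.distrib algebra_simps)
qed

lemma vf_mult:
  assumes "f \<in> smf V" "g \<in> smf V"
  shows "vf a (\<lambda>y. f y * g y) = (\<lambda>y. vf a f y * g y + f y * vf a g y)"
proof -
  obtain S where S: "finite S" "depends_on f S" "depends_on g S" using smf_common_dep[OF assms] by metis
  show ?thesis
    by (simp add: vf_eq[OF S(1) depends_on_comb[OF S(2,3)]] vf_eq[OF S(1,2)] vf_eq[OF S(1,3)]
        partial_mult[OF assms] sum.distrib algebra_simps sum_distrib_left sum_distrib_right)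
qed

lemma vf_sum:
  "(\<And>i. i \<in> I \<Longrightarrow> f i \<in> smf V) \<Longrightarrow> vf a (\<lambda>y. \<Sum>i\<in>I. f i y) = (\<lambda>y. \<Sum>i\<in>I. vf a (f i) y)"
proof (induction I rule: infinite_finite_induct)
  case (insert j I)
  then show ?case by (simp add: vf_add[OF _ smf_sum, of "f j" V I f])
qed auto

lemma vf_subst:
  assumes f: "f \<in> smf V" "finite S" "depends_on f S" and s: "\<And>v. v \<in> S \<Longrightarrow> s v \<in> smf W"
  shows "vf a (subst s f) = (\<lambda>y. \<Sum>v\<in>S. subst s (partial v f) y * vf a (s v) y)"
proof -
  have "\<forall>v\<in>S. \<exists>T. finite T \<and> depends_on (s v) T" using s smf_finite_dep by metis
  then obtain T where T: "\<And>v. v \<in> S \<Longrightarrow> finite (T v)" "\<And>v. v \<in> S \<Longrightarrow> depends_on (s v) (T v)" by metis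
  let ?T = "\<Union>v\<in>S. T v"
  have fin: "finite ?T" using T f by auto
  have dep: "depends_on (s v) ?T" if "v \<in> S" for v using T that depends_on_mono by blast
  have "depends_on (subst s f) ?T"
    unfolding depends_on_def subst_def
    by (intro allI impI depends_onD[OF f(3)]) (metis dep depends_onD)
  then have "vf a (subst s f) = (\<lambda>y. \<Sum>w\<in>?T. a w y * (\<Sum>v\<in>S. subst s (partial v f) y * partial w (s v) y))"
    by (simp add: vf_eq[OF fin] partial_subst[OF f s])
  also have "\<dots> = (\<lambda>y. \<Sum>v\<in>S. subst s (partial v f) y * (\<Sum>w\<in>?T. a w y * partial w (s v) y))"
    unfolding sum_distrib_left by (subst sum.swap) (simp add: algebra_simps)
  also have "\<dots> = (\<lambda>y. \<Sum>v\<in>S. subst s (partial v f) y * vf a (s v) y)"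
    using dep by (intro ext sum.cong refl) (simp add: vf_eq[OF fin])
  finally show ?thesis .
qed

text \<open>The commutator of a coordinate derivative with a vector field. It is the source of both
  formulas for the linearisation of a total derivative, \<open>grad_Db\<close> and
  \<open>grad_Db1\<close>.\<close>

lemma partial_vf:
  assumes f: "f \<in> smf V" "finite S" "depends_on f S" and a: "\<And>v. v \<in> S \<Longrightarrow> a v \<in> smf W"
  shows "partial u (vf a f) = (\<lambda>y. vf a (partial u f) y + (\<Sum>v\<in>S. partial u (a v) y * partial v f y))"
proof -
  have f': "f \<in> smf UNIV" "\<And>v. v \<in> S \<Longrightarrow> a v \<in> smf UNIV" using f a smf_mono by blast+
  have m: "(\<lambda>y. a v y * partial v f y) \<in> smf UNIV" if "v \<in> S" for v
    using f' that by (intro smf_mult smf_partial)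
  have "partial u (\<lambda>y. \<Sum>v\<in>S. a v y * partial v f y) = (\<lambda>y. \<Sum>v\<in>S. partial u (\<lambda>y. a v y * partial v f y) y)"
    using m by (rule partial_sum)
  then show ?thesis
    unfolding vf_eq[OF f(2,3)] vf_eq[OF f(2) depends_on_partial[OF f(3)]]
    using partial_commute[OF f(1)]
    by (auto simp: fun_eq_iff partial_mult[OF f'(2) smf_partial[OF f'(1)]] sum.distrib algebra_simps
        intro!: sum.cong)
qed

text \<open>In either order the second-order terms form the same double sum by symmetry of second
  derivatives, so commutation has to be tested on the coordinates only.\<close>

lemma vf_commute:
  assumes f: "f \<in> smf V" and a: "\<And>v. v \<in> V \<Longrightarrow> a v \<in> smf V" and b: "\<And>v. v \<in> V \<Longrightarrow> b v \<in> smf V"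
    and ab: "\<And>v. v \<in> V \<Longrightarrow> vf a (b v) = vf b (a v)"
  shows "vf a (vf b f) = vf b (vf a f)"
proof -
  obtain S where S: "finite S" "S \<subseteq> V" "depends_on f S" using smf_finite_dep[OF f] by metis
  have *: "vf c (vf d f) = (\<lambda>y. (\<Sum>v\<in>S. vf c (d v) y * partial v f y)
      + (\<Sum>v\<in>S. \<Sum>w\<in>S. d v y * (c w y * partial w (partial v f) y)))"
    if "\<And>v. v \<in> V \<Longrightarrow> d v \<in> smf V" for c d
  proof -
    have d: "\<And>v. v \<in> S \<Longrightarrow> d v \<in> smf V" using that S by blast
    have m: "(\<lambda>y. d v y * partial v f y) \<in> smf V" if "v \<in> S" for v
      using d that f by (intro smf_mult smf_partial)
    have "vf c (\<lambda>y. \<Sum>v\<in>S. d v y * partial v f y) = (\<lambda>y. \<Sum>v\<in>S. vf c (\<lambda>y. d v y * partial v f y) y)"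
      using m by (rule vf_sum)
    then show ?thesis
      unfolding vf_eq[OF S(1,3), of d]
      by (auto simp: fun_eq_iff vf_mult[OF d smf_partial[OF f]] sum.distrib sum_distrib_left
          vf_eq[OF S(1) depends_on_partial[OF S(3)]] intro!: sum.cong)
  qed
  have 1: "vf a (vf b f) = (\<lambda>y. (\<Sum>v\<in>S. vf a (b v) y * partial v f y)
      + (\<Sum>v\<in>S. \<Sum>w\<in>S. b v y * (a w y * partial w (partial v f) y)))"
    by (rule *) (rule b)
  have 2: "vf b (vf a f) = (\<lambda>y. (\<Sum>v\<in>S. vf b (a v) y * partial v f y)
      + (\<Sum>v\<in>S. \<Sum>w\<in>S. a v y * (b w y * partial w (partial v f) y)))"
    by (rule *) (rule a)
  have "(\<Sum>v\<in>S. \<Sum>w\<in>S. b v y * (a w y * partial w (partial v f) y))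
      = (\<Sum>v\<in>S. \<Sum>w\<in>S. a v y * (b w y * partial w (partial v f) y))" for y
    by (subst sum.swap) (simp add: partial_commute[OF f, of _ _] mult.left_commute)
  moreover have "(\<Sum>v\<in>S. vf a (b v) y * partial v f y) = (\<Sum>v\<in>S. vf b (a v) y * partial v f y)" for y
    using S ab by (intro sum.cong) auto
  ultimately show ?thesis unfolding 1 2 by simp
qed

text \<open>Hadamard's lemma along the segment from \<open>h y\<close> to \<open>y v\<close>, whose
  parameter is the coordinate \<open>z\<close>. It turns the change caused by substituting for one
  coordinate into a multiple of \<open>y v - h y\<close>, which is what membership in the ideal
  requires.\<close>

lemma hadamard:
  assumes f: "f \<in> smf V" and h: "h \<in> smf V" and v: "v \<in> V" and z: "z \<notin> V"
  obtains Q where "Q \<in> smf V" "\<And>y. f y - f (y(v := h y)) = (y v - h y) * Q y"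
proof
  define s where "s u = (if u = v then (\<lambda>y. h y + coord z y * (coord v y - h y)) else coord u)" for u
  let ?g = "subst s (partial v f)"
  have s: "s u \<in> smf (insert z V)" if "u \<in> V" for u
    using that h v smf_mono[of V "insert z V"] unfolding s_def
    by (auto intro!: smf_add smf_mult smf_diff smf_coord)
  have "int01 z ?g \<in> smf (insert z V - {z})"
    using f s by (intro smf_int01 smf_subst smf_partial)
  then show "int01 z ?g \<in> smf V" using z by simp
  fix y
  have vz: "v \<noteq> z" using v z by auto
  define c where "c t = h y + t * (y v - h y)" for t
  have g: "?g (y(z := t)) = partial v f (y(v := c t))" for t
  proof -
    have "h (y(z := t)) = h y" using z by (intro depends_onD[OF smf_depends[OF h]]) auto
    then have "(s u) (y(z := t)) = (y(v := c t)) u" if "u \<in> V" for u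
      using that vz z by (auto simp: s_def c_def coord_def)
    then show ?thesis unfolding subst_def
      by (intro depends_onD[OF smf_depends[OF smf_partial[OF f]]])
  qed
  have "((\<lambda>t. f (y(v := c t))) has_real_derivative partial v f (y(v := c t)) * (y v - h y)) (at t)" for t
    by (rule DERIV_chain2[OF smf_has_partial[OF f]]) (auto simp: c_def intro!: derivative_eq_intros)
  then have "((\<lambda>t. partial v f (y(v := c t)) * (y v - h y)) has_integral f (y(v := c 1)) - f (y(v := c 0))) {0..1}"
    by (intro fundamental_theorem_of_calculus)
      (simp_all only: has_real_derivative_iff_has_vector_derivative[symmetric] has_field_derivative_at_within)
  then have "integral {0..1} (\<lambda>t. partial v f (y(v := c t)) * (y v - h y)) = f (y(v := c 1)) - f (y(v := c 0))"
    by (rule integral_unique)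
  then have "integral {0..1} (\<lambda>t. partial v f (y(v := c t))) * (y v - h y) = f y - f (y(v := h y))"
    by (simp only: integral_mult_left) (simp add: c_def)
  then show "f y - f (y(v := h y)) = (y v - h y) * int01 z ?g y"
    by (simp only: int01_def g mult.commute)
qed

section \<open>Total derivatives\<close>

lemma inc_simps [simp]: "inc i \<mu> \<mu> = Suc (i \<mu>)" "\<nu> \<noteq> \<mu> \<Longrightarrow> inc i \<mu> \<nu> = i \<nu>"
  by (auto simp: inc_def)

lemma inc_commute: "inc (inc i a) b = inc (inc i b) a"
  by (auto simp: inc_def fun_eq_iff)

lemma shiftv_simps [simp]:
  "shiftv \<mu> (X \<nu>) = X \<nu>" "shiftv \<mu> (U l i) = U l (inc i \<mu>)" "shiftv \<mu> (P i) = P (inc i \<mu>)"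
  by (auto simp: shiftv_def)

lemma shiftv_commute: "shiftv \<mu> (shiftv \<nu> v) = shiftv \<nu> (shiftv \<mu> v)"
  by (cases v) (auto simp: inc_commute)

lemma is_X_simps [simp]: "is_X (X \<nu>)" "\<not> is_X (U l i)" "\<not> is_X (P i)"
  by (auto simp: is_X_def)

lemma is_X_shiftv [simp]: "is_X (shiftv \<mu> v) = is_X v"
  by (cases v) auto

lemma valid_inc: "valid_mi m i \<Longrightarrow> 1 \<le> \<mu> \<Longrightarrow> \<mu> \<le> m \<Longrightarrow> valid_mi m (inc i \<mu>)"
  by (auto simp: valid_mi_def inc_def)

lemma valid_shiftv: "valid_var m v \<Longrightarrow> 1 \<le> \<mu> \<Longrightarrow> \<mu> \<le> m \<Longrightarrow> valid_var m (shiftv \<mu> v)"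
  by (cases v) (auto simp: valid_var_def valid_inc)

lemma free_shiftv: "free_var m v \<Longrightarrow> 2 \<le> \<mu> \<Longrightarrow> \<mu> \<le> m \<Longrightarrow> free_var m (shiftv \<mu> v)"
  by (cases v) (auto simp: free_var_def valid_var_def valid_inc)

lemma free_valid: "free_var m v \<Longrightarrow> valid_var m v"
  by (simp add: free_var_def)

text \<open>The algebra of the equation, realised by functions of the free coordinates.\<close>

definition FR :: "nat \<Rightarrow> fn set" where
  "FR m = smf {v. free_var m v}"

lemma FR_AB: "f \<in> FR m \<Longrightarrow> f \<in> AB m"
  unfolding FR_def AB_eq_smf by (rule smf_mono[rotated]) (auto simp: free_valid)

definition tvf :: "nat \<Rightarrow> nat \<Rightarrow> var \<Rightarrow> fn" where
  "tvf m \<mu> v = (case v of X \<nu> \<Rightarrow> (\<lambda>_. if \<nu> = \<mu> then 1 else 0)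
      | _ \<Rightarrow> if valid_var m v then coord (shiftv \<mu> v) else (\<lambda>_. 0))"

lemma tvf_X [simp]: "tvf m \<mu> (X \<nu>) = (\<lambda>_. if \<nu> = \<mu> then 1 else 0)"
  by (simp add: tvf_def)

lemma tvf_nonX: "valid_var m v \<Longrightarrow> \<not> is_X v \<Longrightarrow> tvf m \<mu> v = coord (shiftv \<mu> v)"
  by (cases v) (auto simp: tvf_def)

lemma Dt_eq_vf:
  assumes "f \<in> AB m" shows "Dt m \<mu> f = vf (tvf m \<mu>) f"
proof
  fix y
  obtain S where S: "finite S" "depends_on f S"
    using smf_finite_dep assms unfolding AB_eq_smf by metis
  let ?S = "insert (X \<mu>) S"
  have S': "finite ?S" "depends_on f ?S" using S depends_on_mono[OF S(2)] by auto
  let ?D = "{v. valid_var m v \<and> \<not> is_X v \<and> partial v f \<noteq> (\<lambda>_. 0)}"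
  have "?D \<subseteq> ?S - {X \<mu>}" using partial_outside[OF S(2)] by auto
  moreover have "tvf m \<mu> v y * partial v f y = 0" if "v \<in> ?S - {X \<mu>} - ?D" for v
    using that by (cases v) (auto simp: tvf_def)
  ultimately have "(\<Sum>v\<in>?D. tvf m \<mu> v y * partial v f y) = (\<Sum>v\<in>?S - {X \<mu>}. tvf m \<mu> v y * partial v f y)"
    using S by (intro sum.mono_neutral_left) auto
  moreover have "(\<Sum>v\<in>?D. tvf m \<mu> v y * partial v f y) = (\<Sum>v\<in>?D. y (shiftv \<mu> v) * partial v f y)"
    by (intro sum.cong) (auto simp: tvf_nonX coord_def)
  ultimately show "Dt m \<mu> f y = vf (tvf m \<mu>) f y"
    unfolding vf_eq[OF S'] sum.remove[OF S'(1), of "X \<mu>", simplified] by (simp add: Dt_def)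
qed

lemma tvf_AB: "valid_var m v \<Longrightarrow> 1 \<le> \<mu> \<Longrightarrow> \<mu> \<le> m \<Longrightarrow> tvf m \<mu> v \<in> AB m"
  using valid_shiftv[of m v \<mu>] unfolding AB_eq_smf
  by (cases "is_X v", cases v) (auto simp: tvf_nonX intro!: smf_const smf_coord)

lemma tvf_FR: "free_var m v \<Longrightarrow> 2 \<le> \<mu> \<Longrightarrow> \<mu> \<le> m \<Longrightarrow> tvf m \<mu> v \<in> FR m"
  using free_shiftv[of m v \<mu>] free_valid[of m v] unfolding FR_def
  by (cases "is_X v", cases v) (auto simp: tvf_nonX intro!: smf_const smf_coord)

lemma Dt_AB: "f \<in> AB m \<Longrightarrow> 1 \<le> \<mu> \<Longrightarrow> \<mu> \<le> m \<Longrightarrow> Dt m \<mu> f \<in> AB m"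
  using tvf_AB by (simp add: Dt_eq_vf) (auto simp: AB_eq_smf intro!: smf_vf)

lemma Dt_FR: "f \<in> FR m \<Longrightarrow> 2 \<le> \<mu> \<Longrightarrow> \<mu> \<le> m \<Longrightarrow> Dt m \<mu> f \<in> FR m"
  using tvf_FR by (simp add: Dt_eq_vf[OF FR_AB]) (auto simp: FR_def intro!: smf_vf)

lemma Dt_commute:
  assumes "f \<in> AB m" "1 \<le> \<mu>" "\<mu> \<le> m" "1 \<le> \<nu>" "\<nu> \<le> m"
  shows "Dt m \<mu> (Dt m \<nu> f) = Dt m \<nu> (Dt m \<mu> f)"
proof -
  have "vf (tvf m \<mu>) (vf (tvf m \<nu>) f) = vf (tvf m \<nu>) (vf (tvf m \<mu>) f)"
  proof (rule vf_commute)
    show "f \<in> smf {v. valid_var m v}" using assms by (simp add: AB_eq_smf)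
    fix v assume v: "v \<in> {v. valid_var m v}"
    show "tvf m \<mu> v \<in> smf {v. valid_var m v}" "tvf m \<nu> v \<in> smf {v. valid_var m v}"
      using tvf_AB assms v by (auto simp: AB_eq_smf)
    show "vf (tvf m \<mu>) (tvf m \<nu> v) = vf (tvf m \<nu>) (tvf m \<mu> v)"
      using v assms by (cases "is_X v", cases v)
        (auto simp: tvf_nonX valid_shiftv shiftv_commute)
  qed
  then show ?thesis using assms Dt_AB by (simp add: Dt_eq_vf[symmetric])
qed

lemma Dt_coord: "valid_var m v \<Longrightarrow> \<not> is_X v \<Longrightarrow> Dt m \<mu> (coord v) = coord (shiftv \<mu> v)"
  using Dt_eq_vf[of "coord v" m \<mu>] by (simp add: AB_eq_smf smf_coord tvf_nonX)

lemma Dt_const [simp]: "Dt m \<mu> (\<lambda>_. c) = (\<lambda>_. 0)"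
  using Dt_eq_vf[of "\<lambda>_. c" m \<mu>] by (simp add: AB_eq_smf smf_const)

lemma AB_intros:
  "(\<lambda>_. c) \<in> AB m" "valid_var m v \<Longrightarrow> coord v \<in> AB m"
  "f \<in> AB m \<Longrightarrow> g \<in> AB m \<Longrightarrow> (\<lambda>y. f y + g y) \<in> AB m"
  "f \<in> AB m \<Longrightarrow> g \<in> AB m \<Longrightarrow> (\<lambda>y. f y - g y) \<in> AB m"
  "f \<in> AB m \<Longrightarrow> g \<in> AB m \<Longrightarrow> (\<lambda>y. f y * g y) \<in> AB m"
  "f \<in> AB m \<Longrightarrow> (\<lambda>y. - f y) \<in> AB m"
  "(\<And>i. i \<in> I \<Longrightarrow> h i \<in> AB m) \<Longrightarrow> (\<lambda>y. \<Sum>i\<in>I. h i y) \<in> AB m"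
  "f \<in> AB m \<Longrightarrow> partial w f \<in> AB m"
  unfolding AB_eq_smf by (auto intro!: smf_intros)

lemma FR_intros:
  "(\<lambda>_. c) \<in> FR m" "free_var m v \<Longrightarrow> coord v \<in> FR m"
  "f \<in> FR m \<Longrightarrow> g \<in> FR m \<Longrightarrow> (\<lambda>y. f y + g y) \<in> FR m"
  "f \<in> FR m \<Longrightarrow> g \<in> FR m \<Longrightarrow> (\<lambda>y. f y - g y) \<in> FR m"
  "f \<in> FR m \<Longrightarrow> g \<in> FR m \<Longrightarrow> (\<lambda>y. f y * g y) \<in> FR m"
  "f \<in> FR m \<Longrightarrow> (\<lambda>y. - f y) \<in> FR m"
  "(\<And>i. i \<in> I \<Longrightarrow> h i \<in> FR m) \<Longrightarrow> (\<lambda>y. \<Sum>i\<in>I. h i y) \<in> FR m"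
  "f \<in> FR m \<Longrightarrow> partial w f \<in> FR m"
  unfolding FR_def by (auto intro!: smf_intros)

lemma Dt_add: "f \<in> AB m \<Longrightarrow> g \<in> AB m \<Longrightarrow> Dt m \<mu> (\<lambda>y. f y + g y) = (\<lambda>y. Dt m \<mu> f y + Dt m \<mu> g y)"
  using vf_add[of f _ g] by (simp add: Dt_eq_vf AB_intros) (metis AB_eq_smf)

lemma Dt_mult:
  "f \<in> AB m \<Longrightarrow> g \<in> AB m \<Longrightarrow> Dt m \<mu> (\<lambda>y. f y * g y) = (\<lambda>y. Dt m \<mu> f y * g y + f y * Dt m \<mu> g y)"
  using vf_mult[of f _ g] by (simp add: Dt_eq_vf AB_intros) (metis AB_eq_smf)

lemma Dt_cmult: "f \<in> AB m \<Longrightarrow> Dt m \<mu> (\<lambda>y. c * f y) = (\<lambda>y. c * Dt m \<mu> f y)"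
  using Dt_mult[of "\<lambda>_. c" m f \<mu>] by (simp add: AB_intros)

lemma Dt_uminus: "f \<in> AB m \<Longrightarrow> Dt m \<mu> (\<lambda>y. - f y) = (\<lambda>y. - Dt m \<mu> f y)"
  using Dt_cmult[of f m \<mu> "-1"] by simp

lemma Dt_diff: "f \<in> AB m \<Longrightarrow> g \<in> AB m \<Longrightarrow> Dt m \<mu> (\<lambda>y. f y - g y) = (\<lambda>y. Dt m \<mu> f y - Dt m \<mu> g y)"
  using Dt_add[of f m "\<lambda>y. - g y" \<mu>] by (simp add: AB_intros Dt_uminus)

lemma Dt_sum:
  "(\<And>i. i \<in> I \<Longrightarrow> f i \<in> AB m) \<Longrightarrow> Dt m \<mu> (\<lambda>y. \<Sum>i\<in>I. f i y) = (\<lambda>y. \<Sum>i\<in>I. Dt m \<mu> (f i) y)"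
  using vf_sum[of I f "{v. valid_var m v}" "tvf m \<mu>"]
  by (simp add: Dt_eq_vf AB_intros) (simp add: AB_eq_smf)

text \<open>The condition \<open>i \<mu> \<noteq> 0\<close> is aimed at functions of the free
  coordinates: they are not closed under \<open>Dt m 1\<close>, but that operator is never applied
  when \<open>i 1 = 0\<close>.\<close>

lemma foldr_Dt_closed:
  assumes "\<And>g \<mu>. g \<in> F \<Longrightarrow> \<mu> \<in> set xs \<Longrightarrow> i \<mu> \<noteq> 0 \<Longrightarrow> Dt m \<mu> g \<in> F" "f \<in> F"
  shows "foldr (\<lambda>\<mu> g. (Dt m \<mu> ^^ i \<mu>) g) xs f \<in> F"
  using assms(1)
proof (induction xs)
  case (Cons a xs)
  then have "foldr (\<lambda>\<mu> g. (Dt m \<mu> ^^ i \<mu>) g) xs f \<in> F" by simp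
  moreover have "(Dt m a ^^ n) g \<in> F" if "g \<in> F" "n \<le> i a" for n g
    using that by (induction n) (auto intro!: Cons.prems)
  ultimately show ?case by simp
qed (use assms in simp)

lemma Dmi_AB: "f \<in> AB m \<Longrightarrow> Dmi m i f \<in> AB m"
  unfolding Dmi_def by (rule foldr_Dt_closed) (auto intro: Dt_AB)

lemma Dmi_FR: "f \<in> FR m \<Longrightarrow> i 1 = 0 \<Longrightarrow> Dmi m i f \<in> FR m"
  unfolding Dmi_def proof (rule foldr_Dt_closed)
  fix g \<mu> assume "i 1 = 0" "g \<in> FR m" "\<mu> \<in> set [1..<Suc m]" "i \<mu> \<noteq> 0"
  then have "\<mu> \<noteq> 1" "1 \<le> \<mu>" "\<mu> \<le> m" by auto
  then show "Dt m \<mu> g \<in> FR m" using \<open>g \<in> FR m\<close> by (intro Dt_FR) auto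
qed

lemma foldr_Dt_inc:
  assumes "f \<in> AB m" "set xs \<subseteq> {1..m}" "distinct xs" "\<mu> \<in> set xs"
  shows "Dt m \<mu> (foldr (\<lambda>\<mu> g. (Dt m \<mu> ^^ i \<mu>) g) xs f) = foldr (\<lambda>\<nu> g. (Dt m \<nu> ^^ inc i \<mu> \<nu>) g) xs f"
  using assms(2-)
proof (induction xs)
  case (Cons a xs)
  let ?g = "foldr (\<lambda>\<mu> g. (Dt m \<mu> ^^ i \<mu>) g) xs f"
  have g: "?g \<in> AB m" using Cons.prems by (intro foldr_Dt_closed assms Dt_AB) auto
  show ?case
  proof (cases "a = \<mu>")
    case True
    then have "?g = foldr (\<lambda>\<nu> g. (Dt m \<nu> ^^ inc i \<mu> \<nu>) g) xs f"
      using Cons.prems by (intro foldr_cong) (auto simp: inc_def)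
    then show ?thesis using True by simp
  next
    case False
    have "1 \<le> \<mu>" "\<mu> \<le> m" using Cons.prems by auto
    moreover have "1 \<le> a" "a \<le> m" using Cons.prems by auto
    ultimately have "Dt m \<mu> ((Dt m a ^^ n) ?g) = (Dt m a ^^ n) (Dt m \<mu> ?g) \<and> (Dt m a ^^ n) ?g \<in> AB m" for n
    proof (induction n)
      case (Suc n)
      then show ?case using Dt_commute[of "(Dt m a ^^ n) ?g" m \<mu> a] by (simp add: Dt_AB)
    qed (use g in simp)
    then show ?thesis using False Cons by simp
  qed
qed simp

lemma Dt_Dmi: "f \<in> AB m \<Longrightarrow> 1 \<le> \<mu> \<Longrightarrow> \<mu> \<le> m \<Longrightarrow> Dt m \<mu> (Dmi m i f) = Dmi m (inc i \<mu>) f"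
  unfolding Dmi_def by (rule foldr_Dt_inc) auto

lemma Dmi_0 [simp]: "Dmi m (\<lambda>_. 0) f = f"
proof -
  have "foldr (\<lambda>\<mu> g. g) xs f = f" for xs :: "nat list" by (induction xs) auto
  then show ?thesis by (simp add: Dmi_def)
qed

text \<open>The support \<open>A\<close> is a parameter: \<open>{1..m}\<close> reaches every
  multi-index, while \<open>Nset m\<close> reaches those with first entry 0 without ever raising
  that entry.\<close>

lemma mi_induct [consumes 2, case_names zero inc]:
  assumes "finite A" "\<forall>k. k \<notin> A \<longrightarrow> i k = 0" and zero: "Q (\<lambda>_. 0)"
    and inc: "\<And>i \<mu>. (\<forall>k. k \<notin> A \<longrightarrow> i k = 0) \<Longrightarrow> \<mu> \<in> A \<Longrightarrow> Q i \<Longrightarrow> Q (inc i \<mu>)"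
  shows "Q i"
  using assms(2)
proof (induction "\<Sum>k\<in>A. i k" arbitrary: i)
  case 0
  then have "i = (\<lambda>_. 0)" using assms(1) by (metis sum_eq_0_iff)
  then show ?case using zero by simp
next
  case (Suc n)
  then obtain \<mu> where \<mu>: "\<mu> \<in> A" "i \<mu> \<noteq> 0" by (metis sum.neutral nat.distinct(1))
  let ?j = "i(\<mu> := i \<mu> - 1)"
  have i: "i = inc ?j \<mu>" using \<mu> by (auto simp: inc_def)
  have "(\<Sum>k\<in>A. i k) = i \<mu> + (\<Sum>k\<in>A-{\<mu>}. ?j k)" using \<mu> assms(1) by (simp add: sum.remove)
  moreover have "(\<Sum>k\<in>A. ?j k) = i \<mu> - 1 + (\<Sum>k\<in>A-{\<mu>}. ?j k)" using \<mu> assms(1) by (simp add: sum.remove)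
  ultimately have "n = (\<Sum>k\<in>A. ?j k)" using Suc(2) \<mu> by simp
  then have "Q ?j" by (rule Suc(1)) (use Suc(3) \<mu> in auto)
  then have "Q (inc ?j \<mu>)" using Suc(3) \<mu> by (intro inc) auto
  then show ?case using i by simp
qed

section \<open>The substitution onto the equation\<close>

text \<open>The quadratic part of the paper's \<open>\<Phi>\<close>, with \<open>u\<^sup>1\<^sub>(\<^sub>1\<^sub>)\<close> replaced by
  \<open>- \<Sum>\<^sub>\<alpha> u\<^sup>\<alpha>\<^sub>(\<^sub>\<alpha>\<^sub>)\<close>.\<close>

definition quadF :: "nat \<Rightarrow> fn" where
  "quadF m = (\<lambda>y. (\<Sum>\<alpha>\<in>Nset m. coord (U \<alpha> (unit \<alpha>)) y) * (\<Sum>\<alpha>\<in>Nset m. coord (U \<alpha> (unit \<alpha>)) y)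
     + 2 * (\<Sum>\<alpha>\<in>Nset m. coord (U 1 (unit \<alpha>)) y * coord (U \<alpha> (unit 1)) y)
     + (\<Sum>\<alpha>\<in>Nset m. \<Sum>\<beta>\<in>Nset m. coord (U \<alpha> (unit \<beta>)) y * coord (U \<beta> (unit \<alpha>)) y))"

definition Phi :: "nat \<Rightarrow> fn" where
  "Phi m = (\<lambda>y. (\<Sum>\<alpha>\<in>Nset m. coord (P (inc (unit \<alpha>) \<alpha>)) y) + quadF m y)"

text \<open>On functions of the free coordinates the derivation induced by \<open>D\<^sub>1\<close> is the vector field
  with these components.\<close>

definition cvf :: "nat \<Rightarrow> var \<Rightarrow> fn" where
  "cvf m v = (case v of X \<nu> \<Rightarrow> (\<lambda>_. if \<nu> = 1 then 1 else 0)
      | U l i \<Rightarrow> if l = 1 then (\<lambda>y. - (\<Sum>\<beta>\<in>Nset m. coord (U \<beta> (inc i \<beta>)) y)) else coord (U l (inc i 1))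
      | P i \<Rightarrow> if i 1 = 0 then coord (P (inc i 1)) else (\<lambda>y. - Dmi m (i(1 := 0)) (Phi m) y))"

definition Db :: "nat \<Rightarrow> nat \<Rightarrow> fn \<Rightarrow> fn" where
  "Db m \<mu> = (if \<mu> = 1 then vf (cvf m) else Dt m \<mu>)"

text \<open>\<open>sig m v\<close> is the value of the coordinate \<open>v\<close> on the equation in terms of the free ones, so
  \<open>red m f\<close> is the normal form of \<open>f\<close>.\<close>

definition sig :: "nat \<Rightarrow> var \<Rightarrow> fn" where
  "sig m v = (case v of X \<nu> \<Rightarrow> coord v
      | U l i \<Rightarrow> (Db m 1 ^^ i 1) (coord (U l (i(1 := 0))))
      | P i \<Rightarrow> (Db m 1 ^^ i 1) (coord (P (i(1 := 0)))))"

definition red :: "nat \<Rightarrow> fn \<Rightarrow> fn" where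
  "red m = subst (sig m)"

lemma valid_mi_0 [simp]: "valid_mi m (\<lambda>_. 0)"
  by (simp add: valid_mi_def)

lemma valid_unit: "1 \<le> \<mu> \<Longrightarrow> \<mu> \<le> m \<Longrightarrow> valid_mi m (unit \<mu>)"
  by (simp add: unit_def valid_inc)

lemma unit_simps [simp]: "unit \<mu> \<nu> = (if \<nu> = \<mu> then 1 else 0)"
  by (simp add: unit_def inc_def)

lemma valid_upd1: "valid_mi m i \<Longrightarrow> valid_mi m (i(1 := 0))"
  by (simp add: valid_mi_def)

lemma inc_upd1: "(inc i 1)(1 := x) = i(1 := x)" "\<alpha> \<noteq> 1 \<Longrightarrow> (inc i \<alpha>)(1 := x) = inc (i(1 := x)) \<alpha>"
  by (auto simp: inc_def fun_eq_iff)

lemma valid_var_simps: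
  "valid_var m (X \<mu>) \<longleftrightarrow> 1 \<le> \<mu> \<and> \<mu> \<le> m"
  "valid_var m (U l i) \<longleftrightarrow> 1 \<le> l \<and> l \<le> m \<and> valid_mi m i"
  "valid_var m (P i) \<longleftrightarrow> valid_mi m i"
  by (auto simp: valid_var_def)

lemma free_var_simps:
  "free_var m (X \<mu>) \<longleftrightarrow> 1 \<le> \<mu> \<and> \<mu> \<le> m"
  "free_var m (U l i) \<longleftrightarrow> 1 \<le> l \<and> l \<le> m \<and> valid_mi m i \<and> (l = 1 \<longrightarrow> i 1 = 0)"
  "free_var m (P i) \<longleftrightarrow> valid_mi m i \<and> i 1 \<le> 1"
  by (auto simp: free_var_def valid_var_def)

lemma Nset_iff [simp]: "\<alpha> \<in> Nset m \<longleftrightarrow> 2 \<le> \<alpha> \<and> \<alpha> \<le> m"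
  by (simp add: Nset_def)

lemma finite_Nset [simp]: "finite (Nset m)"
  by (simp add: Nset_def)

context
  fixes m :: nat
  assumes m2: "2 \<le> m"
begin

lemma sum_Mset: "(\<Sum>\<mu>=1..m. f \<mu>) = f 1 + (\<Sum>\<mu>\<in>Nset m. f \<mu>)" for f :: "nat \<Rightarrow> real"
proof -
  have "{1..m} = insert 1 {2..m}" using m2 by auto
  then show ?thesis by (simp add: Nset_def)
qed

lemma quadF_FR: "quadF m \<in> FR m"
  unfolding quadF_def using m2
  by (intro FR_intros) (auto simp: free_var_simps valid_unit)

lemma Phi_FR: "Phi m \<in> FR m"
  unfolding Phi_def using m2
  by (intro FR_intros quadF_FR) (auto simp: free_var_simps valid_unit valid_inc)

lemma cvf_FR: "free_var m v \<Longrightarrow> cvf m v \<in> FR m"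
  using m2
  by (cases v) (auto simp: cvf_def free_var_simps valid_inc intro!: FR_intros Dmi_FR Phi_FR)

lemma vf_cvf_FR: "f \<in> FR m \<Longrightarrow> vf (cvf m) f \<in> FR m"
  using cvf_FR unfolding FR_def by (auto intro!: smf_vf)

lemma Db_FR: "f \<in> FR m \<Longrightarrow> 1 \<le> \<mu> \<Longrightarrow> \<mu> \<le> m \<Longrightarrow> Db m \<mu> f \<in> FR m"
  unfolding Db_def using vf_cvf_FR Dt_FR by (cases "\<mu> = 1") auto

lemma Db_eq_vf: "f \<in> FR m \<Longrightarrow> Db m \<mu> f = vf (if \<mu> = 1 then cvf m else tvf m \<mu>) f"
  by (simp add: Db_def Dt_eq_vf[OF FR_AB])

lemma Db_add: "f \<in> FR m \<Longrightarrow> g \<in> FR m \<Longrightarrow> Db m \<mu> (\<lambda>y. f y + g y) = (\<lambda>y. Db m \<mu> f y + Db m \<mu> g y)"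
  by (simp add: Db_eq_vf FR_intros) (metis FR_def vf_add)

lemma Db_mult:
  "f \<in> FR m \<Longrightarrow> g \<in> FR m \<Longrightarrow> Db m \<mu> (\<lambda>y. f y * g y) = (\<lambda>y. Db m \<mu> f y * g y + f y * Db m \<mu> g y)"
  by (simp add: Db_eq_vf FR_intros) (metis FR_def vf_mult)

lemma Db_const [simp]: "Db m \<mu> (\<lambda>_. c) = (\<lambda>_. 0)"
  by (simp add: Db_def)

lemma Db_cmult: "f \<in> FR m \<Longrightarrow> Db m \<mu> (\<lambda>y. c * f y) = (\<lambda>y. c * Db m \<mu> f y)"
  using Db_mult[of "\<lambda>_. c" f \<mu>] by (simp add: FR_intros)

lemma Db_uminus: "f \<in> FR m \<Longrightarrow> Db m \<mu> (\<lambda>y. - f y) = (\<lambda>y. - Db m \<mu> f y)"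
  using Db_cmult[of f \<mu> "-1"] by simp

lemma Db_diff: "f \<in> FR m \<Longrightarrow> g \<in> FR m \<Longrightarrow> Db m \<mu> (\<lambda>y. f y - g y) = (\<lambda>y. Db m \<mu> f y - Db m \<mu> g y)"
  using Db_add[of f "\<lambda>y. - g y" \<mu>] by (simp add: FR_intros Db_uminus)

lemma Db_sum:
  "(\<And>i. i \<in> I \<Longrightarrow> f i \<in> FR m) \<Longrightarrow> Db m \<mu> (\<lambda>y. \<Sum>i\<in>I. f i y) = (\<lambda>y. \<Sum>i\<in>I. Db m \<mu> (f i) y)"
proof (induction I rule: infinite_finite_induct)
  case (insert j I)
  then show ?case by (simp add: Db_add[OF _ FR_intros(7), of "f j" I f])
qed auto

text \<open>This is the compatibility of the solved form of the equation: differentiating the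
  expression that replaces a coordinate gives the expression that replaces the shifted coordinate.
  By \<open>vf_commute\<close> it makes the induced \<open>D\<^sub>1\<close> commute with the other
  total derivatives.\<close>

lemma Dt_cvf:
  assumes v: "free_var m v" and \<alpha>: "2 \<le> \<alpha>" "\<alpha> \<le> m"
  shows "vf (tvf m \<alpha>) (cvf m v) = vf (cvf m) (tvf m \<alpha> v)"
proof -
  have AB: "cvf m v \<in> AB m" using cvf_FR[OF v] FR_AB by blast
  have "Dt m \<alpha> (cvf m v) = vf (cvf m) (tvf m \<alpha> v)"
  proof (cases v)
    case (X \<nu>)
    then show ?thesis by (simp add: cvf_def)
  next
    case (U l i)
    show ?thesis
    proof (cases "l = 1")
      case True
      have c: "coord (U \<beta> (inc i \<beta>)) \<in> AB m" if "\<beta> \<in> Nset m" for \<beta>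
        using that v U by (intro AB_intros) (auto simp: free_var_simps valid_var_simps valid_inc)
      have "Dt m \<alpha> (\<lambda>y. - (\<Sum>\<beta>\<in>Nset m. coord (U \<beta> (inc i \<beta>)) y))
          = (\<lambda>y. - (\<Sum>\<beta>\<in>Nset m. Dt m \<alpha> (coord (U \<beta> (inc i \<beta>))) y))"
        by (subst Dt_uminus, rule AB_intros(7), erule c, subst Dt_sum, erule c, rule refl)
      also have "\<dots> = (\<lambda>y. - (\<Sum>\<beta>\<in>Nset m. coord (U \<beta> (inc (inc i \<alpha>) \<beta>)) y))"
        using v U by (intro ext arg_cong[where f = uminus] sum.cong)
          (auto simp: Dt_coord free_var_simps valid_var_simps valid_inc inc_commute)
      finally show ?thesis using v U True \<alpha> by (simp add: cvf_def tvf_nonX free_valid)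
    next
      case False
      then show ?thesis using v U \<alpha>
        by (simp add: cvf_def tvf_nonX free_valid Dt_coord free_var_simps valid_var_simps valid_inc inc_commute)
    qed
  next
    case (P i)
    show ?thesis
    proof (cases "i 1 = 0")
      case True
      then show ?thesis using v P \<alpha> m2
        by (simp add: cvf_def tvf_nonX free_valid Dt_coord free_var_simps valid_var_simps valid_inc inc_commute)
    next
      case False
      have "(inc i \<alpha>)(1 := 0) = inc (i(1 := 0)) \<alpha>" using \<alpha> by (intro inc_upd1) auto
      then show ?thesis using v P \<alpha> m2 Phi_FR False
        by (simp add: cvf_def tvf_nonX free_valid Dt_uminus Dmi_AB FR_AB Dt_Dmi)
    qed
  qed
  then show ?thesis using Dt_eq_vf[OF AB] by simp
qed

lemma Db_commute:
  assumes f: "f \<in> FR m" and "1 \<le> \<mu>" "\<mu> \<le> m" "1 \<le> \<nu>" "\<nu> \<le> m"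
  shows "Db m \<mu> (Db m \<nu> f) = Db m \<nu> (Db m \<mu> f)"
proof -
  have *: "Dt m \<alpha> (vf (cvf m) f) = vf (cvf m) (Dt m \<alpha> f)" if "2 \<le> \<alpha>" "\<alpha> \<le> m" for \<alpha>
  proof -
    have "vf (tvf m \<alpha>) (vf (cvf m) f) = vf (cvf m) (vf (tvf m \<alpha>) f)"
      by (rule vf_commute[OF f[unfolded FR_def]])
        (use that Dt_cvf tvf_FR cvf_FR in \<open>auto simp: FR_def\<close>)
    then show ?thesis using f vf_cvf_FR by (simp add: Dt_eq_vf FR_AB)
  qed
  consider "\<mu> = \<nu>" | "\<mu> = 1" "\<nu> \<noteq> 1" | "\<mu> \<noteq> 1" "\<nu> = 1" | "\<mu> \<noteq> 1" "\<nu> \<noteq> 1" by blast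
  then show ?thesis
    by cases (use assms * Dt_commute FR_AB in \<open>auto simp: Db_def\<close>)
qed

lemma funpow_Db1:
  assumes "f \<in> FR m"
  shows "(Db m 1 ^^ n) f \<in> FR m" "1 \<le> \<mu> \<Longrightarrow> \<mu> \<le> m \<Longrightarrow> Db m \<mu> ((Db m 1 ^^ n) f) = (Db m 1 ^^ n) (Db m \<mu> f)"
proof -
  show *: "(Db m 1 ^^ n) f \<in> FR m" for n
    using assms m2 by (induction n) (auto intro: Db_FR)
  assume \<mu>: "1 \<le> \<mu>" "\<mu> \<le> m"
  show "Db m \<mu> ((Db m 1 ^^ n) f) = (Db m 1 ^^ n) (Db m \<mu> f)"
  proof (induction n)
    case (Suc n)
    have "Db m \<mu> (Db m 1 ((Db m 1 ^^ n) f)) = Db m 1 (Db m \<mu> ((Db m 1 ^^ n) f))"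
      using * m2 \<mu> by (intro Db_commute) auto
    then show ?case using Suc by simp
  qed simp
qed

lemma sig_FR: "valid_var m v \<Longrightarrow> sig m v \<in> FR m"
  using m2
  by (cases v) (auto simp: sig_def valid_var_simps free_var_simps valid_upd1[simplified]
      intro!: FR_intros funpow_Db1(1)[simplified])

lemma Db1_coord: "Db m 1 (coord v) = cvf m v"
  by (simp add: Db_def)

lemma sig_free:
  assumes "free_var m v" shows "sig m v = coord v"
proof (cases v)
  case (X \<nu>)
  then show ?thesis by (simp add: sig_def)
next
  case (U l i)
  show ?thesis
  proof (cases "l = 1")
    case True
    then have "i(1 := 0) = i" using U assms by (auto simp: free_var_simps)
    then show ?thesis using True U assms by (simp add: sig_def free_var_simps)
  next
    case False
    have "(Db m 1 ^^ n) (coord (U l (i(1 := 0)))) = coord (U l (i(1 := n)))" for n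
    proof (induction n)
      case (Suc n)
      have e: "inc (i(1 := n)) 1 = i(1 := Suc n)" by (auto simp: inc_def)
      have "(Db m 1 ^^ Suc n) (coord (U l (i(1 := 0)))) = Db m 1 (coord (U l (i(1 := n))))"
        unfolding funpow.simps comp_def Suc ..
      also have "\<dots> = coord (U l (inc (i(1 := n)) 1))" unfolding Db1_coord using False by (simp add: cvf_def)
      finally show ?case unfolding e .
    qed simp
    from this[of "i 1"] show ?thesis by (simp add: sig_def U)
  qed
next
  case (P i)
  then have "i 1 = 0 \<or> i 1 = 1" using assms by (auto simp: free_var_simps)
  moreover have "i(1 := 0) = i" if "i 1 = 0" using that by auto
  moreover have "inc (i(1 := 0)) 1 = i" if "i 1 = 1" using that by (auto simp: inc_def)
  ultimately show ?thesis using P by (auto simp: sig_def Db_def cvf_def)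
qed

lemma sig_shiftv:
  assumes v: "valid_var m v" "\<not> is_X v" and \<mu>: "1 \<le> \<mu>" "\<mu> \<le> m"
  shows "Db m \<mu> (sig m v) = sig m (shiftv \<mu> v)"
proof (cases "\<mu> = 1")
  case True
  then show ?thesis using v by (cases v) (auto simp: sig_def inc_upd1(1)[simplified])
next
  case False
  have c: "Db m \<mu> (coord w) = coord (shiftv \<mu> w)" if "valid_var m w" "\<not> is_X w" for w
    using that False by (simp add: Db_def Dt_coord)
  show ?thesis
    using v \<mu> False m2 funpow_Db1(2)[OF FR_intros(2) \<mu>] inc_upd1(2)[of \<mu>]
    by (cases v) (auto simp: sig_def valid_var_simps free_var_simps c valid_upd1[simplified])
qed

lemma red_FR: "f \<in> AB m \<Longrightarrow> red m f \<in> FR m"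
  unfolding red_def FR_def AB_eq_smf by (rule smf_subst) (use sig_FR in \<open>auto simp: FR_def\<close>)

lemma red_id:
  assumes "f \<in> FR m" shows "red m f = f"
  unfolding red_def subst_def
  by (intro ext depends_onD[OF smf_depends[OF assms[unfolded FR_def]]]) (simp add: sig_free coord_def)

lemma red_AB: "f \<in> AB m \<Longrightarrow> red m f \<in> AB m"
  using red_FR FR_AB by blast

lemma red_coord: "red m (coord v) = sig m v"
  by (simp add: red_def subst_def coord_def)

text \<open>Makes \<open>red\<close> a morphism of differential algebras. The chain rule reduces the
  claim to coordinates, where it says that \<open>sig\<close> commutes with shifts.\<close>

lemma Db_red:
  assumes f: "f \<in> AB m" and \<mu>: "1 \<le> \<mu>" "\<mu> \<le> m"
  shows "Db m \<mu> (red m f) = red m (Dt m \<mu> f)"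
proof -
  let ?a = "if \<mu> = 1 then cvf m else tvf m \<mu>"
  obtain S where S: "finite S" "S \<subseteq> {v. valid_var m v}" "depends_on f S"
    using smf_finite_dep f unfolding AB_eq_smf by metis
  have s: "sig m v \<in> smf {v. free_var m v}" if "v \<in> S" for v using sig_FR S that by (auto simp: FR_def)
  have "Db m \<mu> (red m f) = (\<lambda>y. \<Sum>v\<in>S. subst (sig m) (partial v f) y * vf ?a (sig m v) y)"
    using vf_subst[OF f[unfolded AB_eq_smf] S(1,3) s, where a = ?a] Db_eq_vf[OF red_FR[OF f], of \<mu>]
    by (simp add: red_def)
  also have "\<dots> = (\<lambda>y. \<Sum>v\<in>S. subst (sig m) (partial v f) y * subst (sig m) (tvf m \<mu> v) y)"
  proof (intro ext sum.cong refl arg_cong2[where f = "(*)"])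
    fix y v assume "v \<in> S"
    then have v: "valid_var m v" using S by auto
    have "vf ?a (sig m v) = Db m \<mu> (sig m v)" using sig_FR[OF v] by (simp add: Db_eq_vf)
    also have "\<dots> = subst (sig m) (tvf m \<mu> v)"
    proof (cases "is_X v")
      case True
      then obtain \<nu> where "v = X \<nu>" by (cases v) auto
      then show ?thesis
        by (auto simp: sig_def Db_eq_vf[OF FR_intros(2)] Db_def cvf_def subst_def Dt_eq_vf AB_intros v[unfolded \<open>v = X \<nu>\<close>])
    next
      case False
      then show ?thesis using sig_shiftv[OF v False \<mu>] v
        by (simp add: tvf_nonX red_coord[unfolded red_def])
    qed
    finally show "vf ?a (sig m v) y = subst (sig m) (tvf m \<mu> v) y" by simp
  qed
  also have "\<dots> = red m (Dt m \<mu> f)"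
    unfolding Dt_eq_vf[OF f] vf_eq[OF S(1,3)] red_def subst_def by (simp add: mult.commute)
  finally show ?thesis .
qed

subsection \<open>The ideal\<close>

lemma quadU_AB: "quadU m \<in> AB m"
proof -
  have "quadU m = (\<lambda>y. \<Sum>l=1..m. \<Sum>\<mu>=1..m. coord (U l (unit \<mu>)) y * coord (U \<mu> (unit l)) y)"
    by (simp add: quadU_def coord_def)
  also have "\<dots> \<in> AB m" by (intro AB_intros) (auto simp: valid_var_simps valid_unit)
  finally show ?thesis .
qed

lemma quadU_split:
  "quadU m y = coord (U 1 (unit 1)) y * coord (U 1 (unit 1)) y
     + 2 * (\<Sum>\<alpha>\<in>Nset m. coord (U 1 (unit \<alpha>)) y * coord (U \<alpha> (unit 1)) y)
     + (\<Sum>\<alpha>\<in>Nset m. \<Sum>\<beta>\<in>Nset m. coord (U \<alpha> (unit \<beta>)) y * coord (U \<beta> (unit \<alpha>)) y)"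
  by (simp add: quadU_def sum_Mset[simplified] sum.distrib coord_def mult.commute)

lemma gen_AB: "valid_mi m (snd k) \<Longrightarrow> gen m k \<in> AB m"
proof -
  assume k: "valid_mi m (snd k)"
  have "CE m i = (\<lambda>y. \<Sum>\<mu>=1..m. coord (U \<mu> (inc i \<mu>)) y)" for i by (simp add: CE_def coord_def)
  moreover have "PE m i = (\<lambda>y. (\<Sum>\<mu>=1..m. coord (P (inc (inc i \<mu>) \<mu>)) y) + Dmi m i (quadU m) y)" for i
    by (simp add: PE_def coord_def)
  ultimately show ?thesis unfolding gen_def using k
    by (auto intro!: AB_intros Dmi_AB quadU_AB simp: valid_var_simps valid_inc)
qed

lemma Dt_gen:
  assumes i: "valid_mi m i" and \<mu>: "1 \<le> \<mu>" "\<mu> \<le> m"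
  shows "Dt m \<mu> (gen m (b, i)) = gen m (b, inc i \<mu>)"
proof -
  have CE: "CE m i = (\<lambda>y. \<Sum>\<mu>=1..m. coord (U \<mu> (inc i \<mu>)) y)" for i by (simp add: CE_def coord_def)
  have PE: "PE m i = (\<lambda>y. (\<Sum>\<mu>=1..m. coord (P (inc (inc i \<mu>) \<mu>)) y) + Dmi m i (quadU m) y)" for i
    by (simp add: PE_def coord_def)
  have U: "valid_var m (U \<nu> (inc i \<nu>))" and P: "valid_var m (P (inc (inc i \<nu>) \<nu>))" if "\<nu> \<in> {1..m}" for \<nu>
    using that i by (auto simp: valid_var_simps valid_inc)
  have "Dt m \<mu> (CE m i) = CE m (inc i \<mu>)"
  proof -
    have "Dt m \<mu> (CE m i) = (\<lambda>y. \<Sum>\<nu>=1..m. Dt m \<mu> (coord (U \<nu> (inc i \<nu>))) y)"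
      unfolding CE by (rule Dt_sum) (use U AB_intros(2) in auto)
    also have "\<dots> = CE m (inc i \<mu>)"
      unfolding CE using U by (intro ext sum.cong) (auto simp: Dt_coord inc_commute)
    finally show ?thesis .
  qed
  moreover have "Dt m \<mu> (PE m i) = PE m (inc i \<mu>)"
  proof -
    have c: "coord (P (inc (inc i \<nu>) \<nu>)) \<in> AB m" if "\<nu> \<in> {1..m}" for \<nu> using P[OF that] by (rule AB_intros)
    have "Dt m \<mu> (PE m i) = (\<lambda>y. Dt m \<mu> (\<lambda>y. \<Sum>\<nu>=1..m. coord (P (inc (inc i \<nu>) \<nu>)) y) y + Dt m \<mu> (Dmi m i (quadU m)) y)"
      unfolding PE by (intro Dt_add AB_intros(7) Dmi_AB quadU_AB) (rule c)
    also have "Dt m \<mu> (\<lambda>y. \<Sum>\<nu>=1..m. coord (P (inc (inc i \<nu>) \<nu>)) y) = (\<lambda>y. \<Sum>\<nu>=1..m. Dt m \<mu> (coord (P (inc (inc i \<nu>) \<nu>))) y)"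
      by (rule Dt_sum) (rule c)
    also have "\<dots> = (\<lambda>y. \<Sum>\<nu>=1..m. coord (P (inc (inc (inc i \<mu>) \<nu>) \<nu>)) y)"
      using P by (intro ext sum.cong) (auto simp: Dt_coord inc_commute)
    finally show ?thesis unfolding PE using \<mu> by (simp add: Dt_Dmi quadU_AB)
  qed
  ultimately show ?thesis by (simp add: gen_def)
qed

text \<open>Every generator is an iterated total derivative of one with index 0, and
  \<open>red\<close> intertwines total derivatives. Only the continuity equation and the pressure
  equation themselves have to be evaluated.\<close>

lemma red_gen:
  assumes "valid_mi m i" shows "red m (gen m (b, i)) = (\<lambda>_. 0)"
proof -
  have fin: "finite {1..m}" and out: "\<forall>k. k \<notin> {1..m} \<longrightarrow> i k = 0"
    using assms by (auto simp: valid_mi_def not_le)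
  then show ?thesis
  proof (induction i rule: mi_induct)
    case zero
    have CE0: "sig m (U 1 (unit 1)) = (\<lambda>y. - (\<Sum>\<beta>\<in>Nset m. coord (U \<beta> (unit \<beta>)) y))"
    proof -
      have "(unit 1)(1 := 0) = (\<lambda>_. 0)" by (auto simp: unit_def inc_def)
      then show ?thesis by (simp add: sig_def Db_def cvf_def unit_def)
    qed
    have U: "sig m (U \<alpha> (unit \<beta>)) = coord (U \<alpha> (unit \<beta>))" if "\<alpha> \<in> Nset m" "\<beta> \<in> {1..m}" for \<alpha> \<beta>
      using that m2 by (intro sig_free) (auto simp: free_var_simps valid_unit)
    have U1: "sig m (U 1 (unit \<beta>)) = coord (U 1 (unit \<beta>))" if "\<beta> \<in> Nset m" for \<beta>
      using that m2 by (intro sig_free) (auto simp: free_var_simps valid_unit)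
    have c: "red m (CE m (\<lambda>_. 0)) y = 0" for y
      unfolding red_def subst_def CE_def sum_Mset
      using CE0 U by (simp add: unit_def[symmetric])
    have q: "red m (quadU m) y = quadF m y" for y
      unfolding red_def subst_def quadU_split quadF_def
      using CE0 U U1 m2 by (simp add: coord_def)
    have P1: "sig m (P (inc (unit 1) 1)) = (\<lambda>y. - Phi m y)"
    proof -
      have "(inc (unit 1) 1)(1 := 0) = (\<lambda>_. 0)" "(unit 1)(1 := 0) = (\<lambda>_. 0)" by (auto simp: unit_def inc_def)
      then show ?thesis by (simp add: sig_def Db_def cvf_def unit_def numeral_2_eq_2 del: unit_simps)
    qed
    have P: "sig m (P (inc (unit \<alpha>) \<alpha>)) = coord (P (inc (unit \<alpha>) \<alpha>))" if "\<alpha> \<in> Nset m" for \<alpha>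
      using that by (intro sig_free) (auto simp: free_var_simps valid_unit valid_inc)
    have "red m (PE m (\<lambda>_. 0)) y = sig m (P (inc (unit 1) 1)) y + (\<Sum>\<alpha>\<in>Nset m. sig m (P (inc (unit \<alpha>) \<alpha>)) y) + red m (quadU m) y" for y
      unfolding red_def subst_def PE_def sum_Mset unit_def by simp
    then have "red m (PE m (\<lambda>_. 0)) y = 0" for y
      unfolding P1 q using P by (simp add: Phi_def)
    then show ?case using c by (auto simp: gen_def)
  next
    case (inc i \<mu>)
    then have i: "valid_mi m i" by (auto simp: valid_mi_def)
    have \<mu>: "1 \<le> \<mu>" "\<mu> \<le> m" using inc by auto
    show ?case
      using Db_red[OF gen_AB[of "(b, i)"] \<mu>] i inc.IH by (simp add: Dt_gen[OF i \<mu>])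
  qed
qed

lemma Jid_intros:
  shows Jid_zero: "(\<lambda>_. 0) \<in> Jid m"
    and Jid_add: "f \<in> Jid m \<Longrightarrow> g \<in> Jid m \<Longrightarrow> (\<lambda>y. f y + g y) \<in> Jid m"
    and Jid_mult: "a \<in> AB m \<Longrightarrow> f \<in> Jid m \<Longrightarrow> (\<lambda>y. a y * f y) \<in> Jid m"
    and Jid_gen: "valid_mi m (snd k) \<Longrightarrow> gen m k \<in> Jid m"
proof -
  show "(\<lambda>_. 0) \<in> Jid m" unfolding Jid_def by (auto intro!: exI[of _ "{}"])
  show "gen m k \<in> Jid m" if "valid_mi m (snd k)"
    unfolding Jid_def using that
    by (auto intro!: exI[of _ "{k}"] exI[of _ "\<lambda>_ _. 1"] AB_intros)
  show "(\<lambda>y. a y * f y) \<in> Jid m" if a: "a \<in> AB m" and f: "f \<in> Jid m"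
  proof -
    obtain K b where K: "finite K" "K \<subseteq> {k. valid_mi m (snd k)}" "\<forall>k\<in>K. b k \<in> AB m"
      "f = (\<lambda>y. \<Sum>k\<in>K. b k y * gen m k y)" using f unfolding Jid_def by blast
    then show ?thesis unfolding Jid_def mem_Collect_eq using a
      by (intro exI[of _ K] exI[of _ "\<lambda>k y. a y * b k y"])
        (auto simp: sum_distrib_left mult.assoc intro!: AB_intros)
  qed
  show "(\<lambda>y. f y + g y) \<in> Jid m" if f: "f \<in> Jid m" and g: "g \<in> Jid m"
  proof -
    obtain K b where K: "finite K" "K \<subseteq> {k. valid_mi m (snd k)}" "\<forall>k\<in>K. b k \<in> AB m"
      "f = (\<lambda>y. \<Sum>k\<in>K. b k y * gen m k y)" using f unfolding Jid_def by blast
    obtain L c where L: "finite L" "L \<subseteq> {k. valid_mi m (snd k)}" "\<forall>k\<in>L. c k \<in> AB m"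
      "g = (\<lambda>y. \<Sum>k\<in>L. c k y * gen m k y)" using g unfolding Jid_def by blast
    let ?d = "\<lambda>k y. (if k \<in> K then b k y else 0) + (if k \<in> L then c k y else 0)"
    have "(\<lambda>y. if k \<in> K then b k y else 0) \<in> AB m" "(\<lambda>y. if k \<in> L then c k y else 0) \<in> AB m" for k
      using K L by (cases "k \<in> K"; cases "k \<in> L"; auto intro!: AB_intros)+
    then have d: "?d k \<in> AB m" for k by (intro AB_intros)
    have 1: "(\<Sum>k\<in>K \<union> L. (if k \<in> K then b k y else 0) * gen m k y) = (\<Sum>k\<in>K. b k y * gen m k y)" for y
      by (rule sum.mono_neutral_cong_right) (use K L in auto)
    have 2: "(\<Sum>k\<in>K \<union> L. (if k \<in> L then c k y else 0) * gen m k y) = (\<Sum>k\<in>L. c k y * gen m k y)" for y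
      by (rule sum.mono_neutral_cong_right) (use K L in auto)
    have "(\<lambda>y. f y + g y) = (\<lambda>y. \<Sum>k\<in>K \<union> L. ?d k y * gen m k y)"
      unfolding K(4) L(4) by (simp add: distrib_right sum.distrib 1 2)
    then show ?thesis unfolding Jid_def mem_Collect_eq using K L d
      by (intro exI[of _ "K \<union> L"] exI[of _ ?d]) auto
  qed
qed

lemma Jid_uminus: "f \<in> Jid m \<Longrightarrow> (\<lambda>y. - f y) \<in> Jid m"
  using Jid_mult[OF AB_intros(1)[of "-1"]] by simp

lemma Jid_diff: "f \<in> Jid m \<Longrightarrow> g \<in> Jid m \<Longrightarrow> (\<lambda>y. f y - g y) \<in> Jid m"
  using Jid_add[of f "\<lambda>y. - g y"] Jid_uminus by simp

lemma Jid_sum: "(\<And>k. k \<in> K \<Longrightarrow> f k \<in> Jid m) \<Longrightarrow> (\<lambda>y. \<Sum>k\<in>K. f k y) \<in> Jid m"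
  by (induction K rule: infinite_finite_induct) (auto intro: Jid_zero Jid_add)

lemma Jid_Dt:
  assumes "f \<in> Jid m" "1 \<le> \<mu>" "\<mu> \<le> m" shows "Dt m \<mu> f \<in> Jid m"
proof -
  obtain K b where K: "K \<subseteq> {k. valid_mi m (snd k)}" "\<forall>k\<in>K. b k \<in> AB m"
    "f = (\<lambda>y. \<Sum>k\<in>K. b k y * gen m k y)" using assms unfolding Jid_def by blast
  have ab: "b k \<in> AB m" "gen m k \<in> AB m" if "k \<in> K" for k using that K gen_AB[of k] by auto
  have "Dt m \<mu> f = (\<lambda>y. \<Sum>k\<in>K. Dt m \<mu> (\<lambda>y. b k y * gen m k y) y)"
    unfolding K(3) by (rule Dt_sum) (use ab AB_intros(5) in blast)
  also have "\<dots> = (\<lambda>y. \<Sum>k\<in>K. Dt m \<mu> (b k) y * gen m k y + b k y * Dt m \<mu> (gen m k) y)"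
    using ab by (intro ext sum.cong) (auto simp: Dt_mult)
  also have "\<dots> \<in> Jid m"
  proof (rule Jid_sum, rule Jid_add)
    fix k assume k: "k \<in> K"
    have v: "valid_mi m (snd k)" using k K by auto
    show "(\<lambda>y. Dt m \<mu> (b k) y * gen m k y) \<in> Jid m"
      using ab[OF k] v assms by (intro Jid_mult Jid_gen Dt_AB)
    have "Dt m \<mu> (gen m k) = gen m (fst k, inc (snd k) \<mu>)"
      using Dt_gen[of "snd k" \<mu> "fst k"] v assms by simp
    then show "(\<lambda>y. b k y * Dt m \<mu> (gen m k) y) \<in> Jid m"
      using ab[OF k] v assms by (auto intro!: Jid_mult Jid_gen valid_inc)
  qed
  finally show ?thesis .
qed

lemma red_Jid:
  assumes "f \<in> Jid m" shows "red m f = (\<lambda>_. 0)"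
proof -
  obtain K b where K: "K \<subseteq> {k. valid_mi m (snd k)}"
    "f = (\<lambda>y. \<Sum>k\<in>K. b k y * gen m k y)" using assms unfolding Jid_def by blast
  have "gen m k (\<lambda>v. sig m v y) = 0" if "k \<in> K" for k y
    using red_gen[of "snd k" "fst k"] that K unfolding red_def subst_def by (auto simp: fun_eq_iff)
  then show ?thesis unfolding red_def subst_def K(2) by simp
qed

end

section \<open>Every function is congruent to its normal form modulo the ideal\<close>

context
  fixes m :: nat
  assumes m2: "2 \<le> m"
begin

lemma pressure_Jid:
  assumes "valid_mi m j" "j 1 = 0"
  shows "(\<lambda>y. coord (P (inc (inc j 1) 1)) y + Dmi m j (Phi m) y) \<in> Jid m"
proof -
  have "finite (Nset m)" and "\<forall>k. k \<notin> Nset m \<longrightarrow> j k = 0"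
  proof -
    show "\<forall>k. k \<notin> Nset m \<longrightarrow> j k = 0"
    proof (intro allI impI)
      fix k assume "k \<notin> Nset m"
      then have "k = 0 \<or> k = 1 \<or> m < k" by auto
      then show "j k = 0" using assms by (auto simp: valid_mi_def)
    qed
  qed simp
  then show ?thesis
  proof (induction j rule: mi_induct)
    case zero
    let ?S = "\<lambda>y. \<Sum>\<alpha>\<in>Nset m. coord (U \<alpha> (unit \<alpha>)) y"
    have 1: "gen m (True, \<lambda>_. 0) y = coord (P (inc (unit 1) 1)) y
        + (\<Sum>\<alpha>\<in>Nset m. coord (P (inc (unit \<alpha>) \<alpha>)) y) + quadU m y" for y
      unfolding gen_def PE_def sum_Mset[OF m2] by (simp add: coord_def unit_def)
    have 2: "gen m (False, \<lambda>_. 0) y = coord (U 1 (unit 1)) y + ?S y" for y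
      unfolding gen_def CE_def sum_Mset[OF m2] by (simp add: coord_def unit_def)
    \<comment> \<open>The pressure generator carries the square of
      \<open>u\<^sup>1\<^sub>(\<^sub>1\<^sub>)\<close>, whereas \<open>Phi\<close> carries the
      square of \<open>?S\<close>. The difference of squares factors, and the sum of the two roots
      is the continuity generator.\<close>
    have "(\<lambda>y. coord (P (inc (inc (\<lambda>_. 0) 1) 1)) y + Dmi m (\<lambda>_. 0) (Phi m) y) =
      (\<lambda>y. gen m (True, \<lambda>_. 0) y - (coord (U 1 (unit 1)) y - ?S y) * gen m (False, \<lambda>_. 0) y)"
      unfolding 1 2 quadU_split[OF m2] Phi_def quadF_def unit_def[symmetric]
      by (auto simp: algebra_simps)
    also have "\<dots> \<in> Jid m"
      using m2 by (intro Jid_diff[OF m2] Jid_mult[OF m2] Jid_gen[OF m2] AB_intros)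
        (auto simp: valid_var_simps valid_unit)
    finally show ?case .
  next
    case (inc j \<mu>)
    have j: "valid_mi m j" using inc by (auto simp: valid_mi_def)
    have v: "valid_var m (P (inc (inc j 1) 1))" using j m2 by (auto simp: valid_var_simps valid_inc)
    have \<mu>: "1 \<le> \<mu>" "\<mu> \<le> m" using inc by auto
    have "Dt m \<mu> (\<lambda>y. coord (P (inc (inc j 1) 1)) y + Dmi m j (Phi m) y)
      = (\<lambda>y. coord (P (inc (inc (inc j \<mu>) 1) 1)) y + Dmi m (inc j \<mu>) (Phi m) y)"
      using v \<mu> Phi_FR[OF m2]
      by (simp add: Dt_add AB_intros Dmi_AB FR_AB Dt_Dmi Dt_coord inc_commute[of _ \<mu>])
    then show ?case using Jid_Dt[OF m2 inc.IH \<mu>] by simp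
  qed
qed

lemma tvf_cvf_Jid:
  assumes "free_var m w" shows "(\<lambda>y. tvf m 1 w y - cvf m w y) \<in> Jid m"
proof (cases w)
  case (X \<nu>)
  then show ?thesis using Jid_zero[OF m2] by (simp add: cvf_def)
next
  case (U l i)
  have v: "valid_var m w" using assms free_valid by blast
  show ?thesis
  proof (cases "l = 1")
    case True
    have "(\<lambda>y. tvf m 1 w y - cvf m w y) = gen m (False, i)"
      using v U True by (simp add: fun_eq_iff tvf_nonX cvf_def gen_def CE_def sum_Mset[OF m2, simplified] coord_def)
    then show ?thesis using Jid_gen[OF m2, of "(False, i)"] v U by (simp add: valid_var_simps)
  next
    case False
    then have "tvf m 1 w = cvf m w" using v U by (simp add: tvf_nonX cvf_def)
    then show ?thesis using Jid_zero[OF m2] by simp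
  qed
next
  case (P i)
  have v: "valid_var m w" using assms free_valid by blast
  show ?thesis
  proof (cases "i 1 = 0")
    case True
    then have "tvf m 1 w = cvf m w" using v P by (simp add: tvf_nonX cvf_def)
    then show ?thesis using Jid_zero[OF m2] by simp
  next
    case False
    define j where "j = i(1 := 0)"
    have i: "i = inc j 1" using False assms P by (auto simp: free_var_simps inc_def j_def)
    have j: "valid_mi m j" "j 1 = 0" using assms P by (auto simp: free_var_simps valid_mi_def j_def)
    have "(\<lambda>y. tvf m 1 w y - cvf m w y) = (\<lambda>y. coord (P (inc (inc j 1) 1)) y + Dmi m j (Phi m) y)"
      unfolding i[symmetric] using v P False j_def by (simp add: tvf_nonX cvf_def)
    then show ?thesis using pressure_Jid[OF j] by simp
  qed
qed

lemma Dt1_Db1_Jid: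
  assumes f: "f \<in> FR m" shows "(\<lambda>y. Dt m 1 f y - Db m 1 f y) \<in> Jid m"
proof -
  obtain S where S: "finite S" "S \<subseteq> {v. free_var m v}" "depends_on f S"
    using smf_finite_dep f unfolding FR_def by metis
  have "(\<lambda>y. Dt m 1 f y - Db m 1 f y) = (\<lambda>y. \<Sum>v\<in>S. partial v f y * (tvf m 1 v y - cvf m v y))"
    using f by (simp add: Dt_eq_vf FR_AB Db_def vf_eq[OF S(1,3)] sum_subtractf algebra_simps)
  also have "\<dots> \<in> Jid m"
    using S f by (intro Jid_sum[OF m2] Jid_mult[OF m2] tvf_cvf_Jid AB_intros FR_AB) auto
  finally show ?thesis .
qed

text \<open>The first entry of the index is raised step by step: the ideal is stable under
  \<open>Dt m 1\<close>, and on functions of the free coordinates \<open>Dt m 1\<close> may be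
  exchanged for \<open>Db m 1\<close> modulo the ideal.\<close>

lemma coord_sig_Jid:
  assumes "valid_var m v" shows "(\<lambda>y. coord v y - sig m v y) \<in> Jid m"
proof -
  have m1: "(1::nat) \<le> 1" "1 \<le> m" using m2 by auto
  have step: "(\<lambda>y. coord (shiftv 1 v) y - sig m (shiftv 1 v) y) \<in> Jid m"
    if v: "valid_var m v" "\<not> is_X v" and IH: "(\<lambda>y. coord v y - sig m v y) \<in> Jid m" for v
  proof -
    have FR: "sig m v \<in> FR m" using v sig_FR[OF m2] by blast
    have "(\<lambda>y. Dt m 1 (coord v) y - Dt m 1 (sig m v) y) \<in> Jid m"
      using Jid_Dt[OF m2 IH m1] v FR by (simp add: Dt_diff AB_intros FR_AB)
    from Jid_add[OF m2 this Dt1_Db1_Jid[OF FR]] show ?thesis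
      using v unfolding sig_shiftv[OF m2 v m1] by (simp add: Dt_coord)
  qed
  show ?thesis
  proof (cases v)
    case (X \<nu>)
    then show ?thesis using Jid_zero[OF m2] by (simp add: sig_def)
  next
    case (U l i)
    define J where "J n = i(1 := n)" for n
    have "valid_var m (U l (J n)) \<and> (\<lambda>y. coord (U l (J n)) y - sig m (U l (J n)) y) \<in> Jid m" for n
    proof (induction n)
      case 0
      have f: "free_var m (U l (J 0))" using assms U by (auto simp: free_var_simps valid_var_simps valid_mi_def J_def)
      show ?case using Jid_zero[OF m2] free_valid[OF f] unfolding sig_free[OF m2 f] by simp
    next
      case (Suc n)
      have e: "shiftv 1 (U l (J n)) = U l (J (Suc n))" by (simp add: inc_def J_def)
      show ?case using step[of "U l (J n)"] Suc valid_shiftv[of m "U l (J n)" 1] m1 unfolding e by simp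
    qed
    from this[of "i 1"] show ?thesis using U by (simp add: J_def)
  next
    case (P i)
    define J where "J n = i(1 := n)" for n
    have "valid_var m (P (J n)) \<and> (\<lambda>y. coord (P (J n)) y - sig m (P (J n)) y) \<in> Jid m" for n
    proof (induction n)
      case 0
      have f: "free_var m (P (J 0))" using assms P by (auto simp: free_var_simps valid_var_simps valid_mi_def J_def)
      show ?case using Jid_zero[OF m2] free_valid[OF f] unfolding sig_free[OF m2 f] by simp
    next
      case (Suc n)
      have e: "shiftv 1 (P (J n)) = P (J (Suc n))" by (simp add: inc_def J_def)
      show ?case using step[of "P (J n)"] Suc valid_shiftv[of m "P (J n)" 1] m1 unfolding e by simp
    qed
    from this[of "i 1"] show ?thesis using P by (simp add: J_def)
  qed
qed

text \<open>The substantial half of the normal form property. Dependent coordinates are eliminated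
  one at a time, each at the cost of an ideal element supplied by \<open>hadamard\<close> and
  \<open>coord_sig_Jid\<close>. The elimination terminates because \<open>sig m v\<close> involves
  free coordinates only, and it does not alter the normal form because \<open>red\<close> fixes
  \<open>sig m v\<close>.\<close>

lemma diff_red_Jid:
  assumes "f \<in> AB m" shows "(\<lambda>y. f y - red m f y) \<in> Jid m"
proof -
  obtain S where "finite S" "S \<subseteq> {v. valid_var m v}" "depends_on f S"
    using smf_finite_dep assms unfolding AB_eq_smf by metis
  then show ?thesis using assms
  proof (induction "card {v \<in> S. \<not> free_var m v}" arbitrary: S f)
    case 0
    then have "f \<in> FR m"
      unfolding FR_def AB_eq_smf smf_def by (auto intro!: exI[of _ S])
    then show ?case using red_id[OF m2] Jid_zero[OF m2] by simp
  next
    case (Suc n)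
    then have "{v \<in> S. \<not> free_var m v} \<noteq> {}" by (metis card.empty nat.distinct(1))
    then obtain v where v: "v \<in> S" "\<not> free_var m v" "valid_var m v" using Suc.prems by auto
    have sv: "sig m v \<in> FR m" using v sig_FR[OF m2] by blast
    obtain T where T: "finite T" "T \<subseteq> {v. free_var m v}" "depends_on (sig m v) T"
      using smf_finite_dep sv unfolding FR_def by metis
    let ?s = "\<lambda>u. if u = v then sig m v else coord u"
    define g where "g = subst ?s f"
    have g: "g y = f (y(v := sig m v y))" for y
    proof -
      have "(\<lambda>u. ?s u y) = y(v := sig m v y)" by (auto simp: coord_def)
      then show ?thesis unfolding g_def subst_def by simp
    qed
    have gAB: "g \<in> AB m" unfolding g_def AB_eq_smf
      by (rule smf_subst[OF Suc.prems(4)[unfolded AB_eq_smf]])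
        (use FR_AB[OF sv] in \<open>auto simp: AB_eq_smf intro: smf_coord\<close>)
    let ?S = "(S - {v}) \<union> T"
    have dep: "depends_on g ?S"
      unfolding depends_on_def g
    proof (intro allI impI depends_onD[OF Suc.prems(3)])
      fix y z :: pt and u assume yz: "\<forall>v\<in>?S. y v = z v" and "u \<in> S"
      have "sig m v y = sig m v z" using yz by (intro depends_onD[OF T(3)]) auto
      then show "(y(v := sig m v y)) u = (z(v := sig m v z)) u" using yz \<open>u \<in> S\<close> by auto
    qed
    have "{v \<in> S. \<not> free_var m v} = insert v {v \<in> ?S. \<not> free_var m v}" using v T by auto
    then have "Suc n = card (insert v {v \<in> ?S. \<not> free_var m v})" using Suc(2) by simp
    moreover have "finite {v \<in> ?S. \<not> free_var m v}" "v \<notin> {v \<in> ?S. \<not> free_var m v}"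
      using T Suc.prems v by auto
    ultimately have n: "n = card {v \<in> ?S. \<not> free_var m v}" by simp
    have IH: "(\<lambda>y. g y - red m g y) \<in> Jid m"
      by (rule Suc.hyps(1)[OF n _ _ dep gAB]) (use T Suc.prems free_valid in auto)
    have "red m g = red m f"
    proof
      fix y
      have "sig m v (\<lambda>u. sig m u y) = sig m v y"
        using red_id[OF m2 sv] by (simp add: red_def subst_def fun_eq_iff)
      then have "(\<lambda>u. sig m u y)(v := sig m v (\<lambda>u. sig m u y)) = (\<lambda>u. sig m u y)" by auto
      then show "red m g y = red m f y" unfolding red_def subst_def g by simp
    qed
    moreover obtain Q where Q: "Q \<in> AB m" "\<And>y. f y - f (y(v := sig m v y)) = (y v - sig m v y) * Q y"
      using hadamard[OF Suc.prems(4)[unfolded AB_eq_smf] FR_AB[OF sv, unfolded AB_eq_smf], of v "X 0"] v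
      by (auto simp: valid_var_simps AB_eq_smf)
    moreover have "(\<lambda>y. Q y * (coord v y - sig m v y)) \<in> Jid m"
      using Q v by (intro Jid_mult[OF m2] coord_sig_Jid)
    ultimately have "(\<lambda>y. f y - g y) \<in> Jid m" by (simp add: g coord_def mult.commute)
    from Jid_add[OF m2 this IH] show ?case using \<open>red m g = red m f\<close> by simp
  qed
qed

text \<open>From here on congruence modulo the ideal can be traded for equality of functions, so
  that no ideal membership has to be exhibited again.\<close>

lemma eqJ_iff:
  assumes "f \<in> AB m" "g \<in> AB m" shows "eqJ m f g \<longleftrightarrow> red m f = red m g"
proof
  assume "eqJ m f g"
  then show "red m f = red m g"
    using red_Jid[OF m2, of "\<lambda>y. f y - g y"] unfolding eqJ_def
    by (simp add: red_def subst_def fun_eq_iff)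
next
  assume "red m f = red m g"
  then show "eqJ m f g"
    unfolding eqJ_def using Jid_diff[OF m2 diff_red_Jid[OF assms(1)] diff_red_Jid[OF assms(2)]] by simp
qed

lemma nf_eq_red:
  assumes "f \<in> AB m" shows "nf m f = red m f"
  unfolding nf_def
proof (rule the_equality)
  show "red m f \<in> AB m \<and> (\<forall>y z. (\<forall>v. free_var m v \<longrightarrow> y v = z v) \<longrightarrow> red m f y = red m f z) \<and> eqJ m f (red m f)"
    using assms red_AB[OF m2] red_id[OF m2 red_FR[OF m2]] smf_depends[OF red_FR[OF m2 assms, unfolded FR_def]]
    by (auto simp: eqJ_iff depends_on_def)
next
  fix g assume g: "g \<in> AB m \<and> (\<forall>y z. (\<forall>v. free_var m v \<longrightarrow> y v = z v) \<longrightarrow> g y = g z) \<and> eqJ m f g"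
  then have "red m g = g"
    unfolding red_def subst_def using sig_free[OF m2] by (auto simp: fun_eq_iff coord_def)
  then show "g = red m f" using g assms eqJ_iff[of f g] by metis
qed

end

section \<open>Forms\<close>

definition rforms :: "nat \<Rightarrow> nat set \<Rightarrow> nat \<Rightarrow> form set" where
  "rforms m A q = {\<omega>. \<forall>I. (I \<subseteq> A \<and> card I = q \<longrightarrow> \<omega> I \<in> FR m)
                     \<and> (\<not> (I \<subseteq> A \<and> card I = q) \<longrightarrow> \<omega> I = (\<lambda>_. 0))}"

definition dR :: "nat \<Rightarrow> nat set \<Rightarrow> form \<Rightarrow> form" where
  "dR m A \<omega> = (\<lambda>I. if I \<subseteq> A then
       (\<lambda>y. \<Sum>\<mu>\<in>I. sgn_ins \<mu> (I - {\<mu>}) * Db m \<mu> (\<omega> (I - {\<mu>})) y) else (\<lambda>_. 0))"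

text \<open>The form \<theta> + dx^b \<and> \<zeta>, for b not in \<open>A\<close>;
  \<open>lower\<close> and \<open>upper\<close> recover the two components.\<close>

definition jn :: "nat \<Rightarrow> nat set \<Rightarrow> form \<Rightarrow> form \<Rightarrow> form" where
  "jn b A \<theta> \<zeta> = (\<lambda>I. if I \<subseteq> A then \<theta> I else if b \<in> I \<and> I \<subseteq> insert b A then \<zeta> (I - {b}) else (\<lambda>_. 0))"

definition upper :: "nat \<Rightarrow> nat set \<Rightarrow> form \<Rightarrow> form" where
  "upper b A \<omega> = (\<lambda>I. if I \<subseteq> A then \<omega> (insert b I) else (\<lambda>_. 0))"

definition lower :: "nat set \<Rightarrow> form \<Rightarrow> form" where
  "lower A \<omega> = (\<lambda>I. if I \<subseteq> A then \<omega> I else (\<lambda>_. 0))"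

context
  fixes m :: nat
  assumes m2: "2 \<le> m"
begin

lemma rforms_FR: "\<omega> \<in> rforms m A q \<Longrightarrow> \<omega> I \<in> FR m"
  by (cases "I \<subseteq> A \<and> card I = q") (auto simp: rforms_def FR_intros)

lemma rforms_zero: "\<omega> \<in> rforms m A q \<Longrightarrow> \<not> (I \<subseteq> A \<and> card I = q) \<Longrightarrow> \<omega> I = (\<lambda>_. 0)"
  by (auto simp: rforms_def)

lemma rformsI:
  "(\<And>I. \<omega> I \<in> FR m) \<Longrightarrow> (\<And>I. \<not> (I \<subseteq> A \<and> card I = q) \<Longrightarrow> \<omega> I = (\<lambda>_. 0)) \<Longrightarrow> \<omega> \<in> rforms m A q"
  by (auto simp: rforms_def)

lemma formsOn_AB: "\<omega> \<in> formsOn m A q \<Longrightarrow> \<omega> I \<in> AB m"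
  by (cases "I \<subseteq> A \<and> card I = q") (auto simp: formsOn_def AB_intros)

lemma rforms_formsOn: "\<omega> \<in> rforms m A q \<Longrightarrow> \<omega> \<in> formsOn m A q"
  using FR_AB by (auto simp: rforms_def formsOn_def)

lemma red_0 [simp]: "red m (\<lambda>_. c) = (\<lambda>_. c)"
  by (simp add: red_def subst_def)

lemma red_rforms: "\<omega> \<in> formsOn m A q \<Longrightarrow> (\<lambda>I. red m (\<omega> I)) \<in> rforms m A q"
  by (rule rformsI) (blast intro: red_FR[OF m2] formsOn_AB, simp add: formsOn_def)

lemma dOn_AB: "\<omega> \<in> formsOn m A q \<Longrightarrow> A \<subseteq> {1..m} \<Longrightarrow> dOn m A \<omega> I \<in> AB m"
  unfolding dOn_def by (cases "I \<subseteq> A") (auto intro!: AB_intros Dt_AB intro: formsOn_AB)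

lemma red_dOn:
  assumes "\<omega> \<in> formsOn m A q" "A \<subseteq> {1..m}"
  shows "red m (dOn m A \<omega> I) = dR m A (\<lambda>I. red m (\<omega> I)) I"
proof (cases "I \<subseteq> A")
  case True
  have "red m (dOn m A \<omega> I) = (\<lambda>y. \<Sum>\<mu>\<in>I. sgn_ins \<mu> (I - {\<mu>}) * red m (Dt m \<mu> (\<omega> (I - {\<mu>}))) y)"
    using True by (simp add: dOn_def red_def subst_def)
  also have "\<dots> = (\<lambda>y. \<Sum>\<mu>\<in>I. sgn_ins \<mu> (I - {\<mu>}) * Db m \<mu> (red m (\<omega> (I - {\<mu>}))) y)"
    using True assms formsOn_AB[OF assms(1)]
    by (intro ext sum.cong refl) (subst Db_red[OF m2]; auto)
  finally show ?thesis using True by (simp add: dR_def)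
qed (simp add: dOn_def dR_def)

lemma dR_FR: "\<omega> \<in> rforms m A q \<Longrightarrow> A \<subseteq> {1..m} \<Longrightarrow> dR m A \<omega> I \<in> FR m"
  unfolding dR_def by (cases "I \<subseteq> A") (auto intro!: FR_intros Db_FR[OF m2] intro: rforms_FR)

lemma dR_diff:
  assumes "\<omega> \<in> rforms m A q" "\<eta> \<in> rforms m A q"
  shows "dR m A (\<lambda>I y. \<omega> I y - \<eta> I y) I = (\<lambda>y. dR m A \<omega> I y - dR m A \<eta> I y)"
  unfolding dR_def using rforms_FR[OF assms(1)] rforms_FR[OF assms(2)]
  by (auto simp: Db_diff[OF m2] sum_subtractf algebra_simps)

lemma dR_uminus:
  assumes "\<omega> \<in> rforms m A q"
  shows "dR m A (\<lambda>I y. - \<omega> I y) I = (\<lambda>y. - dR m A \<omega> I y)"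
  unfolding dR_def using rforms_FR[OF assms(1)]
  by (auto simp: Db_uminus[OF m2] sum_negf)

lemma dR_zero [simp]: "dR m A (\<lambda>_ _. 0) = (\<lambda>_ _. 0)"
  by (auto simp: dR_def fun_eq_iff Db_const[OF m2])

lemma dR_Db:
  assumes \<omega>: "\<omega> \<in> rforms m A q" and "A \<subseteq> {1..m}" "1 \<le> b" "b \<le> m"
  shows "dR m A (\<lambda>I. Db m b (\<omega> I)) I = Db m b (dR m A \<omega> I)"
proof (cases "I \<subseteq> A")
  case True
  have FR: "Db m \<mu> (\<omega> J) \<in> FR m" if "\<mu> \<in> I" for \<mu> J
    using that True assms rforms_FR[OF \<omega>] by (intro Db_FR[OF m2]) auto
  have "Db m b (dR m A \<omega> I) = (\<lambda>y. \<Sum>\<mu>\<in>I. Db m b (\<lambda>y. sgn_ins \<mu> (I - {\<mu>}) * Db m \<mu> (\<omega> (I - {\<mu>})) y) y)"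
    using True FR by (simp add: dR_def) (rule Db_sum[OF m2], auto intro!: FR_intros)
  also have "\<dots> = (\<lambda>y. \<Sum>\<mu>\<in>I. sgn_ins \<mu> (I - {\<mu>}) * Db m \<mu> (Db m b (\<omega> (I - {\<mu>}))) y)"
  proof (intro ext sum.cong refl)
    fix y \<mu> assume \<mu>: "\<mu> \<in> I"
    then have "Db m b (Db m \<mu> (\<omega> (I - {\<mu>}))) = Db m \<mu> (Db m b (\<omega> (I - {\<mu>})))"
      using True assms rforms_FR[OF \<omega>] by (intro Db_commute[OF m2]) auto
    then show "Db m b (\<lambda>y. sgn_ins \<mu> (I - {\<mu>}) * Db m \<mu> (\<omega> (I - {\<mu>})) y) y
        = sgn_ins \<mu> (I - {\<mu>}) * Db m \<mu> (Db m b (\<omega> (I - {\<mu>}))) y"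
      using FR[OF \<mu>] by (simp add: Db_cmult[OF m2])
  qed
  finally show ?thesis using True by (simp add: dR_def)
qed (simp add: dR_def Db_const[OF m2])

text \<open>Splitting off a direction \<open>b\<close> smaller than all others, \<open>\<omega> = \<theta> + dx\<^sup>b \<and> \<zeta>\<close>, the differential
  becomes \<open>(\<theta>, \<zeta>) \<mapsto> (d\<theta>, D\<^sub>b \<theta> - d\<zeta>)\<close>.\<close>

lemma dR_lower: "I \<subseteq> A \<Longrightarrow> dR m (insert b A) \<omega> I = dR m A \<omega> I"
  by (auto simp: dR_def)

lemma dR_cong: "(\<And>J. J \<subseteq> I \<Longrightarrow> \<omega> J = \<eta> J) \<Longrightarrow> dR m A \<omega> I = dR m A \<eta> I"
  by (auto simp: dR_def)

lemma dR_upper: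
  assumes "I \<subseteq> A" "finite A" and b: "\<And>a. a \<in> A \<Longrightarrow> b < a"
  shows "dR m (insert b A) \<omega> (insert b I) = (\<lambda>y. Db m b (\<omega> I) y - dR m A (\<lambda>J. \<omega> (insert b J)) I y)"
proof
  fix y
  have fin: "finite I" and bI: "b \<notin> I" using assms finite_subset by (blast, blast)
  \<comment> \<open>As \<open>b\<close> precedes all elements of \<open>I\<close>, the factor dx^b
    stands first: it is inserted with sign 1, and every other factor has to pass it, which flips the
    sign.\<close>
  have 1: "sgn_ins b I = 1"
  proof -
    have "{\<nu> \<in> I. \<nu> < b} = {}" using assms by force
    then show ?thesis unfolding sgn_ins_def by (metis card.empty power_0)
  qed
  have 2: "sgn_ins \<mu> (insert b I - {\<mu>}) = - sgn_ins \<mu> (I - {\<mu>})" "insert b I - {\<mu>} = insert b (I - {\<mu>})"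
    if "\<mu> \<in> I" for \<mu>
  proof -
    have "b < \<mu>" using that assms by auto
    then have "{\<nu> \<in> insert b I - {\<mu>}. \<nu> < \<mu>} = insert b {\<nu> \<in> I - {\<mu>}. \<nu> < \<mu>}" by auto
    then show "sgn_ins \<mu> (insert b I - {\<mu>}) = - sgn_ins \<mu> (I - {\<mu>})"
      using fin bI by (simp add: sgn_ins_def)
    show "insert b I - {\<mu>} = insert b (I - {\<mu>})" using \<open>b < \<mu>\<close> by auto
  qed
  have "dR m (insert b A) \<omega> (insert b I) y = (\<Sum>\<mu>\<in>insert b I. sgn_ins \<mu> (insert b I - {\<mu>}) * Db m \<mu> (\<omega> (insert b I - {\<mu>})) y)"
    using assms by (auto simp: dR_def)
  also have "\<dots> = Db m b (\<omega> I) y + (\<Sum>\<mu>\<in>I. sgn_ins \<mu> (insert b I - {\<mu>}) * Db m \<mu> (\<omega> (insert b I - {\<mu>})) y)"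
    using fin bI 1 by simp
  also have "(\<Sum>\<mu>\<in>I. sgn_ins \<mu> (insert b I - {\<mu>}) * Db m \<mu> (\<omega> (insert b I - {\<mu>})) y)
     = (\<Sum>\<mu>\<in>I. - (sgn_ins \<mu> (I - {\<mu>}) * Db m \<mu> (\<omega> (insert b (I - {\<mu>}))) y))"
    by (intro sum.cong refl) (simp add: 2(1), simp add: 2(2))
  also have "\<dots> = - dR m A (\<lambda>J. \<omega> (insert b J)) I y"
    using assms by (simp add: dR_def sum_negf)
  finally show "dR m (insert b A) \<omega> (insert b I) y = Db m b (\<omega> I) y - dR m A (\<lambda>J. \<omega> (insert b J)) I y" by simp
qed

lemma jn_simps: "b \<notin> A \<Longrightarrow> I \<subseteq> A \<Longrightarrow> jn b A \<theta> \<zeta> I = \<theta> I" "b \<notin> A \<Longrightarrow> I \<subseteq> A \<Longrightarrow> jn b A \<theta> \<zeta> (insert b I) = \<zeta> I"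
  by (auto simp: jn_def intro!: arg_cong[where f = \<zeta>])

lemma lower_rforms: "\<omega> \<in> rforms m (insert b A) q \<Longrightarrow> lower A \<omega> \<in> rforms m A q"
  by (rule rformsI) (auto simp: lower_def FR_intros intro: rforms_FR rforms_zero)

lemma upper_rforms:
  assumes "\<omega> \<in> rforms m (insert b A) (Suc q)" "b \<notin> A" "finite A" shows "upper b A \<omega> \<in> rforms m A q"
proof (rule rformsI)
  fix I assume I: "\<not> (I \<subseteq> A \<and> card I = q)"
  show "upper b A \<omega> I = (\<lambda>_. 0)"
  proof (cases "I \<subseteq> A")
    case True
    then have "card (insert b I) = Suc (card I)" using assms finite_subset by (metis card_insert_disjoint subsetD)
    then show ?thesis using I True assms by (simp add: upper_def rforms_zero)
  qed (simp add: upper_def)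
qed (use assms in \<open>auto simp: upper_def FR_intros intro: rforms_FR\<close>)

text \<open>In degree 0 there is no component \<zeta>. Truncated subtraction would read
  \<open>q - 1\<close> as degree 0 again, hence the separate disjunct that forces \<zeta> to
  vanish.\<close>

lemma jn_rforms:
  assumes "\<theta> \<in> rforms m A q" "q = 0 \<and> \<zeta> = (\<lambda>_ _. 0) \<or> \<zeta> \<in> rforms m A (q - 1) \<and> 0 < q" "b \<notin> A" "finite A"
  shows "jn b A \<theta> \<zeta> \<in> rforms m (insert b A) q"
proof (rule rformsI)
  fix I
  show "jn b A \<theta> \<zeta> I \<in> FR m"
    using assms rforms_FR[of \<theta> A q] rforms_FR[of \<zeta> A "q - 1"] by (auto simp: jn_def FR_intros)
  assume I: "\<not> (I \<subseteq> insert b A \<and> card I = q)"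
  show "jn b A \<theta> \<zeta> I = (\<lambda>_. 0)"
  proof (cases "I \<subseteq> A")
    case True
    then show ?thesis using I assms by (auto simp: jn_def rforms_zero)
  next
    case False
    have "\<zeta> (I - {b}) = (\<lambda>_. 0)" if "b \<in> I" "I \<subseteq> insert b A"
    proof (cases "q = 0")
      case False
      have "finite I" using that assms finite_subset by blast
      then have "card (I - {b}) \<noteq> q - 1" using that I False card_Diff_singleton[of b I] card_gt_0_iff[of I] by fastforce
      then show ?thesis using assms False rforms_zero by blast
    qed (use assms in auto)
    then show ?thesis using False by (simp add: jn_def)
  qed
qed

lemma insert_form_eqI:
  assumes "\<And>I. I \<subseteq> A \<Longrightarrow> \<omega> I = \<eta> I" "\<And>I. I \<subseteq> A \<Longrightarrow> \<omega> (insert b I) = \<eta> (insert b I)"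
    "\<And>I. \<not> I \<subseteq> insert b A \<Longrightarrow> \<omega> I = \<eta> I"
  shows "\<omega> = \<eta>"
proof
  fix I
  consider "I \<subseteq> A" | "b \<in> I" "I \<subseteq> insert b A" | "\<not> I \<subseteq> insert b A" by blast
  then show "\<omega> I = \<eta> I"
  proof cases
    case 2
    then have "I - {b} \<subseteq> A" "I = insert b (I - {b})" by auto
    then show ?thesis using assms(2) by metis
  qed (use assms in auto)
qed

text \<open>Once the part without dx^b has a primitive \<eta>, closedness of \<omega> makes the
  defect \<open>D\<^sub>b \<eta> - \<zeta>\<close> closed on \<open>A\<close>. Changing \<eta> by a
  closed \<open>g\<close> and adding a dx^b component \<xi> changes the defect by
  \<open>D\<^sub>b g - d\<xi>\<close>, up to signs. So the remaining obstruction is the cokernel of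
  \<open>D\<^sub>b\<close> on cohomology in degree \<open>q\<close>, and \<open>h\<close> says that
  it is zero.\<close>

lemma cone_exact:
  assumes A: "finite A" "A \<subseteq> {1..m}" "1 \<le> b" "b \<le> m" "\<And>a. a \<in> A \<Longrightarrow> b < a"
    and \<omega>: "\<omega> \<in> rforms m (insert b A) (Suc q)" and closed: "dR m (insert b A) \<omega> = (\<lambda>_ _. 0)"
    and \<eta>: "\<eta> \<in> rforms m A q" "lower A \<omega> = dR m A \<eta>"
    and h: "\<And>\<kappa>. \<kappa> \<in> rforms m A q \<Longrightarrow> dR m A \<kappa> = (\<lambda>_ _. 0) \<Longrightarrow>
       \<exists>g\<in>rforms m A q. \<exists>\<xi>. dR m A g = (\<lambda>_ _. 0) \<and> (q = 0 \<and> \<xi> = (\<lambda>_ _. 0) \<or> \<xi> \<in> rforms m A (q - 1) \<and> 0 < q)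
         \<and> \<kappa> = (\<lambda>I y. Db m b (g I) y - dR m A \<xi> I y)"
  shows "\<exists>\<eta>\<in>rforms m (insert b A) q. \<omega> = dR m (insert b A) \<eta>"
proof -
  have bA: "b \<notin> A" using A by auto
  define \<zeta> where "\<zeta> = upper b A \<omega>"
  have \<zeta>: "\<zeta> \<in> rforms m A q" unfolding \<zeta>_def using upper_rforms[OF \<omega> bA A(1)] .
  define \<kappa> where "\<kappa> = (\<lambda>I y. Db m b (\<eta> I) y - \<zeta> I y)"
  have Db\<eta>: "(\<lambda>I. Db m b (\<eta> I)) \<in> rforms m A q"
    by (rule rformsI) (use A rforms_FR[OF \<eta>(1)] rforms_zero[OF \<eta>(1)] Db_FR[OF m2] in \<open>auto simp: Db_const[OF m2]\<close>)
  have \<kappa>: "\<kappa> \<in> rforms m A q"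
    by (rule rformsI) (use rforms_FR[OF Db\<eta>] rforms_zero[OF Db\<eta>] rforms_FR[OF \<zeta>] rforms_zero[OF \<zeta>] in
        \<open>auto simp: \<kappa>_def fun_eq_iff intro!: FR_intros\<close>)
  have up: "dR m A (\<lambda>J. \<omega> (insert b J)) I = dR m A \<zeta> I" if "I \<subseteq> A" for I
    by (rule dR_cong) (use that in \<open>auto simp: \<zeta>_def upper_def\<close>)
  have low: "\<omega> I = dR m A \<eta> I" if "I \<subseteq> A" for I using fun_cong[OF \<eta>(2), of I] that by (simp add: lower_def)
  have "dR m A \<kappa> I = (\<lambda>_. 0)" for I
  proof (cases "I \<subseteq> A")
    case True
    have "dR m (insert b A) \<omega> (insert b I) = (\<lambda>y. Db m b (\<omega> I) y - dR m A \<zeta> I y)"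
      using dR_upper[OF True A(1,5)] up[OF True] by simp
    then have "Db m b (dR m A \<eta> I) = dR m A \<zeta> I" using closed low[OF True] by (auto simp: fun_eq_iff)
    then show ?thesis
      unfolding \<kappa>_def using dR_diff[OF Db\<eta> \<zeta>, of I] dR_Db[OF \<eta>(1) A(2-4), of I] by simp
  qed (simp add: dR_def)
  then obtain g \<xi> where g: "g \<in> rforms m A q" "dR m A g = (\<lambda>_ _. 0)"
    and \<xi>: "q = 0 \<and> \<xi> = (\<lambda>_ _. 0) \<or> \<xi> \<in> rforms m A (q - 1) \<and> 0 < q"
    and k: "\<kappa> = (\<lambda>I y. Db m b (g I) y - dR m A \<xi> I y)"
    using h[OF \<kappa>] by (auto simp: fun_eq_iff)
  \<comment> \<open>With these signs the dx^b component of the differential is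
    \<open>D\<^sub>b \<eta> - D\<^sub>b g + d\<xi>\<close>, that is
    \<open>D\<^sub>b \<eta> - \<kappa>\<close>, which is \<zeta>.\<close>
  define \<eta>' where "\<eta>' = (\<lambda>I y. \<eta> I y - g I y)"
  define \<xi>' where "\<xi>' = (\<lambda>I y. - \<xi> I y)"
  have \<eta>': "\<eta>' \<in> rforms m A q"
    by (rule rformsI) (use rforms_FR[OF \<eta>(1)] rforms_zero[OF \<eta>(1)] rforms_FR[OF g(1)] rforms_zero[OF g(1)] in
        \<open>auto simp: \<eta>'_def fun_eq_iff intro!: FR_intros\<close>)
  have \<xi>': "q = 0 \<and> \<xi>' = (\<lambda>_ _. 0) \<or> \<xi>' \<in> rforms m A (q - 1) \<and> 0 < q"
    using \<xi>
  proof
    assume x: "\<xi> \<in> rforms m A (q - 1) \<and> 0 < q"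
    have "\<xi>' \<in> rforms m A (q - 1)"
      by (rule rformsI) (use rforms_FR[OF conjunct1[OF x]] rforms_zero[OF conjunct1[OF x]] in
          \<open>auto simp: \<xi>'_def fun_eq_iff intro!: FR_intros\<close>)
    then show ?thesis using x by simp
  qed (simp add: \<xi>'_def)
  have d\<xi>': "dR m A \<xi>' I = (\<lambda>y. - dR m A \<xi> I y)" for I
    using \<xi> dR_uminus unfolding \<xi>'_def by auto
  let ?J = "jn b A \<eta>' \<xi>'"
  have "\<omega> = dR m (insert b A) ?J"
  proof (rule insert_form_eqI[of A _ _ b])
    fix I assume I: "I \<subseteq> A"
    have "dR m (insert b A) ?J I = dR m A \<eta>' I"
      unfolding dR_lower[OF I] by (rule dR_cong) (use I in \<open>auto simp: jn_simps[OF bA]\<close>)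
    also have "\<dots> = dR m A \<eta> I" unfolding \<eta>'_def dR_diff[OF \<eta>(1) g(1)] g(2) by simp
    finally show "\<omega> I = dR m (insert b A) ?J I" using low[OF I] by simp
    have "dR m A (\<lambda>J. ?J (insert b J)) I = dR m A \<xi>' I"
      by (rule dR_cong) (use I in \<open>auto simp: jn_simps[OF bA]\<close>)
    then have "dR m (insert b A) ?J (insert b I) = (\<lambda>y. Db m b (\<eta>' I) y + dR m A \<xi> I y)"
      using dR_upper[OF I A(1,5), of ?J] d\<xi>' by (simp add: jn_simps[OF bA I])
    also have "\<dots> = (\<lambda>y. Db m b (\<eta> I) y - \<kappa> I y)"
      unfolding \<eta>'_def k using rforms_FR[OF \<eta>(1)] rforms_FR[OF g(1)] by (simp add: Db_diff[OF m2] algebra_simps)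
    also have "\<dots> = \<omega> (insert b I)" using I by (simp add: \<kappa>_def \<zeta>_def upper_def)
    finally show "\<omega> (insert b I) = dR m (insert b A) ?J (insert b I)" by simp
  next
    fix I assume "\<not> I \<subseteq> insert b A"
    then show "\<omega> I = dR m (insert b A) ?J I" using rforms_zero[OF \<omega>] by (auto simp: dR_def)
  qed
  then show ?thesis using jn_rforms[OF \<eta>' \<xi>' bA A(1)] by blast
qed

end

section \<open>Linearised functions\<close>

definition idx :: "nat \<Rightarrow> var \<Rightarrow> nat" where
  "idx \<alpha> v = (case v of X _ \<Rightarrow> 0 | U l i \<Rightarrow> i \<alpha> | P i \<Rightarrow> i \<alpha>)"

text \<open>Inverse to \<open>shiftv\<close> only at positive index; at index 0 truncated
  subtraction makes it the identity, which is why \<open>Ds\<close> guards its use.\<close>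

definition unsh :: "nat \<Rightarrow> var \<Rightarrow> var" where
  "unsh \<alpha> v = (case v of X \<nu> \<Rightarrow> X \<nu> | U l i \<Rightarrow> U l (i(\<alpha> := i \<alpha> - 1)) | P i \<Rightarrow> P (i(\<alpha> := i \<alpha> - 1)))"

lemma idx_shiftv: "\<not> is_X v \<Longrightarrow> idx \<alpha> (shiftv \<alpha> v) = Suc (idx \<alpha> v)" "\<beta> \<noteq> \<alpha> \<Longrightarrow> idx \<beta> (shiftv \<alpha> v) = idx \<beta> v"
  by (cases v; simp add: idx_def)+

lemma idx_X [simp]: "is_X v \<Longrightarrow> idx \<alpha> v = 0" "idx \<alpha> (X \<nu>) = 0"
  by (cases v; simp add: idx_def)+

lemma unsh_shiftv [simp]: "unsh \<alpha> (shiftv \<alpha> v) = v"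
  by (cases v) (auto simp: unsh_def inc_def)

lemma shiftv_unsh: "0 < idx \<alpha> v \<Longrightarrow> shiftv \<alpha> (unsh \<alpha> v) = v"
  by (cases v) (auto simp: unsh_def inc_def idx_def)

lemma is_X_unsh [simp]: "is_X (unsh \<alpha> v) = is_X v"
  by (cases v) (auto simp: unsh_def)

lemma idx_unsh: "\<beta> \<noteq> \<alpha> \<Longrightarrow> idx \<beta> (unsh \<alpha> v) = idx \<beta> v"
  by (cases v) (auto simp: unsh_def idx_def)

lemma shiftv_unsh_commute: "\<beta> \<noteq> \<alpha> \<Longrightarrow> shiftv \<alpha> (unsh \<beta> v) = unsh \<beta> (shiftv \<alpha> v)"
  by (cases v) (auto simp: unsh_def inc_def fun_upd_twist)

lemma is_X_shiftn [simp]: "is_X ((shiftv \<alpha> ^^ k) v) = is_X v"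
  by (induction k) auto

lemma idx_shiftn: "\<not> is_X v \<Longrightarrow> idx \<alpha> ((shiftv \<alpha> ^^ k) v) = idx \<alpha> v + k"
  by (induction k) (auto simp: idx_shiftv)

lemma unshn_shiftn: "(unsh \<alpha> ^^ k) ((shiftv \<alpha> ^^ k) v) = v"
proof (induction k)
  case (Suc k)
  have "(unsh \<alpha> ^^ Suc k) ((shiftv \<alpha> ^^ Suc k) v) = (unsh \<alpha> ^^ k) (unsh \<alpha> (shiftv \<alpha> ((shiftv \<alpha> ^^ k) v)))"
    by (simp only: funpow_Suc_right[of k "unsh \<alpha>"] funpow.simps(2)[of k "shiftv \<alpha>"] comp_apply)
  then show ?case using Suc by simp
qed simp

lemma valid_inc_iff: "1 \<le> \<mu> \<Longrightarrow> \<mu> \<le> m \<Longrightarrow> valid_mi m (inc i \<mu>) \<longleftrightarrow> valid_mi m i"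
  by (auto simp: valid_mi_def inc_def)

lemma free_shiftv_iff: "2 \<le> \<alpha> \<Longrightarrow> \<alpha> \<le> m \<Longrightarrow> free_var m (shiftv \<alpha> v) \<longleftrightarrow> free_var m v"
  by (cases v) (auto simp: free_var_simps valid_inc_iff)

lemma free_shiftn_iff: "2 \<le> \<alpha> \<Longrightarrow> \<alpha> \<le> m \<Longrightarrow> free_var m ((shiftv \<alpha> ^^ k) v) \<longleftrightarrow> free_var m v"
  by (induction k) (auto simp: free_shiftv_iff)

lemma free_unsh: "2 \<le> \<alpha> \<Longrightarrow> \<alpha> \<le> m \<Longrightarrow> 0 < idx \<alpha> v \<Longrightarrow> free_var m (unsh \<alpha> v) \<longleftrightarrow> free_var m v"
  using free_shiftv_iff[of \<alpha> m "unsh \<alpha> v"] by (simp add: shiftv_unsh)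

text \<open>A family \<phi> stands for the one-form that is the sum of the \<open>\<phi> v\<close>
  dv. Only dependent coordinates occur, since the linearisation does not vary the x.\<close>

definition fams :: "nat \<Rightarrow> (var \<Rightarrow> fn) set" where
  "fams m = {\<phi>. finite {v. \<phi> v \<noteq> (\<lambda>_. 0)} \<and> (\<forall>v. \<phi> v \<in> FR m)
      \<and> (\<forall>v. \<phi> v \<noteq> (\<lambda>_. 0) \<longrightarrow> free_var m v \<and> \<not> is_X v)}"

definition grad :: "fn \<Rightarrow> var \<Rightarrow> fn" where
  "grad f v = (if is_X v then (\<lambda>_. 0) else partial v f)"

text \<open>\<open>Ds m \<alpha>\<close> is the action of \<open>D\<^sub>\<alpha>\<close> on linearisations: \<open>grad (D\<^sub>\<alpha> f) = Ds m \<alpha> (grad f)\<close>.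
  \<open>Rf m \<alpha>\<close> integrates by parts in the direction \<open>\<alpha>\<close>, so that the composite \<open>Ef m r\<close> over
  \<open>{r..m}\<close> turns \<open>grad f\<close> into the family of variational derivatives of \<open>f\<close>.\<close>

definition Ds :: "nat \<Rightarrow> nat \<Rightarrow> (var \<Rightarrow> fn) \<Rightarrow> var \<Rightarrow> fn" where
  "Ds m \<alpha> \<phi> v = (\<lambda>y. Db m \<alpha> (\<phi> v) y + (if 0 < idx \<alpha> v then \<phi> (unsh \<alpha> v) y else 0))"

definition nD :: "nat \<Rightarrow> nat \<Rightarrow> fn \<Rightarrow> fn" where
  "nD m \<alpha> g = (\<lambda>y. - Db m \<alpha> g y)"

text \<open>The finite solution T of T(v) = \<phi>(v) - \<open>D\<^sub>\<alpha>\<close>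
  T(\<open>shiftv \<alpha> v\<close>). Its values at shifted coordinates are the quotient in a
  division of \<phi> by \<open>Ds m \<alpha>\<close>, and \<open>Rf\<close> is the
  remainder.\<close>

definition Tl :: "nat \<Rightarrow> nat \<Rightarrow> (var \<Rightarrow> fn) \<Rightarrow> var \<Rightarrow> fn" where
  "Tl m \<alpha> \<phi> v = (\<lambda>y. \<Sum>k | \<phi> ((shiftv \<alpha> ^^ k) v) \<noteq> (\<lambda>_. 0). (nD m \<alpha> ^^ k) (\<phi> ((shiftv \<alpha> ^^ k) v)) y)"

definition Rf :: "nat \<Rightarrow> nat \<Rightarrow> (var \<Rightarrow> fn) \<Rightarrow> var \<Rightarrow> fn" where
  "Rf m \<alpha> \<phi> v = (if idx \<alpha> v = 0 then Tl m \<alpha> \<phi> v else (\<lambda>_. 0))"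

definition Ef :: "nat \<Rightarrow> nat \<Rightarrow> (var \<Rightarrow> fn) \<Rightarrow> var \<Rightarrow> fn" where
  "Ef m r \<phi> = foldr (Rf m) [r..<Suc m] \<phi>"

lemma fams_FR: "\<phi> \<in> fams m \<Longrightarrow> \<phi> v \<in> FR m"
  by (simp add: fams_def)

lemma fams_X: "\<phi> \<in> fams m \<Longrightarrow> is_X v \<Longrightarrow> \<phi> v = (\<lambda>_. 0)"
  by (auto simp: fams_def)

lemma fams_nonfree: "\<phi> \<in> fams m \<Longrightarrow> \<not> free_var m v \<Longrightarrow> \<phi> v = (\<lambda>_. 0)"
  by (auto simp: fams_def)

lemma fams_finite: "\<phi> \<in> fams m \<Longrightarrow> finite {v. \<phi> v \<noteq> (\<lambda>_. 0)}"
  by (simp add: fams_def)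

lemma famsI:
  assumes "finite S" "\<And>v. v \<notin> S \<Longrightarrow> \<phi> v = (\<lambda>_. 0)" "\<And>v. \<phi> v \<in> FR m"
    "\<And>v. is_X v \<Longrightarrow> \<phi> v = (\<lambda>_. 0)" "\<And>v. \<not> free_var m v \<Longrightarrow> \<phi> v = (\<lambda>_. 0)"
  shows "\<phi> \<in> fams m"
proof -
  have "{v. \<phi> v \<noteq> (\<lambda>_. 0)} \<subseteq> S" using assms(2) by blast
  then show ?thesis unfolding fams_def using assms finite_subset by blast
qed

text \<open>The bound is uniform in \<open>v\<close>: on dependent coordinates \<open>k\<close>
  shifts produce index at least \<open>k\<close>, while the support of \<phi> is finite.\<close>

lemma fams_bound:
  assumes "\<phi> \<in> fams m" shows "\<exists>K. \<forall>v. \<forall>k\<ge>K. \<phi> ((shiftv \<alpha> ^^ k) v) = (\<lambda>_. 0)"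
proof (intro exI allI impI)
  let ?M = "Max (insert 0 (idx \<alpha> ` {v. \<phi> v \<noteq> (\<lambda>_. 0)}))"
  fix v k assume k: "Suc ?M \<le> k"
  show "\<phi> ((shiftv \<alpha> ^^ k) v) = (\<lambda>_. 0)"
  proof (rule ccontr)
    assume *: "\<phi> ((shiftv \<alpha> ^^ k) v) \<noteq> (\<lambda>_. 0)"
    then have "\<not> is_X v" using fams_X[OF assms] by fastforce
    then have "k \<le> idx \<alpha> ((shiftv \<alpha> ^^ k) v)" by (simp add: idx_shiftn)
    moreover have "idx \<alpha> ((shiftv \<alpha> ^^ k) v) \<le> ?M"
      using * fams_finite[OF assms] by (intro Max_ge) auto
    ultimately show False using k by simp
  qed
qed

section \<open>Integration by parts as division with remainder on finite families\<close>

context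
  fixes m :: nat
  assumes m2: "2 \<le> m"
begin

lemma nD_FR: "g \<in> FR m \<Longrightarrow> 1 \<le> \<alpha> \<Longrightarrow> \<alpha> \<le> m \<Longrightarrow> (nD m \<alpha> ^^ k) g \<in> FR m"
  by (induction k) (auto simp: nD_def intro!: FR_intros Db_FR[OF m2])

lemma nD_zero [simp]: "(nD m \<alpha> ^^ k) (\<lambda>_. 0) = (\<lambda>_. 0)"
  by (induction k) (auto simp: nD_def Db_const[OF m2])

lemma Tl_eq:
  assumes "\<And>k. K \<le> k \<Longrightarrow> \<phi> ((shiftv \<alpha> ^^ k) v) = (\<lambda>_. 0)"
  shows "Tl m \<alpha> \<phi> v = (\<lambda>y. \<Sum>k<K. (nD m \<alpha> ^^ k) (\<phi> ((shiftv \<alpha> ^^ k) v)) y)"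
  unfolding Tl_def using assms
  by (intro ext sum.mono_neutral_left) (auto simp: not_less[symmetric])

lemma famsadd: "\<phi> \<in> fams m \<Longrightarrow> \<psi> \<in> fams m \<Longrightarrow> (\<lambda>v y. \<phi> v y + \<psi> v y) \<in> fams m"
  by (rule famsI[of "{v. \<phi> v \<noteq> (\<lambda>_. 0)} \<union> {v. \<psi> v \<noteq> (\<lambda>_. 0)}"])
    (auto simp: fams_finite fams_X fams_nonfree fams_FR intro!: FR_intros)

lemma fams_zero: "(\<lambda>_ _. 0) \<in> fams m"
  by (rule famsI[of "{}"]) (auto intro: FR_intros)

lemma fams_sum: "(\<And>a. a \<in> A \<Longrightarrow> \<psi> a \<in> fams m) \<Longrightarrow> (\<lambda>v y. \<Sum>a\<in>A. \<psi> a v y) \<in> fams m"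
  by (induction A rule: infinite_finite_induct) (auto intro: fams_zero famsadd)

context
  fixes \<alpha> :: nat
  assumes \<alpha>: "2 \<le> \<alpha>" "\<alpha> \<le> m"
begin

lemma Tl_FR: "\<phi> \<in> fams m \<Longrightarrow> Tl m \<alpha> \<phi> v \<in> FR m"
  unfolding Tl_def using \<alpha> by (intro FR_intros nD_FR fams_FR) auto

lemma Tl_rec:
  assumes \<phi>: "\<phi> \<in> fams m"
  shows "Tl m \<alpha> \<phi> v = (\<lambda>y. \<phi> v y - Db m \<alpha> (Tl m \<alpha> \<phi> (shiftv \<alpha> v)) y)"
proof -
  obtain K where K: "\<forall>v. \<forall>k\<ge>K. \<phi> ((shiftv \<alpha> ^^ k) v) = (\<lambda>_. 0)" using fams_bound[OF \<phi>] by blast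
  have T: "Tl m \<alpha> \<phi> (shiftv \<alpha> v) = (\<lambda>y. \<Sum>k<K. (nD m \<alpha> ^^ k) (\<phi> ((shiftv \<alpha> ^^ k) (shiftv \<alpha> v))) y)"
    using K by (intro Tl_eq) auto
  have "Db m \<alpha> (Tl m \<alpha> \<phi> (shiftv \<alpha> v)) = (\<lambda>y. \<Sum>k<K. Db m \<alpha> ((nD m \<alpha> ^^ k) (\<phi> ((shiftv \<alpha> ^^ k) (shiftv \<alpha> v)))) y)"
    unfolding T by (rule Db_sum[OF m2]) (use nD_FR fams_FR[OF \<phi>] \<alpha> in auto)
  moreover have "Tl m \<alpha> \<phi> v = (\<lambda>y. \<Sum>k<Suc K. (nD m \<alpha> ^^ k) (\<phi> ((shiftv \<alpha> ^^ k) v)) y)"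
    using K by (intro Tl_eq) auto
  then have "Tl m \<alpha> \<phi> v = (\<lambda>y. \<phi> v y + (\<Sum>k<K. nD m \<alpha> ((nD m \<alpha> ^^ k) (\<phi> ((shiftv \<alpha> ^^ k) (shiftv \<alpha> v)))) y))"
    unfolding sum.lessThan_Suc_shift by (simp add: funpow_swap1)
  ultimately show ?thesis by (simp add: nD_def sum_negf)
qed

lemma Tl_vanish:
  assumes "\<forall>v. \<forall>k\<ge>K. \<phi> ((shiftv \<alpha> ^^ k) v) = (\<lambda>_. 0)" "K \<le> k"
  shows "Tl m \<alpha> \<phi> ((shiftv \<alpha> ^^ k) v) = (\<lambda>_. 0)"
proof -
  have "\<phi> ((shiftv \<alpha> ^^ j) ((shiftv \<alpha> ^^ k) v)) = (\<lambda>_. 0)" for j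
    using assms(1)[rule_format, of "j + k" v] assms(2) by (simp add: funpow_add)
  then show ?thesis using Tl_eq[of 0 \<phi> \<alpha> "(shiftv \<alpha> ^^ k) v"] by simp
qed

text \<open>The recursion determines its solution from far out inwards, because both candidates
  vanish after sufficiently many shifts. Identities for \<open>Tl\<close> are therefore proved by
  checking the recursion and not by rearranging alternating sums.\<close>

lemma Tl_unique:
  assumes \<phi>: "\<phi> \<in> fams m" and rec: "\<And>v. \<rho> v = (\<lambda>y. \<phi> v y - Db m \<alpha> (\<rho> (shiftv \<alpha> v)) y)"
    and van: "\<exists>K. \<forall>v. \<forall>k\<ge>K. \<rho> ((shiftv \<alpha> ^^ k) v) = (\<lambda>_. 0)"
  shows "Tl m \<alpha> \<phi> v = \<rho> v"
proof -
  obtain K where K: "\<forall>v. \<forall>k\<ge>K. \<phi> ((shiftv \<alpha> ^^ k) v) = (\<lambda>_. 0)" using fams_bound[OF \<phi>] by blast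
  obtain L where L: "\<forall>v. \<forall>k\<ge>L. \<rho> ((shiftv \<alpha> ^^ k) v) = (\<lambda>_. 0)" using van by blast
  let ?M = "max K L"
  have "Tl m \<alpha> \<phi> ((shiftv \<alpha> ^^ (?M - n)) v) = \<rho> ((shiftv \<alpha> ^^ (?M - n)) v)" if "n \<le> ?M" for n
    using that
  proof (induction n)
    case 0
    then show ?case using Tl_vanish[OF K, of ?M v] L by simp
  next
    case (Suc n)
    let ?v = "(shiftv \<alpha> ^^ (?M - Suc n)) v"
    have "shiftv \<alpha> ?v = (shiftv \<alpha> ^^ (?M - n)) v"
      using Suc.prems by (metis Suc_diff_Suc Suc_le_lessD comp_apply funpow.simps(2))
    then have "Tl m \<alpha> \<phi> (shiftv \<alpha> ?v) = \<rho> (shiftv \<alpha> ?v)" using Suc by simp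
    then show ?case using Tl_rec[OF \<phi>, of ?v] rec[of ?v] by simp
  qed
  from this[of ?M] show ?thesis by simp
qed

lemma Tl_fams:
  assumes \<phi>: "\<phi> \<in> fams m" shows "Tl m \<alpha> \<phi> \<in> fams m"
proof -
  obtain K where K: "\<forall>v. \<forall>k\<ge>K. \<phi> ((shiftv \<alpha> ^^ k) v) = (\<lambda>_. 0)" using fams_bound[OF \<phi>] by blast
  have *: "Tl m \<alpha> \<phi> v = (\<lambda>_. 0)" if "\<And>k. k < K \<Longrightarrow> \<phi> ((shiftv \<alpha> ^^ k) v) = (\<lambda>_. 0)" for v
  proof -
    have "Tl m \<alpha> \<phi> v = (\<lambda>y. \<Sum>k<K. (nD m \<alpha> ^^ k) (\<phi> ((shiftv \<alpha> ^^ k) v)) y)"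
      using K by (intro Tl_eq) auto
    then show ?thesis using that by simp
  qed
  show ?thesis
  proof (rule famsI[of "\<Union>k\<in>{..<K}. (unsh \<alpha> ^^ k) ` {v. \<phi> v \<noteq> (\<lambda>_. 0)}"])
    show "finite (\<Union>k\<in>{..<K}. (unsh \<alpha> ^^ k) ` {v. \<phi> v \<noteq> (\<lambda>_. 0)})" using fams_finite[OF \<phi>] by simp
  next
    fix v assume v: "v \<notin> (\<Union>k\<in>{..<K}. (unsh \<alpha> ^^ k) ` {v. \<phi> v \<noteq> (\<lambda>_. 0)})"
    show "Tl m \<alpha> \<phi> v = (\<lambda>_. 0)"
    proof (rule *)
      fix k assume "k < K"
      show "\<phi> ((shiftv \<alpha> ^^ k) v) = (\<lambda>_. 0)"
      proof (rule ccontr)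
        assume "\<phi> ((shiftv \<alpha> ^^ k) v) \<noteq> (\<lambda>_. 0)"
        then have "(unsh \<alpha> ^^ k) ((shiftv \<alpha> ^^ k) v) \<in> (unsh \<alpha> ^^ k) ` {v. \<phi> v \<noteq> (\<lambda>_. 0)}" by blast
        then show False using v \<open>k < K\<close> by (auto simp: unshn_shiftn)
      qed
    qed
  next
    show "Tl m \<alpha> \<phi> v = (\<lambda>_. 0)" if "is_X v" for v
      using that by (intro *) (simp add: fams_X[OF \<phi>])
    show "Tl m \<alpha> \<phi> v = (\<lambda>_. 0)" if "\<not> free_var m v" for v
      using that by (intro * fams_nonfree[OF \<phi>]) (simp add: free_shiftn_iff \<alpha>)
  qed (rule Tl_FR[OF \<phi>])
qed

lemma Rf_fams:
  assumes \<phi>: "\<phi> \<in> fams m" shows "Rf m \<alpha> \<phi> \<in> fams m"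
  by (rule famsI[OF fams_finite[OF Tl_fams[OF \<phi>]]])
    (use fams_FR[OF Tl_fams[OF \<phi>]] fams_X[OF Tl_fams[OF \<phi>]] fams_nonfree[OF Tl_fams[OF \<phi>]] in
      \<open>auto simp: Rf_def intro: FR_intros\<close>)

lemma Ds_fams:
  assumes \<phi>: "\<phi> \<in> fams m" shows "Ds m \<alpha> \<phi> \<in> fams m"
proof (rule famsI[of "{v. \<phi> v \<noteq> (\<lambda>_. 0)} \<union> shiftv \<alpha> ` {v. \<phi> v \<noteq> (\<lambda>_. 0)}"])
  show "finite ({v. \<phi> v \<noteq> (\<lambda>_. 0)} \<union> shiftv \<alpha> ` {v. \<phi> v \<noteq> (\<lambda>_. 0)})" using fams_finite[OF \<phi>] by simp
  fix v
  have "\<phi> (unsh \<alpha> v) \<in> FR m" "\<phi> v \<in> FR m" using fams_FR[OF \<phi>] by auto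
  then show "Ds m \<alpha> \<phi> v \<in> FR m"
    unfolding Ds_def using \<alpha> by (cases "0 < idx \<alpha> v") (auto intro!: FR_intros Db_FR[OF m2])
  show "Ds m \<alpha> \<phi> v = (\<lambda>_. 0)" if "is_X v"
    using that by (simp add: Ds_def fams_X[OF \<phi>] Db_const[OF m2])
  show "Ds m \<alpha> \<phi> v = (\<lambda>_. 0)" if "\<not> free_var m v"
    using that by (cases "0 < idx \<alpha> v") (simp_all add: Ds_def fams_nonfree[OF \<phi>] Db_const[OF m2] free_unsh \<alpha>)
  assume v: "v \<notin> {v. \<phi> v \<noteq> (\<lambda>_. 0)} \<union> shiftv \<alpha> ` {v. \<phi> v \<noteq> (\<lambda>_. 0)}"
  have "\<phi> (unsh \<alpha> v) = (\<lambda>_. 0)" if "0 < idx \<alpha> v"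
    using v that by (metis (mono_tags, lifting) UnI2 image_eqI mem_Collect_eq shiftv_unsh)
  then show "Ds m \<alpha> \<phi> v = (\<lambda>_. 0)" using v by (auto simp: Ds_def Db_const[OF m2])
qed

lemma Tl_shift_fams:
  assumes \<phi>: "\<phi> \<in> fams m" shows "(\<lambda>v. Tl m \<alpha> \<phi> (shiftv \<alpha> v)) \<in> fams m"
proof (rule famsI[of "unsh \<alpha> ` {v. Tl m \<alpha> \<phi> v \<noteq> (\<lambda>_. 0)}"])
  note T = Tl_fams[OF \<phi>]
  show "finite (unsh \<alpha> ` {v. Tl m \<alpha> \<phi> v \<noteq> (\<lambda>_. 0)})" using fams_finite[OF T] by simp
  fix v
  show "Tl m \<alpha> \<phi> (shiftv \<alpha> v) \<in> FR m" using fams_FR[OF T] .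
  show "Tl m \<alpha> \<phi> (shiftv \<alpha> v) = (\<lambda>_. 0)" if "is_X v" using that fams_X[OF T] by simp
  show "Tl m \<alpha> \<phi> (shiftv \<alpha> v) = (\<lambda>_. 0)" if "\<not> free_var m v"
    using that fams_nonfree[OF T] by (simp add: free_shiftv_iff \<alpha>)
  show "Tl m \<alpha> \<phi> (shiftv \<alpha> v) = (\<lambda>_. 0)" if "v \<notin> unsh \<alpha> ` {v. Tl m \<alpha> \<phi> v \<noteq> (\<lambda>_. 0)}"
    using that by (metis (mono_tags, lifting) image_eqI mem_Collect_eq unsh_shiftv)
qed

text \<open>At index 0 this is the recursion of \<open>Tl\<close>. At positive index the remainder
  is zero, and the shifted term in \<open>Ds\<close> returns \<open>Tl\<close> at \<open>v\<close>
  itself.\<close>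

lemma Rf_decomp:
  assumes \<phi>: "\<phi> \<in> fams m"
  shows "\<phi> v y = Rf m \<alpha> \<phi> v y + Ds m \<alpha> (\<lambda>v. Tl m \<alpha> \<phi> (shiftv \<alpha> v)) v y"
  using fun_cong[OF Tl_rec[OF \<phi>, of v], of y] by (simp add: Rf_def Ds_def shiftv_unsh)

text \<open>Dividing \<open>Ds m \<alpha> \<phi>\<close> by \<open>Ds m \<alpha>\<close> returns
  \<phi> with remainder 0. Both the annihilation \<open>Rf_Ds_same\<close> and the injectivity
  \<open>Ds_inj\<close> come from this one formula.\<close>

lemma Tl_Ds_same:
  assumes \<phi>: "\<phi> \<in> fams m"
  shows "Tl m \<alpha> (Ds m \<alpha> \<phi>) v = (if 0 < idx \<alpha> v then \<phi> (unsh \<alpha> v) else (\<lambda>_. 0))"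
proof (rule Tl_unique[OF Ds_fams[OF \<phi>]])
  fix v
  show "(if 0 < idx \<alpha> v then \<phi> (unsh \<alpha> v) else (\<lambda>_. 0)) =
     (\<lambda>y. Ds m \<alpha> \<phi> v y - Db m \<alpha> (if 0 < idx \<alpha> (shiftv \<alpha> v) then \<phi> (unsh \<alpha> (shiftv \<alpha> v)) else (\<lambda>_. 0)) y)"
    by (cases "is_X v") (auto simp: Ds_def idx_shiftv fams_X[OF \<phi>] Db_const[OF m2] fun_eq_iff)
next
  obtain K where K: "\<forall>v. \<forall>k\<ge>K. \<phi> ((shiftv \<alpha> ^^ k) v) = (\<lambda>_. 0)" using fams_bound[OF \<phi>] by blast
  have "\<phi> (unsh \<alpha> ((shiftv \<alpha> ^^ k) v)) = (\<lambda>_. 0)" if "Suc K \<le> k" for k v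
  proof -
    have "(shiftv \<alpha> ^^ k) v = shiftv \<alpha> ((shiftv \<alpha> ^^ (k - 1)) v)"
      using that by (metis Suc_diff_1 Suc_le_D comp_apply funpow.simps(2) zero_less_Suc)
    then show ?thesis using K that by simp
  qed
  then show "\<exists>K. \<forall>v. \<forall>k\<ge>K. (if 0 < idx \<alpha> ((shiftv \<alpha> ^^ k) v) then \<phi> (unsh \<alpha> ((shiftv \<alpha> ^^ k) v)) else (\<lambda>_. 0)) = (\<lambda>_. 0)"
    by (intro exI[of _ "Suc K"]) simp
qed

lemma Rf_Ds_same: "\<phi> \<in> fams m \<Longrightarrow> Rf m \<alpha> (Ds m \<alpha> \<phi>) = (\<lambda>_ _. 0)"
  by (simp add: Rf_def Tl_Ds_same fun_eq_iff)

lemma Rf_zero: "Rf m \<alpha> (\<lambda>_ _. 0) = (\<lambda>_ _. 0)"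
  by (simp add: Rf_def Tl_def fun_eq_iff)

lemma Ds_inj:
  assumes \<phi>: "\<phi> \<in> fams m" and 0: "Ds m \<alpha> \<phi> = (\<lambda>_ _. 0)" shows "\<phi> = (\<lambda>_ _. 0)"
proof
  fix v
  show "\<phi> v = (\<lambda>_. 0)"
  proof (cases "is_X v")
    case False
    then have "\<phi> v = Tl m \<alpha> (Ds m \<alpha> \<phi>) (shiftv \<alpha> v)" by (simp add: Tl_Ds_same[OF \<phi>] idx_shiftv)
    then show ?thesis unfolding 0 by (simp add: Tl_def)
  qed (rule fams_X[OF \<phi>])
qed

lemma Tl_add:
  assumes \<phi>: "\<phi> \<in> fams m" and \<psi>: "\<psi> \<in> fams m"
  shows "Tl m \<alpha> (\<lambda>v y. \<phi> v y + \<psi> v y) v = (\<lambda>y. Tl m \<alpha> \<phi> v y + Tl m \<alpha> \<psi> v y)"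
proof (rule Tl_unique[OF famsadd[OF \<phi> \<psi>]])
  fix v
  show "(\<lambda>y. Tl m \<alpha> \<phi> v y + Tl m \<alpha> \<psi> v y) =
    (\<lambda>y. \<phi> v y + \<psi> v y - Db m \<alpha> (\<lambda>y. Tl m \<alpha> \<phi> (shiftv \<alpha> v) y + Tl m \<alpha> \<psi> (shiftv \<alpha> v) y) y)"
    unfolding Db_add[OF m2 Tl_FR[OF \<phi>] Tl_FR[OF \<psi>]]
    using fun_cong[OF Tl_rec[OF \<phi>, of v]] fun_cong[OF Tl_rec[OF \<psi>, of v]] by (auto simp: fun_eq_iff)
next
  obtain K where "\<forall>v. \<forall>k\<ge>K. \<phi> ((shiftv \<alpha> ^^ k) v) = (\<lambda>_. 0)" using fams_bound[OF \<phi>] by blast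
  note 1 = Tl_vanish[OF this]
  obtain L where "\<forall>v. \<forall>k\<ge>L. \<psi> ((shiftv \<alpha> ^^ k) v) = (\<lambda>_. 0)" using fams_bound[OF \<psi>] by blast
  note 2 = Tl_vanish[OF this]
  show "\<exists>K. \<forall>v. \<forall>k\<ge>K. (\<lambda>y. Tl m \<alpha> \<phi> ((shiftv \<alpha> ^^ k) v) y + Tl m \<alpha> \<psi> ((shiftv \<alpha> ^^ k) v) y) = (\<lambda>_. 0)"
    using 1 2 by (intro exI[of _ "max K L"]) simp
qed

lemma Rf_add:
  "\<phi> \<in> fams m \<Longrightarrow> \<psi> \<in> fams m \<Longrightarrow> Rf m \<alpha> (\<lambda>v y. \<phi> v y + \<psi> v y) = (\<lambda>v y. Rf m \<alpha> \<phi> v y + Rf m \<alpha> \<psi> v y)"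
  by (auto simp: Rf_def Tl_add fun_eq_iff)

end

text \<open>The right-hand side satisfies the recursion for the left-hand side, because total
  derivatives commute and a shift in direction \<alpha> does not touch the index in direction
  \<beta>.\<close>

lemma Tl_Ds_commute:
  assumes \<phi>: "\<phi> \<in> fams m" and \<alpha>: "2 \<le> \<alpha>" "\<alpha> \<le> m" and \<beta>: "2 \<le> \<beta>" "\<beta> \<le> m" "\<beta> \<noteq> \<alpha>"
  shows "Tl m \<alpha> (Ds m \<beta> \<phi>) v = Ds m \<beta> (Tl m \<alpha> \<phi>) v"
proof (rule Tl_unique[OF \<alpha> Ds_fams[OF \<beta>(1,2) \<phi>]])
  fix v
  let ?T = "Tl m \<alpha> \<phi>"
  have T: "?T w \<in> FR m" for w using Tl_FR[OF \<alpha> \<phi>] .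
  have D: "Db m \<beta> (?T w) \<in> FR m" "Db m \<alpha> (?T w) \<in> FR m" for w using T \<alpha> \<beta> by (auto intro!: Db_FR[OF m2])
  have c: "Db m \<beta> (Db m \<alpha> (?T w)) = Db m \<alpha> (Db m \<beta> (?T w))" for w
    using \<alpha> \<beta> by (intro Db_commute[OF m2 T]) auto
  have r: "?T w = (\<lambda>y. \<phi> w y - Db m \<alpha> (?T (shiftv \<alpha> w)) y)" for w using Tl_rec[OF \<alpha> \<phi>] .
  have b: "Db m \<beta> (?T v) = (\<lambda>y. Db m \<beta> (\<phi> v) y - Db m \<alpha> (Db m \<beta> (?T (shiftv \<alpha> v))) y)"
    by (subst r) (simp add: Db_diff[OF m2 fams_FR[OF \<phi>] D(2)] c)
  show "Ds m \<beta> ?T v = (\<lambda>y. Ds m \<beta> \<phi> v y - Db m \<alpha> (Ds m \<beta> ?T (shiftv \<alpha> v)) y)"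
  proof (cases "0 < idx \<beta> v")
    case True
    have "Db m \<alpha> (Ds m \<beta> ?T (shiftv \<alpha> v)) = (\<lambda>y. Db m \<alpha> (Db m \<beta> (?T (shiftv \<alpha> v))) y + Db m \<alpha> (?T (shiftv \<alpha> (unsh \<beta> v))) y)"
      unfolding Ds_def using True \<beta> by (simp add: idx_shiftv shiftv_unsh_commute Db_add[OF m2 D(1) T])
    then show ?thesis using True b fun_cong[OF r[of "unsh \<beta> v"]] by (auto simp: Ds_def[of m \<beta>] fun_eq_iff)
  next
    case False
    then show ?thesis using b \<beta> by (simp add: Ds_def idx_shiftv)
  qed
next
  show "\<exists>K. \<forall>v. \<forall>k\<ge>K. Ds m \<beta> (Tl m \<alpha> \<phi>) ((shiftv \<alpha> ^^ k) v) = (\<lambda>_. 0)"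
    using fams_bound[OF Ds_fams[OF \<beta>(1,2) Tl_fams[OF \<alpha> \<phi>]]] .
qed

lemma Rf_Ds_commute:
  assumes \<phi>: "\<phi> \<in> fams m" and \<alpha>: "2 \<le> \<alpha>" "\<alpha> \<le> m" and \<beta>: "2 \<le> \<beta>" "\<beta> \<le> m" "\<beta> \<noteq> \<alpha>"
  shows "Rf m \<alpha> (Ds m \<beta> \<phi>) = Ds m \<beta> (Rf m \<alpha> \<phi>)"
proof
  fix v
  show "Rf m \<alpha> (Ds m \<beta> \<phi>) v = Ds m \<beta> (Rf m \<alpha> \<phi>) v"
    using \<beta> by (auto simp: Rf_def Tl_Ds_commute[OF assms] Ds_def idx_unsh Db_const[OF m2])
qed

text \<open>Remainders in several directions compose: an image of \<open>Ds m \<beta>\<close> passes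
  through the divisions in the other directions and is killed by its own. The last claim collects
  the quotients of the successive divisions.\<close>

lemma foldr_Rf:
  assumes \<phi>: "\<phi> \<in> fams m" and xs: "set xs \<subseteq> {2..m}" "distinct xs"
  shows "foldr (Rf m) xs \<phi> \<in> fams m"
    and "\<psi> \<in> fams m \<Longrightarrow> foldr (Rf m) xs (\<lambda>v y. \<phi> v y + \<psi> v y) = (\<lambda>v y. foldr (Rf m) xs \<phi> v y + foldr (Rf m) xs \<psi> v y)"
    and "2 \<le> \<beta> \<Longrightarrow> \<beta> \<le> m \<Longrightarrow> foldr (Rf m) xs (Ds m \<beta> \<phi>) = (if \<beta> \<in> set xs then (\<lambda>_ _. 0) else Ds m \<beta> (foldr (Rf m) xs \<phi>))"
    and "\<exists>\<psi>. (\<forall>\<alpha>\<in>set xs. \<psi> \<alpha> \<in> fams m) \<and> (\<forall>v y. \<phi> v y = foldr (Rf m) xs \<phi> v y + (\<Sum>\<alpha>\<in>set xs. Ds m \<alpha> (\<psi> \<alpha>) v y))"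
proof -
  have fam: "foldr (Rf m) ys \<phi> \<in> fams m" if "\<phi> \<in> fams m" "set ys \<subseteq> {2..m}" for \<phi> ys
    using that by (induction ys) (auto intro!: Rf_fams)
  show "foldr (Rf m) xs \<phi> \<in> fams m" using fam[OF \<phi> xs(1)] .
  show "foldr (Rf m) xs (\<lambda>v y. \<phi> v y + \<psi> v y) = (\<lambda>v y. foldr (Rf m) xs \<phi> v y + foldr (Rf m) xs \<psi> v y)"
    if "\<psi> \<in> fams m"
    using xs(1)
  proof (induction xs)
    case (Cons a xs)
    then show ?case using Rf_add[of a, OF _ _ fam[OF \<phi>] fam[OF that]] by auto
  qed simp
  show "foldr (Rf m) xs (Ds m \<beta> \<phi>) = (if \<beta> \<in> set xs then (\<lambda>_ _. 0) else Ds m \<beta> (foldr (Rf m) xs \<phi>))"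
    if \<beta>: "2 \<le> \<beta>" "\<beta> \<le> m"
    using xs
  proof (induction xs)
    case (Cons a xs)
    have a: "2 \<le> a" "a \<le> m" using Cons.prems by auto
    have f: "foldr (Rf m) xs \<phi> \<in> fams m" using fam[OF \<phi>] Cons.prems by auto
    have IH: "foldr (Rf m) xs (Ds m \<beta> \<phi>) = (if \<beta> \<in> set xs then (\<lambda>_ _. 0) else Ds m \<beta> (foldr (Rf m) xs \<phi>))"
      using Cons by auto
    consider "\<beta> \<in> set xs" | "\<beta> \<notin> set xs" "\<beta> = a" | "\<beta> \<notin> set xs" "\<beta> \<noteq> a" by blast
    then show ?case
      using IH Rf_zero[OF a] Rf_Ds_same[OF a f] Rf_Ds_commute[OF f a \<beta>] by cases simp_all
  qed simp
  show "\<exists>\<psi>. (\<forall>\<alpha>\<in>set xs. \<psi> \<alpha> \<in> fams m) \<and> (\<forall>v y. \<phi> v y = foldr (Rf m) xs \<phi> v y + (\<Sum>\<alpha>\<in>set xs. Ds m \<alpha> (\<psi> \<alpha>) v y))"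
    using xs
  proof (induction xs)
    case (Cons a xs)
    have a: "2 \<le> a" "a \<le> m" using Cons.prems by auto
    have f: "foldr (Rf m) xs \<phi> \<in> fams m" using fam[OF \<phi>] Cons.prems by auto
    obtain \<psi> where \<psi>: "\<forall>\<alpha>\<in>set xs. \<psi> \<alpha> \<in> fams m"
      "\<And>v y. \<phi> v y = foldr (Rf m) xs \<phi> v y + (\<Sum>\<alpha>\<in>set xs. Ds m \<alpha> (\<psi> \<alpha>) v y)"
      using Cons by auto
    let ?t = "\<lambda>v. Tl m a (foldr (Rf m) xs \<phi>) (shiftv a v)"
    have "(\<Sum>\<alpha>\<in>set xs. Ds m \<alpha> ((\<psi>(a := ?t)) \<alpha>) v y) = (\<Sum>\<alpha>\<in>set xs. Ds m \<alpha> (\<psi> \<alpha>) v y)" for v y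
      using Cons.prems by (intro sum.cong) auto
    then have "\<phi> v y = foldr (Rf m) (a # xs) \<phi> v y + (\<Sum>\<alpha>\<in>set (a # xs). Ds m \<alpha> ((\<psi>(a := ?t)) \<alpha>) v y)" for v y
      using \<psi>(2)[of v y] Rf_decomp[OF a f, of v y] Cons.prems by simp
    moreover have "\<forall>\<alpha>\<in>set (a # xs). (\<psi>(a := ?t)) \<alpha> \<in> fams m"
      using \<psi>(1) Tl_shift_fams[OF a f] by simp
    ultimately show ?case by blast
  qed simp
qed

end

text \<open>If the derivative in a coordinate vanishes identically, the coordinate may be moved
  freely. Doing this for the finitely many coordinates of \<open>S\<close> outside \<open>W\<close>,
  one after the other, removes them from the dependency set.\<close>

lemma smf_drop:
  assumes f: "f \<in> smf V" and 0: "\<And>v. v \<notin> W \<Longrightarrow> partial v f = (\<lambda>_. 0)"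
  shows "f \<in> smf W"
proof -
  obtain S where S: "finite S" "S \<subseteq> V" "depends_on f S" using smf_finite_dep[OF f] by metis
  have const: "f (y(v := t)) = f y" if "v \<notin> W" for v y t
    using DERIV_isconst_all[of "\<lambda>t. f (y(v := t))" t "y v"] smf_has_partial[OF f, of y v] 0[OF that] by simp
  have "depends_on f (S \<inter> W)"
    unfolding depends_on_def
  proof (intro allI impI)
    fix y z :: pt assume yz: "\<forall>v\<in>S \<inter> W. y v = z v"
    have "f (\<lambda>u. if u \<in> T then z u else y u) = f y" if "finite T" "T \<subseteq> S - W" for T
      using that
    proof (induction T rule: finite_induct)
      case (insert a T)
      have "(\<lambda>u. if u \<in> insert a T then z u else y u) = (\<lambda>u. if u \<in> T then z u else y u)(a := z a)" by auto
      then show ?case using insert const[of a] by auto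
    qed simp
    from this[of "S - W"] have "f y = f (\<lambda>u. if u \<in> S - W then z u else y u)" using S by simp
    also have "\<dots> = f z" using yz by (intro depends_onD[OF S(3)]) auto
    finally show "f y = f z" .
  qed
  then show ?thesis using f S(1) unfolding smf_def by auto
qed

text \<open>The integral of \<open>f\<close> from 0 to \<open>y v\<close>, rescaled to the unit
  interval: \<open>y v\<close> times the integral of \<open>f (y(v := t * y v))\<close>. A fixed
  interval lets \<open>int01\<close> deliver smoothness.\<close>

lemma antiderivative:
  assumes f: "f \<in> smf V" and v: "v \<in> V" and z: "z \<notin> V"
  shows "\<exists>g\<in>smf V. partial v g = f"
proof -
  define s where "s u = (if u = v then (\<lambda>y. coord z y * coord v y) else coord u)" for u
  have s: "s u \<in> smf (insert z V)" if "u \<in> V" for u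
    using that v unfolding s_def by (auto intro!: smf_mult smf_coord)
  have vz: "v \<noteq> z" using v z by auto
  have ev: "subst s h (y(z := t)) = h (y(v := t * y v))" if "h \<in> smf V" for h y t
    unfolding subst_def using vz z
    by (intro depends_onD[OF smf_depends[OF that]]) (auto simp: s_def coord_def)
  let ?q = "int01 z (subst s f)"
  have sf: "subst s f \<in> smf (insert z V)" using smf_subst[OF f s] .
  have q: "?q \<in> smf V" using smf_int01[OF sf, of z] z by simp
  obtain S where S: "finite S" "S \<subseteq> V" "depends_on f S" using smf_finite_dep[OF f] by metis
  have S': "finite (insert v S)" "depends_on f (insert v S)" using S depends_on_mono[OF S(3) subset_insertI] by auto
  have ps: "partial v (s u) = (if u = v then coord z else (\<lambda>_. 0))" for u
    using vz by (auto simp: s_def partial_mult[OF smf_coord smf_coord, OF UNIV_I UNIV_I] partial_coord)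
  have "partial v (subst s f) = (\<lambda>y. \<Sum>u\<in>insert v S. subst s (partial u f) y * partial v (s u) y)"
    by (rule partial_subst[OF f S', where W = "insert z V"]) (use s S v in auto)
  also have "\<dots> = (\<lambda>y. subst s (partial v f) y * coord z y)"
  proof
    fix y
    have "(\<Sum>u\<in>insert v S. subst s (partial u f) y * partial v (s u) y)
      = (\<Sum>u\<in>insert v S. if u = v then subst s (partial v f) y * coord z y else 0)"
      by (intro sum.cong) (auto simp: ps)
    then show "(\<Sum>u\<in>insert v S. subst s (partial u f) y * partial v (s u) y) = subst s (partial v f) y * coord z y"
      using S by (simp del: sum.insert)
  qed
  finally have pq: "partial v ?q = int01 z (\<lambda>y. subst s (partial v f) y * coord z y)"
    using partial_int01[OF sf vz] by simp
  have "partial v (\<lambda>y. coord v y * ?q y) = f"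
  proof
    fix y
    define F1 where "F1 t = f (y(v := t * y v))" for t
    define F2 where "F2 t = t * partial v f (y(v := t * y v))" for t
    have c: "continuous_on {0..1} (\<lambda>t. h (y(v := t * y v)))" if "h \<in> smf V" for h
      by (rule smf_continuous_compose[OF that], intro continuous_on_upd continuous_intros)
    have i: "F1 integrable_on {0..1}" "F2 integrable_on {0..1}"
      unfolding F1_def F2_def
      by (intro integrable_continuous_real continuous_intros c f smf_partial)+
    \<comment> \<open>Integrating this derivative from 0 to 1 gives \<open>f y\<close> as
      \<open>?q y\<close> plus \<open>y v\<close> times the partial derivative of \<open>?q\<close>,
      which is the product rule for the antiderivative.\<close>
    have "((\<lambda>t. t * F1 t) has_real_derivative F1 t + y v * F2 t) (at t)" for t
    proof -
      have "(F1 has_real_derivative partial v f (y(v := t * y v)) * y v) (at t)"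
        unfolding F1_def by (rule DERIV_chain2[OF smf_has_partial[OF f]]) (auto intro!: derivative_eq_intros)
      from DERIV_mult[OF DERIV_ident this] show ?thesis by (simp add: F2_def algebra_simps)
    qed
    then have "((\<lambda>t. F1 t + y v * F2 t) has_integral 1 * F1 1 - 0 * F1 0) {0..1}"
      by (intro fundamental_theorem_of_calculus)
        (simp_all only: has_real_derivative_iff_has_vector_derivative[symmetric] has_field_derivative_at_within)
    then have "f y = integral {0..1} (\<lambda>t. F1 t + y v * F2 t)" by (simp add: integral_unique F1_def)
    also have "\<dots> = integral {0..1} F1 + y v * integral {0..1} F2"
      by (subst integral_add) (use i in \<open>auto intro: integrable_on_mult_right\<close>)
    also have "integral {0..1} F1 = ?q y" unfolding int01_def ev[OF f] F1_def[abs_def] ..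
    also have "integral {0..1} F2 = partial v ?q y"
      unfolding pq unfolding int01_def ev[OF smf_partial[OF f]] F2_def[abs_def] by (simp add: coord_def mult.commute)
    finally show "partial v (\<lambda>y. coord v y * ?q y) y = f y"
      unfolding partial_mult[OF smf_coord[OF v] q] partial_coord by (simp add: coord_def)
  qed
  moreover have "(\<lambda>y. coord v y * ?q y) \<in> smf V" by (intro smf_mult smf_coord v q)
  ultimately show ?thesis by blast
qed

subsection \<open>Scaling the dependent variables\<close>

definition scl :: "real \<Rightarrow> pt \<Rightarrow> pt" where
  "scl t y = (\<lambda>v. if is_X v then y v else t * y v)"

definition TT :: "fn \<Rightarrow> fn" where
  "TT f = (\<lambda>y. integral {0..1} (\<lambda>t. f (scl t y)))"

text \<open>The homotopy operator of the Poincare lemma in the dependent coordinates: contraction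
  with the velocity of t \<mapsto> \<open>scl t y\<close>, which is \<open>y v\<close> and not
  \<open>t * y v\<close>, and integration over t.\<close>

definition Gf :: "(var \<Rightarrow> fn) \<Rightarrow> fn" where
  "Gf \<phi> = (\<lambda>y. \<Sum>v | \<phi> v \<noteq> (\<lambda>_. 0). y v * TT (\<phi> v) y)"

lemma TT_zero [simp]: "TT (\<lambda>_. 0) = (\<lambda>_. 0)"
  by (simp add: TT_def)

lemma Gf_eq: "finite S \<Longrightarrow> (\<And>v. v \<notin> S \<Longrightarrow> \<phi> v = (\<lambda>_. 0)) \<Longrightarrow> Gf \<phi> = (\<lambda>y. \<Sum>v\<in>S. y v * TT (\<phi> v) y)"
  unfolding Gf_def by (intro ext sum.mono_neutral_left) auto

lemma scl_continuous: "f \<in> smf V \<Longrightarrow> continuous_on A (\<lambda>t. f (scl t y))"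
proof (rule smf_continuous_compose, assumption, rule continuous_on_coordinatewise_then_product)
  fix i show "continuous_on A (\<lambda>t. scl t y i)"
    unfolding scl_def by (cases "is_X i") (auto intro!: continuous_intros)
qed

lemma TT_add: "f \<in> smf V \<Longrightarrow> g \<in> smf V \<Longrightarrow> TT (\<lambda>y. f y + g y) = (\<lambda>y. TT f y + TT g y)"
  unfolding TT_def by (intro ext integral_add integrable_continuous_real scl_continuous)

text \<open>The scaling written as a substitution with parameter \<open>X 0\<close>. Valid x-indices
  start at 1, so this slot never meets a coordinate of the equation.\<close>

definition scs :: "var \<Rightarrow> fn" where
  "scs v = (if is_X v then coord v else (\<lambda>y. coord (X 0) y * coord v y))"

definition divs :: "nat \<Rightarrow> nat set \<Rightarrow> fn \<Rightarrow> bool" where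
  "divs m A f \<longleftrightarrow> (\<exists>g. (\<forall>\<alpha>\<in>A. g \<alpha> \<in> FR m) \<and> f = (\<lambda>y. \<Sum>\<alpha>\<in>A. Db m \<alpha> (g \<alpha>) y))"

context
  fixes m :: nat
  assumes m2: "2 \<le> m"
begin

lemma X0_nonfree: "\<not> free_var m (X 0)" "X 0 \<notin> {v. free_var m v}"
  by (auto simp: free_var_simps)

lemma scs_smf: "v \<in> V \<Longrightarrow> scs v \<in> smf (insert (X 0) V)"
  unfolding scs_def by (auto intro!: smf_mult smf_coord)

lemma subst_scs: "f \<in> FR m \<Longrightarrow> subst scs f (y(X 0 := t)) = f (scl t y)"
  unfolding subst_def FR_def
  by (rule depends_onD[OF smf_depends]) (auto simp: scs_def scl_def coord_def free_var_simps)

lemma TT_eq: "f \<in> FR m \<Longrightarrow> TT f = int01 (X 0) (subst scs f)"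
  unfolding TT_def int01_def by (simp only: subst_scs)

lemma TT_FR:
  assumes f: "f \<in> FR m" shows "TT f \<in> FR m"
proof -
  have "subst scs f \<in> smf (insert (X 0) {v. free_var m v})"
    by (rule smf_subst[OF f[unfolded FR_def] scs_smf])
  from smf_int01[OF this, of "X 0"] show ?thesis
    unfolding TT_eq[OF f] FR_def using X0_nonfree by simp
qed

lemma TT_depends:
  assumes f: "depends_on f S" shows "depends_on (TT f) S"
  unfolding depends_on_def[of "TT f"]
proof (intro allI impI)
  fix y z :: pt assume yz: "\<forall>v\<in>S. y v = z v"
  have "f (scl t y) = f (scl t z)" for t using yz by (intro depends_onD[OF f]) (auto simp: scl_def)
  then show "TT f y = TT f z" by (simp add: TT_def)
qed

lemma partial_TT:
  assumes f: "f \<in> FR m" and v: "free_var m v"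
  shows "partial v (TT f) y = integral {0..1} (\<lambda>t. (if is_X v then 1 else t) * partial v f (scl t y))"
proof -
  have vX: "v \<noteq> X 0" using v X0_nonfree by auto
  have f': "f \<in> smf {v. free_var m v}" using f by (simp add: FR_def)
  obtain S where S: "finite S" "S \<subseteq> {v. free_var m v}" "depends_on f S" using smf_finite_dep[OF f'] by metis
  have S': "finite (insert v S)" "depends_on f (insert v S)" using S depends_on_mono[OF S(3) subset_insertI] by auto
  have sf: "subst scs f \<in> smf (insert (X 0) {v. free_var m v})" by (rule smf_subst[OF f' scs_smf])
  let ?c = "\<lambda>y. if is_X v then 1 else coord (X 0) y"
  have ps: "partial v (scs u) = (if u = v then ?c else (\<lambda>_. 0))" for u
    using vX by (auto simp: scs_def partial_mult[OF smf_coord smf_coord, OF UNIV_I UNIV_I] partial_coord)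
  have "partial v (subst scs f) = (\<lambda>y. \<Sum>u\<in>insert v S. subst scs (partial u f) y * partial v (scs u) y)"
    by (rule partial_subst[OF f' S' scs_smf[OF UNIV_I]])
  also have "\<dots> = (\<lambda>y. subst scs (partial v f) y * ?c y)"
  proof
    fix y
    have "(\<Sum>u\<in>insert v S. subst scs (partial u f) y * partial v (scs u) y)
      = (\<Sum>u\<in>insert v S. if u = v then subst scs (partial v f) y * ?c y else 0)"
      by (intro sum.cong) (auto simp: ps)
    then show "(\<Sum>u\<in>insert v S. subst scs (partial u f) y * partial v (scs u) y) = subst scs (partial v f) y * ?c y"
      using S by (simp del: sum.insert)
  qed
  finally have "partial v (TT f) = int01 (X 0) (\<lambda>y. subst scs (partial v f) y * ?c y)"
    using partial_int01[OF sf vX] by (simp add: TT_eq[OF f])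
  then show ?thesis
    unfolding int01_def subst_scs[OF FR_intros(8)[OF f]]
    by (cases "is_X v") (simp_all add: coord_def mult.commute)
qed

text \<open>The components of \<open>D\<^sub>\<alpha>\<close> are constant at the x and linear at
  the dependent coordinates. The factor t that differentiation of the scaled function produces is
  thus absorbed by evaluating the component at the scaled point. The quadratic terms in
  \<open>cvf\<close> would break this balance.\<close>

lemma Db_TT:
  assumes f: "f \<in> FR m" and \<alpha>: "2 \<le> \<alpha>" "\<alpha> \<le> m"
  shows "Db m \<alpha> (TT f) = TT (Db m \<alpha> f)"
proof
  fix y
  obtain S where S: "finite S" "S \<subseteq> {v. free_var m v}" "depends_on f S"
    using smf_finite_dep f unfolding FR_def by metis
  let ?c = "\<lambda>v (t::real). if is_X v then 1 else t"
  have vf: "Db m \<alpha> g = vf (tvf m \<alpha>) g" if "g \<in> FR m" for g using that \<alpha> by (simp add: Db_eq_vf[OF m2])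
  have "Db m \<alpha> (TT f) y = (\<Sum>v\<in>S. tvf m \<alpha> v y * partial v (TT f) y)"
    unfolding vf[OF TT_FR[OF f]] vf_eq[OF S(1) TT_depends[OF S(3)]] ..
  also have "\<dots> = (\<Sum>v\<in>S. integral {0..1} (\<lambda>t. tvf m \<alpha> v y * (?c v t * partial v f (scl t y))))"
    using S by (intro sum.cong) (auto simp: partial_TT[OF f])
  also have "\<dots> = integral {0..1} (\<lambda>t. \<Sum>v\<in>S. tvf m \<alpha> v y * (?c v t * partial v f (scl t y)))"
  proof (rule integral_sum[symmetric, OF S(1)])
    fix v assume "v \<in> S"
    have "continuous_on {0..1} (\<lambda>t. partial v f (scl t y))"
      using scl_continuous FR_intros(8)[OF f, unfolded FR_def] by blast
    then show "(\<lambda>t. tvf m \<alpha> v y * (?c v t * partial v f (scl t y))) integrable_on {0..1}"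
      by (cases "is_X v") (auto intro!: integrable_continuous_real continuous_intros)
  qed
  also have "\<dots> = integral {0..1} (\<lambda>t. Db m \<alpha> f (scl t y))"
  proof (intro arg_cong[where f = "integral {0..1}"] ext)
    fix t
    have "tvf m \<alpha> v y * (?c v t * partial v f (scl t y)) = tvf m \<alpha> v (scl t y) * partial v f (scl t y)"
      if "v \<in> S" for v
    proof (cases "is_X v")
      case True
      then obtain \<nu> where "v = X \<nu>" by (cases v) auto
      then show ?thesis by simp
    next
      case False
      then show ?thesis using that S free_valid by (auto simp: tvf_nonX coord_def scl_def)
    qed
    then show "(\<Sum>v\<in>S. tvf m \<alpha> v y * (?c v t * partial v f (scl t y))) = Db m \<alpha> f (scl t y)"
      unfolding vf[OF f] vf_eq[OF S(1,3)] by (intro sum.cong) auto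
  qed
  finally show "Db m \<alpha> (TT f) y = TT (Db m \<alpha> f) y" by (simp add: TT_def)
qed

lemma Gf_FR: "\<phi> \<in> fams m \<Longrightarrow> Gf \<phi> \<in> FR m"
proof -
  assume \<phi>: "\<phi> \<in> fams m"
  have "Gf \<phi> = (\<lambda>y. \<Sum>v | \<phi> v \<noteq> (\<lambda>_. 0). coord v y * TT (\<phi> v) y)" by (simp add: Gf_def coord_def)
  also have "\<dots> \<in> FR m" using \<phi> by (intro FR_intros TT_FR) (auto simp: fams_def)
  finally show ?thesis .
qed

lemma Gf_add:
  assumes "\<phi> \<in> fams m" "\<psi> \<in> fams m" shows "Gf (\<lambda>v y. \<phi> v y + \<psi> v y) = (\<lambda>y. Gf \<phi> y + Gf \<psi> y)"
proof -
  let ?S = "{v. \<phi> v \<noteq> (\<lambda>_. 0)} \<union> {v. \<psi> v \<noteq> (\<lambda>_. 0)}"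
  have S: "finite ?S" using assms by (simp add: fams_finite)
  have "TT (\<lambda>y. \<phi> v y + \<psi> v y) = (\<lambda>y. TT (\<phi> v) y + TT (\<psi> v) y)" for v
    using fams_FR[OF assms(1)] fams_FR[OF assms(2)] unfolding FR_def by (rule TT_add)
  moreover have "Gf (\<lambda>v y. \<phi> v y + \<psi> v y) = (\<lambda>y. \<Sum>v\<in>?S. y v * TT (\<lambda>y. \<phi> v y + \<psi> v y) y)"
    by (rule Gf_eq[OF S]) auto
  moreover have "Gf \<phi> = (\<lambda>y. \<Sum>v\<in>?S. y v * TT (\<phi> v) y)" "Gf \<psi> = (\<lambda>y. \<Sum>v\<in>?S. y v * TT (\<psi> v) y)"
    by (rule Gf_eq[OF S]; auto)+
  ultimately show ?thesis by (simp add: sum.distrib algebra_simps)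
qed

lemma Gf_sum:
  "(\<And>a. a \<in> A \<Longrightarrow> \<psi> a \<in> fams m) \<Longrightarrow> Gf (\<lambda>v y. \<Sum>a\<in>A. \<psi> a v y) = (\<lambda>y. \<Sum>a\<in>A. Gf (\<psi> a) y)"
proof (induction A rule: infinite_finite_induct)
  case (insert a A)
  then show ?case using Gf_add[OF _ fams_sum[OF m2], of "\<psi> a" A \<psi>] by simp
qed (auto simp: Gf_def)

text \<open>Translates back from linearisations to functions: a family in the image of
  \<open>Ds m \<alpha>\<close> integrates to a total derivative. The product rule moves the
  coordinate factor one shift up, which is the second summand of \<open>Ds\<close>.\<close>

lemma Db_Gf:
  assumes \<phi>: "\<phi> \<in> fams m" and \<alpha>: "2 \<le> \<alpha>" "\<alpha> \<le> m"
  shows "Db m \<alpha> (Gf \<phi>) = Gf (Ds m \<alpha> \<phi>)"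
proof -
  let ?S = "{v. \<phi> v \<noteq> (\<lambda>_. 0)}"
  let ?S' = "?S \<union> shiftv \<alpha> ` ?S"
  have fin: "finite ?S" "finite ?S'" using fams_finite[OF \<phi>] by auto
  have T: "TT (\<phi> v) \<in> FR m" for v using TT_FR[OF fams_FR[OF \<phi>]] .
  have S: "free_var m v" "\<not> is_X v" if "v \<in> ?S" for v using that \<phi> by (auto simp: fams_def)
  have unsh: "\<phi> (unsh \<alpha> v) = (\<lambda>_. 0)" if "0 < idx \<alpha> v" "v \<notin> shiftv \<alpha> ` ?S" for v
    using that by (metis (mono_tags, lifting) image_eqI mem_Collect_eq shiftv_unsh)
  have "Db m \<alpha> (Gf \<phi>) = Db m \<alpha> (\<lambda>y. \<Sum>v\<in>?S. coord v y * TT (\<phi> v) y)"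
    by (simp add: Gf_def coord_def)
  also have "\<dots> = (\<lambda>y. \<Sum>v\<in>?S. Db m \<alpha> (\<lambda>y. coord v y * TT (\<phi> v) y) y)"
    by (rule Db_sum[OF m2]) (use S T in \<open>auto intro!: FR_intros\<close>)
  also have "\<dots> = (\<lambda>y. \<Sum>v\<in>?S. y (shiftv \<alpha> v) * TT (\<phi> v) y + y v * TT (Db m \<alpha> (\<phi> v)) y)"
  proof (intro ext sum.cong refl)
    fix y v assume v: "v \<in> ?S"
    have "Db m \<alpha> (coord v) = coord (shiftv \<alpha> v)" using S[OF v] \<alpha> by (simp add: Db_def Dt_coord free_valid)
    then show "Db m \<alpha> (\<lambda>y. coord v y * TT (\<phi> v) y) y = y (shiftv \<alpha> v) * TT (\<phi> v) y + y v * TT (Db m \<alpha> (\<phi> v)) y"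
      unfolding Db_mult[OF m2 FR_intros(2)[OF S(1)[OF v]] T] Db_TT[OF fams_FR[OF \<phi>] \<alpha>]
      by (simp add: coord_def)
  qed
  also have "\<dots> = Gf (Ds m \<alpha> \<phi>)"
  proof
    fix y
    have TD: "TT (Ds m \<alpha> \<phi> v) y = TT (Db m \<alpha> (\<phi> v)) y + (if 0 < idx \<alpha> v then TT (\<phi> (unsh \<alpha> v)) y else 0)" for v
    proof (cases "0 < idx \<alpha> v")
      case True
      have "Db m \<alpha> (\<phi> v) \<in> FR m" "\<phi> (unsh \<alpha> v) \<in> FR m"
        using fams_FR[OF \<phi>] \<alpha> by (auto intro!: Db_FR[OF m2])
      then show ?thesis using True by (simp add: Ds_def) (simp add: FR_def TT_add)
    qed (simp add: Ds_def)
    have "Gf (Ds m \<alpha> \<phi>) = (\<lambda>y. \<Sum>v\<in>?S'. y v * TT (Ds m \<alpha> \<phi> v) y)"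
    proof (rule Gf_eq[OF fin(2)])
      fix v assume "v \<notin> ?S'"
      then show "Ds m \<alpha> \<phi> v = (\<lambda>_. 0)" using unsh[of v] by (auto simp: Ds_def Db_const[OF m2])
    qed
    then have "Gf (Ds m \<alpha> \<phi>) y = (\<Sum>v\<in>?S'. y v * TT (Db m \<alpha> (\<phi> v)) y)
        + (\<Sum>v\<in>?S'. y v * (if 0 < idx \<alpha> v then TT (\<phi> (unsh \<alpha> v)) y else 0))"
      by (simp add: TD algebra_simps sum.distrib)
    also have "(\<Sum>v\<in>?S'. y v * TT (Db m \<alpha> (\<phi> v)) y) = (\<Sum>v\<in>?S. y v * TT (Db m \<alpha> (\<phi> v)) y)"
      by (rule sum.mono_neutral_right[OF fin(2)]) (auto simp: Db_const[OF m2])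
    also have "(\<Sum>v\<in>?S'. y v * (if 0 < idx \<alpha> v then TT (\<phi> (unsh \<alpha> v)) y else 0))
        = (\<Sum>v\<in>shiftv \<alpha> ` ?S. y v * (if 0 < idx \<alpha> v then TT (\<phi> (unsh \<alpha> v)) y else 0))"
      by (rule sum.mono_neutral_right[OF fin(2)]) (use unsh in auto)
    also have "\<dots> = (\<Sum>v\<in>?S. y (shiftv \<alpha> v) * (if 0 < idx \<alpha> (shiftv \<alpha> v) then TT (\<phi> (unsh \<alpha> (shiftv \<alpha> v))) y else 0))"
      by (subst sum.reindex) (auto simp: inj_on_def dest: arg_cong[where f = "unsh \<alpha>"])
    also have "\<dots> = (\<Sum>v\<in>?S. y (shiftv \<alpha> v) * TT (\<phi> v) y)"
      by (intro sum.cong refl) (use S(2) in \<open>auto simp: idx_shiftv\<close>)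
    finally show "(\<Sum>v\<in>?S. y (shiftv \<alpha> v) * TT (\<phi> v) y + y v * TT (Db m \<alpha> (\<phi> v)) y) = Gf (Ds m \<alpha> \<phi>) y"
      by (simp add: sum.distrib)
  qed
  finally show ?thesis .
qed

lemma grad_fams:
  assumes f: "f \<in> FR m" shows "grad f \<in> fams m"
proof -
  obtain S where S: "finite S" "S \<subseteq> {v. free_var m v}" "depends_on f S"
    using smf_finite_dep f unfolding FR_def by metis
  show ?thesis
    by (rule famsI[OF S(1)])
      (use S partial_outside[OF S(3)] f in \<open>auto simp: grad_def intro: FR_intros\<close>)
qed

lemma Gf_grad:
  assumes f: "f \<in> FR m" shows "f y - f (scl 0 y) = Gf (grad f) y"
proof -
  have f': "f \<in> smf {v. free_var m v}" using f by (simp add: FR_def)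
  obtain S where S: "finite S" "S \<subseteq> {v. free_var m v}" "depends_on f S" using smf_finite_dep[OF f'] by metis
  let ?d = "\<lambda>v. if is_X v then 0 else y v"
  have "((\<lambda>t. f (scl t y)) has_real_derivative (\<Sum>v\<in>S. partial v f (scl t y) * ?d v)) (at t)" for t
    by (rule deriv_along_curve[OF f' S(1,3)]) (auto simp: scl_def intro!: derivative_eq_intros)
  then have "((\<lambda>t. \<Sum>v\<in>S. partial v f (scl t y) * ?d v) has_integral f (scl 1 y) - f (scl 0 y)) {0..1}"
    by (intro fundamental_theorem_of_calculus)
      (simp_all only: has_real_derivative_iff_has_vector_derivative[symmetric] has_field_derivative_at_within)
  moreover have "scl 1 y = y" by (auto simp: scl_def)
  ultimately have "f y - f (scl 0 y) = integral {0..1} (\<lambda>t. \<Sum>v\<in>S. partial v f (scl t y) * ?d v)"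
    by (simp add: integral_unique)
  also have "\<dots> = (\<Sum>v\<in>S. integral {0..1} (\<lambda>t. partial v f (scl t y) * ?d v))"
    by (rule integral_sum[OF S(1)])
      (intro integrable_continuous_real continuous_intros scl_continuous[OF smf_partial[OF f']])
  also have "\<dots> = (\<Sum>v\<in>S. y v * TT (grad f v) y)"
    by (intro sum.cong refl) (simp add: TT_def grad_def)
  also have "\<dots> = Gf (grad f) y"
    using Gf_eq[OF S(1), of "grad f"] partial_outside[OF S(3)] by (simp add: grad_def)
  finally show ?thesis .
qed

lemma grad_Db:
  assumes f: "f \<in> FR m" and \<alpha>: "2 \<le> \<alpha>" "\<alpha> \<le> m"
  shows "grad (Db m \<alpha> f) = Ds m \<alpha> (grad f)"
proof
  fix u
  show "grad (Db m \<alpha> f) u = Ds m \<alpha> (grad f) u"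
  proof (cases "is_X u")
    case True
    then show ?thesis by (simp add: grad_def Ds_def Db_const[OF m2])
  next
    case False
    have f': "f \<in> smf {v. free_var m v}" using f by (simp add: FR_def)
    obtain S where S: "finite S" "S \<subseteq> {v. free_var m v}" "depends_on f S" using smf_finite_dep[OF f'] by metis
    have vf: "Db m \<alpha> g = vf (tvf m \<alpha>) g" if "g \<in> FR m" for g using that \<alpha> by (simp add: Db_eq_vf[OF m2])
    have t: "tvf m \<alpha> v \<in> smf {v. free_var m v}" if "v \<in> S" for v
      using tvf_FR[of m v \<alpha>] that S \<alpha> by (auto simp: FR_def)
    have pt: "partial u (tvf m \<alpha> v) y * partial v f y = (if v = unsh \<alpha> u then (if 0 < idx \<alpha> u then partial v f y else 0) else 0)"
      if "v \<in> S" for v y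
    proof (cases "is_X v")
      case True
      then have "v \<noteq> unsh \<alpha> u" using False by auto
      then show ?thesis using True by (cases v) auto
    next
      case nX: False
      \<comment> \<open>In the commutator only the component whose coordinate is shifted onto
        \<open>u\<close> depends on \<open>u\<close>, so the sum collapses to the single term at
        \<open>unsh \<alpha> u\<close>.\<close>
      have "u = shiftv \<alpha> v \<longleftrightarrow> v = unsh \<alpha> u \<and> 0 < idx \<alpha> u"
        using nX by (auto simp: idx_shiftv shiftv_unsh)
      then show ?thesis using that S nX free_valid by (auto simp: tvf_nonX partial_coord)
    qed
    have "partial u (vf (tvf m \<alpha>) f) = (\<lambda>y. vf (tvf m \<alpha>) (partial u f) y + (\<Sum>v\<in>S. partial u (tvf m \<alpha> v) y * partial v f y))"
      by (rule partial_vf[OF f' S(1,3) t])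
    moreover have "(\<Sum>v\<in>S. partial u (tvf m \<alpha> v) y * partial v f y) = (if 0 < idx \<alpha> u then partial (unsh \<alpha> u) f y else 0)" for y
      using S(1) partial_outside[OF S(3), of "unsh \<alpha> u"] by (simp add: pt)
    ultimately show ?thesis
      using False f by (auto simp: grad_def Ds_def vf FR_intros fun_eq_iff)
  qed
qed

lemma Db_Xonly:
  assumes "f \<in> FR m" "f \<in> smf (range X)" shows "Db m \<mu> f = partial (X \<mu>) f"
proof -
  obtain S where S: "finite S" "S \<subseteq> range X" "depends_on f S" using smf_finite_dep[OF assms(2)] by metis
  have S': "finite (insert (X \<mu>) S)" "depends_on f (insert (X \<mu>) S)" using S depends_on_mono[OF S(3) subset_insertI] by auto
  let ?a = "if \<mu> = 1 then cvf m else tvf m \<mu>"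
  have a: "?a v y * partial v f y = (if v = X \<mu> then partial (X \<mu>) f y else 0)" if "v \<in> insert (X \<mu>) S" for v y
  proof -
    have "v \<in> range X" using that S by auto
    then obtain \<nu> where "v = X \<nu>" by auto
    then show ?thesis by (auto simp: cvf_def)
  qed
  show ?thesis
    unfolding Db_eq_vf[OF m2 assms(1)] vf_eq[OF S'] using a S(1) by (simp del: sum.insert)
qed

text \<open>One direction already removes all dependent coordinates, since the linearisation of
  \<open>f\<close> is killed by the injective \<open>Ds m \<alpha>\<close>. On a function of the x
  every \<open>D\<^sub>\<alpha>\<close> is the plain partial derivative, so the directions in
  \<open>A\<close> disappear as well.\<close>

lemma Db_kernel:
  assumes f: "f \<in> FR m" and A: "A \<subseteq> {2..m}" "A \<noteq> {}" and 0: "\<And>\<alpha>. \<alpha> \<in> A \<Longrightarrow> Db m \<alpha> f = (\<lambda>_. 0)"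
  shows "f \<in> smf (X ` ({1..m} - A))"
proof -
  obtain \<alpha> where \<alpha>: "\<alpha> \<in> A" "2 \<le> \<alpha>" "\<alpha> \<le> m" using A by fastforce
  have "Ds m \<alpha> (grad f) = (\<lambda>_ _. 0)" unfolding grad_Db[OF f \<alpha>(2,3), symmetric] 0[OF \<alpha>(1)] by (simp add: grad_def fun_eq_iff)
  then have g: "grad f = (\<lambda>_ _. 0)" using Ds_inj[OF m2 \<alpha>(2,3) grad_fams[OF f]] by blast
  have nX: "partial v f = (\<lambda>_. 0)" if "\<not> is_X v" for v using fun_cong[OF g, of v] that by (simp add: grad_def)
  have f': "f \<in> smf {v. free_var m v}" using f by (simp add: FR_def)
  have X: "f \<in> smf (range X)"
  proof (rule smf_drop[OF f'])
    fix v assume "v \<notin> range X"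
    then show "partial v f = (\<lambda>_. 0)" using nX by (cases v) auto
  qed
  show ?thesis
  proof (rule smf_drop[OF f'])
    fix v assume v: "v \<notin> X ` ({1..m} - A)"
    show "partial v f = (\<lambda>_. 0)"
    proof (cases v)
      case (X \<nu>)
      show ?thesis
      proof (cases "\<nu> \<in> A")
        case True
        then show ?thesis using 0[OF True] Db_Xonly[OF f \<open>f \<in> smf (range X)\<close>, of \<nu>] X by simp
      next
        case False
        then have "\<not> free_var m v" using v X by (auto simp: free_var_simps)
        then show ?thesis using smf_partial_outside[OF f'] by simp
      qed
    qed (use nX in auto)
  qed
qed

lemma Xonly_FR: "f \<in> smf (X ` B) \<Longrightarrow> B \<subseteq> {1..m} \<Longrightarrow> f \<in> FR m \<and> f \<in> smf (range X)"
  using smf_mono[of "X ` B" "{v. free_var m v}" f] smf_mono[of "X ` B" "range X" f]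
  unfolding FR_def by (fastforce simp: free_var_simps)

text \<open>Provides the surjectivity of \<open>D\<^sub>b\<close> in degree 0 of the cone
  construction; the antiderivative remains closed in the directions outside
  \<open>B\<close>.\<close>

lemma Xonly_antiderivative:
  assumes "f \<in> smf (X ` B)" "B \<subseteq> {1..m}" "b \<in> B"
  shows "\<exists>g\<in>FR m. Db m b g = f \<and> (\<forall>\<alpha>. \<alpha> \<notin> B \<longrightarrow> Db m \<alpha> g = (\<lambda>_. 0))"
proof -
  have "X 0 \<notin> X ` B" using assms by auto
  then obtain g where g: "g \<in> smf (X ` B)" "partial (X b) g = f"
    using antiderivative[OF assms(1), of "X b" "X 0"] assms by blast
  note g' = Xonly_FR[OF g(1) assms(2)]
  have "Db m \<alpha> g = partial (X \<alpha>) g" for \<alpha> using Db_Xonly g' by blast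
  then show ?thesis using g g' smf_partial_outside[OF g(1)] by (intro bexI[of _ g]) auto
qed

lemma Ef_props:
  assumes "2 \<le> r"
  shows "\<phi> \<in> fams m \<Longrightarrow> Ef m r \<phi> \<in> fams m"
    and "\<phi> \<in> fams m \<Longrightarrow> \<psi> \<in> fams m \<Longrightarrow> Ef m r (\<lambda>v y. \<phi> v y + \<psi> v y) = (\<lambda>v y. Ef m r \<phi> v y + Ef m r \<psi> v y)"
    and "\<phi> \<in> fams m \<Longrightarrow> 2 \<le> \<beta> \<Longrightarrow> \<beta> \<le> m \<Longrightarrow> Ef m r (Ds m \<beta> \<phi>) = (if r \<le> \<beta> then (\<lambda>_ _. 0) else Ds m \<beta> (Ef m r \<phi>))"
    and "\<phi> \<in> fams m \<Longrightarrow> \<exists>\<psi>. (\<forall>\<alpha>\<in>{r..m}. \<psi> \<alpha> \<in> fams m) \<and> (\<forall>v y. \<phi> v y = Ef m r \<phi> v y + (\<Sum>\<alpha>=r..m. Ds m \<alpha> (\<psi> \<alpha>) v y))"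
  unfolding Ef_def
proof -
  have xs: "set [r..<Suc m] \<subseteq> {2..m}" "distinct [r..<Suc m]" "set [r..<Suc m] = {r..m}" using assms by auto
  note F = foldr_Rf[OF m2 _ xs(1,2)]
  show "\<phi> \<in> fams m \<Longrightarrow> foldr (Rf m) [r..<Suc m] \<phi> \<in> fams m" using F(1) .
  show "\<phi> \<in> fams m \<Longrightarrow> \<psi> \<in> fams m \<Longrightarrow> foldr (Rf m) [r..<Suc m] (\<lambda>v y. \<phi> v y + \<psi> v y)
    = (\<lambda>v y. foldr (Rf m) [r..<Suc m] \<phi> v y + foldr (Rf m) [r..<Suc m] \<psi> v y)" using F(2) .
  show "foldr (Rf m) [r..<Suc m] (Ds m \<beta> \<phi>) = (if r \<le> \<beta> then (\<lambda>_ _. 0) else Ds m \<beta> (foldr (Rf m) [r..<Suc m] \<phi>))"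
    if "\<phi> \<in> fams m" "2 \<le> \<beta>" "\<beta> \<le> m"
    using F(3)[OF that] that(3) unfolding xs(3) by simp
  show "\<exists>\<psi>. (\<forall>\<alpha>\<in>{r..m}. \<psi> \<alpha> \<in> fams m) \<and>
      (\<forall>v y. \<phi> v y = foldr (Rf m) [r..<Suc m] \<phi> v y + (\<Sum>\<alpha>=r..m. Ds m \<alpha> (\<psi> \<alpha>) v y))" if "\<phi> \<in> fams m"
    using F(4)[OF that] unfolding xs(3) .
qed

lemma Ef_zero: "2 \<le> r \<Longrightarrow> Ef m r (\<lambda>_ _. 0) = (\<lambda>_ _. 0)"
  using Ef_props(2)[OF _ fams_zero[OF m2] fams_zero[OF m2], of r] by (simp add: fun_eq_iff)

lemma Ef_sum:
  "2 \<le> r \<Longrightarrow> (\<And>a. a \<in> A \<Longrightarrow> \<psi> a \<in> fams m) \<Longrightarrow> Ef m r (\<lambda>v y. \<Sum>a\<in>A. \<psi> a v y) = (\<lambda>v y. \<Sum>a\<in>A. Ef m r (\<psi> a) v y)"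
proof (induction A rule: infinite_finite_induct)
  case (insert a A)
  then show ?case using Ef_props(2)[OF _ _ fams_sum[OF m2], of r "\<psi> a" A \<psi>] by simp
qed (auto simp: Ef_zero)

lemma grad_add:
  "f \<in> FR m \<Longrightarrow> g \<in> FR m \<Longrightarrow> grad (\<lambda>y. f y + g y) = (\<lambda>v y. grad f v y + grad g v y)"
  by (auto simp: grad_def fun_eq_iff FR_def partial_add)

lemma grad_sum: "(\<And>a. a \<in> A \<Longrightarrow> f a \<in> FR m) \<Longrightarrow> grad (\<lambda>y. \<Sum>a\<in>A. f a y) = (\<lambda>v y. \<Sum>a\<in>A. grad (f a) v y)"
  by (rule ext) (auto simp: grad_def FR_def intro: partial_sum)

lemma divs_iff:
  assumes f: "f \<in> FR m" and r: "2 \<le> r" "r \<le> m"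
  shows "divs m {r..m} f \<longleftrightarrow> Ef m r (grad f) = (\<lambda>_ _. 0)"
proof
  assume "divs m {r..m} f"
  then obtain g where g: "\<And>\<alpha>. \<alpha> \<in> {r..m} \<Longrightarrow> g \<alpha> \<in> FR m" "f = (\<lambda>y. \<Sum>\<alpha>=r..m. Db m \<alpha> (g \<alpha>) y)"
    unfolding divs_def by blast
  have "grad f = (\<lambda>v y. \<Sum>\<alpha>=r..m. grad (Db m \<alpha> (g \<alpha>)) v y)"
    unfolding g(2) by (rule grad_sum) (use g r in \<open>auto intro!: Db_FR[OF m2]\<close>)
  then have "Ef m r (grad f) = (\<lambda>v y. \<Sum>\<alpha>=r..m. Ef m r (grad (Db m \<alpha> (g \<alpha>))) v y)"
    using g r by (simp, intro Ef_sum) (auto intro!: grad_fams Db_FR[OF m2])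
  also have "\<dots> = (\<lambda>_ _. 0)"
  proof (intro ext sum.neutral ballI)
    fix v y \<alpha> assume a: "\<alpha> \<in> {r..m}"
    then have "Ef m r (grad (Db m \<alpha> (g \<alpha>))) = (\<lambda>_ _. 0)"
      using grad_Db[OF g(1)[OF a]] Ef_props(3)[OF r(1) grad_fams[OF g(1)[OF a]], of \<alpha>] r by simp
    then show "Ef m r (grad (Db m \<alpha> (g \<alpha>))) v y = 0" by simp
  qed
  finally show "Ef m r (grad f) = (\<lambda>_ _. 0)" .
next
  assume E: "Ef m r (grad f) = (\<lambda>_ _. 0)"
  obtain \<psi> where \<psi>1: "\<forall>\<alpha>\<in>{r..m}. \<psi> \<alpha> \<in> fams m"
    and \<psi>2: "\<forall>v y. grad f v y = Ef m r (grad f) v y + (\<Sum>\<alpha>=r..m. Ds m \<alpha> (\<psi> \<alpha>) v y)"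
    using Ef_props(4)[OF r(1) grad_fams[OF f]] by blast
  have \<psi>: "\<And>\<alpha>. \<alpha> \<in> {r..m} \<Longrightarrow> \<psi> \<alpha> \<in> fams m" "\<And>v y. grad f v y = (\<Sum>\<alpha>=r..m. Ds m \<alpha> (\<psi> \<alpha>) v y)"
    using \<psi>1 \<psi>2 E by auto
  have "Gf (grad f) = Gf (\<lambda>v y. \<Sum>\<alpha>=r..m. Ds m \<alpha> (\<psi> \<alpha>) v y)"
    by (rule arg_cong[where f = Gf]) (simp add: fun_eq_iff \<psi>(2))
  also have "\<dots> = (\<lambda>y. \<Sum>\<alpha>=r..m. Gf (Ds m \<alpha> (\<psi> \<alpha>)) y)"
    by (rule Gf_sum) (use \<psi>(1) r Ds_fams[OF m2] in auto)
  also have "\<dots> = (\<lambda>y. \<Sum>\<alpha>=r..m. Db m \<alpha> (Gf (\<psi> \<alpha>)) y)"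
    using \<psi>(1) r by (intro ext sum.cong refl) (subst Db_Gf, auto)
  finally have G: "Gf (grad f) = (\<lambda>y. \<Sum>\<alpha>=r..m. Db m \<alpha> (Gf (\<psi> \<alpha>)) y)" .
  let ?s = "\<lambda>v. if is_X v then coord v else (\<lambda>_. 0)"
  have f0: "(\<lambda>y. f (scl 0 y)) \<in> smf (X ` {1..m})"
  proof -
    have "(\<lambda>y. f (scl 0 y)) = subst ?s f"
      unfolding subst_def scl_def by (intro ext arg_cong[where f = f]) (auto simp: coord_def)
    also have "\<dots> \<in> smf (X ` {1..m})"
    proof (rule smf_subst[OF f[unfolded FR_def]])
      fix v assume "v \<in> {v. free_var m v}"
      then show "?s v \<in> smf (X ` {1..m})"
        by (cases v) (auto simp: free_var_simps intro!: smf_coord smf_const)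
    qed
    finally show ?thesis .
  qed
  \<comment> \<open>The linearisation does not see the value at vanishing dependent coordinates.
    That value is a function of the x, hence a total derivative in a single direction, for which
    \<open>r\<close> is chosen.\<close>
  obtain h where h: "h \<in> FR m" "Db m r h = (\<lambda>y. f (scl 0 y))"
    using Xonly_antiderivative[OF f0, of r] r by auto
  let ?g = "\<lambda>\<alpha> y. Gf (\<psi> \<alpha>) y + (if \<alpha> = r then h y else 0)"
  have gF: "?g \<alpha> \<in> FR m" if "\<alpha> \<in> {r..m}" for \<alpha>
    using Gf_FR[OF \<psi>(1)[OF that]] h by (cases "\<alpha> = r") (auto intro!: FR_intros)
  have "Db m \<alpha> (?g \<alpha>) y = Db m \<alpha> (Gf (\<psi> \<alpha>)) y + (if \<alpha> = r then f (scl 0 y) else 0)" if "\<alpha> \<in> {r..m}" for \<alpha> y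
    using Gf_FR[OF \<psi>(1)[OF that]] h by (cases "\<alpha> = r") (auto simp: Db_add[OF m2])
  then have sum: "(\<Sum>\<alpha>=r..m. Db m \<alpha> (?g \<alpha>) y) = Gf (grad f) y + f (scl 0 y)" for y
    using r by (simp add: G sum.distrib)
  have "f y = Gf (grad f) y + f (scl 0 y)" for y using Gf_grad[OF f, of y] by linarith
  then have feq: "f = (\<lambda>y. \<Sum>\<alpha>=r..m. Db m \<alpha> (?g \<alpha>) y)" by (intro ext) (rule trans[OF _ sum[symmetric]])
  show "divs m {r..m} f" unfolding divs_def by (rule exI[of _ ?g], rule conjI, rule ballI, erule gF, rule feq)
qed

end

section \<open>Exactness of the auxiliary complexes\<close>

lemma sgn_ins_square: "sgn_ins \<mu> I * (sgn_ins \<mu> I * x) = x"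
  by (simp add: sgn_ins_def mult.assoc[symmetric] power_add[symmetric])

context
  fixes m :: nat
  assumes m2: "2 \<le> m"
begin

lemma top_exact_iff:
  assumes A: "finite A" "A \<subseteq> {1..m}" "card A = Suc n" and \<theta>: "\<theta> \<in> rforms m A (Suc n)"
  shows "(\<exists>\<eta>\<in>rforms m A n. \<theta> = dR m A \<eta>) \<longleftrightarrow> divs m A (\<theta> A)"
proof
  assume "\<exists>\<eta>\<in>rforms m A n. \<theta> = dR m A \<eta>"
  then obtain \<eta> where \<eta>: "\<eta> \<in> rforms m A n" "\<theta> = dR m A \<eta>" by blast
  let ?g = "\<lambda>\<mu> y. sgn_ins \<mu> (A - {\<mu>}) * \<eta> (A - {\<mu>}) y"
  have g: "?g \<mu> \<in> FR m" for \<mu> using rforms_FR[OF m2 \<eta>(1)] by (intro FR_intros)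
  have "\<theta> A = (\<lambda>y. \<Sum>\<mu>\<in>A. Db m \<mu> (?g \<mu>) y)"
    unfolding \<eta>(2) dR_def using rforms_FR[OF m2 \<eta>(1)] by (simp add: Db_cmult[OF m2])
  then show "divs m A (\<theta> A)" unfolding divs_def using g by (intro exI[of _ ?g]) simp
next
  assume "divs m A (\<theta> A)"
  then obtain g where g: "\<forall>\<alpha>\<in>A. g \<alpha> \<in> FR m" "\<theta> A = (\<lambda>y. \<Sum>\<alpha>\<in>A. Db m \<alpha> (g \<alpha>) y)"
    unfolding divs_def by blast
  \<comment> \<open>Each \<open>J\<close> of size \<open>n\<close> misses exactly one direction of
    \<open>A\<close>. The sign is put in so that it meets itself in the differential and squares to
    1.\<close>
  define \<eta> where "\<eta> J = (if J \<subseteq> A \<and> card J = n then (\<lambda>y. sgn_ins (the_elem (A - J)) J * g (the_elem (A - J)) y) else (\<lambda>_. 0))" for J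
  have "\<eta> \<in> rforms m A n"
  proof (rule rformsI[OF m2])
    fix J
    show "\<eta> J \<in> FR m"
    proof (cases "J \<subseteq> A \<and> card J = n")
      case True
      then have "finite J" using A finite_subset by blast
      then have "card (A - J) = 1" using A True by (simp add: card_Diff_subset)
      then obtain a where "A - J = {a}" by (auto simp: card_1_singleton_iff)
      then show ?thesis using g True by (auto simp: \<eta>_def intro!: FR_intros)
    next
      case False
      then have "\<eta> J = (\<lambda>_. 0)" unfolding \<eta>_def by (rule if_not_P)
      then show ?thesis by (simp add: FR_intros)
    qed
  qed (unfold \<eta>_def, rule if_not_P)
  moreover have "\<theta> = dR m A \<eta>"
  proof
    fix I
    consider "I = A" | "I \<subset> A" | "\<not> I \<subseteq> A" by blast
    then show "\<theta> I = dR m A \<eta> I"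
    proof cases
      case 1
      have "\<eta> (A - {\<mu>}) = (\<lambda>y. sgn_ins \<mu> (A - {\<mu>}) * g \<mu> y)" if "\<mu> \<in> A" for \<mu>
      proof -
        have "A - (A - {\<mu>}) = {\<mu>}" "card (A - {\<mu>}) = n" using that A by auto
        then show ?thesis by (auto simp: \<eta>_def)
      qed
      then show ?thesis unfolding 1 g(2) dR_def
        using g(1) by (auto simp: Db_cmult[OF m2] sgn_ins_square intro!: sum.cong)
    next
      case 2
      then have "card I < Suc n" using A psubset_card_mono by metis
      moreover have "\<eta> (I - {\<mu>}) = (\<lambda>_. 0)" if "\<mu> \<in> I" for \<mu>
      proof -
        have "finite I" using 2 A finite_subset by blast
        then have "card (I - {\<mu>}) < card I" using that by (rule card_Diff1_less)
        then show ?thesis using \<open>card I < Suc n\<close> by (simp add: \<eta>_def)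
      qed
      ultimately show ?thesis using rforms_zero[OF m2 \<theta>, of I] 2 by (simp add: dR_def Db_const[OF m2])
    next
      case 3
      then show ?thesis using rforms_zero[OF m2 \<theta>, of I] by (simp add: dR_def)
    qed
  qed
  ultimately show "\<exists>\<eta>\<in>rforms m A n. \<theta> = dR m A \<eta>" by blast
qed

text \<open>Supplies the hypothesis \<open>h\<close> of \<open>cone_exact\<close> for the direction
  \<open>r - 1\<close>. In degree 0 a closed form is a function of \<open>x\<^sup>1\<close> to the x
  of direction \<open>r - 1\<close>, and it can be integrated in the latter. In positive degree
  below the top it is exact by \<open>P\<close>, so \<open>g = 0\<close> will do. The exactness is
  an assumption because the lemma serves inside the induction that proves it.\<close>

lemma closed_cone_hyp:
  assumes r: "2 \<le> r" "r \<le> m" and q: "q < Suc m - r"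
    and P: "\<And>q \<omega>. \<omega> \<in> rforms m {r..m} (Suc q) \<Longrightarrow> dR m {r..m} \<omega> = (\<lambda>_ _. 0) \<Longrightarrow> Suc q < Suc m - r \<Longrightarrow>
       \<exists>\<eta>\<in>rforms m {r..m} q. \<omega> = dR m {r..m} \<eta>"
    and \<kappa>: "\<kappa> \<in> rforms m {r..m} q" "dR m {r..m} \<kappa> = (\<lambda>_ _. 0)"
  shows "\<exists>g\<in>rforms m {r..m} q. \<exists>\<xi>. dR m {r..m} g = (\<lambda>_ _. 0) \<and>
     (q = 0 \<and> \<xi> = (\<lambda>_ _. 0) \<or> \<xi> \<in> rforms m {r..m} (q - 1) \<and> 0 < q)
         \<and> \<kappa> = (\<lambda>I y. Db m (r - 1) (g I) y - dR m {r..m} \<xi> I y)"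
proof (cases q)
  case 0
  have k0: "Db m \<alpha> (\<kappa> {}) = (\<lambda>_. 0)" if "\<alpha> \<in> {r..m}" for \<alpha>
    using fun_cong[OF \<kappa>(2), of "{\<alpha>}"] that by (simp add: dR_def sgn_ins_def fun_eq_iff)
  have "\<kappa> {} \<in> smf (X ` ({1..m} - {r..m}))"
    by (rule Db_kernel[OF m2 rforms_FR[OF m2 \<kappa>(1)]]) (use r k0 in auto)
  moreover have "r - 1 \<in> {1..m} - {r..m}" using r by auto
  ultimately obtain g where g: "g \<in> FR m" "Db m (r - 1) g = \<kappa> {}"
      "\<forall>\<alpha>. \<alpha> \<notin> {1..m} - {r..m} \<longrightarrow> Db m \<alpha> g = (\<lambda>_. 0)"
    using Xonly_antiderivative[OF m2, of "\<kappa> {}" "{1..m} - {r..m}" "r - 1"] by blast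
  let ?g = "\<lambda>I. if I = {} then g else (\<lambda>_. 0)"
  have card0: "I \<subseteq> {r..m} \<and> card I = 0 \<longleftrightarrow> I = {}" for I using finite_subset[of I "{r..m}"] by auto
  have gf: "?g \<in> rforms m {r..m} 0"
    by (rule rformsI[OF m2]) (use g in \<open>auto simp: card0 FR_intros\<close>)
  moreover have "dR m {r..m} ?g = (\<lambda>_ _. 0)"
  proof
    fix I
    show "dR m {r..m} ?g I = (\<lambda>_. 0)"
    proof (cases "I \<subseteq> {r..m}")
      case True
      have "Db m \<mu> (?g (I - {\<mu>})) = (\<lambda>_. 0)" if "\<mu> \<in> I" for \<mu>
      proof -
        have "\<mu> \<notin> {1..m} - {r..m}" using that True by auto
        then show ?thesis using g(3) by (cases "I - {\<mu>} = {}") (simp_all add: Db_const[OF m2])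
      qed
      then show ?thesis using True by (simp add: dR_def)
    qed (simp add: dR_def)
  qed
  moreover have "\<kappa> = (\<lambda>I y. Db m (r - 1) (?g I) y - dR m {r..m} (\<lambda>_ _. 0) I y)"
  proof
    fix I
    show "\<kappa> I = (\<lambda>y. Db m (r - 1) (?g I) y - dR m {r..m} (\<lambda>_ _. 0) I y)"
    proof (cases "I = {}")
      case True
      then show ?thesis by (simp add: dR_zero[OF m2] g(2)[simplified])
    next
      case False
      then have "\<kappa> I = (\<lambda>_. 0)" using rforms_zero[OF m2 \<kappa>(1), of I] card0 0 by blast
      then show ?thesis using False by (simp add: dR_zero[OF m2] Db_const[OF m2])
    qed
  qed
  ultimately show ?thesis using 0 by blast
next
  case (Suc q')
  then obtain \<xi> where \<xi>: "\<xi> \<in> rforms m {r..m} q'" "\<kappa> = dR m {r..m} \<xi>"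
    using P[of \<kappa> q'] \<kappa> q by auto
  let ?x = "\<lambda>I y. - \<xi> I y"
  have x: "?x \<in> rforms m {r..m} q'"
    by (rule rformsI[OF m2]) (use rforms_FR[OF m2 \<xi>(1)] rforms_zero[OF m2 \<xi>(1)] in \<open>auto intro!: FR_intros\<close>)
  have z: "(\<lambda>_ _. 0) \<in> rforms m {r..m} q" by (rule rformsI[OF m2]) (auto intro: FR_intros)
  have "\<kappa> = (\<lambda>I y. Db m (r - 1) ((\<lambda>_ _. 0) I) y - dR m {r..m} ?x I y)"
    using dR_uminus[OF m2 \<xi>(1)] \<xi>(2) by (simp add: Db_const[OF m2])
  moreover have "?x \<in> rforms m {r..m} (q - 1) \<and> 0 < q" using x Suc by simp
  moreover have "dR m {r..m} (\<lambda>_ _. 0) = (\<lambda>_ _. 0)" by (rule dR_zero[OF m2])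
  ultimately show ?thesis using z by (intro bexI[OF _ z] exI[of _ ?x]) auto
qed

lemma lower_closed:
  assumes "dR m (insert b A) \<omega> = (\<lambda>_ _. 0)" shows "dR m A (lower A \<omega>) = (\<lambda>_ _. 0)"
proof
  fix I
  show "dR m A (lower A \<omega>) I = (\<lambda>_. 0)"
  proof (cases "I \<subseteq> A")
    case True
    have "dR m A (lower A \<omega>) I = dR m A \<omega> I" using True by (intro dR_cong[OF m2]) (auto simp: lower_def)
    also have "\<dots> = dR m (insert b A) \<omega> I" using dR_lower[OF m2 True] by simp
    finally show ?thesis using assms by simp
  qed (simp add: dR_def)
qed

text \<open>The dx^b component of the closedness of \<omega> says that \<open>D\<^sub>b\<close> of
  the lower part is the differential of the upper part; in top degree over \<open>{r..m}\<close>
  this is a divergence.\<close>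

lemma Db_top_closed:
  assumes r: "2 \<le> r" "r \<le> m" and b: "b = r - 1"
    and \<omega>: "\<omega> \<in> rforms m (insert b {r..m}) (Suc m - r)" and closed: "dR m (insert b {r..m}) \<omega> = (\<lambda>_ _. 0)"
  shows "divs m {r..m} (Db m b (\<omega> {r..m}))"
proof -
  let ?A = "{r..m}"
  obtain n where n: "Suc m - r = Suc n" using r by (cases "Suc m - r") auto
  have A: "finite ?A" "?A \<subseteq> {1..m}" "card ?A = Suc n" using r n by auto
  have bA: "\<And>a. a \<in> ?A \<Longrightarrow> b < a" "b \<notin> ?A" "1 \<le> b" "b \<le> m" using b r by auto
  let ?z = "upper b ?A \<omega>"
  have z: "?z \<in> rforms m ?A n" using upper_rforms[OF m2 \<omega>[unfolded n] bA(2) A(1)] .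
  have D: "Db m b (\<omega> I) = dR m ?A ?z I" if "I \<subseteq> ?A" for I
  proof -
    have "dR m ?A (\<lambda>J. \<omega> (insert b J)) I = dR m ?A ?z I"
      by (rule dR_cong[OF m2]) (use that in \<open>auto simp: upper_def\<close>)
    then show ?thesis
      using dR_upper[OF m2 that A(1) bA(1), of \<omega>] closed by (auto simp: fun_eq_iff)
  qed
  have top: "dR m ?A ?z \<in> rforms m ?A (Suc n)"
  proof (rule rformsI[OF m2])
    fix I show "dR m ?A ?z I \<in> FR m" using dR_FR[OF m2 z A(2)] .
    assume I: "\<not> (I \<subseteq> ?A \<and> card I = Suc n)"
    show "dR m ?A ?z I = (\<lambda>_. 0)"
    proof (cases "I \<subseteq> ?A")
      case True
      then have "\<omega> I = (\<lambda>_. 0)" using I rforms_zero[OF m2 \<omega>[unfolded n], of I] by auto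
      then show ?thesis using D[OF True] by (simp add: Db_const[OF m2])
    qed (simp add: dR_def)
  qed
  then have "divs m ?A (dR m ?A ?z ?A)" using top_exact_iff[OF A top] z by blast
  then show ?thesis using D[of ?A] by simp
qed

text \<open>Induction on the number of directions, with the smallest one split off. The lower part
  is covered by the induction hypothesis except when it has top degree over the remaining
  directions, where closedness alone proves nothing.\<close>

lemma poincare:
  assumes "2 \<le> r" "\<omega> \<in> rforms m {r..m} (Suc q)" "dR m {r..m} \<omega> = (\<lambda>_ _. 0)" "Suc q < Suc m - r"
  shows "\<exists>\<eta>\<in>rforms m {r..m} q. \<omega> = dR m {r..m} \<eta>"
  using assms
proof (induction "Suc m - r" arbitrary: r q \<omega>)
  case (Suc n)
  let ?A = "{Suc r..m}"
  have n: "Suc m - Suc r = n" "Suc q < Suc n" using Suc by auto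
  then have "0 < n" by simp
  have r: "2 \<le> Suc r" "Suc r \<le> m" "2 \<le> r" "r \<le> m" using Suc n \<open>0 < n\<close> by auto
  have ins: "{r..m} = insert r ?A" using r by auto
  have A: "finite ?A" "?A \<subseteq> {1..m}" "1 \<le> r" "r \<le> m" "\<And>a. a \<in> ?A \<Longrightarrow> r < a" using r by auto
  have \<omega>: "\<omega> \<in> rforms m (insert r ?A) (Suc q)" and cl: "dR m (insert r ?A) \<omega> = (\<lambda>_ _. 0)"
    using Suc.prems ins by auto
  have low: "lower ?A \<omega> \<in> rforms m ?A (Suc q)" using lower_rforms[OF m2 \<omega>] .
  have lowc: "dR m ?A (lower ?A \<omega>) = (\<lambda>_ _. 0)" using lower_closed[OF cl] .
  have "\<exists>\<eta>\<in>rforms m ?A q. lower ?A \<omega> = dR m ?A \<eta>"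
  proof (cases "Suc q < n")
    case True
    then show ?thesis using Suc.hyps(1)[of "Suc r" "lower ?A \<omega>" q] n r low lowc by simp
  next
    case False
    \<comment> \<open>Top degree over \<open>?A\<close>: closedness makes \<open>D\<^sub>r\<close>
      of the coefficient a divergence, so \<open>Ds m r\<close> annihilates the variational family
      of the coefficient. Injectivity of \<open>Ds m r\<close> then makes the coefficient itself a
      divergence.\<close>
    then have nq: "n = Suc q" using n by simp
    let ?f = "lower ?A \<omega> ?A"
    have f: "?f \<in> FR m" using rforms_FR[OF m2 low] .
    have "divs m ?A (Db m r (\<omega> ?A))"
      using Db_top_closed[OF r(1,2), of r \<omega>] \<omega> cl n nq by simp
    then have "Ef m (Suc r) (grad (Db m r ?f)) = (\<lambda>_ _. 0)"
      using divs_iff[OF m2 _ r(1,2), of "Db m r ?f"] Db_FR[OF m2 f, of r] r by (simp add: lower_def)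
    then have "Ds m r (Ef m (Suc r) (grad ?f)) = (\<lambda>_ _. 0)"
      using grad_Db[OF m2 f r(3,4)] Ef_props(3)[OF m2 r(1) grad_fams[OF m2 f] r(3,4)] by simp
    then have "Ef m (Suc r) (grad ?f) = (\<lambda>_ _. 0)"
      using Ds_inj[OF m2 r(3,4) Ef_props(1)[OF m2 r(1) grad_fams[OF m2 f]]] by blast
    then have "divs m ?A ?f" using divs_iff[OF m2 f r(1,2)] by blast
    then show ?thesis using top_exact_iff[OF A(1,2), of q "lower ?A \<omega>"] low n nq by simp
  qed
  then obtain \<eta> where \<eta>: "\<eta> \<in> rforms m ?A q" "lower ?A \<omega> = dR m ?A \<eta>" by blast
  have "\<exists>\<eta>\<in>rforms m (insert r ?A) q. \<omega> = dR m (insert r ?A) \<eta>"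
  proof (rule cone_exact[OF m2 A \<omega> cl \<eta>])
    fix \<kappa> assume \<kappa>: "\<kappa> \<in> rforms m ?A q" "dR m ?A \<kappa> = (\<lambda>_ _. 0)"
    have "q < Suc m - Suc r" using n by simp
    from closed_cone_hyp[OF r(1,2) this _ \<kappa>] Suc.hyps(1)[of "Suc r"] n r(1)
    show "\<exists>g\<in>rforms m ?A q. \<exists>\<xi>. dR m ?A g = (\<lambda>_ _. 0) \<and>
        (q = 0 \<and> \<xi> = (\<lambda>_ _. 0) \<or> \<xi> \<in> rforms m ?A (q - 1) \<and> 0 < q) \<and>
        \<kappa> = (\<lambda>I y. Db m r (g I) y - dR m ?A \<xi> I y)"
      by simp
  qed
  then show ?case using ins by simp
qed simp

text \<open>Direction 1 is attached with exactness of the lower part as a hypothesis. No injectivity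
  of \<open>D\<^sub>1\<close> is available in top degree over \<open>{2..m}\<close>, and in degree m
  - 1 this hypothesis becomes the actual condition.\<close>

lemma cone_exact_1:
  assumes \<omega>: "\<omega> \<in> rforms m {1..m} (Suc q)" and cl: "dR m {1..m} \<omega> = (\<lambda>_ _. 0)" and q: "Suc q < m"
    and \<eta>: "\<eta> \<in> rforms m {2..m} q" "lower {2..m} \<omega> = dR m {2..m} \<eta>"
  shows "\<exists>\<eta>\<in>rforms m {1..m} q. \<omega> = dR m {1..m} \<eta>"
proof -
  have ins: "{1..m} = insert 1 {2..m}" using m2 by auto
  have A: "finite {2..m}" "{2..m} \<subseteq> {1..m}" "(1::nat) \<le> 1" "1 \<le> m" "\<And>a. a \<in> {2..m} \<Longrightarrow> 1 < a" using m2 by auto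
  show ?thesis unfolding ins
  proof (rule cone_exact[OF m2 A \<omega>[unfolded ins] cl[unfolded ins] \<eta>])
    fix \<kappa> assume \<kappa>: "\<kappa> \<in> rforms m {2..m} q" "dR m {2..m} \<kappa> = (\<lambda>_ _. 0)"
    have "q < Suc m - 2" using q by simp
    from closed_cone_hyp[OF _ m2 this poincare \<kappa>]
    show "\<exists>g\<in>rforms m {2..m} q. \<exists>\<xi>. dR m {2..m} g = (\<lambda>_ _. 0) \<and>
        (q = 0 \<and> \<xi> = (\<lambda>_ _. 0) \<or> \<xi> \<in> rforms m {2..m} (q - 1) \<and> 0 < q) \<and>
        \<kappa> = (\<lambda>I y. Db m 1 (g I) y - dR m {2..m} \<xi> I y)"
      by simp
  qed
qed

end

section \<open>Variational derivatives\<close>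

definition NJ :: "nat \<Rightarrow> nat \<Rightarrow> mi \<Rightarrow> fn \<Rightarrow> fn" where
  "NJ m r j f = foldr (\<lambda>\<alpha> g. (nD m \<alpha> ^^ j \<alpha>) g) [r..<Suc m] f"

text \<open>A finite box containing all derivative orders that can contribute, so that nested sums
  over one direction at a time unfold into one sum over multi-indices.\<close>

definition Box :: "nat \<Rightarrow> nat \<Rightarrow> nat \<Rightarrow> mi set" where
  "Box m r K = {j. \<forall>k. (k \<in> {r..m} \<longrightarrow> j k \<in> {..<K}) \<and> (k \<notin> {r..m} \<longrightarrow> j k = 0)}"

lemma finite_Box: "finite (Box m r K)"
  unfolding Box_def by (rule finite_set_of_finite_funs) auto

text \<open>The coordinates that index the partial variational derivatives: the free dependent ones
  that are not shifts of others in the directions 2 to m.\<close>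

definition base_var :: "nat \<Rightarrow> var \<Rightarrow> bool" where
  "base_var m v \<longleftrightarrow> free_var m v \<and> \<not> is_X v \<and> (\<forall>\<alpha>\<in>{2..m}. idx \<alpha> v = 0)"

lemma at1_simps: "at1 0 = (\<lambda>_. 0)" "at1 1 = unit 1" "inc (at1 k) 1 = at1 (Suc k)"
  "at1 k = at1 l \<longleftrightarrow> k = l" "at1 k 1 = k" "n \<noteq> 1 \<Longrightarrow> at1 k n = 0"
  by (auto simp: at1_def unit_def inc_def fun_eq_iff)

lemma base_var_iff:
  assumes "2 \<le> m"
  shows "base_var m v \<longleftrightarrow> v = U 1 (at1 0) \<or> (\<exists>\<alpha>\<in>Nset m. \<exists>k. v = U \<alpha> (at1 k)) \<or> v = P (at1 0) \<or> v = P (at1 1)"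
proof
  assume b: "base_var m v"
  have i: "i = at1 (i 1)" if "valid_mi m i" "\<forall>\<alpha>\<in>{2..m}. i \<alpha> = 0" for i
  proof
    fix k
    consider "k = 0" | "k = 1" | "k \<in> {2..m}" | "m < k" by fastforce
    then show "i k = at1 (i 1) k" using that by cases (auto simp: valid_mi_def at1_def)
  qed
  show "v = U 1 (at1 0) \<or> (\<exists>\<alpha>\<in>Nset m. \<exists>k. v = U \<alpha> (at1 k)) \<or> v = P (at1 0) \<or> v = P (at1 1)"
  proof (cases v)
    case (X \<nu>)
    then show ?thesis using b by (simp add: base_var_def)
  next
    case (U l j)
    then have l: "1 \<le> l" "l \<le> m" "valid_mi m j" "l = 1 \<longrightarrow> j 1 = 0" "\<forall>\<alpha>\<in>{2..m}. j \<alpha> = 0"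
      using b by (auto simp: base_var_def free_var_simps idx_def)
    have "j = at1 (j 1)" using i l by blast
    then show ?thesis using l U by (cases "l = 1") (auto simp: Suc_le_eq intro!: bexI[of _ l] exI[of _ "j 1"])
  next
    case (P j)
    then have l: "valid_mi m j" "j 1 = 0 \<or> j 1 = 1" "\<forall>\<alpha>\<in>{2..m}. j \<alpha> = 0"
      using b by (auto simp: base_var_def free_var_simps idx_def)
    have "j = at1 (j 1)" using i l by blast
    then show ?thesis using l P by metis
  qed
next
  have "valid_mi m (at1 k)" for k using assms by (auto simp: valid_mi_def at1_def)
  then show "base_var m v" if "v = U 1 (at1 0) \<or> (\<exists>\<alpha>\<in>Nset m. \<exists>k. v = U \<alpha> (at1 k)) \<or> v = P (at1 0) \<or> v = P (at1 1)"
    using that assms by (auto simp: base_var_def free_var_simps idx_def at1_simps(6) at1_simps(5)[simplified])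
qed

lemma shiftn_simps: "(shiftv \<alpha> ^^ k) (U l i) = U l (i(\<alpha> := i \<alpha> + k))" "(shiftv \<alpha> ^^ k) (P i) = P (i(\<alpha> := i \<alpha> + k))"
  by (induction k) (auto simp: inc_def)

lemma shiftj_shiftn:
  assumes "\<not> is_X v" "j r = 0"
  shows "shiftj ((shiftv r ^^ k) v) j = shiftj v (j(r := k))"
proof (cases v)
  case (U l i)
  have "(\<lambda>n. (i(r := i r + k)) n + j n) = (\<lambda>n. i n + (j(r := k)) n)" using assms by auto
  then show ?thesis using U by (simp add: shiftn_simps shiftj_def)
next
  case (P i)
  have "(\<lambda>n. (i(r := i r + k)) n + j n) = (\<lambda>n. i n + (j(r := k)) n)" using assms by auto
  then show ?thesis using P by (simp add: shiftn_simps shiftj_def)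
qed (use assms in simp)

lemma idx_shiftn_other: "\<beta> \<noteq> \<alpha> \<Longrightarrow> idx \<beta> ((shiftv \<alpha> ^^ k) v) = idx \<beta> v"
  by (induction k) (auto simp: idx_shiftv)

lemma idx_shiftn_ge: "idx \<beta> v \<le> idx \<beta> ((shiftv \<alpha> ^^ k) v)"
  by (cases "is_X v"; cases "\<beta> = \<alpha>") (auto simp: idx_shiftn_other idx_shiftn)

lemma idx_shiftj: "\<not> is_X v \<Longrightarrow> idx \<alpha> (shiftj v j) = idx \<alpha> v + j \<alpha>"
  by (cases v) (auto simp: idx_def shiftj_def)

lemma is_X_shiftj [simp]: "is_X (shiftj v j) = is_X v"
  by (cases v) (auto simp: shiftj_def)

context
  fixes m :: nat
  assumes m2: "2 \<le> m"
begin

lemma nDn_sum: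
  assumes "\<And>i. i \<in> I \<Longrightarrow> f i \<in> FR m" "1 \<le> \<alpha>" "\<alpha> \<le> m"
  shows "(nD m \<alpha> ^^ k) (\<lambda>y. \<Sum>i\<in>I. f i y) = (\<lambda>y. \<Sum>i\<in>I. (nD m \<alpha> ^^ k) (f i) y)"
proof (induction k)
  case (Suc k)
  have "Db m \<alpha> (\<lambda>y. \<Sum>i\<in>I. (nD m \<alpha> ^^ k) (f i) y) = (\<lambda>y. \<Sum>i\<in>I. Db m \<alpha> ((nD m \<alpha> ^^ k) (f i)) y)"
    by (rule Db_sum[OF m2]) (use assms nD_FR[OF m2] in auto)
  then show ?case using Suc by (simp add: nD_def[of m \<alpha> "\<lambda>y. \<Sum>i\<in>I. (nD m \<alpha> ^^ k) (f i) y"]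
        nD_def[of m \<alpha> "(nD m \<alpha> ^^ k) (f i)" for i] sum_negf)
qed simp

lemma NJ_FR:
  assumes "f \<in> FR m" "1 \<le> r" shows "NJ m r j f \<in> FR m"
proof -
  have "foldr (\<lambda>\<alpha> g. (nD m \<alpha> ^^ j \<alpha>) g) xs f \<in> FR m" if "set xs \<subseteq> {1..m}" for xs
    using that assms by (induction xs) (auto intro!: nD_FR[OF m2])
  moreover have "set [r..<Suc m] \<subseteq> {1..m}" using assms by auto
  ultimately show ?thesis unfolding NJ_def by blast
qed

lemma Rf_bounded:
  assumes "\<And>v \<beta>. \<beta> \<in> {2..m} \<Longrightarrow> K \<le> idx \<beta> v \<Longrightarrow> \<phi> v = (\<lambda>_. 0)" "\<beta> \<in> {2..m}" "K \<le> idx \<beta> v"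
  shows "Rf m \<alpha> \<phi> v = (\<lambda>_. 0)"
proof -
  have "\<phi> ((shiftv \<alpha> ^^ k) v) = (\<lambda>_. 0)" for k
    by (rule assms(1)[OF assms(2)]) (use assms(3) idx_shiftn_ge order.trans in blast)
  then show ?thesis by (simp add: Rf_def Tl_def)
qed

text \<open>Unfolds the successive integrations by parts into the sum over multi-indices that
  defines \<open>vder\<close>. The first conjunct is there for the induction: the same
  \<open>K\<close> has to bound the families produced in between.\<close>

lemma Ef_formula:
  assumes \<phi>: "\<phi> \<in> fams m" and K: "\<And>v \<beta>. \<beta> \<in> {2..m} \<Longrightarrow> K \<le> idx \<beta> v \<Longrightarrow> \<phi> v = (\<lambda>_. 0)"
    and "2 \<le> r" "r \<le> Suc m"
  shows "(\<forall>v. \<forall>\<beta>\<in>{2..m}. K \<le> idx \<beta> v \<longrightarrow> Ef m r \<phi> v = (\<lambda>_. 0)) \<and>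
    (\<forall>v. \<not> is_X v \<longrightarrow> (\<forall>\<alpha>\<in>{r..m}. idx \<alpha> v = 0) \<longrightarrow>
      Ef m r \<phi> v = (\<lambda>y. \<Sum>j\<in>Box m r K. NJ m r j (\<phi> (shiftj v j)) y))"
  using assms(3,4)
proof (induction "Suc m - r" arbitrary: r)
  case 0
  then have r: "r = Suc m" by simp
  have "Box m (Suc m) K = {\<lambda>_. 0}" by (auto simp: Box_def)
  moreover have "shiftj v (\<lambda>_. 0) = v" for v by (cases v) (auto simp: shiftj_def)
  ultimately show ?case using K by (simp add: r Ef_def NJ_def)
next
  case (Suc n)
  have r: "2 \<le> r" "r \<le> m" "1 \<le> r" using Suc by auto
  define \<psi> where "\<psi> = Ef m (Suc r) \<phi>"
  have upt: "[r..<Suc m] = r # [Suc r..<Suc m]" using r by (simp add: upt_conv_Cons)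
  have E: "Ef m r \<phi> = Rf m r \<psi>" unfolding Ef_def \<psi>_def upt by simp
  have IH: "\<And>v \<beta>. \<beta> \<in> {2..m} \<Longrightarrow> K \<le> idx \<beta> v \<Longrightarrow> \<psi> v = (\<lambda>_. 0)"
    "\<And>v. \<not> is_X v \<Longrightarrow> \<forall>\<alpha>\<in>{Suc r..m}. idx \<alpha> v = 0 \<Longrightarrow> \<psi> v = (\<lambda>y. \<Sum>j\<in>Box m (Suc r) K. NJ m (Suc r) j (\<phi> (shiftj v j)) y)"
  proof -
    have "n = Suc m - Suc r" "2 \<le> Suc r" "Suc r \<le> Suc m" using Suc.hyps(2) r by auto
    note I = Suc.hyps(1)[OF this]
    show "\<And>v \<beta>. \<beta> \<in> {2..m} \<Longrightarrow> K \<le> idx \<beta> v \<Longrightarrow> \<psi> v = (\<lambda>_. 0)" using conjunct1[OF I] unfolding \<psi>_def by blast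
    show "\<And>v. \<not> is_X v \<Longrightarrow> \<forall>\<alpha>\<in>{Suc r..m}. idx \<alpha> v = 0 \<Longrightarrow> \<psi> v = (\<lambda>y. \<Sum>j\<in>Box m (Suc r) K. NJ m (Suc r) j (\<phi> (shiftj v j)) y)"
      using conjunct2[OF I] unfolding \<psi>_def by blast
  qed
  have 1: "Ef m r \<phi> v = (\<lambda>_. 0)" if "\<beta> \<in> {2..m}" "K \<le> idx \<beta> v" for v \<beta>
    unfolding E using Rf_bounded[OF IH(1) that] .
  have 2: "Ef m r \<phi> v = (\<lambda>y. \<Sum>j\<in>Box m r K. NJ m r j (\<phi> (shiftj v j)) y)"
    if v: "\<not> is_X v" "\<forall>\<alpha>\<in>{r..m}. idx \<alpha> v = 0" for v
  proof
    fix y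
    have "Tl m r \<psi> v = (\<lambda>y. \<Sum>k<K. (nD m r ^^ k) (\<psi> ((shiftv r ^^ k) v)) y)"
      by (rule Tl_eq[OF m2], rule IH(1)[of r]) (use v r in \<open>auto simp: idx_shiftn\<close>)
    then have "Ef m r \<phi> v y = (\<Sum>k<K. (nD m r ^^ k) (\<psi> ((shiftv r ^^ k) v)) y)"
      unfolding E Rf_def using v r by simp
    also have "\<dots> = (\<Sum>k<K. \<Sum>j\<in>Box m (Suc r) K. (nD m r ^^ k) (NJ m (Suc r) j (\<phi> (shiftj v (j(r := k))))) y)"
    proof (rule sum.cong[OF refl])
      fix k
      have j0: "j r = 0" if "j \<in> Box m (Suc r) K" for j using that by (simp add: Box_def)
      have "\<psi> ((shiftv r ^^ k) v) = (\<lambda>y. \<Sum>j\<in>Box m (Suc r) K. NJ m (Suc r) j (\<phi> (shiftj ((shiftv r ^^ k) v) j)) y)"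
        by (rule IH(2)) (use v in \<open>auto simp: idx_shiftn_other\<close>)
      then have "(nD m r ^^ k) (\<psi> ((shiftv r ^^ k) v)) y = (\<Sum>j\<in>Box m (Suc r) K. (nD m r ^^ k) (NJ m (Suc r) j (\<phi> (shiftj ((shiftv r ^^ k) v) j))) y)"
        by (simp only:) (subst nDn_sum, use r NJ_FR fams_FR[OF \<phi>] in auto)
      also have "\<dots> = (\<Sum>j\<in>Box m (Suc r) K. (nD m r ^^ k) (NJ m (Suc r) j (\<phi> (shiftj v (j(r := k))))) y)"
        by (rule sum.cong[OF refl]) (simp add: shiftj_shiftn[OF v(1) j0])
      finally show "(nD m r ^^ k) (\<psi> ((shiftv r ^^ k) v)) y = (\<Sum>j\<in>Box m (Suc r) K. (nD m r ^^ k) (NJ m (Suc r) j (\<phi> (shiftj v (j(r := k))))) y)" .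
    qed
    also have "\<dots> = (\<Sum>(k, j)\<in>{..<K} \<times> Box m (Suc r) K. (nD m r ^^ k) (NJ m (Suc r) j (\<phi> (shiftj v (j(r := k))))) y)"
      by (rule sum.cartesian_product)
    also have "\<dots> = (\<Sum>j\<in>Box m r K. NJ m r j (\<phi> (shiftj v j)) y)"
    \<comment> \<open>A multi-index over \<open>{r..m}\<close> is its entry at \<open>r\<close>
      together with a multi-index over \<open>{Suc r..m}\<close>.\<close>
    proof (rule sum.reindex_bij_witness[where j = "\<lambda>(k, j). j(r := k)" and i = "\<lambda>j. (j r, j(r := 0))"])
      fix a assume a: "a \<in> {..<K} \<times> Box m (Suc r) K"
      obtain k j where kj: "a = (k, j)" by (cases a)
      have j: "j r = 0" using a kj by (simp add: Box_def)
      show "((\<lambda>(k, j). j(r := k)) a r, ((\<lambda>(k, j). j(r := k)) a)(r := 0)) = a" using kj j by auto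
      show "(\<lambda>(k, j). j(r := k)) a \<in> Box m r K" using a kj r by (auto simp: Box_def)
      have "NJ m (Suc r) (j(r := k)) f = NJ m (Suc r) j f" for f
        unfolding NJ_def by (rule foldr_cong) auto
      moreover have "NJ m r (j(r := k)) f = (nD m r ^^ k) (NJ m (Suc r) (j(r := k)) f)" for f
        unfolding NJ_def upt by simp
      ultimately show "NJ m r ((\<lambda>(k, j). j(r := k)) a) (\<phi> (shiftj v ((\<lambda>(k, j). j(r := k)) a))) y
        = (case a of (k, j) \<Rightarrow> (nD m r ^^ k) (NJ m (Suc r) j (\<phi> (shiftj v (j(r := k))))) y)"
        using kj by simp
    next
      fix j assume j: "j \<in> Box m r K"
      show "(\<lambda>(k, j). j(r := k)) (j r, j(r := 0)) = j" by simp
      show "(j r, j(r := 0)) \<in> {..<K} \<times> Box m (Suc r) K" using j r by (auto simp: Box_def)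
    qed
    finally show "Ef m r \<phi> v y = (\<Sum>j\<in>Box m r K. NJ m r j (\<phi> (shiftj v j)) y)" .
  qed
  show ?case using 1 2 by blast
qed

lemma negDj_eq: "negDj m j f = NJ m 2 j f"
  unfolding negDj_def NJ_def
proof (rule foldr_cong)
  fix \<alpha> g assume "\<alpha> \<in> set [2..<Suc m]"
  then have "(\<lambda>h y. - Dt m \<alpha> h y) = nD m \<alpha>" by (auto simp: nD_def Db_def fun_eq_iff)
  then show "((\<lambda>h y. - Dt m \<alpha> h y) ^^ j \<alpha>) g = (nD m \<alpha> ^^ j \<alpha>) g" by simp
qed auto

lemma NJ_zero: "NJ m r j (\<lambda>_. 0) = (\<lambda>_. 0)"
proof -
  have "foldr (\<lambda>\<alpha> g. (nD m \<alpha> ^^ j \<alpha>) g) xs (\<lambda>_. 0) = (\<lambda>_. 0)" for xs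
    by (induction xs) (auto simp: nD_zero[OF m2])
  then show ?thesis by (simp add: NJ_def)
qed

lemma vder_eq:
  assumes L: "L \<in> AB m" and v: "base_var m v"
  shows "vder m v L = Ef m 2 (grad (red m L)) v"
proof -
  define g where "g = red m L"
  have g: "g \<in> FR m" unfolding g_def using red_FR[OF m2 L] .
  have \<phi>: "grad g \<in> fams m" using grad_fams[OF m2 g] .
  let ?M = "\<Union>\<alpha>\<in>{2..m}. idx \<alpha> ` {v. grad g v \<noteq> (\<lambda>_. 0)}"
  have fin: "finite ?M" using fams_finite[OF \<phi>] by simp
  define K where "K = Suc (Max (insert 0 ?M))"
  have K: "grad g v = (\<lambda>_. 0)" if "\<beta> \<in> {2..m}" "K \<le> idx \<beta> v" for v \<beta>
  proof (rule ccontr)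
    assume "grad g v \<noteq> (\<lambda>_. 0)"
    then have "idx \<beta> v \<le> Max (insert 0 ?M)" using fin that by (intro Max_ge) auto
    then show False using that by (simp add: K_def)
  qed
  have nX: "\<not> is_X v" and v0: "\<forall>\<alpha>\<in>{2..m}. idx \<alpha> v = 0" using v by (auto simp: base_var_def)
  have E: "Ef m 2 (grad g) v = (\<lambda>y. \<Sum>j\<in>Box m 2 K. NJ m 2 j (grad g (shiftj v j)) y)"
  proof -
    have "\<forall>v. \<not> is_X v \<longrightarrow> (\<forall>\<alpha>\<in>{2..m}. idx \<alpha> v = 0) \<longrightarrow>
      Ef m 2 (grad g) v = (\<lambda>y. \<Sum>j\<in>Box m 2 K. NJ m 2 j (grad g (shiftj v j)) y)"
      by (rule conjunct2[OF Ef_formula[OF \<phi>]], rule K) (use m2 in auto)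
    then show ?thesis using nX v0 by blast
  qed
  have gr: "grad g (shiftj v j) = partial (shiftj v j) g" for j using nX by (simp add: grad_def)
  let ?J = "{j. validJ m j \<and> partial (shiftj v j) g \<noteq> (\<lambda>_. 0)}"
  have sub: "?J \<subseteq> Box m 2 K"
  proof
    fix j assume j: "j \<in> ?J"
    have "j k < K" if "k \<in> {2..m}" for k
    proof (rule ccontr)
      assume "\<not> j k < K"
      then have "grad g (shiftj v j) = (\<lambda>_. 0)" using K[OF that, of "shiftj v j"] nX by (simp add: idx_shiftj)
      then show False using j gr by simp
    qed
    moreover have "j k = 0" if "k \<notin> {2..m}" for k
    proof -
      have "k = 0 \<or> k = 1 \<or> m < k" using that by auto
      then show ?thesis using j by (auto simp: validJ_def valid_mi_def)
    qed
    ultimately show "j \<in> Box m 2 K" by (simp add: Box_def)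
  qed
  have "vder m v L = (\<lambda>y. \<Sum>j\<in>?J. NJ m 2 j (grad g (shiftj v j)) y)"
    unfolding vder_def nf_eq_red[OF m2 L] Let_def g_def[symmetric] negDj_eq gr ..
  also have "\<dots> = (\<lambda>y. \<Sum>j\<in>Box m 2 K. NJ m 2 j (grad g (shiftj v j)) y)"
  proof (intro ext sum.mono_neutral_left[OF finite_Box sub] ballI)
    fix y j assume j: "j \<in> Box m 2 K - ?J"
    then have "validJ m j" by (auto simp: validJ_def valid_mi_def Box_def)
    then have "grad g (shiftj v j) = (\<lambda>_. 0)" using j gr by simp
    then show "NJ m 2 j (grad g (shiftj v j)) y = 0" by (simp add: NJ_zero)
  qed
  finally show ?thesis using E g_def by simp
qed

text \<open>The factor \<open>Rf m \<alpha>\<close> clears all coordinates of positive index in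
  direction \<alpha>, and the remaining factors shift in other directions and cannot bring them
  back.\<close>

lemma Ef_nonbase:
  assumes \<phi>: "\<phi> \<in> fams m" and v: "\<not> base_var m v" shows "Ef m 2 \<phi> v = (\<lambda>_. 0)"
proof -
  have *: "foldr (Rf m) xs \<phi> v = (\<lambda>_. 0)" if "\<alpha> \<in> set xs" "idx \<alpha> v \<noteq> 0" for xs v \<alpha>
    using that
  proof (induction xs arbitrary: v)
    case (Cons a xs)
    show ?case
    proof (cases "a = \<alpha>")
      case False
      have "foldr (Rf m) xs \<phi> ((shiftv a ^^ k) v) = (\<lambda>_. 0)" for k
        using Cons False by (intro Cons.IH) (auto simp: idx_shiftn_other)
      then have "Tl m a (foldr (Rf m) xs \<phi>) v = (\<lambda>_. 0)" by (simp add: Tl_def)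
      then show ?thesis by (simp add: Rf_def[of m a])
    qed (use Cons in \<open>simp add: Rf_def[of m \<alpha>]\<close>)
  qed simp
  have E: "Ef m 2 \<phi> \<in> fams m" by (rule Ef_props(1)[OF m2 _ \<phi>]) simp
  show ?thesis
  proof (cases "free_var m v \<and> \<not> is_X v")
    case True
    then obtain \<alpha> where "\<alpha> \<in> {2..m}" "idx \<alpha> v \<noteq> 0" using v by (auto simp: base_var_def)
    then show ?thesis unfolding Ef_def by (intro *[of \<alpha>]) auto
  qed (use fams_nonfree[OF E] fams_X[OF E] in blast)
qed

end

section \<open>The linear system\<close>

text \<open>The action of \<open>D\<^sub>1\<close> on linearisations.\<close>

definition Ds1 :: "nat \<Rightarrow> (var \<Rightarrow> fn) \<Rightarrow> var \<Rightarrow> fn" where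
  "Ds1 m \<phi> v = (if free_var m v \<and> \<not> is_X v then
      (\<lambda>y. Db m 1 (\<phi> v) y + (\<Sum>w | \<phi> w \<noteq> (\<lambda>_. 0). partial v (cvf m w) y * \<phi> w y)) else (\<lambda>_. 0))"

definition single :: "var \<Rightarrow> fn \<Rightarrow> var \<Rightarrow> fn" where
  "single w g v = (if v = w then g else (\<lambda>_. 0))"

definition gmul :: "fn \<Rightarrow> fn \<Rightarrow> var \<Rightarrow> fn" where
  "gmul f g v = (\<lambda>y. grad f v y * g y)"

lemma single_apply: "single w g v y = (if v = w then g y else 0)"
  by (simp add: single_def)

lemma Ds1_eq:
  assumes "finite S" "\<And>w. w \<notin> S \<Longrightarrow> \<phi> w = (\<lambda>_. 0)"
  shows "Ds1 m \<phi> v = (if free_var m v \<and> \<not> is_X v then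
      (\<lambda>y. Db m 1 (\<phi> v) y + (\<Sum>w\<in>S. partial v (cvf m w) y * \<phi> w y)) else (\<lambda>_. 0))"
proof -
  have "(\<Sum>w | \<phi> w \<noteq> (\<lambda>_. 0). partial v (cvf m w) y * \<phi> w y) = (\<Sum>w\<in>S. partial v (cvf m w) y * \<phi> w y)" for y
    by (rule sum.mono_neutral_left) (use assms in auto)
  then show ?thesis by (simp add: Ds1_def)
qed

section \<open>The action of the first total derivative on linearisations\<close>

context
  fixes m :: nat
  assumes m2: "2 \<le> m"
begin

lemma single_fams: "free_var m w \<Longrightarrow> \<not> is_X w \<Longrightarrow> g \<in> FR m \<Longrightarrow> single w g \<in> fams m"
  by (rule famsI[of "{w}"]) (auto simp: single_def FR_intros)

lemma gmul_fams: "f \<in> FR m \<Longrightarrow> g \<in> FR m \<Longrightarrow> gmul f g \<in> fams m"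
proof -
  assume f: "f \<in> FR m" and g: "g \<in> FR m"
  note G = grad_fams[OF m2 f]
  show ?thesis
    by (rule famsI[OF fams_finite[OF G]])
      (use g fams_FR[OF G] fams_X[OF G] fams_nonfree[OF G] in \<open>auto simp: gmul_def intro!: FR_intros\<close>)
qed

lemma Ds1_add:
  assumes "\<phi> \<in> fams m" "\<psi> \<in> fams m"
  shows "Ds1 m (\<lambda>v y. \<phi> v y + \<psi> v y) = (\<lambda>v y. Ds1 m \<phi> v y + Ds1 m \<psi> v y)"
proof
  fix v
  let ?S = "{v. \<phi> v \<noteq> (\<lambda>_. 0)} \<union> {v. \<psi> v \<noteq> (\<lambda>_. 0)}"
  have S: "finite ?S" using assms by (simp add: fams_finite)
  have 1: "Ds1 m (\<lambda>v y. \<phi> v y + \<psi> v y) v = (if free_var m v \<and> \<not> is_X v then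
      (\<lambda>y. Db m 1 (\<lambda>y. \<phi> v y + \<psi> v y) y + (\<Sum>w\<in>?S. partial v (cvf m w) y * (\<phi> w y + \<psi> w y))) else (\<lambda>_. 0))"
    by (rule Ds1_eq[OF S]) auto
  have 2: "Ds1 m \<phi> v = (if free_var m v \<and> \<not> is_X v then
      (\<lambda>y. Db m 1 (\<phi> v) y + (\<Sum>w\<in>?S. partial v (cvf m w) y * \<phi> w y)) else (\<lambda>_. 0))"
    by (rule Ds1_eq[OF S]) auto
  have 3: "Ds1 m \<psi> v = (if free_var m v \<and> \<not> is_X v then
      (\<lambda>y. Db m 1 (\<psi> v) y + (\<Sum>w\<in>?S. partial v (cvf m w) y * \<psi> w y)) else (\<lambda>_. 0))"
    by (rule Ds1_eq[OF S]) auto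
  show "Ds1 m (\<lambda>v y. \<phi> v y + \<psi> v y) v = (\<lambda>y. Ds1 m \<phi> v y + Ds1 m \<psi> v y)"
    unfolding 1 2 3 using fams_FR[OF assms(1)] fams_FR[OF assms(2)]
    by (simp add: Db_add[OF m2] distrib_left sum.distrib fun_eq_iff)
qed

lemma Ds1_zero: "Ds1 m (\<lambda>_ _. 0) = (\<lambda>_ _. 0)"
  by (auto simp: Ds1_def Db_const[OF m2] fun_eq_iff)

lemma Ds1_sum:
  "(\<And>a. a \<in> A \<Longrightarrow> \<psi> a \<in> fams m) \<Longrightarrow> Ds1 m (\<lambda>v y. \<Sum>a\<in>A. \<psi> a v y) = (\<lambda>v y. \<Sum>a\<in>A. Ds1 m (\<psi> a) v y)"
proof (induction A rule: infinite_finite_induct)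
  case (insert a A)
  then show ?case using Ds1_add[OF _ fams_sum[OF m2], of "\<psi> a" A \<psi>] by simp
qed (auto simp: Ds1_zero)

text \<open>The Lie derivative rule
  \<open>D\<^sub>1 (g dw) = (D\<^sub>1 g) dw + g d(D\<^sub>1 w)\<close>, with \<open>cvf m w\<close>
  as \<open>D\<^sub>1 w\<close>. Families are treated as sums of such pieces.\<close>

lemma Ds1_single:
  assumes w: "free_var m w" "\<not> is_X w" and g: "g \<in> FR m"
  shows "Ds1 m (single w g) = (\<lambda>v y. single w (Db m 1 g) v y + gmul (cvf m w) g v y)"
proof
  fix v
  have c: "cvf m w \<in> FR m" using cvf_FR[OF m2 w(1)] .
  have 1: "Ds1 m (single w g) v = (if free_var m v \<and> \<not> is_X v then
      (\<lambda>y. Db m 1 (single w g v) y + (\<Sum>w'\<in>{w}. partial v (cvf m w') y * single w g w' y)) else (\<lambda>_. 0))"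
    by (rule Ds1_eq) (auto simp: single_def)
  have "partial v (cvf m w) = (\<lambda>_. 0)" if "\<not> free_var m v"
    using c that smf_partial_outside unfolding FR_def by blast
  then show "Ds1 m (single w g) v = (\<lambda>y. single w (Db m 1 g) v y + gmul (cvf m w) g v y)"
    unfolding 1 using w by (auto simp: single_def gmul_def grad_def Db_const[OF m2] fun_eq_iff)
qed

lemma Ds1_fams:
  assumes \<phi>: "\<phi> \<in> fams m" shows "Ds1 m \<phi> \<in> fams m"
proof -
  let ?S = "{w. \<phi> w \<noteq> (\<lambda>_. 0)}"
  have fw: "free_var m w" "\<not> is_X w" if "w \<in> ?S" for w using that \<phi> by (auto simp: fams_def)
  have sing: "single w (\<phi> w) \<in> fams m" if "w \<in> ?S" for w
    using fw[OF that] fams_FR[OF \<phi>] by (intro single_fams)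
  have \<phi>eq: "\<phi> = (\<lambda>v y. \<Sum>w\<in>?S. single w (\<phi> w) v y)"
    using fams_finite[OF \<phi>] by (auto simp: fun_eq_iff single_apply)
  have "Ds1 m \<phi> = (\<lambda>v y. \<Sum>w\<in>?S. Ds1 m (single w (\<phi> w)) v y)"
    by (rule trans[OF arg_cong[where f = "Ds1 m", OF \<phi>eq]], rule Ds1_sum, rule sing)
  also have "\<dots> \<in> fams m"
  proof (rule fams_sum[OF m2])
    fix w assume w: "w \<in> ?S"
    show "Ds1 m (single w (\<phi> w)) \<in> fams m"
      unfolding Ds1_single[OF fw[OF w] fams_FR[OF \<phi>]]
      using fw[OF w] fams_FR[OF \<phi>, of w] m2
      by (intro famsadd[OF m2] single_fams gmul_fams cvf_FR[OF m2] Db_FR[OF m2]) auto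
  qed
  finally show ?thesis .
qed

lemma grad_Db1:
  assumes f: "f \<in> FR m" shows "grad (Db m 1 f) = Ds1 m (grad f)"
proof
  fix u
  have f': "f \<in> smf {v. free_var m v}" using f by (simp add: FR_def)
  obtain S where S: "finite S" "S \<subseteq> {v. free_var m v}" "depends_on f S" using smf_finite_dep[OF f'] by metis
  have g0: "grad f w = (\<lambda>_. 0)" if "w \<notin> S" for w using partial_outside[OF S(3) that] by (simp add: grad_def)
  have DF: "Db m 1 f \<in> FR m" using f m2 by (intro Db_FR[OF m2]) auto
  show "grad (Db m 1 f) u = Ds1 m (grad f) u"
  proof (cases "free_var m u \<and> \<not> is_X u")
    case True
    have c: "cvf m v \<in> smf {v. free_var m v}" if "v \<in> S" for v
      using cvf_FR[OF m2, of v] that S by (auto simp: FR_def)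
    have "partial u (vf (cvf m) f) = (\<lambda>y. vf (cvf m) (partial u f) y + (\<Sum>v\<in>S. partial u (cvf m v) y * partial v f y))"
      by (rule partial_vf[OF f' S(1,3) c])
    also have "\<dots> = (\<lambda>y. vf (cvf m) (partial u f) y + (\<Sum>v\<in>S. partial u (cvf m v) y * grad f v y))"
    proof (intro ext arg_cong2[where f = "(+)"] sum.cong refl)
      fix y v
      show "partial u (cvf m v) y * partial v f y = partial u (cvf m v) y * grad f v y"
      proof (cases v)
        case (X \<nu>)
        then show ?thesis by (simp add: cvf_def)
      qed (auto simp: grad_def)
    qed
    moreover have "Ds1 m (grad f) u = (if free_var m u \<and> \<not> is_X u then
      (\<lambda>y. Db m 1 (grad f u) y + (\<Sum>v\<in>S. partial u (cvf m v) y * grad f v y)) else (\<lambda>_. 0))"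
      by (rule Ds1_eq[OF S(1) g0])
    ultimately show ?thesis using True by (simp add: Db_def grad_def[of _ u])
  next
    case False
    then have "grad (Db m 1 f) u = (\<lambda>_. 0)"
      using fams_nonfree[OF grad_fams[OF m2 DF]] fams_X[OF grad_fams[OF m2 DF]] by blast
    then show ?thesis using False by (auto simp: Ds1_def)
  qed
qed

lemma Db_cvf:
  assumes w: "free_var m w" "\<not> is_X w" and \<alpha>: "2 \<le> \<alpha>" "\<alpha> \<le> m"
  shows "Db m \<alpha> (cvf m w) = cvf m (shiftv \<alpha> w)"
proof -
  have "Db m \<alpha> (cvf m w) = vf (tvf m \<alpha>) (cvf m w)"
    using Db_eq_vf[OF m2 cvf_FR[OF m2 w(1)]] \<alpha> by simp
  then show ?thesis using Dt_cvf[OF m2 w(1) \<alpha>] w free_valid by (simp add: tvf_nonX)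
qed

lemma Ds_single:
  assumes w: "free_var m w" "\<not> is_X w" and g: "g \<in> FR m"
  shows "Ds m \<alpha> (single w g) = (\<lambda>v y. single w (Db m \<alpha> g) v y + single (shiftv \<alpha> w) g v y)"
proof
  fix v
  have "0 < idx \<alpha> v \<and> unsh \<alpha> v = w \<longleftrightarrow> v = shiftv \<alpha> w"
    using w by (auto simp: idx_shiftv shiftv_unsh)
  then show "Ds m \<alpha> (single w g) v = (\<lambda>y. single w (Db m \<alpha> g) v y + single (shiftv \<alpha> w) g v y)"
    by (auto simp: Ds_def single_def Db_const[OF m2] fun_eq_iff)
qed

lemma Ds_add:
  assumes "\<phi> \<in> fams m" "\<psi> \<in> fams m"
  shows "Ds m \<alpha> (\<lambda>v y. \<phi> v y + \<psi> v y) = (\<lambda>v y. Ds m \<alpha> \<phi> v y + Ds m \<alpha> \<psi> v y)"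
  using fams_FR[OF assms(1)] fams_FR[OF assms(2)] by (auto simp: Ds_def Db_add[OF m2] fun_eq_iff)

lemma Ds_zero: "Ds m \<alpha> (\<lambda>_ _. 0) = (\<lambda>_ _. 0)"
  by (auto simp: Ds_def Db_const[OF m2] fun_eq_iff)

lemma Ds_sum:
  "(\<And>a. a \<in> A \<Longrightarrow> \<psi> a \<in> fams m) \<Longrightarrow> Ds m \<alpha> (\<lambda>v y. \<Sum>a\<in>A. \<psi> a v y) = (\<lambda>v y. \<Sum>a\<in>A. Ds m \<alpha> (\<psi> a) v y)"
proof (induction A rule: infinite_finite_induct)
  case (insert a A)
  then show ?case using Ds_add[OF _ fams_sum[OF m2], of "\<psi> a" A \<psi>] by simp
qed (auto simp: Ds_zero)

lemma Ds_gmul: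
  assumes f: "f \<in> FR m" and g: "g \<in> FR m" and \<alpha>: "2 \<le> \<alpha>" "\<alpha> \<le> m"
  shows "Ds m \<alpha> (gmul f g) = (\<lambda>v y. gmul (Db m \<alpha> f) g v y + gmul f (Db m \<alpha> g) v y)"
proof
  fix v
  have "grad (Db m \<alpha> f) v = Ds m \<alpha> (grad f) v" using grad_Db[OF m2 f \<alpha>] by simp
  then show "Ds m \<alpha> (gmul f g) v = (\<lambda>y. gmul (Db m \<alpha> f) g v y + gmul f (Db m \<alpha> g) v y)"
    using Db_mult[OF m2 fams_FR[OF grad_fams[OF m2 f]] g, of \<alpha> v]
    by (auto simp: Ds_def gmul_def fun_eq_iff algebra_simps)
qed

text \<open>The commutator vanishes for two reasons: the derivations commute on the coefficient
  \<open>g\<close>, and \<open>Db_cvf\<close> says that they commute on the coordinate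
  \<open>w\<close>.\<close>

lemma Ds1_Ds_single:
  assumes w: "free_var m w" "\<not> is_X w" and g: "g \<in> FR m" and \<alpha>: "2 \<le> \<alpha>" "\<alpha> \<le> m"
  shows "Ds1 m (Ds m \<alpha> (single w g)) = Ds m \<alpha> (Ds1 m (single w g))"
proof -
  have Dg: "Db m \<alpha> g \<in> FR m" "Db m 1 g \<in> FR m" using g \<alpha> m2 by (auto intro!: Db_FR[OF m2])
  have sw: "free_var m (shiftv \<alpha> w)" "\<not> is_X (shiftv \<alpha> w)" using w \<alpha> by (auto simp: free_shiftv_iff)
  have c: "cvf m w \<in> FR m" using cvf_FR[OF m2 w(1)] .
  have com: "Db m \<alpha> (Db m 1 g) = Db m 1 (Db m \<alpha> g)" using \<alpha> m2 by (intro Db_commute[OF m2 g]) auto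
  have "Ds1 m (Ds m \<alpha> (single w g)) = (\<lambda>v y. Ds1 m (single w (Db m \<alpha> g)) v y + Ds1 m (single (shiftv \<alpha> w) g) v y)"
    unfolding Ds_single[OF w g] by (rule Ds1_add) (use w sw g Dg single_fams in auto)
  moreover have "Ds m \<alpha> (Ds1 m (single w g)) = (\<lambda>v y. Ds m \<alpha> (single w (Db m 1 g)) v y + Ds m \<alpha> (gmul (cvf m w) g) v y)"
    unfolding Ds1_single[OF w g] by (rule Ds_add) (use w g Dg c single_fams gmul_fams in auto)
  ultimately show ?thesis
    unfolding Ds1_single[OF w Dg(1)] Ds1_single[OF sw g] Ds_single[OF w Dg(2)] Ds_gmul[OF c g \<alpha>]
      Db_cvf[OF w \<alpha>] com by (auto simp: fun_eq_iff)
qed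

lemma Ds1_Ds_commute:
  assumes \<phi>: "\<phi> \<in> fams m" and \<alpha>: "2 \<le> \<alpha>" "\<alpha> \<le> m"
  shows "Ds1 m (Ds m \<alpha> \<phi>) = Ds m \<alpha> (Ds1 m \<phi>)"
proof -
  let ?S = "{w. \<phi> w \<noteq> (\<lambda>_. 0)}"
  let ?f = "\<lambda>w. single w (\<phi> w)"
  have fw: "free_var m w" "\<not> is_X w" if "w \<in> ?S" for w using that \<phi> by (auto simp: fams_def)
  have sing: "?f w \<in> fams m" if "w \<in> ?S" for w
    using fw[OF that] fams_FR[OF \<phi>] by (intro single_fams)
  have \<phi>eq: "\<phi> = (\<lambda>v y. \<Sum>w\<in>?S. ?f w v y)"
    using fams_finite[OF \<phi>] by (auto simp: fun_eq_iff single_apply)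
  have D: "Ds m \<alpha> \<phi> = (\<lambda>v y. \<Sum>w\<in>?S. Ds m \<alpha> (?f w) v y)"
    by (rule trans[OF arg_cong[where f = "Ds m \<alpha>", OF \<phi>eq]], rule Ds_sum, rule sing)
  have D1: "Ds1 m \<phi> = (\<lambda>v y. \<Sum>w\<in>?S. Ds1 m (?f w) v y)"
    by (rule trans[OF arg_cong[where f = "Ds1 m", OF \<phi>eq]], rule Ds1_sum, rule sing)
  have "Ds1 m (Ds m \<alpha> \<phi>) = (\<lambda>v y. \<Sum>w\<in>?S. Ds1 m (Ds m \<alpha> (?f w)) v y)"
    unfolding D by (rule Ds1_sum) (rule Ds_fams[OF m2 \<alpha> sing])
  also have "\<dots> = (\<lambda>v y. \<Sum>w\<in>?S. Ds m \<alpha> (Ds1 m (?f w)) v y)"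
    by (intro ext sum.cong refl) (simp add: Ds1_Ds_single[OF fw fams_FR[OF \<phi>] \<alpha>])
  also have "\<dots> = Ds m \<alpha> (Ds1 m \<phi>)"
    unfolding D1 by (rule Ds_sum[symmetric]) (rule Ds1_fams[OF sing])
  finally show ?thesis .
qed

text \<open>The linearisation of \<open>L\<close> differs from its variational family by images of
  the operators \<open>Ds m \<alpha>\<close>. \<open>Ds1\<close> commutes with these operators and
  \<open>Ef\<close> kills their images, so the variational derivatives of \<open>D\<^sub>1 L\<close>
  depend only on those of \<open>L\<close>.\<close>

lemma Ef_Db1:
  assumes L: "L \<in> FR m"
  shows "Ef m 2 (grad (Db m 1 L)) = Ef m 2 (Ds1 m (Ef m 2 (grad L)))"
proof -
  let ?\<phi> = "grad L" and ?x = "Ef m 2 (grad L)"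
  have two: "(2::nat) \<le> 2" by simp
  have \<phi>: "?\<phi> \<in> fams m" using grad_fams[OF m2 L] .
  have x: "?x \<in> fams m" using Ef_props(1)[OF m2 two \<phi>] .
  obtain \<psi> where \<psi>1: "\<forall>\<alpha>\<in>{2..m}. \<psi> \<alpha> \<in> fams m"
    and \<psi>2: "\<forall>v y. ?\<phi> v y = ?x v y + (\<Sum>\<alpha>=2..m. Ds m \<alpha> (\<psi> \<alpha>) v y)"
    using Ef_props(4)[OF m2 two \<phi>] by blast
  have f: "Ds m \<alpha> (\<psi> \<alpha>) \<in> fams m" if "\<alpha> \<in> {2..m}" for \<alpha> using \<psi>1 that by (intro Ds_fams[OF m2]) auto
  have f1: "Ds1 m (Ds m \<alpha> (\<psi> \<alpha>)) \<in> fams m" if "\<alpha> \<in> {2..m}" for \<alpha> using f[OF that] by (rule Ds1_fams)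
  have s: "(\<lambda>v y. \<Sum>\<alpha>=2..m. Ds m \<alpha> (\<psi> \<alpha>) v y) \<in> fams m" by (rule fams_sum[OF m2]) (rule f)
  have s1: "(\<lambda>v y. \<Sum>\<alpha>=2..m. Ds1 m (Ds m \<alpha> (\<psi> \<alpha>)) v y) \<in> fams m" by (rule fams_sum[OF m2]) (rule f1)
  have "Ds1 m (\<lambda>v y. ?x v y + (\<Sum>\<alpha>=2..m. Ds m \<alpha> (\<psi> \<alpha>) v y)) = (\<lambda>v y. Ds1 m ?x v y + Ds1 m (\<lambda>v y. \<Sum>\<alpha>=2..m. Ds m \<alpha> (\<psi> \<alpha>) v y) v y)"
    by (rule Ds1_add[OF x s])
  also have "Ds1 m (\<lambda>v y. \<Sum>\<alpha>=2..m. Ds m \<alpha> (\<psi> \<alpha>) v y) = (\<lambda>v y. \<Sum>\<alpha>=2..m. Ds1 m (Ds m \<alpha> (\<psi> \<alpha>)) v y)"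
    by (rule Ds1_sum) (rule f)
  finally have D1: "Ds1 m (\<lambda>v y. ?x v y + (\<Sum>\<alpha>=2..m. Ds m \<alpha> (\<psi> \<alpha>) v y)) = (\<lambda>v y. Ds1 m ?x v y + (\<Sum>\<alpha>=2..m. Ds1 m (Ds m \<alpha> (\<psi> \<alpha>)) v y))" .
  have "?\<phi> = (\<lambda>v y. ?x v y + (\<Sum>\<alpha>=2..m. Ds m \<alpha> (\<psi> \<alpha>) v y))" by (intro ext) (rule \<psi>2[rule_format])
  from trans[OF arg_cong[OF this, of "Ds1 m"] D1] have "Ef m 2 (Ds1 m ?\<phi>) = (\<lambda>v y. Ef m 2 (Ds1 m ?x) v y + Ef m 2 (\<lambda>v y. \<Sum>\<alpha>=2..m. Ds1 m (Ds m \<alpha> (\<psi> \<alpha>)) v y) v y)"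
    using Ef_props(2)[OF m2 two Ds1_fams[OF x] s1] by simp
  also have "Ef m 2 (\<lambda>v y. \<Sum>\<alpha>=2..m. Ds1 m (Ds m \<alpha> (\<psi> \<alpha>)) v y) = (\<lambda>v y. \<Sum>\<alpha>=2..m. Ef m 2 (Ds1 m (Ds m \<alpha> (\<psi> \<alpha>))) v y)"
    by (rule Ef_sum[OF m2 two f1])
  also have "\<dots> = (\<lambda>v y. 0)"
  proof (intro ext sum.neutral ballI)
    fix v y \<alpha> assume a: "\<alpha> \<in> {2..m}"
    then have p: "\<psi> \<alpha> \<in> fams m" "2 \<le> \<alpha>" "\<alpha> \<le> m" using \<psi>1 by auto
    have "Ef m 2 (Ds1 m (Ds m \<alpha> (\<psi> \<alpha>))) = (\<lambda>_ _. 0)"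
      using Ds1_Ds_commute[OF p] Ef_props(3)[OF m2 two Ds1_fams[OF p(1)] p(2,3)] p by simp
    then show "Ef m 2 (Ds1 m (Ds m \<alpha> (\<psi> \<alpha>))) v y = 0" by simp
  qed
  finally show ?thesis using grad_Db1[OF L] by simp
qed

lemma Ef_single_base:
  assumes "base_var m w" shows "Ef m 2 (single w g) = single w g"
proof -
  have nX: "\<not> is_X w" and w0: "\<And>\<alpha>. \<alpha> \<in> {2..m} \<Longrightarrow> idx \<alpha> w = 0" using assms by (auto simp: base_var_def)
  have R: "Rf m \<alpha> (single w g) = single w g" if \<alpha>: "\<alpha> \<in> {2..m}" for \<alpha>
  proof
    fix v
    have "single w g ((shiftv \<alpha> ^^ k) v) = (\<lambda>_. 0)" if "1 \<le> k" for k
    proof (cases "(shiftv \<alpha> ^^ k) v = w")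
      case True
      then have "\<not> is_X v" using nX by auto
      then show ?thesis using idx_shiftn[of v \<alpha> k] True w0[OF \<alpha>] that by simp
    qed (simp add: single_def)
    then have "Tl m \<alpha> (single w g) v = single w g v" using Tl_eq[OF m2, of 1 "single w g" \<alpha> v] by simp
    then show "Rf m \<alpha> (single w g) v = single w g v"
      using w0[OF \<alpha>] by (auto simp: Rf_def single_def)
  qed
  have "foldr (Rf m) xs (single w g) = single w g" if "set xs \<subseteq> {2..m}" for xs
    using that by (induction xs) (auto simp: R)
  moreover have "set [2..<Suc m] \<subseteq> {2..m}" by auto
  ultimately show ?thesis unfolding Ef_def by blast
qed

text \<open>\<open>Ef\<close> annihilates \<open>Ds m \<alpha> (single w g)\<close>, whose two terms
  are the two families compared here. This is integration by parts for a single derivative.\<close>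

lemma Ef_shift_single:
  assumes w: "free_var m w" "\<not> is_X w" and g: "g \<in> FR m" and \<alpha>: "2 \<le> \<alpha>" "\<alpha> \<le> m"
  shows "Ef m 2 (single (shiftv \<alpha> w) g) = (\<lambda>v y. - Ef m 2 (single w (Db m \<alpha> g)) v y)"
proof -
  have two: "(2::nat) \<le> 2" by simp
  have Dg: "Db m \<alpha> g \<in> FR m" using g \<alpha> m2 by (auto intro!: Db_FR[OF m2])
  have sw: "free_var m (shiftv \<alpha> w)" "\<not> is_X (shiftv \<alpha> w)" using w \<alpha> by (auto simp: free_shiftv_iff)
  have "Ef m 2 (Ds m \<alpha> (single w g)) = (\<lambda>_ _. 0)"
    using Ef_props(3)[OF m2 two single_fams[OF w g] \<alpha>] \<alpha> by simp
  then have "(\<lambda>v y. Ef m 2 (single w (Db m \<alpha> g)) v y + Ef m 2 (single (shiftv \<alpha> w) g) v y) = (\<lambda>_ _. 0)"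
    unfolding Ds_single[OF w g] using Ef_props(2)[OF m2 two single_fams[OF w Dg] single_fams[OF sw g]] by simp
  then show ?thesis by (simp add: fun_eq_iff add_eq_0_iff)
qed

lemma Ef_shift1:
  assumes w: "base_var m w" and g: "g \<in> FR m" and \<alpha>: "2 \<le> \<alpha>" "\<alpha> \<le> m"
  shows "Ef m 2 (single (shiftv \<alpha> w) g) = (\<lambda>v y. - single w (Db m \<alpha> g) v y)"
  using Ef_shift_single[OF _ _ g \<alpha>, of w] w by (simp add: Ef_single_base base_var_def)

lemma Ef_shift2:
  assumes w: "base_var m w" and g: "g \<in> FR m" and \<alpha>: "2 \<le> \<alpha>" "\<alpha> \<le> m"
  shows "Ef m 2 (single (shiftv \<alpha> (shiftv \<alpha> w)) g) = single w (Db m \<alpha> (Db m \<alpha> g))"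
proof -
  have Dg: "Db m \<alpha> g \<in> FR m" using g \<alpha> m2 by (auto intro!: Db_FR[OF m2])
  have sw: "free_var m (shiftv \<alpha> w)" "\<not> is_X (shiftv \<alpha> w)" using w \<alpha> by (auto simp: free_shiftv_iff base_var_def)
  show ?thesis using Ef_shift_single[OF sw g \<alpha>] Ef_shift1[OF w Dg \<alpha>] by simp
qed

end

definition trc :: "nat \<Rightarrow> fn" where
  "trc m = (\<lambda>y. \<Sum>\<alpha>\<in>Nset m. coord (U \<alpha> (unit \<alpha>)) y)"

text \<open>The family \<open>(\<chi>\<^sub>u, (\<chi>\<^sup>k\<^sub>\<alpha>)\<^sub>k\<^sub>,\<^sub>\<alpha>, \<chi>\<^sub>p\<^sub>,\<^sub>0, \<chi>\<^sub>p\<^sub>,\<^sub>1)\<close>, cut off at \<open>k < K\<close>, as a function on coordinates.\<close>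

definition fv :: "nat \<Rightarrow> nat \<Rightarrow> fn \<Rightarrow> (nat \<Rightarrow> nat \<Rightarrow> fn) \<Rightarrow> fn \<Rightarrow> fn \<Rightarrow> var \<Rightarrow> fn" where
  "fv m K u c p0 p1 = (\<lambda>v y. single (U 1 (\<lambda>_. 0)) u v y + (single (P (\<lambda>_. 0)) p0 v y
     + (single (P (at1 1)) p1 v y + (\<Sum>\<alpha>\<in>Nset m. \<Sum>k<K. single (U \<alpha> (at1 k)) (c k \<alpha>) v y))))"

lemma grad_coord: "\<not> is_X w \<Longrightarrow> grad (coord w) v = (\<lambda>_. if v = w then 1 else 0)"
  by (auto simp: grad_def partial_coord)

lemma gmul_coord: "\<not> is_X w \<Longrightarrow> gmul (coord w) g = single w g"
  by (auto simp: gmul_def grad_coord single_def fun_eq_iff)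

lemma grad_linear:
  "f \<in> smf V \<Longrightarrow> g \<in> smf V \<Longrightarrow> grad (\<lambda>y. f y + g y) v y = grad f v y + grad g v y"
  "f \<in> smf V \<Longrightarrow> g \<in> smf V \<Longrightarrow> grad (\<lambda>y. f y * g y) v y = grad f v y * g y + f y * grad g v y"
  "f \<in> smf V \<Longrightarrow> grad (\<lambda>y. a * f y) v y = a * grad f v y"
  "f \<in> smf V \<Longrightarrow> grad (\<lambda>y. - f y) v y = - grad f v y"
  by (auto simp: grad_def partial_add partial_mult partial_cmult partial_uminus)

lemma grad_sum_apply:
  "(\<And>i. i \<in> I \<Longrightarrow> h i \<in> smf V) \<Longrightarrow> grad (\<lambda>y. \<Sum>i\<in>I. h i y) v y = (\<Sum>i\<in>I. grad (h i) v y)"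
  using partial_sum[of I h V v] by (auto simp: grad_def)

lemma gmul_Phi:
  "gmul (Phi m) g = (\<lambda>v y. \<Sum>\<alpha>\<in>Nset m. single (P (inc (unit \<alpha>) \<alpha>)) g v y
     + (single (U \<alpha> (unit \<alpha>)) (\<lambda>y. 2 * (trc m y * g y)) v y
     + (single (U 1 (unit \<alpha>)) (\<lambda>y. 2 * (coord (U \<alpha> (unit 1)) y * g y)) v y
     + (single (U \<alpha> (unit 1)) (\<lambda>y. 2 * (coord (U 1 (unit \<alpha>)) y * g y)) v y
     + (\<Sum>\<beta>\<in>Nset m. single (U \<alpha> (unit \<beta>)) (\<lambda>y. 2 * (coord (U \<beta> (unit \<alpha>)) y * g y)) v y)))))"
    (is "_ = ?R")
proof (intro ext)
  fix v y
  let ?N = "Nset m"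
  let ?d = "\<lambda>w. grad (coord w) v y" and ?x = "\<lambda>w. coord w y"
  note c = smf_coord[OF UNIV_I]
  have mem: "(\<lambda>y. \<Sum>\<alpha>\<in>?N. coord (P (inc (unit \<alpha>) \<alpha>)) y) \<in> smf UNIV" "trc m \<in> smf UNIV"
    "(\<lambda>y. \<Sum>\<alpha>\<in>?N. coord (U 1 (unit \<alpha>)) y * coord (U \<alpha> (unit 1)) y) \<in> smf UNIV"
    "(\<lambda>y. \<Sum>\<alpha>\<in>?N. \<Sum>\<beta>\<in>?N. coord (U \<alpha> (unit \<beta>)) y * coord (U \<beta> (unit \<alpha>)) y) \<in> smf UNIV"
    unfolding trc_def by (intro smf_sum smf_mult c)+
  have Phi: "Phi m = (\<lambda>y. (\<Sum>\<alpha>\<in>?N. coord (P (inc (unit \<alpha>) \<alpha>)) y) + ((trc m y * trc m y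
     + 2 * (\<Sum>\<alpha>\<in>?N. coord (U 1 (unit \<alpha>)) y * coord (U \<alpha> (unit 1)) y))
     + (\<Sum>\<alpha>\<in>?N. \<Sum>\<beta>\<in>?N. coord (U \<alpha> (unit \<beta>)) y * coord (U \<beta> (unit \<alpha>)) y)))"
    by (simp add: Phi_def quadF_def trc_def)
  have 1: "grad (\<lambda>y. \<Sum>\<alpha>\<in>?N. coord (P (inc (unit \<alpha>) \<alpha>)) y) v y = (\<Sum>\<alpha>\<in>?N. ?d (P (inc (unit \<alpha>) \<alpha>)))"
    by (rule grad_sum_apply[OF c])
  have 2: "grad (trc m) v y = (\<Sum>\<alpha>\<in>?N. ?d (U \<alpha> (unit \<alpha>)))"
    unfolding trc_def by (rule grad_sum_apply[OF c])
  have 3: "grad (\<lambda>y. \<Sum>\<alpha>\<in>?N. coord (U 1 (unit \<alpha>)) y * coord (U \<alpha> (unit 1)) y) v y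
      = (\<Sum>\<alpha>\<in>?N. ?d (U 1 (unit \<alpha>)) * ?x (U \<alpha> (unit 1)) + ?x (U 1 (unit \<alpha>)) * ?d (U \<alpha> (unit 1)))"
    by (subst grad_sum_apply[OF smf_mult[OF c c]]) (simp only: grad_linear(2)[OF c c])
  have 4: "grad (\<lambda>y. \<Sum>\<alpha>\<in>?N. \<Sum>\<beta>\<in>?N. coord (U \<alpha> (unit \<beta>)) y * coord (U \<beta> (unit \<alpha>)) y) v y
      = (\<Sum>\<alpha>\<in>?N. \<Sum>\<beta>\<in>?N. 2 * (?d (U \<alpha> (unit \<beta>)) * ?x (U \<beta> (unit \<alpha>))))"
  proof -
    have "grad (\<lambda>y. \<Sum>\<alpha>\<in>?N. \<Sum>\<beta>\<in>?N. coord (U \<alpha> (unit \<beta>)) y * coord (U \<beta> (unit \<alpha>)) y) v y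
      = (\<Sum>\<alpha>\<in>?N. \<Sum>\<beta>\<in>?N. ?d (U \<alpha> (unit \<beta>)) * ?x (U \<beta> (unit \<alpha>)) + ?x (U \<alpha> (unit \<beta>)) * ?d (U \<beta> (unit \<alpha>)))"
      by (subst grad_sum_apply[OF smf_sum[OF smf_mult[OF c c]]], subst grad_sum_apply[OF smf_mult[OF c c]])
        (simp only: grad_linear(2)[OF c c])
    also have "\<dots> = (\<Sum>\<alpha>\<in>?N. \<Sum>\<beta>\<in>?N. ?d (U \<alpha> (unit \<beta>)) * ?x (U \<beta> (unit \<alpha>)))
       + (\<Sum>\<alpha>\<in>?N. \<Sum>\<beta>\<in>?N. ?x (U \<alpha> (unit \<beta>)) * ?d (U \<beta> (unit \<alpha>)))"
      by (simp only: sum.distrib)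
    \<comment> \<open>The quadratic form is symmetric under exchange of \<alpha> and \<beta>, so
      both halves of the product rule agree; this is one origin of the factor 2 in the linear
      system.\<close>
    also have "(\<Sum>\<alpha>\<in>?N. \<Sum>\<beta>\<in>?N. ?x (U \<alpha> (unit \<beta>)) * ?d (U \<beta> (unit \<alpha>)))
       = (\<Sum>\<alpha>\<in>?N. \<Sum>\<beta>\<in>?N. ?d (U \<alpha> (unit \<beta>)) * ?x (U \<beta> (unit \<alpha>)))"
      by (subst sum.swap) (simp only: mult.commute)
    finally show ?thesis by (simp only: sum_distrib_left[symmetric])
  qed
  have "grad (Phi m) v y = (\<Sum>\<alpha>\<in>?N. ?d (P (inc (unit \<alpha>) \<alpha>))) + ((2 * trc m y * (\<Sum>\<alpha>\<in>?N. ?d (U \<alpha> (unit \<alpha>)))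
      + 2 * (\<Sum>\<alpha>\<in>?N. ?d (U 1 (unit \<alpha>)) * ?x (U \<alpha> (unit 1)) + ?x (U 1 (unit \<alpha>)) * ?d (U \<alpha> (unit 1))))
      + (\<Sum>\<alpha>\<in>?N. \<Sum>\<beta>\<in>?N. 2 * (?d (U \<alpha> (unit \<beta>)) * ?x (U \<beta> (unit \<alpha>)))))"
  proof -
    note t = smf_mult[OF mem(2) mem(2)] and b = smf_cmult[OF mem(3), of 2]
    show ?thesis unfolding Phi grad_linear(1)[OF mem(1) smf_add[OF smf_add[OF t b] mem(4)]]
      grad_linear(1)[OF smf_add[OF t b] mem(4)] grad_linear(1)[OF t b]
      grad_linear(2)[OF mem(2) mem(2)] grad_linear(3)[OF mem(3)] 1 2 3 4 by simp
  qed
  then have "gmul (Phi m) g v y = (\<Sum>\<alpha>\<in>?N. ?d (P (inc (unit \<alpha>) \<alpha>)) * g y + (2 * trc m y * ?d (U \<alpha> (unit \<alpha>)) * g y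
      + (2 * (?d (U 1 (unit \<alpha>)) * ?x (U \<alpha> (unit 1)) * g y) + (2 * (?x (U 1 (unit \<alpha>)) * ?d (U \<alpha> (unit 1)) * g y)
      + (\<Sum>\<beta>\<in>?N. 2 * (?d (U \<alpha> (unit \<beta>)) * ?x (U \<beta> (unit \<alpha>))) * g y)))))"
    unfolding gmul_def by (simp add: sum.distrib sum_distrib_left sum_distrib_right algebra_simps)
  also have "\<dots> = ?R v y"
    by (intro sum.cong arg_cong2[where f = "(+)"] refl) (auto simp: grad_coord single_apply)
  finally show "gmul (Phi m) g v y = ?R v y" .
qed

section \<open>The linear system as the variational action of the first total derivative\<close>

context
  fixes m :: nat
  assumes m2: "2 \<le> m"
begin

lemma two2: "(2::nat) \<le> 2" by simp

lemmas Ef_fams = Ef_props(1)[OF m2 two2]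
lemmas Ef_add = Ef_props(2)[OF m2 two2]

lemma base_vars:
  "base_var m (U 1 (\<lambda>_. 0))" "base_var m (P (\<lambda>_. 0))" "base_var m (P (at1 1))" "\<alpha> \<in> Nset m \<Longrightarrow> base_var m (U \<alpha> (at1 k))"
  "\<alpha> \<in> Nset m \<Longrightarrow> base_var m (U \<alpha> (\<lambda>_. 0))"
  using base_var_iff[OF m2] at1_simps(1) by metis+

lemma base_free: "base_var m w \<Longrightarrow> free_var m w" "base_var m w \<Longrightarrow> \<not> is_X w"
  by (auto simp: base_var_def)

lemma single_base_fams: "base_var m w \<Longrightarrow> g \<in> FR m \<Longrightarrow> single w g \<in> fams m"
  using base_free by (intro single_fams[OF m2]) auto

lemma shift_base_fams: "base_var m w \<Longrightarrow> \<alpha> \<in> Nset m \<Longrightarrow> g \<in> FR m \<Longrightarrow> single (shiftv \<alpha> w) g \<in> fams m"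
  using base_free by (intro single_fams[OF m2]) (auto simp: free_shiftv_iff)

lemma shift2_base_fams: "base_var m w \<Longrightarrow> \<alpha> \<in> Nset m \<Longrightarrow> g \<in> FR m \<Longrightarrow> single (shiftv \<alpha> (shiftv \<alpha> w)) g \<in> fams m"
  using base_free by (intro single_fams[OF m2]) (auto simp: free_shiftv_iff)

lemma u_FR: "\<alpha> \<in> Nset m \<Longrightarrow> \<mu> \<in> {1..m} \<Longrightarrow> coord (U \<alpha> (unit \<mu>)) \<in> FR m" "\<alpha> \<in> Nset m \<Longrightarrow> coord (U 1 (unit \<alpha>)) \<in> FR m"
  using m2 by (intro FR_intros; auto simp: free_var_simps valid_unit)+

lemma trc_FR: "trc m \<in> FR m"
  unfolding trc_def by (intro FR_intros(7) u_FR) auto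

text \<open>The adjoint of the linearised \<open>Phi\<close>, which produces all terms with
  \<open>\<chi>\<^sub>p\<^sub>,\<^sub>1\<close> that come from the pressure equation. A coordinate
  with one shift costs a minus and one total derivative, the doubly shifted pressure coordinates
  keep their sign, and \<open>U \<alpha> (unit 1)\<close> is a base coordinate and stays as it
  is.\<close>

lemma Ef_gmul_Phi:
  assumes g: "g \<in> FR m"
  shows "Ef m 2 (gmul (Phi m) g) = (\<lambda>v y. \<Sum>\<alpha>\<in>Nset m. single (P (\<lambda>_. 0)) (Db m \<alpha> (Db m \<alpha> g)) v y
     + (- single (U \<alpha> (\<lambda>_. 0)) (Db m \<alpha> (\<lambda>y. 2 * (trc m y * g y))) v y
     + (- single (U 1 (\<lambda>_. 0)) (Db m \<alpha> (\<lambda>y. 2 * (coord (U \<alpha> (unit 1)) y * g y))) v y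
     + (single (U \<alpha> (at1 1)) (\<lambda>y. 2 * (coord (U 1 (unit \<alpha>)) y * g y)) v y
     + (\<Sum>\<beta>\<in>Nset m. - single (U \<alpha> (\<lambda>_. 0)) (Db m \<beta> (\<lambda>y. 2 * (coord (U \<beta> (unit \<alpha>)) y * g y))) v y)))))"
proof -
  let ?N = "Nset m"
  define f1 where "f1 \<alpha> = single (shiftv \<alpha> (shiftv \<alpha> (P (\<lambda>_. 0)))) g" for \<alpha>
  define f2 where "f2 \<alpha> = single (shiftv \<alpha> (U \<alpha> (\<lambda>_. 0))) (\<lambda>y. 2 * (trc m y * g y))" for \<alpha>
  define f3 where "f3 \<alpha> = single (shiftv \<alpha> (U 1 (\<lambda>_. 0))) (\<lambda>y. 2 * (coord (U \<alpha> (unit 1)) y * g y))" for \<alpha>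
  define f4 where "f4 \<alpha> = single (U \<alpha> (at1 1)) (\<lambda>y. 2 * (coord (U 1 (unit \<alpha>)) y * g y))" for \<alpha>
  define f5 where "f5 \<alpha> \<beta> = single (shiftv \<beta> (U \<alpha> (\<lambda>_. 0))) (\<lambda>y. 2 * (coord (U \<beta> (unit \<alpha>)) y * g y))" for \<alpha> \<beta>
  have gP: "gmul (Phi m) g = (\<lambda>v y. \<Sum>\<alpha>\<in>?N. f1 \<alpha> v y + (f2 \<alpha> v y + (f3 \<alpha> v y + (f4 \<alpha> v y + (\<Sum>\<beta>\<in>?N. f5 \<alpha> \<beta> v y)))))"
    unfolding gmul_Phi f1_def f2_def f3_def f4_def f5_def shiftv_simps unit_def at1_simps(2) ..
  have FR: "(\<lambda>y. 2 * (trc m y * g y)) \<in> FR m"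
    "\<alpha> \<in> ?N \<Longrightarrow> (\<lambda>y. 2 * (coord (U \<alpha> (unit 1)) y * g y)) \<in> FR m"
    "\<alpha> \<in> ?N \<Longrightarrow> (\<lambda>y. 2 * (coord (U 1 (unit \<alpha>)) y * g y)) \<in> FR m"
    "\<alpha> \<in> ?N \<Longrightarrow> \<beta> \<in> ?N \<Longrightarrow> (\<lambda>y. 2 * (coord (U \<alpha> (unit \<beta>)) y * g y)) \<in> FR m" for \<alpha> \<beta>
    by (intro FR_intros(1,5) trc_FR g u_FR; use m2 in auto)+
  note bs = single_base_fams shift_base_fams shift2_base_fams base_vars g FR
  have f: "f1 \<alpha> \<in> fams m" "f2 \<alpha> \<in> fams m" "f3 \<alpha> \<in> fams m" "f4 \<alpha> \<in> fams m" if "\<alpha> \<in> ?N" for \<alpha>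
    unfolding f1_def f2_def f3_def f4_def using that by (intro bs; assumption)+
  have f5: "f5 \<alpha> \<beta> \<in> fams m" if "\<alpha> \<in> ?N" "\<beta> \<in> ?N" for \<alpha> \<beta>
    unfolding f5_def by (rule shift_base_fams[OF base_vars(5)[OF that(1)] that(2) FR(4)[OF that(2,1)]])
  have s5: "(\<lambda>v y. \<Sum>\<beta>\<in>?N. f5 \<alpha> \<beta> v y) \<in> fams m" if "\<alpha> \<in> ?N" for \<alpha> by (rule fams_sum[OF m2]) (rule f5[OF that])
  have s4: "(\<lambda>v y. f4 \<alpha> v y + (\<Sum>\<beta>\<in>?N. f5 \<alpha> \<beta> v y)) \<in> fams m" if "\<alpha> \<in> ?N" for \<alpha> by (rule famsadd[OF m2 f(4)[OF that] s5[OF that]])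
  have s3: "(\<lambda>v y. f3 \<alpha> v y + (f4 \<alpha> v y + (\<Sum>\<beta>\<in>?N. f5 \<alpha> \<beta> v y))) \<in> fams m" if "\<alpha> \<in> ?N" for \<alpha> by (rule famsadd[OF m2 f(3)[OF that] s4[OF that]])
  have s2: "(\<lambda>v y. f2 \<alpha> v y + (f3 \<alpha> v y + (f4 \<alpha> v y + (\<Sum>\<beta>\<in>?N. f5 \<alpha> \<beta> v y)))) \<in> fams m" if "\<alpha> \<in> ?N" for \<alpha> by (rule famsadd[OF m2 f(2)[OF that] s3[OF that]])
  have s1: "(\<lambda>v y. f1 \<alpha> v y + (f2 \<alpha> v y + (f3 \<alpha> v y + (f4 \<alpha> v y + (\<Sum>\<beta>\<in>?N. f5 \<alpha> \<beta> v y))))) \<in> fams m" if "\<alpha> \<in> ?N" for \<alpha> by (rule famsadd[OF m2 f(1)[OF that] s2[OF that]])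
  have "Ef m 2 (gmul (Phi m) g) = (\<lambda>v y. \<Sum>\<alpha>\<in>?N. Ef m 2 (\<lambda>v y. f1 \<alpha> v y + (f2 \<alpha> v y + (f3 \<alpha> v y + (f4 \<alpha> v y + (\<Sum>\<beta>\<in>?N. f5 \<alpha> \<beta> v y))))) v y)"
    unfolding gP by (rule Ef_sum[OF m2 two2]) (rule s1)
  also have "\<dots> = (\<lambda>v y. \<Sum>\<alpha>\<in>?N. Ef m 2 (f1 \<alpha>) v y + (Ef m 2 (f2 \<alpha>) v y + (Ef m 2 (f3 \<alpha>) v y + (Ef m 2 (f4 \<alpha>) v y + (\<Sum>\<beta>\<in>?N. Ef m 2 (f5 \<alpha> \<beta>) v y)))))"
  proof (intro ext sum.cong refl)
    fix v y \<alpha> assume a: "\<alpha> \<in> ?N"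
    have "Ef m 2 (\<lambda>v y. \<Sum>\<beta>\<in>?N. f5 \<alpha> \<beta> v y) = (\<lambda>v y. \<Sum>\<beta>\<in>?N. Ef m 2 (f5 \<alpha> \<beta>) v y)"
      by (rule Ef_sum[OF m2 two2]) (rule f5[OF a])
    then show "Ef m 2 (\<lambda>v y. f1 \<alpha> v y + (f2 \<alpha> v y + (f3 \<alpha> v y + (f4 \<alpha> v y + (\<Sum>\<beta>\<in>?N. f5 \<alpha> \<beta> v y))))) v y
      = Ef m 2 (f1 \<alpha>) v y + (Ef m 2 (f2 \<alpha>) v y + (Ef m 2 (f3 \<alpha>) v y + (Ef m 2 (f4 \<alpha>) v y + (\<Sum>\<beta>\<in>?N. Ef m 2 (f5 \<alpha> \<beta>) v y))))"
      by (simp only: Ef_add[OF f(1)[OF a] s2[OF a]] Ef_add[OF f(2)[OF a] s3[OF a]] Ef_add[OF f(3)[OF a] s4[OF a]] Ef_add[OF f(4)[OF a] s5[OF a]])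
  qed
  also have "\<dots> = (\<lambda>v y. \<Sum>\<alpha>\<in>Nset m. single (P (\<lambda>_. 0)) (Db m \<alpha> (Db m \<alpha> g)) v y
     + (- single (U \<alpha> (\<lambda>_. 0)) (Db m \<alpha> (\<lambda>y. 2 * (trc m y * g y))) v y
     + (- single (U 1 (\<lambda>_. 0)) (Db m \<alpha> (\<lambda>y. 2 * (coord (U \<alpha> (unit 1)) y * g y))) v y
     + (single (U \<alpha> (at1 1)) (\<lambda>y. 2 * (coord (U 1 (unit \<alpha>)) y * g y)) v y
     + (\<Sum>\<beta>\<in>Nset m. - single (U \<alpha> (\<lambda>_. 0)) (Db m \<beta> (\<lambda>y. 2 * (coord (U \<beta> (unit \<alpha>)) y * g y))) v y)))))"
  proof (intro ext sum.cong refl)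
    fix v y \<alpha> assume a: "\<alpha> \<in> ?N"
    then have a': "2 \<le> \<alpha>" "\<alpha> \<le> m" by auto
    have 5: "Ef m 2 (f5 \<alpha> \<beta>) v y = - single (U \<alpha> (\<lambda>_. 0)) (Db m \<beta> (\<lambda>y. 2 * (coord (U \<beta> (unit \<alpha>)) y * g y))) v y" if "\<beta> \<in> ?N" for \<beta>
      unfolding f5_def using that by (subst Ef_shift1[OF m2 base_vars(5)[OF a] FR(4)[OF that a]]) auto
    show "Ef m 2 (f1 \<alpha>) v y + (Ef m 2 (f2 \<alpha>) v y + (Ef m 2 (f3 \<alpha>) v y + (Ef m 2 (f4 \<alpha>) v y + (\<Sum>\<beta>\<in>?N. Ef m 2 (f5 \<alpha> \<beta>) v y))))
      = single (P (\<lambda>_. 0)) (Db m \<alpha> (Db m \<alpha> g)) v y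
     + (- single (U \<alpha> (\<lambda>_. 0)) (Db m \<alpha> (\<lambda>y. 2 * (trc m y * g y))) v y
     + (- single (U 1 (\<lambda>_. 0)) (Db m \<alpha> (\<lambda>y. 2 * (coord (U \<alpha> (unit 1)) y * g y))) v y
     + (single (U \<alpha> (at1 1)) (\<lambda>y. 2 * (coord (U 1 (unit \<alpha>)) y * g y)) v y
     + (\<Sum>\<beta>\<in>Nset m. - single (U \<alpha> (\<lambda>_. 0)) (Db m \<beta> (\<lambda>y. 2 * (coord (U \<beta> (unit \<alpha>)) y * g y))) v y))))"
      unfolding f1_def Ef_shift2[OF m2 base_vars(2) g a'] f2_def Ef_shift1[OF m2 base_vars(5)[OF a] FR(1) a']
        f3_def Ef_shift1[OF m2 base_vars(1) FR(2)[OF a] a'] f4_def Ef_single_base[OF m2 base_vars(4)[OF a]]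
      using 5 by simp
  qed
  finally show ?thesis .
qed

lemma Ef_Ds1_single:
  assumes w: "base_var m w" and g: "g \<in> FR m"
  shows "Ef m 2 (Ds1 m (single w g)) = (\<lambda>v y. single w (Db m 1 g) v y + Ef m 2 (gmul (cvf m w) g) v y)"
proof -
  have D: "Db m 1 g \<in> FR m" using g m2 by (intro Db_FR[OF m2]) auto
  have c: "gmul (cvf m w) g \<in> fams m" using base_free[OF w] g by (intro gmul_fams[OF m2] cvf_FR[OF m2])
  show ?thesis
    unfolding Ds1_single[OF m2 base_free[OF w] g] Ef_add[OF single_base_fams[OF w D] c] Ef_single_base[OF m2 w] ..
qed

text \<open>The minus of the solved continuity equation and the minus of integration by parts
  cancel. The result is the term \<open>D\<^sub>\<alpha> \<chi>\<^sub>u\<close> in the equation for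
  k = 0.\<close>

lemma Ef_gmul_u:
  assumes g: "g \<in> FR m"
  shows "Ef m 2 (gmul (cvf m (U 1 (\<lambda>_. 0))) g) = (\<lambda>v y. \<Sum>\<beta>\<in>Nset m. single (U \<beta> (\<lambda>_. 0)) (Db m \<beta> g) v y)"
proof -
  let ?h = "\<lambda>y. - g y"
  have h: "?h \<in> FR m" using g by (intro FR_intros)
  note c = smf_coord[OF UNIV_I]
  have "gmul (cvf m (U 1 (\<lambda>_. 0))) g = (\<lambda>v y. \<Sum>\<beta>\<in>Nset m. single (shiftv \<beta> (U \<beta> (\<lambda>_. 0))) ?h v y)"
  proof (intro ext)
    fix v y
    have "grad (\<lambda>y. - (\<Sum>\<beta>\<in>Nset m. coord (U \<beta> (inc (\<lambda>_. 0) \<beta>)) y)) v y = - (\<Sum>\<beta>\<in>Nset m. grad (coord (U \<beta> (inc (\<lambda>_. 0) \<beta>))) v y)"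
      by (simp only: grad_linear(4)[OF smf_sum[OF c]] grad_sum_apply[OF c])
    then show "gmul (cvf m (U 1 (\<lambda>_. 0))) g v y = (\<Sum>\<beta>\<in>Nset m. single (shiftv \<beta> (U \<beta> (\<lambda>_. 0))) ?h v y)"
      by (simp add: gmul_def cvf_def grad_coord single_apply sum_distrib_right sum_negf[symmetric] if_distrib if_distribR cong: if_cong)
  qed
  then have "Ef m 2 (gmul (cvf m (U 1 (\<lambda>_. 0))) g) = (\<lambda>v y. \<Sum>\<beta>\<in>Nset m. Ef m 2 (single (shiftv \<beta> (U \<beta> (\<lambda>_. 0))) ?h) v y)"
    by (simp only:) (rule Ef_sum[OF m2 two2], rule shift_base_fams[OF base_vars(5) _ h])
  also have "\<dots> = (\<lambda>v y. \<Sum>\<beta>\<in>Nset m. single (U \<beta> (\<lambda>_. 0)) (Db m \<beta> g) v y)"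
  proof (intro ext sum.cong refl)
    fix v y \<beta> assume b: "\<beta> \<in> Nset m"
    then have b': "2 \<le> \<beta>" "\<beta> \<le> m" by auto
    show "Ef m 2 (single (shiftv \<beta> (U \<beta> (\<lambda>_. 0))) ?h) v y = single (U \<beta> (\<lambda>_. 0)) (Db m \<beta> g) v y"
      unfolding Ef_shift1[OF m2 base_vars(5)[OF b] h b'] Db_uminus[OF m2 g] by (simp add: single_apply)
  qed
  finally show ?thesis .
qed

text \<open>These account for the undifferentiated terms of the system: the first total derivative
  raises the index at a base coordinate by one, so a coefficient reappears one place higher, as
  \<open>\<chi>\<^sup>k\<^sup>-\<^sup>1\<close> or as \<open>\<chi>\<^sub>p\<^sub>,\<^sub>0\<close>.
  At the last base coordinate of the pressure, \<open>- Phi\<close> takes over.\<close>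

lemma Ef_gmul_rest:
  assumes g: "g \<in> FR m"
  shows "\<alpha> \<in> Nset m \<Longrightarrow> Ef m 2 (gmul (cvf m (U \<alpha> (at1 k))) g) = single (U \<alpha> (at1 (Suc k))) g"
    and "Ef m 2 (gmul (cvf m (P (\<lambda>_. 0))) g) = single (P (at1 1)) g"
    and "Ef m 2 (gmul (cvf m (P (at1 1))) g) = Ef m 2 (gmul (Phi m) (\<lambda>y. - g y))"
proof -
  show "Ef m 2 (gmul (cvf m (U \<alpha> (at1 k))) g) = single (U \<alpha> (at1 (Suc k))) g" if a: "\<alpha> \<in> Nset m"
  proof -
    have "cvf m (U \<alpha> (at1 k)) = coord (U \<alpha> (at1 (Suc k)))" using a at1_simps(3)[of k] by (auto simp: cvf_def)
    then show ?thesis using Ef_single_base[OF m2 base_vars(4)[OF a]] by (simp add: gmul_coord)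
  qed
  have "inc (\<lambda>_. 0) 1 = at1 1" using at1_simps(3)[of 0] at1_simps(1) by simp
  then have "cvf m (P (\<lambda>_. 0)) = coord (P (at1 1))" by (simp add: cvf_def)
  then show "Ef m 2 (gmul (cvf m (P (\<lambda>_. 0))) g) = single (P (at1 1)) g"
    using Ef_single_base[OF m2 base_vars(3)] by (simp add: gmul_coord)
  have "(at1 1)(1 := 0) = (\<lambda>_. 0)" "at1 1 1 = 1" by (auto simp: at1_def)
  then have e: "cvf m (P (at1 1)) = (\<lambda>y. - Phi m y)" by (simp add: cvf_def)
  have "gmul (cvf m (P (at1 1))) g = gmul (Phi m) (\<lambda>y. - g y)"
    unfolding e using Phi_FR[OF m2] by (auto simp: gmul_def fun_eq_iff FR_def grad_linear(4))
  then show "Ef m 2 (gmul (cvf m (P (at1 1))) g) = Ef m 2 (gmul (Phi m) (\<lambda>y. - g y))" by simp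
qed

context
  fixes u p0 p1 :: fn and c :: "nat \<Rightarrow> nat \<Rightarrow> fn" and K :: nat
  assumes FR: "u \<in> FR m" "p0 \<in> FR m" "p1 \<in> FR m" "\<And>k \<alpha>. \<alpha> \<in> Nset m \<Longrightarrow> c k \<alpha> \<in> FR m"
    and K: "\<And>k \<alpha>. K \<le> k \<Longrightarrow> \<alpha> \<in> Nset m \<Longrightarrow> c k \<alpha> = (\<lambda>_. 0)"
begin

lemma Ef_Ds1_fv:
  "Ef m 2 (Ds1 m (fv m K u c p0 p1)) = (\<lambda>v y. Ef m 2 (Ds1 m (single (U 1 (\<lambda>_. 0)) u)) v y
     + (Ef m 2 (Ds1 m (single (P (\<lambda>_. 0)) p0)) v y + (Ef m 2 (Ds1 m (single (P (at1 1)) p1)) v y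
     + (\<Sum>\<alpha>\<in>Nset m. \<Sum>k<K. Ef m 2 (Ds1 m (single (U \<alpha> (at1 k)) (c k \<alpha>))) v y))))"
proof -
  let ?a = "single (U 1 (\<lambda>_. 0)) u" and ?b = "single (P (\<lambda>_. 0)) p0" and ?d = "single (P (at1 1)) p1"
  let ?e = "\<lambda>\<alpha> k. single (U \<alpha> (at1 k)) (c k \<alpha>)"
  let ?E = "\<lambda>v y. \<Sum>\<alpha>\<in>Nset m. \<Sum>k<K. ?e \<alpha> k v y"
  have a: "?a \<in> fams m" and b: "?b \<in> fams m" and d: "?d \<in> fams m"
    by (intro single_base_fams base_vars FR)+
  have e: "?e \<alpha> k \<in> fams m" if "\<alpha> \<in> Nset m" for \<alpha> k using that by (intro single_base_fams base_vars FR)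
  have es: "(\<lambda>v y. \<Sum>k<K. ?e \<alpha> k v y) \<in> fams m" if "\<alpha> \<in> Nset m" for \<alpha>
    by (rule fams_sum[OF m2]) (rule e[OF that])
  have E: "?E \<in> fams m" by (rule fams_sum[OF m2]) (rule es)
  note db = famsadd[OF m2 d E] note bb = famsadd[OF m2 b db]
  have 1: "Ds1 m (fv m K u c p0 p1) = (\<lambda>v y. Ds1 m ?a v y + (Ds1 m ?b v y + (Ds1 m ?d v y + Ds1 m ?E v y)))"
    unfolding fv_def Ds1_add[OF m2 a bb] Ds1_add[OF m2 b db] Ds1_add[OF m2 d E] ..
  note D = Ds1_fams[OF m2]
  note db' = famsadd[OF m2 D[OF d] D[OF E]] note bb' = famsadd[OF m2 D[OF b] db']
  have 2: "Ef m 2 (Ds1 m (fv m K u c p0 p1)) = (\<lambda>v y. Ef m 2 (Ds1 m ?a) v y + (Ef m 2 (Ds1 m ?b) v y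
      + (Ef m 2 (Ds1 m ?d) v y + Ef m 2 (Ds1 m ?E) v y)))"
    unfolding 1 Ef_add[OF D[OF a] bb'] Ef_add[OF D[OF b] db'] Ef_add[OF D[OF d] D[OF E]] ..
  have "Ds1 m ?E = (\<lambda>v y. \<Sum>\<alpha>\<in>Nset m. Ds1 m (\<lambda>v y. \<Sum>k<K. ?e \<alpha> k v y) v y)"
    by (rule Ds1_sum[OF m2]) (rule es)
  then have "Ef m 2 (Ds1 m ?E) = (\<lambda>v y. \<Sum>\<alpha>\<in>Nset m. Ef m 2 (Ds1 m (\<lambda>v y. \<Sum>k<K. ?e \<alpha> k v y)) v y)"
    by (simp only:) (rule Ef_sum[OF m2 two2], rule D[OF es])
  also have "\<dots> = (\<lambda>v y. \<Sum>\<alpha>\<in>Nset m. \<Sum>k<K. Ef m 2 (Ds1 m (?e \<alpha> k)) v y)"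
  proof (intro ext sum.cong refl)
    fix v y \<alpha> assume al: "\<alpha> \<in> Nset m"
    have "Ds1 m (\<lambda>v y. \<Sum>k<K. ?e \<alpha> k v y) = (\<lambda>v y. \<Sum>k<K. Ds1 m (?e \<alpha> k) v y)"
      by (rule Ds1_sum[OF m2]) (rule e[OF al])
    then have "Ef m 2 (Ds1 m (\<lambda>v y. \<Sum>k<K. ?e \<alpha> k v y)) = (\<lambda>v y. \<Sum>k<K. Ef m 2 (Ds1 m (?e \<alpha> k)) v y)"
      by (simp only:) (rule Ef_sum[OF m2 two2], rule D[OF e[OF al]])
    then show "Ef m 2 (Ds1 m (\<lambda>v y. \<Sum>k<K. ?e \<alpha> k v y)) v y = (\<Sum>k<K. Ef m 2 (Ds1 m (?e \<alpha> k)) v y)" by simp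
  qed
  finally show ?thesis unfolding 2 by simp
qed

lemma Db_scale2: "h \<in> FR m \<Longrightarrow> Db m \<alpha> (\<lambda>y. - (2 * (h y * p1 y))) = (\<lambda>y. - 2 * Db m \<alpha> (\<lambda>y. h y * p1 y) y)"
proof -
  assume h: "h \<in> FR m"
  have "(\<lambda>y. - (2 * (h y * p1 y))) = (\<lambda>y. (- 2) * (h y * p1 y))" by auto
  then show ?thesis using Db_cmult[OF m2 FR_intros(5)[OF h FR(3)], of \<alpha> "- 2"] by simp
qed

lemma Ef_Ds1_fv_expand:
  "Ef m 2 (Ds1 m (fv m K u c p0 p1)) v y =
     single (U 1 (\<lambda>_. 0)) (Db m 1 u) v y + (\<Sum>\<beta>\<in>Nset m. single (U \<beta> (\<lambda>_. 0)) (Db m \<beta> u) v y)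
     + single (P (\<lambda>_. 0)) (Db m 1 p0) v y + single (P (at1 1)) p0 v y + single (P (at1 1)) (Db m 1 p1) v y
     + (\<Sum>\<alpha>\<in>Nset m. - single (P (\<lambda>_. 0)) (Db m \<alpha> (Db m \<alpha> p1)) v y)
     + (\<Sum>\<alpha>\<in>Nset m. 2 * single (U \<alpha> (\<lambda>_. 0)) (Db m \<alpha> (\<lambda>y. trc m y * p1 y)) v y)
     + (\<Sum>\<alpha>\<in>Nset m. 2 * single (U 1 (\<lambda>_. 0)) (Db m \<alpha> (\<lambda>y. coord (U \<alpha> (unit 1)) y * p1 y)) v y)
     + (\<Sum>\<alpha>\<in>Nset m. - 2 * single (U \<alpha> (at1 1)) (\<lambda>y. coord (U 1 (unit \<alpha>)) y * p1 y) v y)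
     + (\<Sum>\<alpha>\<in>Nset m. \<Sum>\<beta>\<in>Nset m. 2 * single (U \<alpha> (\<lambda>_. 0)) (Db m \<beta> (\<lambda>y. coord (U \<beta> (unit \<alpha>)) y * p1 y)) v y)
     + (\<Sum>\<alpha>\<in>Nset m. \<Sum>k<K. single (U \<alpha> (at1 k)) (Db m 1 (c k \<alpha>)) v y)
     + (\<Sum>\<alpha>\<in>Nset m. \<Sum>k<K. single (U \<alpha> (at1 (Suc k))) (c k \<alpha>) v y)"
proof -
  have np: "(\<lambda>y. - p1 y) \<in> FR m" using FR by (intro FR_intros)
  have u1: "\<And>\<alpha>. \<alpha> \<in> Nset m \<Longrightarrow> coord (U \<alpha> (unit 1)) \<in> FR m"
    "\<And>\<alpha> \<beta>. \<alpha> \<in> Nset m \<Longrightarrow> \<beta> \<in> Nset m \<Longrightarrow> coord (U \<beta> (unit \<alpha>)) \<in> FR m"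
    by (intro u_FR; use m2 in auto)+
  have DD: "Db m \<alpha> (Db m \<alpha> (\<lambda>y. - p1 y)) = (\<lambda>y. - Db m \<alpha> (Db m \<alpha> p1) y)" if "\<alpha> \<in> Nset m" for \<alpha>
  proof -
    have "Db m \<alpha> p1 \<in> FR m" using that FR by (intro Db_FR[OF m2]) auto
    then show ?thesis by (simp add: Db_uminus[OF m2] FR)
  qed
  have P: "Ef m 2 (gmul (Phi m) (\<lambda>y. - p1 y)) v y = (\<Sum>\<alpha>\<in>Nset m. - single (P (\<lambda>_. 0)) (Db m \<alpha> (Db m \<alpha> p1)) v y
     + (2 * single (U \<alpha> (\<lambda>_. 0)) (Db m \<alpha> (\<lambda>y. trc m y * p1 y)) v y
     + (2 * single (U 1 (\<lambda>_. 0)) (Db m \<alpha> (\<lambda>y. coord (U \<alpha> (unit 1)) y * p1 y)) v y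
     + (- 2 * single (U \<alpha> (at1 1)) (\<lambda>y. coord (U 1 (unit \<alpha>)) y * p1 y) v y
     + (\<Sum>\<beta>\<in>Nset m. 2 * single (U \<alpha> (\<lambda>_. 0)) (Db m \<beta> (\<lambda>y. coord (U \<beta> (unit \<alpha>)) y * p1 y)) v y)))))"
    unfolding Ef_gmul_Phi[OF np]
    by (intro sum.cong arg_cong2[where f = "(+)"] refl)
      (simp_all add: single_apply DD Db_scale2 trc_FR u1[simplified] cong: if_cong)
  have C: "(\<Sum>\<alpha>\<in>Nset m. \<Sum>k<K. Ef m 2 (Ds1 m (single (U \<alpha> (at1 k)) (c k \<alpha>))) v y)
     = (\<Sum>\<alpha>\<in>Nset m. \<Sum>k<K. single (U \<alpha> (at1 k)) (Db m 1 (c k \<alpha>)) v y) + (\<Sum>\<alpha>\<in>Nset m. \<Sum>k<K. single (U \<alpha> (at1 (Suc k))) (c k \<alpha>) v y)"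
    unfolding sum.distrib[symmetric]
    by (intro sum.cong refl) (simp only: Ef_Ds1_single[OF base_vars(4) FR(4)] Ef_gmul_rest(1)[OF FR(4)])
  show ?thesis
    unfolding Ef_Ds1_fv Ef_Ds1_single[OF base_vars(1) FR(1)] Ef_Ds1_single[OF base_vars(2) FR(2)]
      Ef_Ds1_single[OF base_vars(3) FR(3)] Ef_gmul_u[OF FR(1)] Ef_gmul_rest(2)[OF FR(2)] Ef_gmul_rest(3)[OF FR(3)] P C
    by (simp only: sum.distrib add_ac)
qed

lemma Sop_u:
  "Ef m 2 (Ds1 m (fv m K u c p0 p1)) (U 1 (\<lambda>_. 0)) y =
     Db m 1 u y + 2 * (\<Sum>\<alpha>\<in>Nset m. Db m \<alpha> (\<lambda>y. coord (U \<alpha> (unit 1)) y * p1 y) y)"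
  unfolding Ef_Ds1_fv_expand by (simp add: single_apply sum_distrib_left)

lemma Sop_p:
  "Ef m 2 (Ds1 m (fv m K u c p0 p1)) (P (\<lambda>_. 0)) y = Db m 1 p0 y - (\<Sum>\<alpha>\<in>Nset m. Db m \<alpha> (Db m \<alpha> p1) y)"
  "Ef m 2 (Ds1 m (fv m K u c p0 p1)) (P (at1 1)) y = Db m 1 p1 y + p0 y"
  using at1_simps(4)[of 0 1] at1_simps(4)[of 1 0] unfolding Ef_Ds1_fv_expand at1_simps(1)[symmetric]
  by (simp_all add: single_apply sum_negf)

lemma Sop_c:
  assumes b: "\<beta> \<in> Nset m"
  shows "Ef m 2 (Ds1 m (fv m K u c p0 p1)) (U \<beta> (at1 k)) y =
     Db m 1 (c k \<beta>) y + (if k = 0 then Db m \<beta> u y else 0) + (if k = 0 then 0 else c (k - 1) \<beta> y)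
     + 2 * ((if k = 0 then Db m \<beta> (\<lambda>z. trc m z * p1 z) y else 0)
        - (if k = 1 then coord (U 1 (unit \<beta>)) y * p1 y else 0)
        + (if k = 0 then (\<Sum>\<gamma>\<in>Nset m. Db m \<gamma> (\<lambda>z. coord (U \<gamma> (unit \<beta>)) z * p1 z) y) else 0))"
proof -
  have s: "(\<Sum>\<alpha>\<in>Nset m. a * (if U \<beta> (at1 k) = U \<alpha> (at1 l) then h \<alpha> else 0)) = (if k = l then a * h \<beta> else 0)" for l a and h :: "nat \<Rightarrow> real"
    using b by (cases "k = l") (auto simp: at1_simps(4) if_distrib cong: if_cong)
  have s': "(\<Sum>\<alpha>\<in>Nset m. if U \<beta> (at1 k) = U \<alpha> (at1 l) then h \<alpha> else 0) = (if k = l then h \<beta> else 0)" for l and h :: "nat \<Rightarrow> real"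
    using s[of 1 l h] by simp
  have s2: "(\<Sum>\<alpha>\<in>Nset m. \<Sum>j\<in>J. if U \<beta> (at1 k) = U \<alpha> (at1 (l j)) then h \<alpha> j else 0) = (\<Sum>j\<in>J. if k = l j then h \<beta> j else 0)"
    for J :: "nat set" and l and h :: "nat \<Rightarrow> nat \<Rightarrow> real"
    by (subst sum.swap) (simp only: s')
  have s3: "(\<Sum>\<alpha>\<in>Nset m. \<Sum>j\<in>Nset m. 2 * (if U \<beta> (at1 k) = U \<alpha> (at1 l) then h \<alpha> j else 0)) = (\<Sum>j\<in>Nset m. if k = l then 2 * h \<beta> j else 0)"
    for l and h :: "nat \<Rightarrow> nat \<Rightarrow> real"
    by (subst sum.swap) (simp only: s)
  have D: "(if k < K then Db m 1 (c k \<beta>) y else 0) = Db m 1 (c k \<beta>) y"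
    using K[of k \<beta>] b by (auto simp: Db_const[OF m2])
  \<comment> \<open>The shift from \<open>j\<close> to \<open>Suc j\<close> realises the convention
    that the family vanishes at k = -1; the cut-off loses nothing because the \<open>c k\<close>
    vanish from \<open>K\<close> on.\<close>
  have Cs: "(\<Sum>j<K. if k = Suc j then c j \<beta> y else 0) = (if k = 0 then 0 else c (k - 1) \<beta> y)"
  proof (cases k)
    case (Suc n)
    then have "(\<Sum>j<K. if k = Suc j then c j \<beta> y else 0) = (if n < K then c n \<beta> y else 0)" by simp
    then show ?thesis using K[of n \<beta>] b Suc by auto
  qed simp
  have Dk: "(\<Sum>j<K. if k = j then Db m 1 (c j \<beta>) y else 0) = Db m 1 (c k \<beta>) y"
    using D by simp
  show ?thesis
    unfolding Ef_Ds1_fv_expand at1_simps(1)[symmetric] single_apply s s' s2 s3 Cs Dk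
    using b by (auto simp: sum_distrib_left)
qed

text \<open>Values of \<open>Ef\<close> outside the base coordinates vanish anyway, so the vanishing
  of the whole family amounts to one equation for each base coordinate.\<close>

lemma Ef_Ds1_zero_iff:
  "Ef m 2 (Ds1 m (fv m K u c p0 p1)) = (\<lambda>_ _. 0) \<longleftrightarrow>
    (\<lambda>y. Db m 1 u y + 2 * (\<Sum>\<alpha>\<in>Nset m. Db m \<alpha> (\<lambda>y. coord (U \<alpha> (unit 1)) y * p1 y) y)) = (\<lambda>_. 0)
  \<and> (\<forall>k. \<forall>\<beta>\<in>Nset m. (\<lambda>y. Db m 1 (c k \<beta>) y + (if k = 0 then Db m \<beta> u y else 0) + (if k = 0 then 0 else c (k - 1) \<beta> y)
     + 2 * ((if k = 0 then Db m \<beta> (\<lambda>z. trc m z * p1 z) y else 0)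
        - (if k = 1 then coord (U 1 (unit \<beta>)) y * p1 y else 0)
        + (if k = 0 then (\<Sum>\<gamma>\<in>Nset m. Db m \<gamma> (\<lambda>z. coord (U \<gamma> (unit \<beta>)) z * p1 z) y) else 0))) = (\<lambda>_. 0))
  \<and> (\<lambda>y. Db m 1 p0 y - (\<Sum>\<alpha>\<in>Nset m. Db m \<alpha> (Db m \<alpha> p1) y)) = (\<lambda>_. 0)
  \<and> (\<lambda>y. Db m 1 p1 y + p0 y) = (\<lambda>_. 0)"
proof -
  let ?E = "Ef m 2 (Ds1 m (fv m K u c p0 p1))"
  have f: "fv m K u c p0 p1 \<in> fams m"
    unfolding fv_def by (intro famsadd[OF m2] fams_sum[OF m2] single_base_fams base_vars FR)
  have nb: "?E v = (\<lambda>_. 0)" if "\<not> base_var m v" for v by (rule Ef_nonbase[OF m2 Ds1_fams[OF m2 f] that])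
  have "?E = (\<lambda>_ _. 0) \<longleftrightarrow> ?E (U 1 (\<lambda>_. 0)) = (\<lambda>_. 0) \<and> (\<forall>k. \<forall>\<beta>\<in>Nset m. ?E (U \<beta> (at1 k)) = (\<lambda>_. 0))
     \<and> ?E (P (\<lambda>_. 0)) = (\<lambda>_. 0) \<and> ?E (P (at1 1)) = (\<lambda>_. 0)" (is "?L \<longleftrightarrow> ?R")
  proof
    assume R: ?R
    show ?L
    proof
      fix v show "?E v = (\<lambda>_. 0)"
        using R nb[of v] base_var_iff[OF m2, of v] unfolding at1_simps(1) by blast
    qed
  qed simp
  then show ?thesis
    by (simp only: ext[of "?E (U 1 (\<lambda>_. 0))", OF Sop_u] ext[of "?E (U \<beta> (at1 k))" for \<beta> k, OF Sop_c]
        ext[of "?E (P (\<lambda>_. 0))", OF Sop_p(1)] ext[of "?E (P (at1 1))", OF Sop_p(2)] cong: ball_cong)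
qed

end

end

section \<open>Passing to representatives\<close>

context
  fixes m :: nat
  assumes m2: "2 \<le> m"
begin

lemma red_apply: "red m f y = f (\<lambda>v. sig m v y)"
  by (simp add: red_def subst_def)

lemma Dt_sig: "f \<in> AB m \<Longrightarrow> 1 \<le> \<mu> \<Longrightarrow> \<mu> \<le> m \<Longrightarrow> Dt m \<mu> f (\<lambda>v. sig m v y) = Db m \<mu> (red m f) y"
  using Db_red[OF m2, of f \<mu>] by (simp add: red_apply)

lemma red_mult: "f \<in> FR m \<Longrightarrow> red m (\<lambda>y. f y * g y) = (\<lambda>y. f y * red m g y)"
  using red_id[OF m2, of f] by (auto simp: fun_eq_iff red_apply)

lemma eqJ_zero_iff: "f \<in> AB m \<Longrightarrow> eqJ m f (\<lambda>_. 0) \<longleftrightarrow> red m f = (\<lambda>_. 0)"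
  using eqJ_iff[OF m2 _ AB_intros(1)] by (simp add: red_apply fun_eq_iff)

text \<open>\<open>Sspace\<close> is phrased with \<open>Dt\<close> and congruence on arbitrary
  representatives. Reducing each equation replaces \<open>Dt\<close> by \<open>Db\<close> and each
  entry by its normal form, since \<open>red\<close> is a morphism that fixes the free
  coefficients.\<close>

lemma Sspace_iff:
  assumes F: "(u, c, p0, p1) \<in> Fams m" and K: "\<And>k \<alpha>. K \<le> k \<Longrightarrow> \<alpha> \<in> Nset m \<Longrightarrow> red m (c k \<alpha>) = (\<lambda>_. 0)"
  shows "(u, c, p0, p1) \<in> Sspace m \<longleftrightarrow>
    Ef m 2 (Ds1 m (fv m K (red m u) (\<lambda>k \<alpha>. red m (c k \<alpha>)) (red m p0) (red m p1))) = (\<lambda>_ _. 0)"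
proof -
  have AB: "u \<in> AB m" "p0 \<in> AB m" "p1 \<in> AB m" "\<And>k \<alpha>. \<alpha> \<in> Nset m \<Longrightarrow> c k \<alpha> \<in> AB m"
    using F by (auto simp: Fams_def)
  note FR = AB[THEN red_FR[OF m2]]
  have N: "1 \<le> \<alpha>" "\<alpha> \<le> m" if "\<alpha> \<in> Nset m" for \<alpha> using that by auto
  have m1: "(1::nat) \<le> 1" "1 \<le> m" using m2 by auto
  note uFR = u_FR[OF m2] and uAB = u_FR[OF m2, THEN FR_AB]
  have one: "1 \<in> {1..m}" and NM: "\<And>\<alpha>. \<alpha> \<in> Nset m \<Longrightarrow> \<alpha> \<in> {1..m}" using m2 by auto
  define q1 where "q1 \<alpha> = mulf (coord (U \<alpha> (unit 1))) p1" for \<alpha>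
  define q2 where "q2 = (\<lambda>z. (\<Sum>\<beta>\<in>Nset m. z (U \<beta> (unit \<beta>))) * p1 z)"
  define q3 where "q3 \<alpha> \<beta> = mulf (coord (U \<beta> (unit \<alpha>))) p1" for \<alpha> \<beta>
  have q2: "q2 = (\<lambda>y. trc m y * p1 y)" by (simp add: q2_def trc_def coord_def)
  have qAB: "\<And>\<alpha>. \<alpha> \<in> Nset m \<Longrightarrow> q1 \<alpha> \<in> AB m" "q2 \<in> AB m" "\<And>\<alpha> \<beta>. \<alpha> \<in> Nset m \<Longrightarrow> \<beta> \<in> Nset m \<Longrightarrow> q3 \<alpha> \<beta> \<in> AB m"
    unfolding q1_def q2 q3_def mulf_def
    by (intro AB_intros(5) uAB AB FR_AB[OF trc_FR[OF m2]] one NM; assumption)+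
  have qr: "\<And>\<alpha>. \<alpha> \<in> Nset m \<Longrightarrow> red m (q1 \<alpha>) = (\<lambda>y. coord (U \<alpha> (unit 1)) y * red m p1 y)"
    "red m q2 = (\<lambda>y. trc m y * red m p1 y)"
    "\<And>\<alpha> \<beta>. \<alpha> \<in> Nset m \<Longrightarrow> \<beta> \<in> Nset m \<Longrightarrow> red m (q3 \<alpha> \<beta>) = (\<lambda>y. coord (U \<beta> (unit \<alpha>)) y * red m p1 y)"
    unfolding q1_def q2 q3_def mulf_def by (intro red_mult uFR trc_FR[OF m2] one NM; assumption)+
  let ?e1 = "\<lambda>y. Dt m 1 u y + 2 * (\<Sum>\<alpha>\<in>Nset m. Dt m \<alpha> (q1 \<alpha>) y)"
  let ?e2 = "\<lambda>k \<alpha> y. Dt m 1 (c k \<alpha>) y + (if k = 0 then Dt m \<alpha> u y else 0) + (if k = 0 then 0 else c (k - 1) \<alpha> y)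
     + 2 * ((if k = 0 then Dt m \<alpha> q2 y else 0) - (if k = 1 then y (U 1 (unit \<alpha>)) * p1 y else 0)
        + (if k = 0 then (\<Sum>\<beta>\<in>Nset m. Dt m \<beta> (q3 \<alpha> \<beta>) y) else 0))"
  let ?e3 = "\<lambda>y. Dt m 1 p0 y - (\<Sum>\<alpha>\<in>Nset m. Dt m \<alpha> (Dt m \<alpha> p1) y)"
  let ?e4 = "\<lambda>y. Dt m 1 p1 y + p0 y"
  have S: "(u, c, p0, p1) \<in> Sspace m \<longleftrightarrow> eqJ m ?e1 (\<lambda>_. 0) \<and> (\<forall>k. \<forall>\<alpha>\<in>Nset m. eqJ m (?e2 k \<alpha>) (\<lambda>_. 0))
      \<and> eqJ m ?e3 (\<lambda>_. 0) \<and> eqJ m ?e4 (\<lambda>_. 0)"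
    unfolding Sspace_def q1_def q2_def q3_def using F by simp
  have e1: "?e1 \<in> AB m" "red m ?e1 = (\<lambda>y. Db m 1 (red m u) y + 2 * (\<Sum>\<alpha>\<in>Nset m. Db m \<alpha> (\<lambda>y. coord (U \<alpha> (unit 1)) y * red m p1 y) y))"
  proof -
    show "?e1 \<in> AB m"
      by (intro AB_intros(1,3,5,7) Dt_AB AB m1 qAB N; assumption)
    show "red m ?e1 = (\<lambda>y. Db m 1 (red m u) y + 2 * (\<Sum>\<alpha>\<in>Nset m. Db m \<alpha> (\<lambda>y. coord (U \<alpha> (unit 1)) y * red m p1 y) y))"
      by (intro ext, unfold red_apply[of ?e1], intro arg_cong2[where f = "(+)"] arg_cong2[where f = "(*)"] sum.cong refl)
        (simp_all only: Dt_sig[OF AB(1) m1] Dt_sig[OF qAB(1) N] qr(1))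
  qed
  have e2: "?e2 k \<alpha> \<in> AB m" "red m (?e2 k \<alpha>) = (\<lambda>y. Db m 1 (red m (c k \<alpha>)) y + (if k = 0 then Db m \<alpha> (red m u) y else 0)
     + (if k = 0 then 0 else red m (c (k - 1) \<alpha>) y)
     + 2 * ((if k = 0 then Db m \<alpha> (\<lambda>z. trc m z * red m p1 z) y else 0)
        - (if k = 1 then coord (U 1 (unit \<alpha>)) y * red m p1 y else 0)
        + (if k = 0 then (\<Sum>\<gamma>\<in>Nset m. Db m \<gamma> (\<lambda>z. coord (U \<gamma> (unit \<alpha>)) z * red m p1 z) y) else 0)))"
    if a: "\<alpha> \<in> Nset m" for k \<alpha>
  proof -
    have i: "(\<lambda>y. if b then f y else 0) \<in> AB m" "(\<lambda>y. if b then 0 else f y) \<in> AB m" if "f \<in> AB m" for b f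
      using that AB_intros(1)[of 0] by (cases b; simp)+
    have "(\<lambda>y. coord (U 1 (unit \<alpha>)) y * p1 y) \<in> AB m" by (intro AB_intros(5) uAB a AB)
    then have u: "(\<lambda>y. y (U 1 (unit \<alpha>)) * p1 y) \<in> AB m" by (simp add: coord_def)
    have s: "(\<lambda>y. \<Sum>\<beta>\<in>Nset m. Dt m \<beta> (q3 \<alpha> \<beta>) y) \<in> AB m"
      using a by (intro AB_intros(7) Dt_AB qAB N)
    show "?e2 k \<alpha> \<in> AB m"
      by (intro AB_intros(3,4) AB_intros(5)[OF AB_intros(1)] i Dt_AB AB m1 qAB N u s a)
    have sg: "sig m (U 1 (unit \<alpha>)) = coord (U 1 (unit \<alpha>))"
      using a by (intro sig_free[OF m2]) (auto simp: free_var_simps valid_unit)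
    have "(\<Sum>\<beta>\<in>Nset m. Dt m \<beta> (q3 \<alpha> \<beta>) (\<lambda>v. sig m v y)) = (\<Sum>\<gamma>\<in>Nset m. Db m \<gamma> (\<lambda>z. coord (U \<gamma> (unit \<alpha>)) z * red m p1 z) y)" for y
      by (intro sum.cong refl) (simp only: Dt_sig[OF qAB(3)[OF a] N] qr(3)[OF a])
    then show "red m (?e2 k \<alpha>) = (\<lambda>y. Db m 1 (red m (c k \<alpha>)) y + (if k = 0 then Db m \<alpha> (red m u) y else 0)
     + (if k = 0 then 0 else red m (c (k - 1) \<alpha>) y)
     + 2 * ((if k = 0 then Db m \<alpha> (\<lambda>z. trc m z * red m p1 z) y else 0)
        - (if k = 1 then coord (U 1 (unit \<alpha>)) y * red m p1 y else 0)
        + (if k = 0 then (\<Sum>\<gamma>\<in>Nset m. Db m \<gamma> (\<lambda>z. coord (U \<gamma> (unit \<alpha>)) z * red m p1 z) y) else 0)))"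
      by (intro ext, unfold red_apply[of "?e2 k \<alpha>"])
        (simp only: Dt_sig[OF AB(4)[OF a] m1] Dt_sig[OF AB(1) N[OF a]] Dt_sig[OF qAB(2) N[OF a]] qr(2) sg
          red_apply[of "c (k - 1) \<alpha>", symmetric] red_apply[of p1, symmetric])
  qed
  have e3: "?e3 \<in> AB m" "red m ?e3 = (\<lambda>y. Db m 1 (red m p0) y - (\<Sum>\<alpha>\<in>Nset m. Db m \<alpha> (Db m \<alpha> (red m p1)) y))"
  proof -
    show "?e3 \<in> AB m" by (intro AB_intros(4,7) Dt_AB AB m1 N; assumption)
    have "red m (Dt m \<alpha> p1) = Db m \<alpha> (red m p1)" if "\<alpha> \<in> Nset m" for \<alpha>
      using Db_red[OF m2 AB(3) N[OF that]] by simp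
    then have "Dt m \<alpha> (Dt m \<alpha> p1) (\<lambda>v. sig m v y) = Db m \<alpha> (Db m \<alpha> (red m p1)) y" if "\<alpha> \<in> Nset m" for \<alpha> y
      using Dt_sig[OF Dt_AB[OF AB(3) N[OF that]] N[OF that]] that by simp
    then show "red m ?e3 = (\<lambda>y. Db m 1 (red m p0) y - (\<Sum>\<alpha>\<in>Nset m. Db m \<alpha> (Db m \<alpha> (red m p1)) y))"
      unfolding red_apply[of ?e3, abs_def] by (simp only: Dt_sig[OF AB(2) m1] cong: sum.cong)
  qed
  have e4: "?e4 \<in> AB m" "red m ?e4 = (\<lambda>y. Db m 1 (red m p1) y + red m p0 y)"
  proof -
    show "?e4 \<in> AB m" by (intro AB_intros(3) Dt_AB AB m1)
    show "red m ?e4 = (\<lambda>y. Db m 1 (red m p1) y + red m p0 y)"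
      unfolding red_apply[of ?e4, abs_def] by (simp only: Dt_sig[OF AB(3) m1] red_apply[of p0])
  qed
  have "Ef m 2 (Ds1 m (fv m K (red m u) (\<lambda>k \<alpha>. red m (c k \<alpha>)) (red m p0) (red m p1))) = (\<lambda>_ _. 0) \<longleftrightarrow>
     red m ?e1 = (\<lambda>_. 0) \<and> (\<forall>k. \<forall>\<alpha>\<in>Nset m. red m (?e2 k \<alpha>) = (\<lambda>_. 0)) \<and> red m ?e3 = (\<lambda>_. 0) \<and> red m ?e4 = (\<lambda>_. 0)"
    using Ef_Ds1_zero_iff[OF m2, of "red m u" "red m p0" "red m p1" "\<lambda>k \<alpha>. red m (c k \<alpha>)" K] FR K
    by (simp only: e1(2) e2(2) e3(2) e4(2) cong: ball_cong)
  then show ?thesis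
    unfolding S using eqJ_zero_iff[OF e1(1)] eqJ_zero_iff[OF e2(1)] eqJ_zero_iff[OF e3(1)] eqJ_zero_iff[OF e4(1)]
    by (simp only: cong: ball_cong)
qed

end

definition rform :: "nat \<Rightarrow> form \<Rightarrow> form" where
  "rform m \<omega> = (\<lambda>I. red m (\<omega> I))"

section \<open>Cocycles and coboundaries in terms of reduced forms\<close>

context
  fixes m :: nat
  assumes m2: "2 \<le> m"
begin

lemma Mset_ins: "Mset m = insert 1 (Nset m)" "Nset m = {2..m}" "Mset m = {1..m}"
  using m2 by (auto simp: Mset_def Nset_def)

lemma N_props: "finite (Nset m)" "Nset m \<subseteq> {1..m}" "1 \<notin> Nset m" "\<And>a. a \<in> Nset m \<Longrightarrow> 1 < a"
  "card (Nset m) = m - 1" "(1::nat) \<le> 1" "1 \<le> m"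
  using m2 by (auto simp: Nset_def)

lemma rform_rforms: "\<omega> \<in> formsOn m A q \<Longrightarrow> rform m \<omega> \<in> rforms m A q"
  unfolding rform_def by (rule red_rforms[OF m2])

lemma rform_id: "\<omega> \<in> rforms m A q \<Longrightarrow> rform m \<omega> = \<omega>"
  unfolding rform_def using red_id[OF m2] rforms_FR[OF m2] by blast

lemma formEqJ_iff:
  "(\<And>I. \<omega> I \<in> AB m) \<Longrightarrow> (\<And>I. \<eta> I \<in> AB m) \<Longrightarrow> formEqJ m \<omega> \<eta> \<longleftrightarrow> rform m \<omega> = rform m \<eta>"
  unfolding formEqJ_def rform_def using eqJ_iff[OF m2] by (simp add: fun_eq_iff[of "\<lambda>I. red m (\<omega> I)"])

lemma rform_zero: "rform m (\<lambda>_ _. 0) = (\<lambda>_ _. 0)"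
  by (simp add: rform_def red_apply[OF m2] fun_eq_iff)

lemma zero_rforms: "(\<lambda>_ _. 0) \<in> rforms m A q"
  by (rule rformsI[OF m2]) (auto intro: FR_intros)

lemma cocycle_iff:
  assumes "\<omega> \<in> formsOn m A q" "A \<subseteq> {1..m}"
  shows "formEqJ m (dOn m A \<omega>) (\<lambda>_ _. 0) \<longleftrightarrow> dR m A (rform m \<omega>) = (\<lambda>_ _. 0)"
proof -
  have "formEqJ m (dOn m A \<omega>) (\<lambda>_ _. 0) \<longleftrightarrow> rform m (dOn m A \<omega>) = rform m (\<lambda>_ _. 0)"
    by (rule formEqJ_iff) (use dOn_AB[OF m2 assms] AB_intros(1) in auto)
  also have "rform m (dOn m A \<omega>) = dR m A (rform m \<omega>)"
    unfolding rform_def using red_dOn[OF m2 assms] by auto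
  finally show ?thesis by (simp add: rform_zero)
qed

lemma coboundary_iff:
  assumes "\<omega> \<in> formsOn m A q" "A \<subseteq> {1..m}"
  shows "(\<exists>\<eta>\<in>formsOn m A n. formEqJ m \<omega> (dOn m A \<eta>)) \<longleftrightarrow> (\<exists>\<eta>\<in>rforms m A n. rform m \<omega> = dR m A \<eta>)"
proof -
  have *: "formEqJ m \<omega> (dOn m A \<eta>) \<longleftrightarrow> rform m \<omega> = dR m A (rform m \<eta>)" if "\<eta> \<in> formsOn m A n" for \<eta>
  proof -
    have "formEqJ m \<omega> (dOn m A \<eta>) \<longleftrightarrow> rform m \<omega> = rform m (dOn m A \<eta>)"
      by (rule formEqJ_iff) (use formsOn_AB[OF m2 assms(1)] dOn_AB[OF m2 that assms(2)] in auto)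
    also have "rform m (dOn m A \<eta>) = dR m A (rform m \<eta>)"
      unfolding rform_def using red_dOn[OF m2 that assms(2)] by auto
    finally show ?thesis .
  qed
  show ?thesis
  proof
    assume "\<exists>\<eta>\<in>formsOn m A n. formEqJ m \<omega> (dOn m A \<eta>)"
    then show "\<exists>\<eta>\<in>rforms m A n. rform m \<omega> = dR m A \<eta>" using * rform_rforms by blast
  next
    assume "\<exists>\<eta>\<in>rforms m A n. rform m \<omega> = dR m A \<eta>"
    then obtain \<eta> where \<eta>: "\<eta> \<in> rforms m A n" "rform m \<omega> = dR m A \<eta>" by blast
    then have "formEqJ m \<omega> (dOn m A \<eta>)" using *[OF rforms_formsOn[OF m2 \<eta>(1)]] rform_id[OF \<eta>(1)] by simp
    then show "\<exists>\<eta>\<in>formsOn m A n. formEqJ m \<omega> (dOn m A \<eta>)" using rforms_formsOn[OF m2 \<eta>(1)] by blast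
  qed
qed

lemma Hcocycles_iff: "\<omega> \<in> Hcocycles m q \<longleftrightarrow> \<omega> \<in> formsOn m (Mset m) q \<and> dR m (Mset m) (rform m \<omega>) = (\<lambda>_ _. 0)"
  unfolding Hcocycles_def using cocycle_iff[of \<omega> "Mset m" q] Mset_ins(3) by auto

lemma Tcocycles_iff: "\<omega> \<in> Tcocycles m q \<longleftrightarrow> \<omega> \<in> formsOn m (Nset m) q \<and> dR m (Nset m) (rform m \<omega>) = (\<lambda>_ _. 0)"
  unfolding Tcocycles_def using cocycle_iff[of \<omega> "Nset m" q] N_props(2) by auto

lemma Hcobound_iff: "0 < q \<Longrightarrow> \<omega> \<in> Hcobound m q \<longleftrightarrow> \<omega> \<in> formsOn m (Mset m) q \<and> (\<exists>\<eta>\<in>rforms m (Mset m) (q - 1). rform m \<omega> = dR m (Mset m) \<eta>)"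
  unfolding Hcobound_def using coboundary_iff[of \<omega> "Mset m" q "q - 1"] Mset_ins(3) by auto

lemma Tcobound_iff: "0 < q \<Longrightarrow> \<omega> \<in> Tcobound m q \<longleftrightarrow> \<omega> \<in> formsOn m (Nset m) q \<and> (\<exists>\<eta>\<in>rforms m (Nset m) (q - 1). rform m \<omega> = dR m (Nset m) \<eta>)"
  unfolding Tcobound_def using coboundary_iff[of \<omega> "Nset m" q "q - 1"] N_props(2) by auto

lemma dR_rforms:
  assumes \<omega>: "\<omega> \<in> rforms m A q" and A: "finite A" "A \<subseteq> {1..m}" shows "dR m A \<omega> \<in> rforms m A (Suc q)"
proof (rule rformsI[OF m2])
  fix I show "dR m A \<omega> I \<in> FR m" using dR_FR[OF m2 \<omega> A(2)] .
  assume I: "\<not> (I \<subseteq> A \<and> card I = Suc q)"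
  show "dR m A \<omega> I = (\<lambda>_. 0)"
  proof (cases "I \<subseteq> A")
    case True
    have "\<omega> (I - {\<mu>}) = (\<lambda>_. 0)" if "\<mu> \<in> I" for \<mu>
    proof -
      have "finite I" using True A finite_subset by blast
      then have "Suc (card (I - {\<mu>})) = card I" using that by (rule card_Suc_Diff1)
      then have "card (I - {\<mu>}) \<noteq> q" using I True by auto
      then show ?thesis using rforms_zero[OF m2 \<omega>] by blast
    qed
    then show ?thesis using True by (simp add: dR_def Db_const[OF m2])
  qed (simp add: dR_def)
qed

lemma top_closed:
  assumes \<omega>: "\<omega> \<in> rforms m A q" and A: "finite A" "A \<subseteq> {1..m}" "card A \<le> q"
  shows "dR m A \<omega> = (\<lambda>_ _. 0)"
proof
  fix I
  have "card I \<noteq> Suc q" if "I \<subseteq> A" using card_mono[OF A(1) that] A(3) by simp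
  then show "dR m A \<omega> I = (\<lambda>_. 0)" using rforms_zero[OF m2 dR_rforms[OF \<omega> A(1,2)]] by blast
qed

lemma N_exact_iff:
  assumes "\<theta> \<in> rforms m (Nset m) (m - 1)"
  shows "(\<exists>\<eta>\<in>rforms m (Nset m) (m - 1 - 1). \<theta> = dR m (Nset m) \<eta>) \<longleftrightarrow> Ef m 2 (grad (\<theta> (Nset m))) = (\<lambda>_ _. 0)"
proof -
  have n: "m - 1 = Suc (m - 1 - 1)" using m2 by simp
  have "(\<exists>\<eta>\<in>rforms m (Nset m) (m - 1 - 1). \<theta> = dR m (Nset m) \<eta>) \<longleftrightarrow> divs m (Nset m) (\<theta> (Nset m))"
    by (rule top_exact_iff[OF m2 N_props(1,2)]) (use n N_props(5) assms in auto)
  also have "\<dots> \<longleftrightarrow> Ef m 2 (grad (\<theta> (Nset m))) = (\<lambda>_ _. 0)"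
    unfolding Mset_ins(2) by (rule divs_iff[OF m2 rforms_FR[OF m2 assms] _ m2]) simp
  finally show ?thesis .
qed

lemma Db1_rforms:
  assumes "\<theta> \<in> rforms m A q" shows "(\<lambda>I. Db m 1 (\<theta> I)) \<in> rforms m A q"
  by (rule rformsI[OF m2]) (use rforms_FR[OF m2 assms] rforms_zero[OF m2 assms] Db_FR[OF m2] m2 in \<open>auto simp: Db_const[OF m2]\<close>)

lemma upper_rform: "upper b A (rform m \<omega>) = rform m (upper b A \<omega>)"
  by (auto simp: upper_def rform_def red_apply[OF m2] fun_eq_iff)

lemma formsOnI:
  "(\<And>I. \<omega> I \<in> AB m) \<Longrightarrow> (\<And>I. \<not> (I \<subseteq> A \<and> card I = q) \<Longrightarrow> \<omega> I = (\<lambda>_. 0)) \<Longrightarrow> \<omega> \<in> formsOn m A q"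
  by (auto simp: formsOn_def)

lemma formsOn_zero: "\<omega> \<in> formsOn m A q \<Longrightarrow> \<not> (I \<subseteq> A \<and> card I = q) \<Longrightarrow> \<omega> I = (\<lambda>_. 0)"
  unfolding formsOn_def by blast

lemma lower_formsOn: "\<omega> \<in> formsOn m (Mset m) q \<Longrightarrow> lower (Nset m) \<omega> \<in> formsOn m (Nset m) q"
  using Mset_ins(1) by (intro formsOnI) (auto simp: lower_def AB_intros intro: formsOn_AB[OF m2] formsOn_zero)

lemma upper_formsOn:
  assumes "\<omega> \<in> formsOn m (Mset m) m" shows "upper 1 (Nset m) \<omega> \<in> formsOn m (Nset m) (m - 1)"
proof (rule formsOnI)
  fix I
  show "upper 1 (Nset m) \<omega> I \<in> AB m" using formsOn_AB[OF m2 assms] by (simp add: upper_def AB_intros)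
  assume I: "\<not> (I \<subseteq> Nset m \<and> card I = m - 1)"
  show "upper 1 (Nset m) \<omega> I = (\<lambda>_. 0)"
  proof (cases "I \<subseteq> Nset m")
    case True
    have "finite I" "1 \<notin> I" using True N_props(1,3) finite_subset[of I "Nset m"] by auto
    then have "card (insert 1 I) \<noteq> m" using I True by auto
    then show ?thesis using formsOn_zero[OF assms] by (simp add: upper_def)
  qed (simp add: upper_def)
qed

lemma fadd_formsOn: "\<omega> \<in> formsOn m A q \<Longrightarrow> \<eta> \<in> formsOn m A q \<Longrightarrow> fadd \<omega> (fscale a \<eta>) \<in> formsOn m A q"
  unfolding fadd_def fscale_def
  by (rule formsOnI) (auto intro!: AB_intros intro: formsOn_AB[OF m2] simp: formsOn_zero)

lemma rform_fadd: "rform m (fadd \<omega> \<eta>) = fadd (rform m \<omega>) (rform m \<eta>)" "rform m (fscale a \<omega>) = fscale a (rform m \<omega>)"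
  by (auto simp: fadd_def fscale_def rform_def red_apply[OF m2] fun_eq_iff)

lemma fadd_rform_zero: "\<omega> \<in> formsOn m A q \<Longrightarrow> rform m (fadd \<omega> (fscale (-1) (rform m \<omega>))) = (\<lambda>_ _. 0)"
  unfolding rform_fadd rform_id[OF rform_rforms] by (simp add: fadd_def fscale_def)

text \<open>Injectivity of restriction to forms without dx^1: in degree m - 1 the cone obstruction
  sits in degree m - 2 over the directions 2 to m, where it vanishes. Exactness of the lower part,
  which \<open>N_exact_iff\<close> detects by variational derivatives, is all that is left.\<close>

lemma H_top_exact_iff:
  assumes \<omega>: "\<omega> \<in> Hcocycles m (m - 1)"
  shows "\<omega> \<in> Hcobound m (m - 1) \<longleftrightarrow> Ef m 2 (grad (red m (\<omega> (Nset m)))) = (\<lambda>_ _. 0)"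
proof -
  have f: "\<omega> \<in> formsOn m (Mset m) (m - 1)" and c: "dR m (Mset m) (rform m \<omega>) = (\<lambda>_ _. 0)"
    using \<omega> Hcocycles_iff by auto
  have r: "rform m \<omega> \<in> rforms m (Mset m) (m - 1)" using rform_rforms[OF f] .
  have low: "lower (Nset m) (rform m \<omega>) \<in> rforms m (Nset m) (m - 1)"
    using lower_rforms[OF m2 r[unfolded Mset_ins(1)]] .
  have q: "0 < m - 1" "m - 1 = Suc (m - 1 - 1)" using m2 by auto
  have "(\<exists>\<eta>\<in>rforms m (Mset m) (m - 1 - 1). rform m \<omega> = dR m (Mset m) \<eta>) \<longleftrightarrow>
      (\<exists>\<eta>\<in>rforms m (Nset m) (m - 1 - 1). lower (Nset m) (rform m \<omega>) = dR m (Nset m) \<eta>)"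
  proof
    assume "\<exists>\<eta>\<in>rforms m (Mset m) (m - 1 - 1). rform m \<omega> = dR m (Mset m) \<eta>"
    then obtain \<eta> where \<eta>: "\<eta> \<in> rforms m (Mset m) (m - 1 - 1)" "rform m \<omega> = dR m (Mset m) \<eta>" by blast
    have "lower (Nset m) (rform m \<omega>) = dR m (Nset m) (lower (Nset m) \<eta>)"
    proof
      fix I
      show "lower (Nset m) (rform m \<omega>) I = dR m (Nset m) (lower (Nset m) \<eta>) I"
      proof (cases "I \<subseteq> Nset m")
        case True
        have "dR m (Nset m) (lower (Nset m) \<eta>) I = dR m (Nset m) \<eta> I"
          by (rule dR_cong[OF m2]) (use True in \<open>auto simp: lower_def\<close>)
        then show ?thesis using True \<eta>(2) dR_lower[OF m2 True, of 1 \<eta>] by (simp add: lower_def Mset_ins(1))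
      qed (simp add: lower_def dR_def)
    qed
    then show "\<exists>\<eta>\<in>rforms m (Nset m) (m - 1 - 1). lower (Nset m) (rform m \<omega>) = dR m (Nset m) \<eta>"
      using lower_rforms[OF m2 \<eta>(1)[unfolded Mset_ins(1)]] by blast
  next
    assume "\<exists>\<eta>\<in>rforms m (Nset m) (m - 1 - 1). lower (Nset m) (rform m \<omega>) = dR m (Nset m) \<eta>"
    then obtain \<eta> where \<eta>: "\<eta> \<in> rforms m (Nset m) (m - 1 - 1)" "lower (Nset m) (rform m \<omega>) = dR m (Nset m) \<eta>" by blast
    show "\<exists>\<eta>\<in>rforms m (Mset m) (m - 1 - 1). rform m \<omega> = dR m (Mset m) \<eta>"
      unfolding Mset_ins(3)
      by (rule cone_exact_1[OF m2 _ _ _ \<eta>[unfolded Mset_ins(2)]]) (use r c q Mset_ins(3) in auto)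
  qed
  also have "\<dots> \<longleftrightarrow> Ef m 2 (grad (lower (Nset m) (rform m \<omega>) (Nset m))) = (\<lambda>_ _. 0)"
    by (rule N_exact_iff[OF low])
  finally show ?thesis unfolding Hcobound_iff[OF q(1)] using f by (simp add: lower_def rform_def)
qed

lemma H_divs:
  assumes \<omega>: "\<omega> \<in> Hcocycles m (m - 1)"
  shows "Ef m 2 (grad (Db m 1 (red m (\<omega> (Nset m))))) = (\<lambda>_ _. 0)"
proof -
  have f: "\<omega> \<in> formsOn m (Mset m) (m - 1)" and c: "dR m (Mset m) (rform m \<omega>) = (\<lambda>_ _. 0)"
    using \<omega> Hcocycles_iff by auto
  have r: "rform m \<omega> \<in> rforms m (insert 1 {2..m}) (Suc m - 2)"
    using rform_rforms[OF f] Mset_ins by (simp add: numeral_2_eq_2)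
  have "divs m {2..m} (Db m 1 (rform m \<omega> {2..m}))"
    by (rule Db_top_closed[OF m2 _ m2 _ r]) (use c Mset_ins in auto)
  moreover have "Db m 1 (rform m \<omega> {2..m}) \<in> FR m"
    using rforms_FR[OF m2 rform_rforms[OF f]] m2 by (intro Db_FR[OF m2]) auto
  ultimately show ?thesis
    using divs_iff[OF m2 _ _ m2, of "Db m 1 (rform m \<omega> {2..m})"] by (simp add: rform_def Mset_ins(2))
qed

text \<open>Converse to \<open>H_divs\<close>: a primitive \<zeta> of
  \<open>D\<^sub>1 \<theta>\<close> serves as the dx^1 component, and \<theta> itself is closed over
  \<open>Nset m\<close> for reasons of degree.\<close>

lemma H_extend:
  assumes \<theta>: "\<theta> \<in> rforms m (Nset m) (m - 1)" and E: "Ef m 2 (grad (Db m 1 (\<theta> (Nset m)))) = (\<lambda>_ _. 0)"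
  shows "\<exists>\<omega>\<in>Hcocycles m (m - 1). lower (Nset m) \<omega> = \<theta>"
proof -
  let ?N = "Nset m"
  have "\<exists>\<zeta>\<in>rforms m ?N (m - 1 - 1). (\<lambda>I. Db m 1 (\<theta> I)) = dR m ?N \<zeta>"
    using N_exact_iff[OF Db1_rforms[OF \<theta>]] E by simp
  then obtain \<zeta> where \<zeta>: "\<zeta> \<in> rforms m ?N (m - 1 - 1)" "\<And>I. Db m 1 (\<theta> I) = dR m ?N \<zeta> I" by (metis (no_types))
  let ?w = "jn 1 ?N \<theta> \<zeta>"
  have w: "?w \<in> rforms m (Mset m) (m - 1)"
    unfolding Mset_ins(1) by (rule jn_rforms[OF m2 \<theta> _ N_props(3,1)]) (use \<zeta>(1) m2 in auto)
  have dth: "dR m ?N \<theta> = (\<lambda>_ _. 0)" by (rule top_closed[OF \<theta> N_props(1,2)]) (simp add: N_props(5))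
  have "dR m (Mset m) ?w = (\<lambda>_ _. 0)"
    unfolding Mset_ins(1)
  proof (rule insert_form_eqI[OF m2, of ?N _ _ 1])
    fix I assume I: "I \<subseteq> ?N"
    have "dR m (insert 1 ?N) ?w I = dR m ?N \<theta> I"
      unfolding dR_lower[OF m2 I] by (rule dR_cong[OF m2], rule jn_simps(1)[OF m2 N_props(3)]) (use I in blast)
    then show "dR m (insert 1 ?N) ?w I = (\<lambda>_. 0)" using dth by simp
    have "dR m ?N (\<lambda>J. ?w (insert 1 J)) I = dR m ?N \<zeta> I"
      by (rule dR_cong[OF m2], rule jn_simps(2)[OF m2 N_props(3)]) (use I in blast)
    moreover have up: "dR m (insert 1 ?N) ?w (insert 1 I) = (\<lambda>y. Db m 1 (?w I) y - dR m ?N (\<lambda>J. ?w (insert 1 J)) I y)"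
      by (rule dR_upper[OF m2 I N_props(1)]) (rule N_props(4))
    ultimately show "dR m (insert 1 ?N) ?w (insert 1 I) = (\<lambda>_. 0)"
      unfolding up jn_simps(1)[OF m2 N_props(3) I] \<zeta>(2) by simp
  qed (simp add: dR_def)
  then have "?w \<in> Hcocycles m (m - 1)"
    unfolding Hcocycles_iff using rforms_formsOn[OF m2 w] rform_id[OF w] by simp
  moreover have "lower ?N ?w = \<theta>"
    using rforms_zero[OF m2 \<theta>] by (auto simp: lower_def jn_def fun_eq_iff)
  ultimately show ?thesis by blast
qed

end

text \<open>The variational derivatives of a representative as one family on coordinates, the form
  in which the operators on \<open>fams\<close> apply; \<open>vdfam_eq\<close> compares it with the
  tuple \<open>vdfam\<close>.\<close>

definition vfam :: "nat \<Rightarrow> fn \<Rightarrow> var \<Rightarrow> fn" where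
  "vfam m L = Ef m 2 (grad (red m L))"

section \<open>Families of variational derivatives and their classes\<close>

context
  fixes m :: nat
  assumes m2: "2 \<le> m"
begin

lemma Rf_cmult:
  assumes \<alpha>: "2 \<le> \<alpha>" "\<alpha> \<le> m" and \<phi>: "\<phi> \<in> fams m"
  shows "(\<lambda>v y. a * \<phi> v y) \<in> fams m" "Rf m \<alpha> (\<lambda>v y. a * \<phi> v y) = (\<lambda>v y. a * Rf m \<alpha> \<phi> v y)"
proof -
  show f: "(\<lambda>v y. a * \<phi> v y) \<in> fams m"
    by (rule famsI[OF fams_finite[OF \<phi>]])
      (auto simp: fams_X[OF \<phi>] fams_nonfree[OF \<phi>] intro!: FR_intros fams_FR[OF \<phi>])
  have "Tl m \<alpha> (\<lambda>v y. a * \<phi> v y) v = (\<lambda>y. a * Tl m \<alpha> \<phi> v y)" for v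
  proof (rule Tl_unique[OF m2 \<alpha> f])
    fix v show "(\<lambda>y. a * Tl m \<alpha> \<phi> v y) = (\<lambda>y. a * \<phi> v y - Db m \<alpha> (\<lambda>y. a * Tl m \<alpha> \<phi> (shiftv \<alpha> v) y) y)"
      unfolding Db_cmult[OF m2 Tl_FR[OF m2 \<alpha> \<phi>]]
      by (subst Tl_rec[OF m2 \<alpha> \<phi>, of v]) (simp add: right_diff_distrib)
  next
    obtain K where "\<forall>v. \<forall>k\<ge>K. \<phi> ((shiftv \<alpha> ^^ k) v) = (\<lambda>_. 0)" using fams_bound[OF \<phi>] by blast
    from Tl_vanish[OF m2 \<alpha> this]
    show "\<exists>K. \<forall>v. \<forall>k\<ge>K. (\<lambda>y. a * Tl m \<alpha> \<phi> ((shiftv \<alpha> ^^ k) v) y) = (\<lambda>_. 0)"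
      by (intro exI[of _ K]) simp
  qed
  then show "Rf m \<alpha> (\<lambda>v y. a * \<phi> v y) = (\<lambda>v y. a * Rf m \<alpha> \<phi> v y)" by (auto simp: Rf_def fun_eq_iff)
qed

lemma Ef_cmult:
  assumes "\<phi> \<in> fams m" shows "Ef m 2 (\<lambda>v y. a * \<phi> v y) = (\<lambda>v y. a * Ef m 2 \<phi> v y)"
proof -
  have "foldr (Rf m) xs \<phi> \<in> fams m \<and> foldr (Rf m) xs (\<lambda>v y. a * \<phi> v y) = (\<lambda>v y. a * foldr (Rf m) xs \<phi> v y)"
    if "set xs \<subseteq> {2..m}" for xs
    using that
  proof (induction xs)
    case (Cons x xs)
    then show ?case using Rf_cmult(2)[of x "foldr (Rf m) xs \<phi>" a] Rf_fams[OF m2, of x "foldr (Rf m) xs \<phi>"] by simp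
  qed (use assms in simp)
  moreover have "set [2..<Suc m] \<subseteq> {2..m}" by auto
  ultimately show ?thesis unfolding Ef_def by blast
qed

lemma vfam_fams: "L \<in> AB m \<Longrightarrow> vfam m L \<in> fams m"
  unfolding vfam_def by (intro Ef_fams[OF m2] grad_fams[OF m2] red_FR[OF m2])

lemma vdfam_eq:
  assumes "L \<in> AB m"
  shows "vdfam m L = (vfam m L (U 1 (\<lambda>_. 0)), \<lambda>k \<alpha>. if \<alpha> \<in> Nset m then vfam m L (U \<alpha> (at1 k)) else (\<lambda>_. 0),
      vfam m L (P (\<lambda>_. 0)), vfam m L (P (at1 1)))"
  unfolding vdfam_def vfam_def
  using vder_eq[OF m2 assms] base_vars[OF m2] by (auto simp: fun_eq_iff simp del: Nset_iff)

lemma fams_at1_bound: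
  assumes "\<phi> \<in> fams m" shows "\<exists>K. \<forall>k\<ge>K. \<forall>\<alpha>. \<phi> (U \<alpha> (at1 k)) = (\<lambda>_. 0)"
proof (intro exI allI impI)
  let ?M = "Max (insert 0 (idx 1 ` {v. \<phi> v \<noteq> (\<lambda>_. 0)}))"
  fix k \<alpha> assume k: "Suc ?M \<le> k"
  show "\<phi> (U \<alpha> (at1 k)) = (\<lambda>_. 0)"
  proof (rule ccontr)
    assume "\<phi> (U \<alpha> (at1 k)) \<noteq> (\<lambda>_. 0)"
    then have "idx 1 (U \<alpha> (at1 k)) \<le> ?M" using fams_finite[OF assms] by (intro Max_ge) auto
    moreover have "idx 1 (U \<alpha> (at1 k)) = k" by (simp add: idx_def at1_def)
    ultimately show False using k by simp
  qed
qed

lemma fv_apply: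
  assumes c: "\<And>k \<alpha>. K \<le> k \<Longrightarrow> \<alpha> \<in> Nset m \<Longrightarrow> c k \<alpha> = (\<lambda>_. 0)"
  shows "fv m K u c p0 p1 (U 1 (\<lambda>_. 0)) = u" "fv m K u c p0 p1 (P (\<lambda>_. 0)) = p0" "fv m K u c p0 p1 (P (at1 1)) = p1"
    "\<alpha> \<in> Nset m \<Longrightarrow> fv m K u c p0 p1 (U \<alpha> (at1 k)) = c k \<alpha>"
    "\<not> base_var m v \<Longrightarrow> fv m K u c p0 p1 v = (\<lambda>_. 0)"
proof -
  note ne = at1_simps(4)[of 0 1, unfolded at1_simps(1)] at1_simps(4)[of 1 0, unfolded at1_simps(1)]
  have [simp]: "U (Suc 0) (\<lambda>_. 0) = U \<alpha> i \<longleftrightarrow> False" if "\<alpha> \<in> Nset m" for \<alpha> i using that by auto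
  show "fv m K u c p0 p1 (U 1 (\<lambda>_. 0)) = u"
    by (simp add: fv_def single_apply fun_eq_iff)
  show "fv m K u c p0 p1 (P (\<lambda>_. 0)) = p0" "fv m K u c p0 p1 (P (at1 1)) = p1"
    using ne unfolding fv_def single_apply by (auto intro!: ext)
  show "fv m K u c p0 p1 (U \<alpha> (at1 k)) = c k \<alpha>" if a: "\<alpha> \<in> Nset m"
  proof
    fix y
    have "(\<Sum>\<beta>\<in>Nset m. \<Sum>j<K. single (U \<beta> (at1 j)) (c j \<beta>) (U \<alpha> (at1 k)) y) = (\<Sum>\<beta>\<in>Nset m. if \<alpha> = \<beta> then (\<Sum>j<K. if k = j then c j \<beta> y else 0) else 0)"
      by (intro sum.cong refl) (auto simp: single_apply at1_simps(4))
    also have "\<dots> = (if k < K then c k \<alpha> y else 0)" using a by simp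
    also have "\<dots> = c k \<alpha> y" using c[of k \<alpha>] a by auto
    finally show "fv m K u c p0 p1 (U \<alpha> (at1 k)) y = c k \<alpha> y" using a by (simp add: fv_def single_apply)
  qed
  show "fv m K u c p0 p1 v = (\<lambda>_. 0)" if v: "\<not> base_var m v"
  proof
    fix y
    have "v \<noteq> U 1 (\<lambda>_. 0)" "v \<noteq> P (\<lambda>_. 0)" "v \<noteq> P (at1 1)" "\<And>\<alpha> k. \<alpha> \<in> Nset m \<Longrightarrow> v \<noteq> U \<alpha> (at1 k)"
      using v base_vars[OF m2] by auto
    then show "fv m K u c p0 p1 v y = 0" by (simp add: fv_def single_apply)
  qed
qed

lemma fv_vfam:
  assumes L: "L \<in> AB m" and K: "\<And>k \<alpha>. K \<le> k \<Longrightarrow> \<alpha> \<in> Nset m \<Longrightarrow> vfam m L (U \<alpha> (at1 k)) = (\<lambda>_. 0)"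
    and c: "\<And>k \<alpha>. \<alpha> \<in> Nset m \<Longrightarrow> c k \<alpha> = vfam m L (U \<alpha> (at1 k))"
  shows "fv m K (vfam m L (U 1 (\<lambda>_. 0))) c (vfam m L (P (\<lambda>_. 0))) (vfam m L (P (at1 1))) = vfam m L"
proof
  fix v
  have c0: "\<And>k \<alpha>. K \<le> k \<Longrightarrow> \<alpha> \<in> Nset m \<Longrightarrow> c k \<alpha> = (\<lambda>_. 0)" using K c by simp
  have f: "fv m K u c p0 p1 (U 1 (\<lambda>_. 0)) = u" "fv m K u c p0 p1 (P (\<lambda>_. 0)) = p0" "fv m K u c p0 p1 (P (at1 1)) = p1"
    "\<And>\<alpha> k. \<alpha> \<in> Nset m \<Longrightarrow> fv m K u c p0 p1 (U \<alpha> (at1 k)) = c k \<alpha>"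
    "\<And>v. \<not> base_var m v \<Longrightarrow> fv m K u c p0 p1 v = (\<lambda>_. 0)" for u p0 p1
    by (rule fv_apply; use c0 in blast)+
  show "fv m K (vfam m L (U 1 (\<lambda>_. 0))) c (vfam m L (P (\<lambda>_. 0))) (vfam m L (P (at1 1))) v = vfam m L v"
  proof (cases "base_var m v")
    case True
    then consider "v = U 1 (\<lambda>_. 0)" | \<alpha> k where "\<alpha> \<in> Nset m" "v = U \<alpha> (at1 k)" | "v = P (\<lambda>_. 0)" | "v = P (at1 1)"
      using base_var_iff[OF m2, of v] unfolding at1_simps(1) by blast
    then show ?thesis using f(1-4) c by cases simp_all
  next
    case False
    then have "vfam m L v = (\<lambda>_. 0)"
      unfolding vfam_def using L by (intro Ef_nonbase[OF m2] grad_fams[OF m2] red_FR[OF m2])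
    then show ?thesis using f(5)[OF False] by simp
  qed
qed

lemma vdfam_Fams:
  assumes "L \<in> AB m" shows "vdfam m L \<in> Fams m"
proof -
  have AB: "vfam m L v \<in> AB m" for v using FR_AB[OF fams_FR[OF vfam_fams[OF assms]]] .
  obtain K where K: "\<forall>k\<ge>K. \<forall>\<alpha>. vfam m L (U \<alpha> (at1 k)) = (\<lambda>_. 0)" using fams_at1_bound[OF vfam_fams[OF assms]] by blast
  have z: "eqJ m (\<lambda>_. 0) (\<lambda>_. 0)" using eqJ_iff[OF m2 AB_intros(1) AB_intros(1)] by simp
  have "\<exists>K. \<forall>k\<ge>K. \<forall>\<alpha>\<in>Nset m. eqJ m (if \<alpha> \<in> Nset m then vfam m L (U \<alpha> (at1 k)) else (\<lambda>_. 0)) (\<lambda>_. 0)"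
    using K z by (intro exI[of _ K]) simp
  then show ?thesis unfolding vdfam_eq[OF assms] Fams_def using AB by (simp del: Nset_iff)
qed

lemma vdfam_Hspace: "L \<in> AB m \<Longrightarrow> vdfam m L \<in> Hspace m"
proof -
  assume L: "L \<in> AB m"
  have "eqJ m f f" for f by (simp add: eqJ_def Jid_zero[OF m2])
  then have "famEqJ m (vdfam m L) (vdfam m L)" by (simp add: famEqJ_def split: prod.split)
  then show ?thesis using vdfam_Fams[OF L] L by (auto simp: Hspace_def)
qed

text \<open>For a family that represents the variational derivatives of \<open>L\<close>, the linear
  system says that those of \<open>D\<^sub>1 L\<close> vanish, hence that \<open>D\<^sub>1 L\<close>
  is a divergence in the directions 2 to m. This is also the condition under which \<open>L\<close>
  extends to a closed form.\<close>

lemma vdfam_Sspace_iff: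
  assumes L: "L \<in> AB m" and F: "ch \<in> Fams m" and e: "famEqJ m ch (vdfam m L)"
  shows "ch \<in> Sspace m \<longleftrightarrow> Ef m 2 (grad (Db m 1 (red m L))) = (\<lambda>_ _. 0)"
proof -
  obtain u c p0 p1 where ch: "ch = (u, c, p0, p1)" by (cases ch) auto
  have AB: "u \<in> AB m" "p0 \<in> AB m" "p1 \<in> AB m" "\<And>k \<alpha>. \<alpha> \<in> Nset m \<Longrightarrow> c k \<alpha> \<in> AB m"
    using F by (auto simp: Fams_def ch)
  have vFR: "vfam m L v \<in> FR m" for v using fams_FR[OF vfam_fams[OF L]] .
  have r: "eqJ m f (vfam m L v) \<longleftrightarrow> red m f = vfam m L v" if "f \<in> AB m" for f v
    using eqJ_iff[OF m2 that FR_AB[OF vFR]] red_id[OF m2 vFR] by simp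
  have eq: "red m u = vfam m L (U 1 (\<lambda>_. 0))" "red m p0 = vfam m L (P (\<lambda>_. 0))" "red m p1 = vfam m L (P (at1 1))"
    "\<And>k \<alpha>. \<alpha> \<in> Nset m \<Longrightarrow> red m (c k \<alpha>) = vfam m L (U \<alpha> (at1 k))"
    using e AB unfolding vdfam_eq[OF L] famEqJ_def ch by (auto simp: r simp del: Nset_iff)
  obtain K where K: "\<forall>k\<ge>K. \<forall>\<alpha>. vfam m L (U \<alpha> (at1 k)) = (\<lambda>_. 0)" using fams_at1_bound[OF vfam_fams[OF L]] by blast
  have "ch \<in> Sspace m \<longleftrightarrow> Ef m 2 (Ds1 m (fv m K (red m u) (\<lambda>k \<alpha>. red m (c k \<alpha>)) (red m p0) (red m p1))) = (\<lambda>_ _. 0)"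
    unfolding ch by (rule Sspace_iff[OF m2 F[unfolded ch]]) (use K eq(4) in simp)
  also have "fv m K (red m u) (\<lambda>k \<alpha>. red m (c k \<alpha>)) (red m p0) (red m p1) = vfam m L"
    unfolding eq(1-3) by (rule fv_vfam[OF L]) (use K eq(4) in auto)
  also have "Ef m 2 (Ds1 m (vfam m L)) = Ef m 2 (grad (Db m 1 (red m L)))"
    unfolding vfam_def using Ef_Db1[OF m2 red_FR[OF m2 L]] by simp
  finally show ?thesis .
qed

lemma vdfam_zero_iff:
  assumes L: "L \<in> AB m"
  shows "famEqJ m (vdfam m L) (\<lambda>_. 0, \<lambda>_ _ _. 0, \<lambda>_. 0, \<lambda>_. 0) \<longleftrightarrow> vfam m L = (\<lambda>_ _. 0)"
proof
  have vFR: "vfam m L v \<in> FR m" for v using fams_FR[OF vfam_fams[OF L]] .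
  have r: "eqJ m (vfam m L v) (\<lambda>_. 0) \<longleftrightarrow> vfam m L v = (\<lambda>_. 0)" for v
    using eqJ_zero_iff[OF m2 FR_AB[OF vFR]] red_id[OF m2 vFR] by simp
  assume e: "famEqJ m (vdfam m L) (\<lambda>_. 0, \<lambda>_ _ _. 0, \<lambda>_. 0, \<lambda>_. 0)"
  show "vfam m L = (\<lambda>_ _. 0)"
  proof
    fix v
    show "vfam m L v = (\<lambda>_. 0)"
    proof (cases "base_var m v")
      case True
      then consider "v = U 1 (\<lambda>_. 0)" | \<alpha> k where "\<alpha> \<in> Nset m" "v = U \<alpha> (at1 k)" | "v = P (\<lambda>_. 0)" | "v = P (at1 1)"
        using base_var_iff[OF m2, of v] unfolding at1_simps(1) by blast
      then show ?thesis
        using e unfolding vdfam_eq[OF L] famEqJ_def by cases (auto simp: r simp del: Nset_iff)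
    next
      case False
      then show ?thesis
        unfolding vfam_def using L by (intro Ef_nonbase[OF m2] grad_fams[OF m2] red_FR[OF m2])
    qed
  qed
next
  assume "vfam m L = (\<lambda>_ _. 0)"
  moreover have "eqJ m (\<lambda>_. 0) (\<lambda>_. 0)" by (simp add: eqJ_def Jid_zero[OF m2])
  ultimately show "famEqJ m (vdfam m L) (\<lambda>_. 0, \<lambda>_ _ _. 0, \<lambda>_. 0, \<lambda>_. 0)"
    unfolding vdfam_eq[OF L] famEqJ_def by simp
qed

lemma vfam_red: "L \<in> AB m \<Longrightarrow> vfam m (red m L) = vfam m L"
  unfolding vfam_def using red_id[OF m2 red_FR[OF m2]] by simp

lemma vdfam_red: "L \<in> AB m \<Longrightarrow> vdfam m (red m L) = vdfam m L"
  by (simp add: vdfam_eq red_AB[OF m2] vfam_red cong: if_cong)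

lemma vfam_linear:
  assumes "L \<in> AB m" "L' \<in> AB m"
  shows "vfam m (\<lambda>y. L y + L' y) = (\<lambda>v y. vfam m L v y + vfam m L' v y)"
    "vfam m (\<lambda>y. a * L y) = (\<lambda>v y. a * vfam m L v y)"
proof -
  note r = red_FR[OF m2 assms(1)] and r' = red_FR[OF m2 assms(2)]
  have "red m (\<lambda>y. L y + L' y) = (\<lambda>y. red m L y + red m L' y)" by (simp add: red_apply[OF m2] fun_eq_iff)
  then show "vfam m (\<lambda>y. L y + L' y) = (\<lambda>v y. vfam m L v y + vfam m L' v y)"
    unfolding vfam_def using grad_add[OF m2 r r'] Ef_add[OF m2 grad_fams[OF m2 r] grad_fams[OF m2 r']] by simp
  have "red m (\<lambda>y. a * L y) = (\<lambda>y. a * red m L y)" by (simp add: red_apply[OF m2] fun_eq_iff)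
  moreover have "grad (\<lambda>y. a * red m L y) = (\<lambda>v y. a * grad (red m L) v y)"
    using r unfolding FR_def by (intro ext) (rule grad_linear(3))
  ultimately show "vfam m (\<lambda>y. a * L y) = (\<lambda>v y. a * vfam m L v y)"
    unfolding vfam_def using Ef_cmult[OF grad_fams[OF m2 r]] by simp
qed

lemma vdfam_linear:
  assumes "L \<in> AB m" "L' \<in> AB m"
  shows "vdfam m (\<lambda>y. L y + L' y) = famadd (vdfam m L) (vdfam m L')"
    "vdfam m (\<lambda>y. a * L y) = famscale a (vdfam m L)"
  using assms by (auto simp: vdfam_eq AB_intros vfam_linear famadd_def famscale_def fun_eq_iff)

lemma Fams_comb:
  assumes "x \<in> Fams m" "z \<in> Fams m" and e: "famEqJ m x z"
  shows "famadd x (famscale (-1) z) \<in> famZeroJ m"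
proof -
  obtain u c p0 p1 where x: "x = (u, c, p0, p1)" by (cases x) auto
  obtain u' c' p0' p1' where z: "z = (u', c', p0', p1')" by (cases z) auto
  have AB: "u \<in> AB m" "p0 \<in> AB m" "p1 \<in> AB m" "\<And>k \<alpha>. \<alpha> \<in> Nset m \<Longrightarrow> c k \<alpha> \<in> AB m" "\<And>k \<alpha>. \<alpha> \<notin> Nset m \<Longrightarrow> c k \<alpha> = (\<lambda>_. 0)"
    using assms(1) by (auto simp: Fams_def x)
  have AB': "u' \<in> AB m" "p0' \<in> AB m" "p1' \<in> AB m" "\<And>k \<alpha>. \<alpha> \<in> Nset m \<Longrightarrow> c' k \<alpha> \<in> AB m" "\<And>k \<alpha>. \<alpha> \<notin> Nset m \<Longrightarrow> c' k \<alpha> = (\<lambda>_. 0)"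
    using assms(2) by (auto simp: Fams_def z)
  have d: "(\<lambda>y. f y + (-1) * g y) \<in> AB m" if "f \<in> AB m" "g \<in> AB m" for f g using that by (intro AB_intros)
  have q: "eqJ m (\<lambda>y. f y + (-1) * g y) (\<lambda>_. 0)" if "eqJ m f g" for f g using that by (simp add: eqJ_def)
  have e': "eqJ m u u'" "eqJ m p0 p0'" "eqJ m p1 p1'" "\<And>k \<alpha>. \<alpha> \<in> Nset m \<Longrightarrow> eqJ m (c k \<alpha>) (c' k \<alpha>)"
    using e by (auto simp: famEqJ_def x z)
  have eq: "famadd x (famscale (-1) z) = (\<lambda>y. u y + (-1) * u' y, \<lambda>k \<alpha> y. c k \<alpha> y + (-1) * c' k \<alpha> y,
      \<lambda>y. p0 y + (-1) * p0' y, \<lambda>y. p1 y + (-1) * p1' y)"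
    unfolding x z famadd_def famscale_def by simp
  have "\<forall>k. \<forall>\<alpha>\<in>Nset m. eqJ m (\<lambda>y. c k \<alpha> y + (-1) * c' k \<alpha> y) (\<lambda>_. 0)" using q e'(4) by blast
  then show ?thesis
    unfolding famZeroJ_def Fams_def eq famEqJ_def mem_Collect_eq prod.case
    using d[OF AB(1) AB'(1)] d[OF AB(2) AB'(2)] d[OF AB(3) AB'(3)] d[OF AB(4) AB'(4)] AB(5) AB'(5)
      q[OF e'(1)] q[OF e'(2)] q[OF e'(3)] by (intro conjI allI) auto
qed

end

section \<open>The cohomology spaces degree by degree\<close>

context
  fixes m :: nat
  assumes m2: "2 \<le> m"
begin

lemma H_middle:
  assumes q: "1 \<le> q" "q \<le> m - 2" shows "Hcocycles m q \<subseteq> Hcobound m q"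
proof
  fix \<omega> assume "\<omega> \<in> Hcocycles m q"
  then have f: "\<omega> \<in> formsOn m (Mset m) q" and c: "dR m (Mset m) (rform m \<omega>) = (\<lambda>_ _. 0)"
    using Hcocycles_iff[OF m2] by auto
  obtain q' where q': "q = Suc q'" using q by (cases q) auto
  have r: "rform m \<omega> \<in> rforms m (Mset m) (Suc q')" using rform_rforms[OF m2 f] q' by simp
  note r' = r[unfolded Mset_ins(1)[OF m2]] and c' = c[unfolded Mset_ins(1)[OF m2]]
  have "\<exists>\<eta>\<in>rforms m {2..m} q'. lower {2..m} (rform m \<omega>) = dR m {2..m} \<eta>"
    using lower_rforms[OF m2 r'] lower_closed[OF m2 c'] q q' unfolding Mset_ins(2)[OF m2]
    by (intro poincare[OF m2]) auto
  then obtain \<eta> where \<eta>: "\<eta> \<in> rforms m {2..m} q'" "lower {2..m} (rform m \<omega>) = dR m {2..m} \<eta>" by blast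
  have "\<exists>\<eta>\<in>rforms m (Mset m) q'. rform m \<omega> = dR m (Mset m) \<eta>"
    unfolding Mset_ins(3)[OF m2]
    by (rule cone_exact_1[OF m2 _ _ _ \<eta>]) (use r c q q' Mset_ins(3)[OF m2] in auto)
  then show "\<omega> \<in> Hcobound m q" using Hcobound_iff[OF m2, of q \<omega>] f q' by simp
qed

lemma H_above:
  assumes q: "m < q" shows "Hcocycles m q \<subseteq> Hcobound m q"
proof
  fix \<omega> assume "\<omega> \<in> Hcocycles m q"
  then have f: "\<omega> \<in> formsOn m (Mset m) q" using Hcocycles_iff[OF m2] by auto
  have "\<omega> I = (\<lambda>_. 0)" for I
  proof -
    have "card I \<noteq> q" if "I \<subseteq> Mset m"
      using card_mono[OF _ that] q by (auto simp: Mset_def)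
    then show ?thesis using formsOn_zero[OF m2 f] by blast
  qed
  then have "\<omega> = (\<lambda>_ _. 0)" by auto
  then have "rform m \<omega> = dR m (Mset m) (\<lambda>_ _. 0)" using rform_zero[OF m2] dR_zero[OF m2] by simp
  then show "\<omega> \<in> Hcobound m q" using Hcobound_iff[OF m2, of q \<omega>] f q zero_rforms[OF m2] by blast
qed

lemma H_zero:
  assumes "\<omega> \<in> Hcocycles m 0"
  shows "\<exists>c::real. formEqJ m \<omega> (\<lambda>I. if I = {} then (\<lambda>_. c) else (\<lambda>_. 0))"
proof -
  have f: "\<omega> \<in> formsOn m (Mset m) 0" and c: "dR m (Mset m) (rform m \<omega>) = (\<lambda>_ _. 0)"
    using assms Hcocycles_iff[OF m2] by auto
  let ?f = "red m (\<omega> {})"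
  have F: "?f \<in> FR m" using red_FR[OF m2 formsOn_AB[OF m2 f]] .
  have D: "Db m \<mu> ?f = (\<lambda>_. 0)" if "\<mu> \<in> {1..m}" for \<mu>
    using fun_cong[OF c, of "{\<mu>}"] that by (simp add: dR_def sgn_ins_def rform_def Mset_def fun_eq_iff)
  have "?f \<in> smf (X ` ({1..m} - {2..m}))"
    by (rule Db_kernel[OF m2 F]) (use D m2 in auto)
  then have X: "?f \<in> smf (X ` {1})"
    by (rule smf_mono[rotated]) auto
  note X' = Xonly_FR[OF m2 X]
  have "?f \<in> smf {}"
  proof (rule smf_drop[OF X])
    fix v
    show "partial v ?f = (\<lambda>_. 0)"
    proof (cases "v = X 1")
      case True
      then show ?thesis using D[of 1] Db_Xonly[OF m2, of ?f 1] X' m2 by auto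
    next
      case False
      then show ?thesis using smf_partial_outside[OF X] by auto
    qed
  qed
  then have "?f y = ?f (\<lambda>_. 0)" for y by (rule depends_onD[OF smf_depends]) auto
  then have const: "?f = (\<lambda>_. ?f (\<lambda>_. 0))" by auto
  let ?c = "?f (\<lambda>_. 0)"
  have "eqJ m (\<omega> I) (if I = {} then (\<lambda>_. ?c) else (\<lambda>_. 0))" for I
  proof (cases "I = {}")
    case True
    then show ?thesis
      using eqJ_iff[OF m2 formsOn_AB[OF m2 f, of "{}"] AB_intros(1)[of ?c]] const red_id[OF m2 F] by (simp add: red_0[OF m2])
  next
    case False
    have "\<not> (I \<subseteq> Mset m \<and> card I = 0)" using False finite_subset[of I "Mset m"] by (auto simp: Mset_def)
    then have "\<omega> I = (\<lambda>_. 0)" using formsOn_zero[OF m2 f] by blast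
    then show ?thesis using False by (simp add: eqJ_def Jid_zero[OF m2])
  qed
  then show ?thesis unfolding formEqJ_def by blast
qed

lemma H_const:
  assumes "formEqJ m (\<lambda>I. if I = {} then (\<lambda>_. c) else (\<lambda>_. 0)) (\<lambda>_ _. 0)" shows "c = (0::real)"
proof -
  have "eqJ m (\<lambda>_. c) (\<lambda>_. 0)" using assms unfolding formEqJ_def by (metis (full_types))
  then have "red m (\<lambda>_. c) = red m (\<lambda>_. 0)" using eqJ_iff[OF m2 AB_intros(1) AB_intros(1)] by blast
  then show ?thesis by (simp add: red_0[OF m2] fun_eq_iff)
qed

lemma top_form_exists:
  assumes "L \<in> FR m"
  shows "(\<lambda>I. if I = Nset m then L else (\<lambda>_. 0)) \<in> rforms m (Nset m) (m - 1)"
  using assms N_props(5)[OF m2] by (intro rformsI[OF m2]) (auto intro: FR_intros)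

text \<open>The coefficient at \<open>Nset m\<close> is \<open>J\<^sup>1\<close>, because
  \<open>d\<^sub>1x\<close> is the product of dx^2 to dx^m with sign 1.\<close>

lemma H_to_SH:
  assumes "\<omega> \<in> Hcocycles m (m - 1)"
  shows "vdfam m (\<omega> (Nset m)) \<in> Sspace m \<inter> Hspace m"
    "famEqJ m (vdfam m (\<omega> (Nset m))) (\<lambda>_. 0, \<lambda>_ _ _. 0, \<lambda>_. 0, \<lambda>_. 0) \<longleftrightarrow> \<omega> \<in> Hcobound m (m - 1)"
proof -
  have L: "\<omega> (Nset m) \<in> AB m" using assms formsOn_AB[OF m2] Hcocycles_iff[OF m2] by blast
  have "famEqJ m (vdfam m (\<omega> (Nset m))) (vdfam m (\<omega> (Nset m)))"
    by (simp add: famEqJ_def eqJ_def Jid_zero[OF m2] split: prod.split)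
  then show "vdfam m (\<omega> (Nset m)) \<in> Sspace m \<inter> Hspace m"
    using vdfam_Sspace_iff[OF m2 L vdfam_Fams[OF m2 L]] H_divs[OF m2 assms] vdfam_Hspace[OF m2 L] by blast
  show "famEqJ m (vdfam m (\<omega> (Nset m))) (\<lambda>_. 0, \<lambda>_ _ _. 0, \<lambda>_. 0, \<lambda>_. 0) \<longleftrightarrow> \<omega> \<in> Hcobound m (m - 1)"
    unfolding vdfam_zero_iff[OF m2 L] H_top_exact_iff[OF m2 assms] vfam_def ..
qed

lemma SH_representative:
  assumes "ch \<in> Sspace m \<inter> Hspace m"
  obtains L where "L \<in> FR m" "famEqJ m ch (vdfam m L)" "Ef m 2 (grad (Db m 1 L)) = (\<lambda>_ _. 0)" "ch \<in> Fams m"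
proof -
  obtain L where L: "L \<in> AB m" "famEqJ m ch (vdfam m L)" and F: "ch \<in> Fams m"
    using assms by (auto simp: Hspace_def)
  have "famEqJ m ch (vdfam m (red m L))" using L vdfam_red[OF m2] by simp
  moreover have "Ef m 2 (grad (Db m 1 (red m L))) = (\<lambda>_ _. 0)"
    using vdfam_Sspace_iff[OF m2 L(1) F L(2)] assms by blast
  ultimately show thesis using that red_FR[OF m2 L(1)] F by blast
qed

lemma H_onto_SH:
  assumes "ch \<in> Sspace m \<inter> Hspace m"
  shows "\<exists>\<omega>\<in>Hcocycles m (m - 1). famEqJ m ch (vdfam m (\<omega> (Nset m)))"
proof -
  obtain L where L: "L \<in> FR m" "famEqJ m ch (vdfam m L)" "Ef m 2 (grad (Db m 1 L)) = (\<lambda>_ _. 0)"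
    using SH_representative[OF assms] by blast
  obtain \<omega> where \<omega>: "\<omega> \<in> Hcocycles m (m - 1)" "lower (Nset m) \<omega> = (\<lambda>I. if I = Nset m then L else (\<lambda>_. 0))"
    using H_extend[OF m2 top_form_exists[OF L(1)]] L(3) by auto
  have "\<omega> (Nset m) = L" using fun_cong[OF \<omega>(2), of "Nset m"] by (simp add: lower_def)
  then show ?thesis using \<omega>(1) L(2) by blast
qed

lemma m1_pos: "0 < m - 1" using m2 by simp

text \<open>Forms of degree m - 1 over m - 1 directions are closed for reasons of degree, so the
  kernel is cut out by the variational criterion for \<open>D\<^sub>1\<close> of the single
  coefficient.\<close>

lemma kerD1_iff:
  "\<theta> \<in> kerD1 m \<longleftrightarrow> \<theta> \<in> formsOn m (Nset m) (m - 1) \<and> Ef m 2 (grad (Db m 1 (red m (\<theta> (Nset m))))) = (\<lambda>_ _. 0)"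
proof (cases "\<theta> \<in> formsOn m (Nset m) (m - 1)")
  case True
  note r = rform_rforms[OF m2 True]
  have m1: "(1::nat) \<le> 1" "1 \<le> m" using m2 by auto
  have c: "\<theta> \<in> Tcocycles m (m - 1)"
    unfolding Tcocycles_iff[OF m2] using True top_closed[OF m2 r N_props(1,2)[OF m2]] N_props(5)[OF m2] by simp
  have D: "D1form m \<theta> \<in> formsOn m (Nset m) (m - 1)"
    unfolding D1form_def
    by (rule formsOnI[OF m2]) (use formsOn_AB[OF m2 True] Dt_AB m1 formsOn_zero[OF m2 True] in auto)
  have rD: "rform m (D1form m \<theta>) = (\<lambda>I. Db m 1 (rform m \<theta> I))"
    unfolding rform_def D1form_def using Db_red[OF m2 formsOn_AB[OF m2 True] m1] by simp
  show ?thesis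
    unfolding kerD1_def mem_Collect_eq Tcobound_iff[OF m2 m1_pos] rD N_exact_iff[OF m2 Db1_rforms[OF m2 r]]
    using c D True by (simp add: rform_def)
qed (auto simp: kerD1_def Tcocycles_def)

lemma Tcobound_Ef_iff:
  assumes "\<theta> \<in> formsOn m (Nset m) (m - 1)"
  shows "\<theta> \<in> Tcobound m (m - 1) \<longleftrightarrow> Ef m 2 (grad (red m (\<theta> (Nset m)))) = (\<lambda>_ _. 0)"
  unfolding Tcobound_iff[OF m2 m1_pos] N_exact_iff[OF m2 rform_rforms[OF m2 assms]]
  using assms by (simp add: rform_def)

lemma zero_rform_Tcobound:
  assumes "\<theta> \<in> formsOn m (Nset m) (m - 1)" "rform m \<theta> = (\<lambda>_ _. 0)" shows "\<theta> \<in> Tcobound m (m - 1)"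
  unfolding Tcobound_iff[OF m2 m1_pos] using assms zero_rforms[OF m2] dR_zero[OF m2] by metis

lemma iso_H_ker:
  "quot_iso fadd fscale (Hcocycles m (m - 1)) (Hcobound m (m - 1)) fadd fscale (kerD1 m) (Tcobound m (m - 1))"
  unfolding quot_iso_def
proof (intro exI[of _ "lower (Nset m)"] conjI ballI allI)
  fix x assume x: "x \<in> Hcocycles m (m - 1)"
  have f: "lower (Nset m) x \<in> formsOn m (Nset m) (m - 1)"
    using x Hcocycles_iff[OF m2] lower_formsOn[OF m2] by blast
  have N: "lower (Nset m) x (Nset m) = x (Nset m)" by (simp add: lower_def)
  show "lower (Nset m) x \<in> kerD1 m" unfolding kerD1_iff N using f H_divs[OF m2 x] by blast
  show "lower (Nset m) x \<in> Tcobound m (m - 1) \<longleftrightarrow> x \<in> Hcobound m (m - 1)"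
    unfolding Tcobound_Ef_iff[OF f] H_top_exact_iff[OF m2 x] N ..
  show "lower (Nset m) (fscale c x) = fscale c (lower (Nset m) x)" for c
    by (auto simp: lower_def fscale_def fun_eq_iff)
  show "lower (Nset m) (fadd x x') = fadd (lower (Nset m) x) (lower (Nset m) x')" for x'
    by (auto simp: lower_def fadd_def fun_eq_iff)
next
  fix z assume "z \<in> kerD1 m"
  then have z: "z \<in> formsOn m (Nset m) (m - 1)" "Ef m 2 (grad (Db m 1 (rform m z (Nset m)))) = (\<lambda>_ _. 0)"
    using kerD1_iff by (auto simp: rform_def)
  obtain x where x: "x \<in> Hcocycles m (m - 1)" "lower (Nset m) x = rform m z"
    using H_extend[OF m2 rform_rforms[OF m2 z(1)] z(2)] by blast
  \<comment> \<open>The preimage found hits the normal form of \<open>z\<close> and not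
    \<open>z\<close> itself; the difference reduces to zero and is therefore a coboundary.\<close>
  have "fadd z (fscale (-1) (lower (Nset m) x)) \<in> Tcobound m (m - 1)"
    unfolding x(2)
    by (rule zero_rform_Tcobound[OF fadd_formsOn[OF m2 z(1) rforms_formsOn[OF m2 rform_rforms[OF m2 z(1)]]]
          fadd_rform_zero[OF m2 z(1)]])
  then show "\<exists>x\<in>Hcocycles m (m - 1). fadd z (fscale (-1) (lower (Nset m) x)) \<in> Tcobound m (m - 1)"
    using x(1) by blast
qed

lemma iso_ker_SH:
  "quot_iso fadd fscale (kerD1 m) (Tcobound m (m - 1)) famadd famscale (Sspace m \<inter> Hspace m) (famZeroJ m)"
  unfolding quot_iso_def
proof (intro exI[of _ "\<lambda>\<theta>. vdfam m (\<theta> (Nset m))"] conjI ballI allI)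
  fix x assume x: "x \<in> kerD1 m"
  then have f: "x \<in> formsOn m (Nset m) (m - 1)" and E: "Ef m 2 (grad (Db m 1 (red m (x (Nset m))))) = (\<lambda>_ _. 0)"
    using kerD1_iff by auto
  have L: "x (Nset m) \<in> AB m" using formsOn_AB[OF m2 f] .
  have "famEqJ m (vdfam m (x (Nset m))) (vdfam m (x (Nset m)))"
    by (simp add: famEqJ_def eqJ_def Jid_zero[OF m2] split: prod.split)
  then show "vdfam m (x (Nset m)) \<in> Sspace m \<inter> Hspace m"
    using vdfam_Sspace_iff[OF m2 L vdfam_Fams[OF m2 L]] E vdfam_Hspace[OF m2 L] by blast
  show "vdfam m (x (Nset m)) \<in> famZeroJ m \<longleftrightarrow> x \<in> Tcobound m (m - 1)"
    unfolding famZeroJ_def mem_Collect_eq vdfam_zero_iff[OF m2 L] Tcobound_Ef_iff[OF f]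
    using vdfam_Fams[OF m2 L] by (simp add: vfam_def)
  show "vdfam m (fscale c x (Nset m)) = famscale c (vdfam m (x (Nset m)))" for c
    unfolding fscale_def using vdfam_linear(2)[OF m2 L L] .
  fix x' assume "x' \<in> kerD1 m"
  then have L': "x' (Nset m) \<in> AB m" using kerD1_iff formsOn_AB[OF m2] by blast
  show "vdfam m (fadd x x' (Nset m)) = famadd (vdfam m (x (Nset m))) (vdfam m (x' (Nset m)))"
    unfolding fadd_def using vdfam_linear(1)[OF m2 L L'] .
next
  fix z assume z: "z \<in> Sspace m \<inter> Hspace m"
  obtain L where L: "L \<in> FR m" "famEqJ m z (vdfam m L)" "Ef m 2 (grad (Db m 1 L)) = (\<lambda>_ _. 0)" and F: "z \<in> Fams m"
    using SH_representative[OF z] by blast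
  let ?x = "\<lambda>I. if I = Nset m then L else (\<lambda>_. 0)"
  have "?x \<in> kerD1 m"
    unfolding kerD1_iff using rforms_formsOn[OF m2 top_form_exists[OF L(1)]] red_id[OF m2 L(1)] L(3) by simp
  moreover have "famadd z (famscale (-1) (vdfam m (?x (Nset m)))) \<in> famZeroJ m"
    using Fams_comb[OF m2 F vdfam_Fams[OF m2 FR_AB[OF L(1)]] L(2)] by simp
  ultimately show "\<exists>x\<in>kerD1 m. famadd z (famscale (-1) (vdfam m (x (Nset m)))) \<in> famZeroJ m"
    by (intro bexI[of _ ?x])
qed

lemma rform_sum: "rform m (\<lambda>I y. \<beta> I y + \<gamma> I y) = (\<lambda>I y. rform m \<beta> I y + rform m \<gamma> I y)"
  by (auto simp: rform_def red_apply[OF m2] fun_eq_iff)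

lemma TcoboundPlusImD1_iff:
  assumes \<theta>: "\<theta> \<in> formsOn m (Nset m) (m - 1)"
  shows "\<theta> \<in> TcoboundPlusImD1 m \<longleftrightarrow> (\<exists>\<xi>\<in>rforms m (Nset m) (m - 1 - 1). \<exists>\<zeta>\<in>rforms m (Nset m) (m - 1).
     rform m \<theta> = (\<lambda>I y. dR m (Nset m) \<xi> I y + Db m 1 (\<zeta> I) y))"
proof -
  have m1: "(1::nat) \<le> 1" "1 \<le> m" using m2 by auto
  have rD: "rform m (D1form m \<zeta>) = (\<lambda>I. Db m 1 (rform m \<zeta> I))" if "\<zeta> \<in> formsOn m (Nset m) (m - 1)" for \<zeta>
    unfolding rform_def D1form_def using Db_red[OF m2 formsOn_AB[OF m2 that] m1] by simp
  have eq: "formEqJ m \<theta> (\<lambda>I y. \<beta> I y + D1form m \<zeta> I y) \<longleftrightarrow> rform m \<theta> = (\<lambda>I y. rform m \<beta> I y + Db m 1 (rform m \<zeta> I) y)"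
    if b: "\<beta> \<in> formsOn m (Nset m) (m - 1)" and z: "\<zeta> \<in> formsOn m (Nset m) (m - 1)" for \<beta> \<zeta>
  proof -
    have "formEqJ m \<theta> (\<lambda>I y. \<beta> I y + D1form m \<zeta> I y) \<longleftrightarrow> rform m \<theta> = rform m (\<lambda>I y. \<beta> I y + D1form m \<zeta> I y)"
      by (rule formEqJ_iff[OF m2 formsOn_AB[OF m2 \<theta>]])
        (use formsOn_AB[OF m2 b] formsOn_AB[OF m2 z] Dt_AB m1 in \<open>auto simp: D1form_def intro!: AB_intros\<close>)
    then show ?thesis unfolding rform_sum rD[OF z] .
  qed
  show ?thesis
  proof
    assume "\<theta> \<in> TcoboundPlusImD1 m"
    then obtain \<beta> \<zeta> where b: "\<beta> \<in> Tcobound m (m - 1)" and z: "\<zeta> \<in> Tcocycles m (m - 1)"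
      and e: "formEqJ m \<theta> (\<lambda>I y. \<beta> I y + D1form m \<zeta> I y)"
      unfolding TcoboundPlusImD1_def by blast
    obtain \<xi> where \<xi>: "\<xi> \<in> rforms m (Nset m) (m - 1 - 1)" "rform m \<beta> = dR m (Nset m) \<xi>" "\<beta> \<in> formsOn m (Nset m) (m - 1)"
      using b Tcobound_iff[OF m2 m1_pos] by blast
    have z': "\<zeta> \<in> formsOn m (Nset m) (m - 1)" using z Tcocycles_iff[OF m2] by blast
    have "rform m \<theta> = (\<lambda>I y. dR m (Nset m) \<xi> I y + Db m 1 (rform m \<zeta> I) y)" using eq[OF \<xi>(3) z'] e \<xi>(2) by simp
    then show "\<exists>\<xi>\<in>rforms m (Nset m) (m - 1 - 1). \<exists>\<zeta>\<in>rforms m (Nset m) (m - 1).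
       rform m \<theta> = (\<lambda>I y. dR m (Nset m) \<xi> I y + Db m 1 (\<zeta> I) y)"
      using \<xi>(1) rform_rforms[OF m2 z'] by blast
  next
    assume "\<exists>\<xi>\<in>rforms m (Nset m) (m - 1 - 1). \<exists>\<zeta>\<in>rforms m (Nset m) (m - 1).
       rform m \<theta> = (\<lambda>I y. dR m (Nset m) \<xi> I y + Db m 1 (\<zeta> I) y)"
    then obtain \<xi> \<zeta> where \<xi>: "\<xi> \<in> rforms m (Nset m) (m - 1 - 1)" and \<zeta>: "\<zeta> \<in> rforms m (Nset m) (m - 1)"
      and e: "rform m \<theta> = (\<lambda>I y. dR m (Nset m) \<xi> I y + Db m 1 (\<zeta> I) y)" by blast
    let ?b = "dR m (Nset m) \<xi>"
    have b: "?b \<in> rforms m (Nset m) (m - 1)"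
      using dR_rforms[OF m2 \<xi> N_props(1,2)[OF m2]] unfolding Suc_diff_1[OF m1_pos] .
    have "?b \<in> Tcobound m (m - 1)"
      unfolding Tcobound_iff[OF m2 m1_pos] using rforms_formsOn[OF m2 b] rform_id[OF m2 b] \<xi> by auto
    moreover have "\<zeta> \<in> Tcocycles m (m - 1)"
      unfolding Tcocycles_iff[OF m2] rform_id[OF m2 \<zeta>]
      using rforms_formsOn[OF m2 \<zeta>] top_closed[OF m2 \<zeta> N_props(1,2)[OF m2]] N_props(5)[OF m2] by simp
    moreover have "formEqJ m \<theta> (\<lambda>I y. ?b I y + D1form m \<zeta> I y)"
      using eq[OF rforms_formsOn[OF m2 b] rforms_formsOn[OF m2 \<zeta>]] e rform_id[OF m2 b] rform_id[OF m2 \<zeta>] by simp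
    ultimately show "\<theta> \<in> TcoboundPlusImD1 m" unfolding TcoboundPlusImD1_def using \<theta> by blast
  qed
qed

text \<open>An m-form is dx^1 wedged with its upper part, and the differential of \<theta> + dx^1
  \<and> \<zeta> has upper part \<open>D\<^sub>1 \<theta> - d\<zeta>\<close>. Coboundaries thus
  correspond to the sum of the image of \<open>D\<^sub>1\<close> and the coboundaries over
  \<open>Nset m\<close>; the component \<theta> is arbitrary, being closed for reasons of
  degree.\<close>

lemma iso_H_top:
  "quot_iso fadd fscale (Hcocycles m m) (Hcobound m m) fadd fscale (Tcocycles m (m - 1)) (TcoboundPlusImD1 m)"
  unfolding quot_iso_def
proof (intro exI[of _ "upper 1 (Nset m)"] conjI ballI allI)
  let ?N = "Nset m"
  have m0: "0 < m" "m = Suc (m - 1)" using m2 by auto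
  have top: "\<theta> \<in> Tcocycles m (m - 1)" if "\<theta> \<in> formsOn m ?N (m - 1)" for \<theta>
    unfolding Tcocycles_iff[OF m2]
    using that top_closed[OF m2 rform_rforms[OF m2 that] N_props(1,2)[OF m2]] N_props(5)[OF m2] by simp
  fix x assume "x \<in> Hcocycles m m"
  then have x: "x \<in> formsOn m (Mset m) m" using Hcocycles_iff[OF m2] by blast
  have f: "upper 1 ?N x \<in> formsOn m ?N (m - 1)" using upper_formsOn[OF m2 x] .
  show "upper 1 ?N x \<in> Tcocycles m (m - 1)" using top[OF f] .
  show "upper 1 ?N (fscale c x) = fscale c (upper 1 ?N x)" for c
    by (auto simp: upper_def fscale_def fun_eq_iff)
  show "upper 1 ?N (fadd x x') = fadd (upper 1 ?N x) (upper 1 ?N x')" for x'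
    by (auto simp: upper_def fadd_def fun_eq_iff)
  have up: "dR m (insert 1 ?N) \<eta> (insert 1 I) = (\<lambda>y. Db m 1 (\<eta> I) y - dR m ?N (\<lambda>J. \<eta> (insert 1 J)) I y)"
    if "I \<subseteq> ?N" for \<eta> I
    by (rule dR_upper[OF m2 that N_props(1)[OF m2]]) (rule N_props(4)[OF m2])
  note ru = upper_rform[OF m2, of 1 ?N x]
  show "upper 1 ?N x \<in> TcoboundPlusImD1 m \<longleftrightarrow> x \<in> Hcobound m m"
    unfolding TcoboundPlusImD1_iff[OF f] Hcobound_iff[OF m2 m0(1)]
  proof
    assume "\<exists>\<xi>\<in>rforms m ?N (m - 1 - 1). \<exists>\<zeta>\<in>rforms m ?N (m - 1).
       rform m (upper 1 ?N x) = (\<lambda>I y. dR m ?N \<xi> I y + Db m 1 (\<zeta> I) y)"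
    then obtain \<xi> \<zeta> where \<xi>: "\<xi> \<in> rforms m ?N (m - 1 - 1)" and \<zeta>: "\<zeta> \<in> rforms m ?N (m - 1)"
      and e: "rform m (upper 1 ?N x) = (\<lambda>I y. dR m ?N \<xi> I y + Db m 1 (\<zeta> I) y)" by blast
    let ?x = "\<lambda>I y. - \<xi> I y"
    let ?w = "jn 1 ?N \<zeta> ?x"
    have x': "?x \<in> rforms m ?N (m - 1 - 1)"
      by (rule rformsI[OF m2]) (use rforms_FR[OF m2 \<xi>] rforms_zero[OF m2 \<xi>] in \<open>auto intro!: FR_intros\<close>)
    have w: "?w \<in> rforms m (Mset m) (m - 1)"
      unfolding Mset_ins(1)[OF m2] by (rule jn_rforms[OF m2 \<zeta> _ N_props(3,1)[OF m2]]) (use x' m2 in auto)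
    have "rform m x = dR m (Mset m) ?w"
      unfolding Mset_ins(1)[OF m2]
    proof (rule insert_form_eqI[OF m2, of ?N _ _ 1])
      fix I assume I: "I \<subseteq> ?N"
      have "dR m (insert 1 ?N) ?w I = dR m ?N \<zeta> I"
        unfolding dR_lower[OF m2 I] by (rule dR_cong[OF m2], rule jn_simps(1)[OF m2 N_props(3)[OF m2]]) (use I in blast)
      also have "\<dots> = (\<lambda>_. 0)"
        using top_closed[OF m2 \<zeta> N_props(1,2)[OF m2]] N_props(5)[OF m2] by simp
      finally have 1: "dR m (insert 1 ?N) ?w I = (\<lambda>_. 0)" .
      have "card I \<le> m - 1" using card_mono[OF N_props(1)[OF m2] I] N_props(5)[OF m2] by simp
      then have "card I \<noteq> m" using m0 by simp
      then have "x I = (\<lambda>_. 0)" using formsOn_zero[OF m2 x] by blast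
      then show "rform m x I = dR m (insert 1 ?N) ?w I" using 1 by (simp add: rform_def red_0[OF m2])
      have 2: "dR m ?N (\<lambda>J. ?w (insert 1 J)) I = dR m ?N ?x I"
        by (rule dR_cong[OF m2], rule jn_simps(2)[OF m2 N_props(3)[OF m2]]) (use I in blast)
      have "rform m x (insert 1 I) = upper 1 ?N (rform m x) I" using I by (simp add: upper_def)
      also have "\<dots> = (\<lambda>y. dR m ?N \<xi> I y + Db m 1 (\<zeta> I) y)" unfolding ru e ..
      also have "\<dots> = dR m (insert 1 ?N) ?w (insert 1 I)"
        unfolding up[OF I] 2 dR_uminus[OF m2 \<xi>] jn_simps(1)[OF m2 N_props(3)[OF m2] I] by (simp add: add.commute)
      finally show "rform m x (insert 1 I) = dR m (insert 1 ?N) ?w (insert 1 I)" .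
    next
      fix I assume "\<not> I \<subseteq> insert 1 ?N"
      then have "\<not> I \<subseteq> Mset m" using Mset_ins(1)[OF m2] by simp
      then have "x I = (\<lambda>_. 0)" using formsOn_zero[OF m2 x] by blast
      then show "rform m x I = dR m (insert 1 ?N) ?w I"
        using \<open>\<not> I \<subseteq> insert 1 ?N\<close> by (simp add: rform_def red_0[OF m2] dR_def)
    qed
    then show "x \<in> formsOn m (Mset m) m \<and> (\<exists>\<eta>\<in>rforms m (Mset m) (m - 1). rform m x = dR m (Mset m) \<eta>)"
      using x w by blast
  next
    assume "x \<in> formsOn m (Mset m) m \<and> (\<exists>\<eta>\<in>rforms m (Mset m) (m - 1). rform m x = dR m (Mset m) \<eta>)"
    then obtain \<eta> where \<eta>: "\<eta> \<in> rforms m (insert 1 ?N) (m - 1)" "rform m x = dR m (insert 1 ?N) \<eta>"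
      using Mset_ins(1)[OF m2] by auto
    let ?u = "upper 1 ?N \<eta>"
    have u: "?u \<in> rforms m ?N (m - 1 - 1)"
      by (rule upper_rforms[OF m2 _ N_props(3,1)[OF m2]]) (unfold Suc_diff_1[OF m1_pos], rule \<eta>(1))
    let ?x = "\<lambda>I y. - ?u I y"
    have x': "?x \<in> rforms m ?N (m - 1 - 1)"
      by (rule rformsI[OF m2]) (use rforms_FR[OF m2 u] rforms_zero[OF m2 u] in \<open>auto intro!: FR_intros\<close>)
    have l: "lower ?N \<eta> \<in> rforms m ?N (m - 1)" using lower_rforms[OF m2 \<eta>(1)] .
    have "rform m (upper 1 ?N x) = (\<lambda>I y. dR m ?N ?x I y + Db m 1 (lower ?N \<eta> I) y)"
    proof
      fix I
      show "rform m (upper 1 ?N x) I = (\<lambda>y. dR m ?N ?x I y + Db m 1 (lower ?N \<eta> I) y)"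
      proof (cases "I \<subseteq> ?N")
        case True
        have 2: "dR m ?N (\<lambda>J. \<eta> (insert 1 J)) I = dR m ?N ?u I"
          by (rule dR_cong[OF m2]) (use True in \<open>auto simp: upper_def\<close>)
        have "rform m (upper 1 ?N x) I = dR m (insert 1 ?N) \<eta> (insert 1 I)"
          unfolding ru[symmetric] using True \<eta>(2) by (simp add: upper_def)
        also have "\<dots> = (\<lambda>y. dR m ?N ?x I y + Db m 1 (lower ?N \<eta> I) y)"
          unfolding up[OF True] 2 dR_uminus[OF m2 u] using True by (simp add: lower_def)
        finally show ?thesis .
      next
        case False
        then show ?thesis unfolding ru[symmetric] by (simp add: upper_def dR_def lower_def Db_const[OF m2])
      qed
    qed
    then show "\<exists>\<xi>\<in>rforms m ?N (m - 1 - 1). \<exists>\<zeta>\<in>rforms m ?N (m - 1).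
       rform m (upper 1 ?N x) = (\<lambda>I y. dR m ?N \<xi> I y + Db m 1 (\<zeta> I) y)"
      using x' l by blast
  qed
next
  let ?N = "Nset m"
  fix z assume "z \<in> Tcocycles m (m - 1)"
  then have z: "z \<in> formsOn m ?N (m - 1)" using Tcocycles_iff[OF m2] by blast
  note r = rform_rforms[OF m2 z]
  let ?w = "jn 1 ?N (\<lambda>_ _. 0) (rform m z)"
  have w: "?w \<in> rforms m (Mset m) m"
    unfolding Mset_ins(1)[OF m2]
    by (rule jn_rforms[OF m2 zero_rforms[OF m2] _ N_props(3,1)[OF m2]]) (use r m2 in auto)
  have "dR m (Mset m) ?w = (\<lambda>_ _. 0)"
    by (rule top_closed[OF m2 w]) (auto simp: Mset_def)
  then have "?w \<in> Hcocycles m m" unfolding Hcocycles_iff[OF m2] rform_id[OF m2 w] using rforms_formsOn[OF m2 w] by blast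
  moreover have uw: "upper 1 ?N ?w = rform m z"
  proof
    fix I show "upper 1 ?N ?w I = rform m z I"
      using jn_simps(2)[OF m2 N_props(3)[OF m2], of I] rforms_zero[OF m2 r, of I] by (auto simp: upper_def)
  qed
  have d: "fadd z (fscale (-1) (rform m z)) \<in> formsOn m ?N (m - 1)"
    by (rule fadd_formsOn[OF m2 z rforms_formsOn[OF m2 r]])
  have "fadd z (fscale (-1) (upper 1 ?N ?w)) \<in> TcoboundPlusImD1 m"
    unfolding uw TcoboundPlusImD1_iff[OF d] fadd_rform_zero[OF m2 z]
    by (intro bexI[OF _ zero_rforms[OF m2]]) (simp add: dR_zero[OF m2] Db_const[OF m2])
  ultimately show "\<exists>x\<in>Hcocycles m m. fadd z (fscale (-1) (upper 1 ?N x)) \<in> TcoboundPlusImD1 m" by blast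
qed

end

theorem mainTheorem5:
  fixes m :: nat
  assumes "2 \<le> m"
  shows
    \<comment> \<open>H^q = 0 for 1 \<le> q \<le> m-2 and q > m\<close>
    "(\<forall>q. (1 \<le> q \<and> q \<le> m - 2) \<or> m < q \<longrightarrow> Hcocycles m q \<subseteq> Hcobound m q)
   \<comment> \<open>H^0 = R: the classes of constants\<close>
   \<and> (\<forall>\<omega>\<in>Hcocycles m 0. \<exists>c::real. formEqJ m \<omega> (\<lambda>I. if I = {} then (\<lambda>_. c) else (\<lambda>_. 0)))
   \<and> (\<forall>c::real. formEqJ m (\<lambda>I. if I = {} then (\<lambda>_. c) else (\<lambda>_. 0)) (\<lambda>_ _. 0) \<longrightarrow> c = 0)
   \<comment> \<open>H^{m-1} = S \<inter> H via [J^mu d_mu x] \<mapsto> variational derivatives of J^1\<close>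
   \<and> (\<forall>\<omega>\<in>Hcocycles m (m - 1). vdfam m (\<omega> (Nset m)) \<in> Sspace m \<inter> Hspace m)
   \<and> (\<forall>\<omega>\<in>Hcocycles m (m - 1).
        famEqJ m (vdfam m (\<omega> (Nset m))) (\<lambda>_. 0, \<lambda>_ _ _. 0, \<lambda>_. 0, \<lambda>_. 0) \<longleftrightarrow> \<omega> \<in> Hcobound m (m - 1))
   \<and> (\<forall>ch\<in>Sspace m \<inter> Hspace m. \<exists>\<omega>\<in>Hcocycles m (m - 1). famEqJ m ch (vdfam m (\<omega> (Nset m))))
   \<comment> \<open>H^{m-1} = ker D_1^{m-1} = S \<inter> H\<close>
   \<and> quot_iso fadd fscale (Hcocycles m (m - 1)) (Hcobound m (m - 1))
              fadd fscale (kerD1 m) (Tcobound m (m - 1))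
   \<and> quot_iso fadd fscale (kerD1 m) (Tcobound m (m - 1))
              famadd famscale (Sspace m \<inter> Hspace m) (famZeroJ m)
   \<comment> \<open>H^m = H^{m-1}(Theta) / im D_1^{m-1}\<close>
   \<and> quot_iso fadd fscale (Hcocycles m m) (Hcobound m m)
              fadd fscale (Tcocycles m (m - 1)) (TcoboundPlusImD1 m)"
proof (intro conjI ballI allI impI)
  fix q assume "1 \<le> q \<and> q \<le> m - 2 \<or> m < q"
  then show "Hcocycles m q \<subseteq> Hcobound m q" using H_middle[OF assms] H_above[OF assms] by blast
qed (use H_zero[OF assms] H_const[OF assms] H_to_SH[OF assms] H_onto_SH[OF assms]
      iso_H_ker[OF assms] iso_ker_SH[OF assms] iso_H_top[OF assms] in blast)+

end
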